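(* Let $K$ be a commutative ring with unit, let $\mathcal{A},\mathcal{B}$ be small $K$-categories, and let $\eta_f,\varepsilon_f:f\dashv f^*:\mathcal{B}\to\mathcal{A}$ be an adjunction in the bicategory $\mathbf{Bim}$ (so $f$ is an $\mathcal{A}$-$\mathcal{B}$-bimodule). (i) If $f$ is right flat and $\eta_f$ is right pure, then the map $\Gamma_f:\mathbf{I}^l_{\mathcal{A}}(S_f)\to\mathrm{End}_{\mathcal{B}}(\mathfrak{C}_f,\mathfrak{C}_f)$ is an isomorphism of monoids. (ii) If $f^*$ is left flat and $\eta_f$ is left pure, then the map $\Gamma_{f^*}:(\mathbf{I}^r_{\mathcal{A}}(S_f))^{\mathrm{op}}\to\mathrm{End}_{\mathcal{B}}(\mathfrak{C}_f,\mathfrak{C}_f)$ is an isomorphism of monoids. (iii) If $f$ is a separable bimodule, then each of the maps $\Gamma_f$ and $\Gamma_{f^*}$ is an isomorphism of monoids.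
   Context: A $K$-category is a category enriched in $K$-modules; $[\mathcal{A},\mathrm{Mod}_K]$ is the category of $K$-linear functors. $\mathbf{Bim}$ is the bicategory whose 0-cells are small $K$-categories, with $\mathbf{Bim}(\mathcal{A},\mathcal{B})=[\mathcal{B}^{\mathrm{op}}\otimes_K\mathcal{A},\mathrm{Mod}_K]$ (the $\mathcal{A}$-$\mathcal{B}$-bimodules $\mathcal{A}\rightsquigarrow\mathcal{B}$), 2-cells the natural transformations, horizontal composition of $\phi:\mathcal{A}\rightsquigarrow\mathcal{B}$ and $\varphi:\mathcal{B}\rightsquigarrow\mathcal{C}$ given by $(\varphi\otimes\phi)(c,a)=\varphi(c,-)\otimes_{\mathcal{B}}\phi(-,a)$ (the coend/tensor product of functors over $\mathcal{B}$), and identities $1_{\mathcal{B}}(b,b')=\mathcal{B}(b,b')$. A 1-cell $g:\mathcal{X}\to\mathcal{Y}$ is right (resp. left) flat if for every 0-cell $\mathcal{C}$ the functor $g\otimes-:\mathbf{Bim}(\mathcal{C},\mathcal{X})\to\mathbf{Bim}(\mathcal{C},\mathcal{Y})$ (resp. $-\otimes g:\mathbf{Bim}(\mathcal{Y},\mathcal{C})\to\mathbf{Bim}(\mathcal{X},\mathcal{C})$) preserves equalizers. A 2-cell $\tau:g\to g':\mathcal{X}\to\mathcal{Y}$ is right (resp. left) pure if for every 0-cell $\mathcal{C}$ and every 1-cell $h:\mathcal{C}\to\mathcal{X}$ (resp. $h:\mathcal{Y}\to\mathcal{C}$) the morphism $\tau\otimes h$ (resp. $h\otimes\tau$) is a regular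 monomorphism. $f$ is separable if $\eta_f:1_{\mathcal{A}}\to f^*\otimes f$ is a split monomorphism in $\mathbf{Bim}(\mathcal{A},\mathcal{A})$. Suppressing constraints: with unit $\eta_f:1_{\mathcal{A}}\to f^*\otimes f$ and counit $\varepsilon_f:f\otimes f^*\to1_{\mathcal{B}}$, $S_f=(f^*\otimes f,\ m_f=f^*\otimes\varepsilon_f\otimes f,\ \eta_f)$ is a monoid in $\mathbf{Bim}(\mathcal{A},\mathcal{A})$, and $\mathfrak{C}_f=(f\otimes f^*,\ f\otimes\eta_f\otimes f^*,\ \varepsilon_f)$ is a comonoid in $\mathbf{Bim}(\mathcal{B},\mathcal{B})$; $\mathrm{End}_{\mathcal{B}}(\mathfrak{C}_f,\mathfrak{C}_f)$ is the monoid, under composition, of its comonoid endomorphisms. $\mathbf{I}^l_{\mathcal{A}}(S_f)$ (resp. $\mathbf{I}^r_{\mathcal{A}}(S_f)$) is the set of $\mathcal{A}$-subbimodules $I\subseteq S_f$ (inclusion $i_I$) for which the multiplication $m_f\cdot(S_f\otimes i_I):S_f\otimes I\to S_f$ (resp. $m_f\cdot(i_I\otimes S_f):I\otimes S_f\to S_f$) is an isomorphism. The product of $I$ and $J$ is the subbimodule $IJ$, the image of $m_f\cdot(i_I\otimes i_J):I\otimes J\to S_f$; the unit is the image of $\eta_f$. $\Gamma_f$ sends $I$ to $(f\otimes f^*\otimes\varepsilon_f)\cdot(f\otimes i_I\otimes f^* )\cdot(\xi_{i_I}^{-1}\otimes f^* )$, where $\xi_{i_I}=(\varepsilon_f\otimes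 f)\cdot(f\otimes i_I):f\otimes I\to f$ (invertible). $\Gamma_{f^*}$ sends $I$ to $(\varepsilon_f\otimes f\otimes f^* )\cdot(f\otimes i_I\otimes f^* )\cdot(f\otimes\xi_{i_I}^{-1})$, where $\xi_{i_I}=(f^*\otimes\varepsilon_f)\cdot(i_I\otimes f^* ):I\otimes f^*\to f^*$ (invertible). *)

theory Defs
  imports "HOL-Algebra.Module" "HOL-Library.Infinite_Typeclass"
begin

text \<open>
  The type \<open>'u\<close>, of class \<^class>\<open>infinite\<close> and otherwise arbitrary, plays the role of the
  universe: the objects and morphisms of small \<open>K\<close>-categories and the elements of the \<open>K\<close>-modules
  that occur as values of bimodules are taken from it. Tensor products over a small \<open>K\<close>-category
  do not leave an infinite universe, up to a choice of names for their elements (see \<open>code\<close>).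
\<close>

section \<open>K-categories and bimodules\<close>

definition klinear :: "'k ring \<Rightarrow> ('k,'a) module \<Rightarrow> ('k,'b) module \<Rightarrow> ('a \<Rightarrow> 'b) \<Rightarrow> bool" where
  "klinear K M N h \<longleftrightarrow>
     h \<in> carrier M \<rightarrow> carrier N \<and>
     (\<forall>x\<in>carrier M. \<forall>y\<in>carrier M. h (x \<oplus>\<^bsub>M\<^esub> y) = h x \<oplus>\<^bsub>N\<^esub> h y) \<and>
     (\<forall>k\<in>carrier K. \<forall>x\<in>carrier M. h (k \<odot>\<^bsub>M\<^esub> x) = k \<odot>\<^bsub>N\<^esub> h x)"

text \<open>\<open>Comp A a b c g f\<close> is the composite of \<open>f : a \<rightarrow> b\<close> and \<open>g : b \<rightarrow> c\<close>. The fields \<open>mult\<close> and \<open>one\<close>,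
  which \<^theory>\<open>HOL-Algebra.Module\<close> includes in every module record, carry no meaning.\<close>

record ('k,'u) kcat =
  Ob :: "'u set"
  Hom :: "'u \<Rightarrow> 'u \<Rightarrow> ('k,'u) module"
  Comp :: "'u \<Rightarrow> 'u \<Rightarrow> 'u \<Rightarrow> 'u \<Rightarrow> 'u \<Rightarrow> 'u"
  Ident :: "'u \<Rightarrow> 'u"

locale kcategory =
  fixes K :: "'k ring" and A :: "('k,'u) kcat"
  assumes cring_K: "cring K"
    and hom_module: "\<lbrakk>a \<in> Ob A; b \<in> Ob A\<rbrakk> \<Longrightarrow> Module.module K (Hom A a b)"
    and ident_hom: "a \<in> Ob A \<Longrightarrow> Ident A a \<in> carrier (Hom A a a)"
    and comp_linear_left:
      "\<lbrakk>a \<in> Ob A; b \<in> Ob A; c \<in> Ob A; f \<in> carrier (Hom A a b)\<rbrakk>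
         \<Longrightarrow> klinear K (Hom A b c) (Hom A a c) (\<lambda>g. Comp A a b c g f)"
    and comp_linear_right:
      "\<lbrakk>a \<in> Ob A; b \<in> Ob A; c \<in> Ob A; g \<in> carrier (Hom A b c)\<rbrakk>
         \<Longrightarrow> klinear K (Hom A a b) (Hom A a c) (\<lambda>f. Comp A a b c g f)"
    and comp_ident_left:
      "\<lbrakk>a \<in> Ob A; b \<in> Ob A; f \<in> carrier (Hom A a b)\<rbrakk> \<Longrightarrow> Comp A a b b (Ident A b) f = f"
    and comp_ident_right:
      "\<lbrakk>a \<in> Ob A; b \<in> Ob A; f \<in> carrier (Hom A a b)\<rbrakk> \<Longrightarrow> Comp A a a b f (Ident A a) = f"
    and comp_assoc:
      "\<lbrakk>a \<in> Ob A; b \<in> Ob A; c \<in> Ob A; d \<in> Ob A;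
        f \<in> carrier (Hom A a b); g \<in> carrier (Hom A b c); h \<in> carrier (Hom A c d)\<rbrakk>
         \<Longrightarrow> Comp A a b d (Comp A b c d h g) f = Comp A a c d h (Comp A a b c g f)"

text \<open>
  A 1-cell \<open>F : A \<leadsto> B\<close>, that is, a \<open>K\<close>-linear functor \<open>B\<^sup>o\<^sup>p \<otimes>\<^sub>K A \<rightarrow> Mod\<^sub>K\<close>, is given as a functor of two
  variables that is \<open>K\<close>-linear in each of them: \<open>act F b b' a a' \<beta> \<alpha> : F(b,a) \<rightarrow> F(b',a')\<close> is the value
  at \<open>\<beta> \<otimes> \<alpha>\<close> for \<open>\<beta> : b' \<rightarrow> b\<close> in \<open>B\<close> and \<open>\<alpha> : a \<rightarrow> a'\<close> in \<open>A\<close>.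
\<close>

record ('k,'u) bimod =
  dom :: "('k,'u) kcat"
  cod :: "('k,'u) kcat"
  val :: "'u \<Rightarrow> 'u \<Rightarrow> ('k,'u) module"
  act :: "'u \<Rightarrow> 'u \<Rightarrow> 'u \<Rightarrow> 'u \<Rightarrow> 'u \<Rightarrow> 'u \<Rightarrow> 'u \<Rightarrow> 'u"

locale bimodule =
  fixes K :: "'k ring" and F :: "('k,'u) bimod"
  assumes dom_kcategory: "kcategory K (dom F)"
    and cod_kcategory: "kcategory K (cod F)"
    and val_module: "\<lbrakk>b \<in> Ob (cod F); a \<in> Ob (dom F)\<rbrakk> \<Longrightarrow> Module.module K (val F b a)"
    and act_linear:
      "\<lbrakk>b \<in> Ob (cod F); b' \<in> Ob (cod F); a \<in> Ob (dom F); a' \<in> Ob (dom F);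
        \<beta> \<in> carrier (Hom (cod F) b' b); \<alpha> \<in> carrier (Hom (dom F) a a')\<rbrakk>
         \<Longrightarrow> klinear K (val F b a) (val F b' a') (act F b b' a a' \<beta> \<alpha>)"
    and act_linear_cod:
      "\<lbrakk>b \<in> Ob (cod F); b' \<in> Ob (cod F); a \<in> Ob (dom F); a' \<in> Ob (dom F);
        \<alpha> \<in> carrier (Hom (dom F) a a'); x \<in> carrier (val F b a)\<rbrakk>
         \<Longrightarrow> klinear K (Hom (cod F) b' b) (val F b' a') (\<lambda>\<beta>. act F b b' a a' \<beta> \<alpha> x)"
    and act_linear_dom:
      "\<lbrakk>b \<in> Ob (cod F); b' \<in> Ob (cod F); a \<in> Ob (dom F); a' \<in> Ob (dom F);
        \<beta> \<in> carrier (Hom (cod F) b' b); x \<in> carrier (val F b a)\<rbrakk>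
         \<Longrightarrow> klinear K (Hom (dom F) a a') (val F b' a') (\<lambda>\<alpha>. act F b b' a a' \<beta> \<alpha> x)"
    and act_ident:
      "\<lbrakk>b \<in> Ob (cod F); a \<in> Ob (dom F); x \<in> carrier (val F b a)\<rbrakk>
         \<Longrightarrow> act F b b a a (Ident (cod F) b) (Ident (dom F) a) x = x"
    and act_comp:
      "\<lbrakk>b \<in> Ob (cod F); b' \<in> Ob (cod F); b'' \<in> Ob (cod F);
        a \<in> Ob (dom F); a' \<in> Ob (dom F); a'' \<in> Ob (dom F);
        \<beta> \<in> carrier (Hom (cod F) b' b); \<beta>' \<in> carrier (Hom (cod F) b'' b');
        \<alpha> \<in> carrier (Hom (dom F) a a'); \<alpha>' \<in> carrier (Hom (dom F) a' a'');
        x \<in> carrier (val F b a)\<rbrakk>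
         \<Longrightarrow> act F b b'' a a'' (Comp (cod F) b'' b' b \<beta> \<beta>') (Comp (dom F) a a' a'' \<alpha>' \<alpha>) x
             = act F b' b'' a' a'' \<beta>' \<alpha>' (act F b b' a a' \<beta> \<alpha> x)"

definition one_cell ::
  "'k ring \<Rightarrow> ('k,'u) kcat \<Rightarrow> ('k,'u) kcat \<Rightarrow> ('k,'u) bimod \<Rightarrow> bool" where
  "one_cell K A B F \<longleftrightarrow> bimodule K F \<and> dom F = A \<and> cod F = B"

section \<open>2-cells and vertical composition\<close>

record ('k,'u) cell =
  src :: "('k,'u) bimod"
  tgt :: "('k,'u) bimod"
  cmp :: "'u \<Rightarrow> 'u \<Rightarrow> 'u \<Rightarrow> 'u"

text \<open>Components are undefined outside the modules on which they live, so that two natural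
  transformations are equal as soon as they agree there.\<close>

definition two_cell :: "'k ring \<Rightarrow> ('k,'u) cell \<Rightarrow> bool" where
  "two_cell K \<tau> \<longleftrightarrow>
     bimodule K (src \<tau>) \<and> bimodule K (tgt \<tau>) \<and>
     dom (src \<tau>) = dom (tgt \<tau>) \<and> cod (src \<tau>) = cod (tgt \<tau>) \<and>
     (\<forall>b\<in>Ob (cod (src \<tau>)). \<forall>a\<in>Ob (dom (src \<tau>)).
        klinear K (val (src \<tau>) b a) (val (tgt \<tau>) b a) (cmp \<tau> b a)) \<and>
     (\<forall>b\<in>Ob (cod (src \<tau>)). \<forall>b'\<in>Ob (cod (src \<tau>)). \<forall>a\<in>Ob (dom (src \<tau>)). \<forall>a'\<in>Ob (dom (src \<tau>)).
        \<forall>\<beta>\<in>carrier (Hom (cod (src \<tau>)) b' b). \<forall>\<alpha>\<in>carrier (Hom (dom (src \<tau>)) a a').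
        \<forall>x\<in>carrier (val (src \<tau>) b a).
          cmp \<tau> b' a' (act (src \<tau>) b b' a a' \<beta> \<alpha> x) = act (tgt \<tau>) b b' a a' \<beta> \<alpha> (cmp \<tau> b a x)) \<and>
     (\<forall>b a x. \<not> (b \<in> Ob (cod (src \<tau>)) \<and> a \<in> Ob (dom (src \<tau>)) \<and> x \<in> carrier (val (src \<tau>) b a))
        \<longrightarrow> cmp \<tau> b a x = undefined)"

definition cells :: "'k ring \<Rightarrow> ('k,'u) bimod \<Rightarrow> ('k,'u) bimod \<Rightarrow> ('k,'u) cell set" where
  "cells K F G = {\<tau>. two_cell K \<tau> \<and> src \<tau> = F \<and> tgt \<tau> = G}"

definition mk_cell ::
  "('k,'u) bimod \<Rightarrow> ('k,'u) bimod \<Rightarrow> ('u \<Rightarrow> 'u \<Rightarrow> 'u \<Rightarrow> 'u) \<Rightarrow> ('k,'u) cell" where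
  "mk_cell F G t = \<lparr>src = F, tgt = G, cmp = (\<lambda>b a x.
     if b \<in> Ob (cod F) \<and> a \<in> Ob (dom F) \<and> x \<in> carrier (val F b a) then t b a x else undefined)\<rparr>"

definition id_cell :: "('k,'u) bimod \<Rightarrow> ('k,'u) cell" where
  "id_cell F = mk_cell F F (\<lambda>b a x. x)"

definition vcomp :: "('k,'u) cell \<Rightarrow> ('k,'u) cell \<Rightarrow> ('k,'u) cell"  (infixr \<open>\<bullet>\<close> 55) where
  "\<sigma> \<bullet> \<tau> = mk_cell (src \<tau>) (tgt \<sigma>) (\<lambda>b a x. cmp \<sigma> b a (cmp \<tau> b a x))"

definition is_inverse :: "'k ring \<Rightarrow> ('k,'u) cell \<Rightarrow> ('k,'u) cell \<Rightarrow> bool" where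
  "is_inverse K \<tau> \<sigma> \<longleftrightarrow>
     \<sigma> \<in> cells K (tgt \<tau>) (src \<tau>) \<and> \<sigma> \<bullet> \<tau> = id_cell (src \<tau>) \<and> \<tau> \<bullet> \<sigma> = id_cell (tgt \<tau>)"

definition iso_cell :: "'k ring \<Rightarrow> ('k,'u) cell \<Rightarrow> bool" where
  "iso_cell K \<tau> \<longleftrightarrow> two_cell K \<tau> \<and> (\<exists>\<sigma>. is_inverse K \<tau> \<sigma>)"

definition inv_cell :: "'k ring \<Rightarrow> ('k,'u) cell \<Rightarrow> ('k,'u) cell" where
  "inv_cell K \<tau> = (THE \<sigma>. is_inverse K \<tau> \<sigma>)"

definition is_equalizer ::
  "'k ring \<Rightarrow> ('k,'u) cell \<Rightarrow> ('k,'u) cell \<Rightarrow> ('k,'u) cell \<Rightarrow> bool" where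
  "is_equalizer K e p q \<longleftrightarrow>
     two_cell K e \<and> p \<in> cells K (tgt e) (tgt p) \<and> q \<in> cells K (tgt e) (tgt p) \<and>
     p \<bullet> e = q \<bullet> e \<and>
     (\<forall>T. \<forall>t\<in>cells K T (tgt e). p \<bullet> t = q \<bullet> t \<longrightarrow> (\<exists>!s. s \<in> cells K T (src e) \<and> e \<bullet> s = t))"

definition regular_mono :: "'k ring \<Rightarrow> ('k,'u) cell \<Rightarrow> bool" where
  "regular_mono K e \<longleftrightarrow> (\<exists>p q. is_equalizer K e p q)"

definition split_mono :: "'k ring \<Rightarrow> ('k,'u) cell \<Rightarrow> bool" where
  "split_mono K e \<longleftrightarrow>
     two_cell K e \<and> (\<exists>r\<in>cells K (tgt e) (src e). r \<bullet> e = id_cell (src e))"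

section \<open>Horizontal composition\<close>

definition tgens ::
  "('k,'u) bimod \<Rightarrow> ('k,'u) bimod \<Rightarrow> 'u \<Rightarrow> 'u \<Rightarrow> ('u \<times> 'u \<times> 'u) set" where
  "tgens F G c a =
     {(b, y, x). b \<in> Ob (cod G) \<and> y \<in> carrier (val F c b) \<and> x \<in> carrier (val G b a)}"

text \<open>
  The coend \<open>F(c,-) \<otimes>\<^sub>B G(-,a)\<close>: a list of triples \<open>(b, y, x)\<close> stands for the sum of the
  \<open>y \<otimes> x\<close> with \<open>y \<in> F(c,b)\<close> and \<open>x \<in> G(b,a)\<close>, and \<open>teq\<close> is the least congruence that makes
  \<open>\<otimes>\<close> biadditive and \<open>B\<close>-balanced. That it is also \<open>K\<close>-balanced is the instance \<open>\<beta> = k \<odot> 1\<close> of \<open>bal\<close>.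
\<close>

inductive teq ::
  "('k,'u) bimod \<Rightarrow> ('k,'u) bimod \<Rightarrow> 'u \<Rightarrow> 'u \<Rightarrow>
   ('u \<times> 'u \<times> 'u) list \<Rightarrow> ('u \<times> 'u \<times> 'u) list \<Rightarrow> bool"
  for F G :: "('k,'u) bimod" and c a :: 'u where
  refl: "teq F G c a l l"
| sym: "teq F G c a l l' \<Longrightarrow> teq F G c a l' l"
| trans: "teq F G c a l l' \<Longrightarrow> teq F G c a l' l'' \<Longrightarrow> teq F G c a l l''"
| append: "teq F G c a l l' \<Longrightarrow> teq F G c a m m' \<Longrightarrow> teq F G c a (l @ m) (l' @ m')"
| commute: "teq F G c a (l @ m) (m @ l)"
| zero_left: "(b, \<zero>\<^bsub>val F c b\<^esub>, x) \<in> tgens F G c a \<Longrightarrow> teq F G c a [(b, \<zero>\<^bsub>val F c b\<^esub>, x)] []"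
| zero_right: "(b, y, \<zero>\<^bsub>val G b a\<^esub>) \<in> tgens F G c a \<Longrightarrow> teq F G c a [(b, y, \<zero>\<^bsub>val G b a\<^esub>)] []"
| add_left:
    "(b, y, x) \<in> tgens F G c a \<Longrightarrow> (b, y', x) \<in> tgens F G c a
       \<Longrightarrow> teq F G c a [(b, y \<oplus>\<^bsub>val F c b\<^esub> y', x)] [(b, y, x), (b, y', x)]"
| add_right:
    "(b, y, x) \<in> tgens F G c a \<Longrightarrow> (b, y, x') \<in> tgens F G c a
       \<Longrightarrow> teq F G c a [(b, y, x \<oplus>\<^bsub>val G b a\<^esub> x')] [(b, y, x), (b, y, x')]"
| bal:
    "b \<in> Ob (cod G) \<Longrightarrow> b' \<in> Ob (cod G) \<Longrightarrow> \<beta> \<in> carrier (Hom (cod G) b b')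
       \<Longrightarrow> y \<in> carrier (val F c b) \<Longrightarrow> x \<in> carrier (val G b' a)
       \<Longrightarrow> teq F G c a [(b', act F c c b b' (Ident (cod F) c) \<beta> y, x)]
                      [(b, y, act G b' b a a \<beta> (Ident (dom G) a) x)]"

text \<open>The class of \<open>l\<close> is named by the code of a chosen representative; \<open>decode\<close> returns
  that representative.\<close>

definition code :: "('u::infinite \<times> 'u \<times> 'u) list \<Rightarrow> 'u" where
  "code = (SOME e. inj e)"

definition decode :: "'u::infinite \<Rightarrow> ('u \<times> 'u \<times> 'u) list" where
  "decode = inv_into UNIV code"

lemma inj_code: "inj (code :: ('u::infinite \<times> 'u \<times> 'u) list \<Rightarrow> 'u)"
proof -
  have inf: "\<not> finite (UNIV :: 'u set)" by (rule infinite_UNIV)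
  have "(card_of ((UNIV :: 'u set) \<times> (UNIV :: 'u set)), card_of (UNIV :: 'u set)) \<in> ordIso"
    by (rule card_of_Times_same_infinite[OF inf])
  then have "(card_of (UNIV :: ('u \<times> 'u) set), card_of (UNIV :: 'u set)) \<in> ordIso" by simp
  then obtain p :: "'u \<times> 'u \<Rightarrow> 'u" where p: "inj p"
    using card_of_ordIso[of "UNIV :: ('u \<times> 'u) set" "UNIV :: 'u set"] bij_betw_imp_inj_on by blast
  obtain s :: "nat \<Rightarrow> 'u" where s: "inj s"
    using arb_countable_map[of "{}"] by blast
  define w where "w = (\<lambda>(x::'u, y, z). p (x, p (y, z)))"
  have p_eq: "p u = p v \<longleftrightarrow> u = v" for u v using p by (rule inj_eq)
  have w_eq: "w u = w v \<longleftrightarrow> u = v" for u v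
    by (cases u; cases v) (simp add: w_def p_eq)
  define g :: "('u \<times> 'u \<times> 'u) list \<Rightarrow> 'u" where
    "g = (\<lambda>l. foldr (\<lambda>t r. p (w t, r)) l (s 0))"
  define e :: "('u \<times> 'u \<times> 'u) list \<Rightarrow> 'u" where "e = (\<lambda>l. p (s (length l), g l))"
  have g: "length l = length m \<Longrightarrow> g l = g m \<Longrightarrow> l = m" for l m
    unfolding g_def by (induction l m rule: list_induct2) (simp_all add: p_eq w_eq)
  have "inj e"
  proof (rule injI)
    fix l m assume "e l = e m"
    then have "s (length l) = s (length m)" "g l = g m"
      by (simp_all add: e_def p_eq)
    then show "l = m" using g[of l m] injD[OF s] by blast
  qed
  then show ?thesis unfolding code_def by (rule someI[of inj])
qed

definition tcls ::
  "('k,'u::infinite) bimod \<Rightarrow> ('k,'u) bimod \<Rightarrow> 'u \<Rightarrow> 'u \<Rightarrow> ('u \<times> 'u \<times> 'u) list \<Rightarrow> 'u" where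
  "tcls F G c a l = code (SOME l'. teq F G c a l l')"

lemma tcls_eq_iff: "tcls F G c a l = tcls F G c a m \<longleftrightarrow> teq F G c a l m"
proof -
  have r: "teq F G c a l (SOME l'. teq F G c a l l')" for l
    by (rule someI[of _ l]) (rule teq.refl)
  show ?thesis
  proof
    assume "tcls F G c a l = tcls F G c a m"
    then have "(SOME l'. teq F G c a l l') = (SOME l'. teq F G c a m l')"
      using inj_code by (auto simp: tcls_def dest: injD)
    then show "teq F G c a l m" using r[of l] r[of m] by (metis teq.sym teq.trans)
  next
    assume "teq F G c a l m"
    then have "teq F G c a l = teq F G c a m"
      by (intro ext iffI) (blast intro: teq.sym teq.trans)+
    then show "tcls F G c a l = tcls F G c a m" by (simp add: tcls_def)
  qed
qed

lemma decode_tcls: "teq F G c a l (decode (tcls F G c a l))"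
  unfolding decode_def tcls_def
  using someI[of "teq F G c a l" l, OF teq.refl] by (simp add: inv_into_f_f[OF inj_code])

text \<open>\<open>F \<boxtimes> G : A \<leadsto> C\<close> for \<open>G : A \<leadsto> B\<close> and \<open>F : B \<leadsto> C\<close>.\<close>

definition tens ::
  "('k,'u::infinite) bimod \<Rightarrow> ('k,'u) bimod \<Rightarrow> ('k,'u) bimod"  (infixr \<open>\<boxtimes>\<close> 70) where
  "F \<boxtimes> G = \<lparr>dom = dom G, cod = cod F,
     val = (\<lambda>c a. \<lparr>carrier = tcls F G c a ` lists (tgens F G c a),
                   monoid.mult = undefined, one = undefined,
                   zero = tcls F G c a [],
                   add = (\<lambda>p q. tcls F G c a (decode p @ decode q)),
                   smult = (\<lambda>k p. tcls F G c a
                     (map (\<lambda>(b, y, x). (b, k \<odot>\<^bsub>val F c b\<^esub> y, x)) (decode p)))\<rparr>),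
     act = (\<lambda>c c' a a' \<gamma> \<alpha> p. tcls F G c' a'
              (map (\<lambda>(b, y, x). (b, act F c c' b b \<gamma> (Ident (dom F) b) y,
                                    act G b b a a' (Ident (cod G) b) \<alpha> x)) (decode p)))\<rparr>"

definition hcomp ::
  "('k,'u::infinite) cell \<Rightarrow> ('k,'u) cell \<Rightarrow> ('k,'u) cell"  (infixr \<open>\<star>\<close> 70) where
  "\<sigma> \<star> \<tau> = mk_cell (src \<sigma> \<boxtimes> src \<tau>) (tgt \<sigma> \<boxtimes> tgt \<tau>)
     (\<lambda>c a p. tcls (tgt \<sigma>) (tgt \<tau>) c a
        (map (\<lambda>(b, y, x). (b, cmp \<sigma> c b y, cmp \<tau> b a x)) (decode p)))"

definition unit_bimod :: "('k,'u) kcat \<Rightarrow> ('k,'u) bimod" where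
  "unit_bimod B = \<lparr>dom = B, cod = B, val = Hom B,
     act = (\<lambda>b b' d d' \<beta> \<delta> h. Comp B b' b d' (Comp B b d d' \<delta> h) \<beta>)\<rparr>"

text \<open>The associativity constraint \<open>(H \<boxtimes> G) \<boxtimes> F \<rightarrow> H \<boxtimes> (G \<boxtimes> F)\<close>, \<open>(z \<otimes> y) \<otimes> x \<mapsto> z \<otimes> (y \<otimes> x)\<close>.\<close>

definition assoc ::
  "('k,'u::infinite) bimod \<Rightarrow> ('k,'u) bimod \<Rightarrow> ('k,'u) bimod \<Rightarrow> ('k,'u) cell" where
  "assoc H G F = mk_cell ((H \<boxtimes> G) \<boxtimes> F) (H \<boxtimes> (G \<boxtimes> F))
     (\<lambda>d a p. tcls H (G \<boxtimes> F) d a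
        [(c, z, tcls G F c a [(b, y, x)]). (b, w, x) \<leftarrow> decode p, (c, z, y) \<leftarrow> decode w])"

definition msum :: "('k,'u) module \<Rightarrow> 'u list \<Rightarrow> 'u" where
  "msum M xs = foldr (\<lambda>x s. x \<oplus>\<^bsub>M\<^esub> s) xs \<zero>\<^bsub>M\<^esub>"

text \<open>The unit constraints \<open>1\<^sub>B \<boxtimes> F \<rightarrow> F\<close> and \<open>F \<boxtimes> 1\<^sub>A \<rightarrow> F\<close>, given by the actions of \<open>B\<close> and of \<open>A\<close>.\<close>

definition lunit :: "('k,'u::infinite) bimod \<Rightarrow> ('k,'u) cell" where
  "lunit F = mk_cell (unit_bimod (cod F) \<boxtimes> F) F
     (\<lambda>b a p. msum (val F b a)
        (map (\<lambda>(b', \<beta>, x). act F b' b a a \<beta> (Ident (dom F) a) x) (decode p)))"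

definition runit :: "('k,'u::infinite) bimod \<Rightarrow> ('k,'u) cell" where
  "runit F = mk_cell (F \<boxtimes> unit_bimod (dom F)) F
     (\<lambda>b a p. msum (val F b a)
        (map (\<lambda>(a', y, \<alpha>). act F b b a' a (Ident (cod F) b) \<alpha> y) (decode p)))"

section \<open>Flatness, purity, adjunctions\<close>

definition right_flat :: "'k ring \<Rightarrow> ('k,'u::infinite) bimod \<Rightarrow> bool" where
  "right_flat K g \<longleftrightarrow>
     (\<forall>C. kcategory K C \<longrightarrow>
        (\<forall>e p q. is_equalizer K e p q \<and> one_cell K C (dom g) (src e) \<longrightarrow>
           is_equalizer K (id_cell g \<star> e) (id_cell g \<star> p) (id_cell g \<star> q)))"

definition left_flat :: "'k ring \<Rightarrow> ('k,'u::infinite) bimod \<Rightarrow> bool" where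
  "left_flat K g \<longleftrightarrow>
     (\<forall>C. kcategory K C \<longrightarrow>
        (\<forall>e p q. is_equalizer K e p q \<and> one_cell K (cod g) C (src e) \<longrightarrow>
           is_equalizer K (e \<star> id_cell g) (p \<star> id_cell g) (q \<star> id_cell g)))"

definition right_pure :: "'k ring \<Rightarrow> ('k,'u::infinite) cell \<Rightarrow> bool" where
  "right_pure K \<tau> \<longleftrightarrow>
     (\<forall>C h. kcategory K C \<and> one_cell K C (dom (src \<tau>)) h \<longrightarrow> regular_mono K (\<tau> \<star> id_cell h))"

definition left_pure :: "'k ring \<Rightarrow> ('k,'u::infinite) cell \<Rightarrow> bool" where
  "left_pure K \<tau> \<longleftrightarrow>
     (\<forall>C h. kcategory K C \<and> one_cell K (cod (src \<tau>)) C h \<longrightarrow> regular_mono K (id_cell h \<star> \<tau>))"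

definition adjunction ::
  "'k ring \<Rightarrow> ('k,'u::infinite) kcat \<Rightarrow> ('k,'u) kcat \<Rightarrow> ('k,'u) bimod \<Rightarrow> ('k,'u) bimod \<Rightarrow>
   ('k,'u) cell \<Rightarrow> ('k,'u) cell \<Rightarrow> bool" where
  "adjunction K A B f fs \<eta> \<epsilon> \<longleftrightarrow>
     one_cell K A B f \<and> one_cell K B A fs \<and>
     \<eta> \<in> cells K (unit_bimod A) (fs \<boxtimes> f) \<and> \<epsilon> \<in> cells K (f \<boxtimes> fs) (unit_bimod B) \<and>
     lunit f \<bullet> (\<epsilon> \<star> id_cell f) \<bullet> inv_cell K (assoc f fs f) \<bullet> (id_cell f \<star> \<eta>) \<bullet> inv_cell K (runit f)
       = id_cell f \<and>
     runit fs \<bullet> (id_cell fs \<star> \<epsilon>) \<bullet> assoc fs f fs \<bullet> (\<eta> \<star> id_cell fs) \<bullet> inv_cell K (lunit fs)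
       = id_cell fs"

text \<open>\<open>\<eta>\<^sub>f\<close> for a separable bimodule \<open>f\<close> splits in \<open>Bim(A,A)\<close>.\<close>

definition separable :: "'k ring \<Rightarrow> ('k,'u::infinite) cell \<Rightarrow> bool" where
  "separable K \<eta> \<longleftrightarrow> split_mono K \<eta>"

section \<open>The monoid of the adjunction and its subbimodules\<close>

text \<open>\<open>m\<^sub>f : (f\<^sup>* \<boxtimes> f) \<boxtimes> (f\<^sup>* \<boxtimes> f) \<rightarrow> f\<^sup>* \<boxtimes> f\<close>.\<close>

definition mon_mult ::
  "'k ring \<Rightarrow> ('k,'u::infinite) bimod \<Rightarrow> ('k,'u) bimod \<Rightarrow> ('k,'u) cell \<Rightarrow> ('k,'u) cell" where
  "mon_mult K f fs \<epsilon> =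
     (id_cell fs \<star> (lunit f \<bullet> (\<epsilon> \<star> id_cell f) \<bullet> inv_cell K (assoc f fs f))) \<bullet>
     assoc fs f (fs \<boxtimes> f)"

text \<open>Subbimodules are kept empty away from the objects, so that they are determined by their
  values.\<close>

definition subbimodule :: "'k ring \<Rightarrow> ('k,'u) bimod \<Rightarrow> ('u \<Rightarrow> 'u \<Rightarrow> 'u set) \<Rightarrow> bool" where
  "subbimodule K F I \<longleftrightarrow>
     (\<forall>b\<in>Ob (cod F). \<forall>a\<in>Ob (dom F). submodule (I b a) K (val F b a)) \<and>
     (\<forall>b\<in>Ob (cod F). \<forall>b'\<in>Ob (cod F). \<forall>a\<in>Ob (dom F). \<forall>a'\<in>Ob (dom F).
        \<forall>\<beta>\<in>carrier (Hom (cod F) b' b). \<forall>\<alpha>\<in>carrier (Hom (dom F) a a').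
        \<forall>x\<in>I b a. act F b b' a a' \<beta> \<alpha> x \<in> I b' a') \<and>
     (\<forall>b a. \<not> (b \<in> Ob (cod F) \<and> a \<in> Ob (dom F)) \<longrightarrow> I b a = {})"

definition sub_bimod :: "('k,'u) bimod \<Rightarrow> ('u \<Rightarrow> 'u \<Rightarrow> 'u set) \<Rightarrow> ('k,'u) bimod" where
  "sub_bimod F I = F\<lparr>val := \<lambda>b a. (val F b a)\<lparr>carrier := I b a\<rparr>\<rparr>"

definition incl :: "('k,'u) bimod \<Rightarrow> ('u \<Rightarrow> 'u \<Rightarrow> 'u set) \<Rightarrow> ('k,'u) cell" where
  "incl F I = mk_cell (sub_bimod F I) F (\<lambda>b a x. x)"

definition image_cell :: "('k,'u) cell \<Rightarrow> 'u \<Rightarrow> 'u \<Rightarrow> 'u set" where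
  "image_cell \<tau> b a =
     (if b \<in> Ob (cod (src \<tau>)) \<and> a \<in> Ob (dom (src \<tau>))
      then cmp \<tau> b a ` carrier (val (src \<tau>) b a) else {})"

definition Il_set ::
  "'k ring \<Rightarrow> ('k,'u::infinite) bimod \<Rightarrow> ('k,'u) bimod \<Rightarrow> ('k,'u) cell \<Rightarrow>
   ('u \<Rightarrow> 'u \<Rightarrow> 'u set) set" where
  "Il_set K f fs \<epsilon> = {I. subbimodule K (fs \<boxtimes> f) I \<and>
     iso_cell K (mon_mult K f fs \<epsilon> \<bullet> (id_cell (fs \<boxtimes> f) \<star> incl (fs \<boxtimes> f) I))}"

definition Ir_set ::
  "'k ring \<Rightarrow> ('k,'u::infinite) bimod \<Rightarrow> ('k,'u) bimod \<Rightarrow> ('k,'u) cell \<Rightarrow>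
   ('u \<Rightarrow> 'u \<Rightarrow> 'u set) set" where
  "Ir_set K f fs \<epsilon> = {I. subbimodule K (fs \<boxtimes> f) I \<and>
     iso_cell K (mon_mult K f fs \<epsilon> \<bullet> (incl (fs \<boxtimes> f) I \<star> id_cell (fs \<boxtimes> f)))}"

definition sub_prod ::
  "'k ring \<Rightarrow> ('k,'u::infinite) bimod \<Rightarrow> ('k,'u) bimod \<Rightarrow> ('k,'u) cell \<Rightarrow>
   ('u \<Rightarrow> 'u \<Rightarrow> 'u set) \<Rightarrow> ('u \<Rightarrow> 'u \<Rightarrow> 'u set) \<Rightarrow> ('u \<Rightarrow> 'u \<Rightarrow> 'u set)" where
  "sub_prod K f fs \<epsilon> I J =
     image_cell (mon_mult K f fs \<epsilon> \<bullet> (incl (fs \<boxtimes> f) I \<star> incl (fs \<boxtimes> f) J))"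

definition Il ::
  "'k ring \<Rightarrow> ('k,'u::infinite) bimod \<Rightarrow> ('k,'u) bimod \<Rightarrow> ('k,'u) cell \<Rightarrow> ('k,'u) cell \<Rightarrow>
   ('u \<Rightarrow> 'u \<Rightarrow> 'u set) monoid" where
  "Il K f fs \<eta> \<epsilon> =
     \<lparr>carrier = Il_set K f fs \<epsilon>, monoid.mult = sub_prod K f fs \<epsilon>, one = image_cell \<eta>\<rparr>"

definition Ir ::
  "'k ring \<Rightarrow> ('k,'u::infinite) bimod \<Rightarrow> ('k,'u) bimod \<Rightarrow> ('k,'u) cell \<Rightarrow> ('k,'u) cell \<Rightarrow>
   ('u \<Rightarrow> 'u \<Rightarrow> 'u set) monoid" where
  "Ir K f fs \<eta> \<epsilon> =
     \<lparr>carrier = Ir_set K f fs \<epsilon>, monoid.mult = sub_prod K f fs \<epsilon>, one = image_cell \<eta>\<rparr>"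

section \<open>The comonoid of the adjunction and its endomorphisms\<close>

text \<open>\<open>f \<boxtimes> f\<^sup>* \<rightarrow> (f \<boxtimes> f\<^sup>*) \<boxtimes> (f \<boxtimes> f\<^sup>*)\<close>.\<close>

definition comon_comult ::
  "'k ring \<Rightarrow> ('k,'u::infinite) bimod \<Rightarrow> ('k,'u) bimod \<Rightarrow> ('k,'u) cell \<Rightarrow> ('k,'u) cell" where
  "comon_comult K f fs \<eta> =
     inv_cell K (assoc f fs (f \<boxtimes> fs)) \<bullet>
     (id_cell f \<star> (assoc fs f fs \<bullet> (\<eta> \<star> id_cell fs) \<bullet> inv_cell K (lunit fs)))"

definition comonoid_End ::
  "'k ring \<Rightarrow> ('k,'u::infinite) bimod \<Rightarrow> ('k,'u) bimod \<Rightarrow> ('k,'u) cell \<Rightarrow> ('k,'u) cell \<Rightarrow>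
   ('k,'u) cell monoid" where
  "comonoid_End K f fs \<eta> \<epsilon> =
     \<lparr>carrier = {g \<in> cells K (f \<boxtimes> fs) (f \<boxtimes> fs).
        comon_comult K f fs \<eta> \<bullet> g = (g \<star> g) \<bullet> comon_comult K f fs \<eta> \<and> \<epsilon> \<bullet> g = \<epsilon>},
      monoid.mult = (\<lambda>g h. g \<bullet> h), one = id_cell (f \<boxtimes> fs)\<rparr>"

section \<open>The comparison maps\<close>

definition xi ::
  "'k ring \<Rightarrow> ('k,'u::infinite) bimod \<Rightarrow> ('k,'u) bimod \<Rightarrow> ('k,'u) cell \<Rightarrow>
   ('u \<Rightarrow> 'u \<Rightarrow> 'u set) \<Rightarrow> ('k,'u) cell" where
  "xi K f fs \<epsilon> I =
     lunit f \<bullet> (\<epsilon> \<star> id_cell f) \<bullet> inv_cell K (assoc f fs f) \<bullet> (id_cell f \<star> incl (fs \<boxtimes> f) I)"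

definition Gamma ::
  "'k ring \<Rightarrow> ('k,'u::infinite) bimod \<Rightarrow> ('k,'u) bimod \<Rightarrow> ('k,'u) cell \<Rightarrow>
   ('u \<Rightarrow> 'u \<Rightarrow> 'u set) \<Rightarrow> ('k,'u) cell" where
  "Gamma K f fs \<epsilon> I =
     runit (f \<boxtimes> fs) \<bullet> (id_cell (f \<boxtimes> fs) \<star> \<epsilon>) \<bullet> assoc (f \<boxtimes> fs) f fs \<bullet>
     ((inv_cell K (assoc f fs f) \<bullet> (id_cell f \<star> incl (fs \<boxtimes> f) I)) \<star> id_cell fs) \<bullet>
     (inv_cell K (xi K f fs \<epsilon> I) \<star> id_cell fs)"

definition xi_star ::
  "'k ring \<Rightarrow> ('k,'u::infinite) bimod \<Rightarrow> ('k,'u) bimod \<Rightarrow> ('k,'u) cell \<Rightarrow>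
   ('u \<Rightarrow> 'u \<Rightarrow> 'u set) \<Rightarrow> ('k,'u) cell" where
  "xi_star K f fs \<epsilon> I =
     runit fs \<bullet> (id_cell fs \<star> \<epsilon>) \<bullet> assoc fs f fs \<bullet> (incl (fs \<boxtimes> f) I \<star> id_cell fs)"

definition Gamma_star ::
  "'k ring \<Rightarrow> ('k,'u::infinite) bimod \<Rightarrow> ('k,'u) bimod \<Rightarrow> ('k,'u) cell \<Rightarrow>
   ('u \<Rightarrow> 'u \<Rightarrow> 'u set) \<Rightarrow> ('k,'u) cell" where
  "Gamma_star K f fs \<epsilon> I =
     lunit (f \<boxtimes> fs) \<bullet> (\<epsilon> \<star> id_cell (f \<boxtimes> fs)) \<bullet> inv_cell K (assoc f fs (f \<boxtimes> fs)) \<bullet>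
     (id_cell f \<star> (assoc fs f fs \<bullet> (incl (fs \<boxtimes> f) I \<star> id_cell fs))) \<bullet>
     (id_cell f \<star> inv_cell K (xi_star K f fs \<epsilon> I))"

section \<open>Monoid isomorphisms\<close>

definition opposite_monoid :: "'a monoid \<Rightarrow> 'a monoid" where
  "opposite_monoid M = M\<lparr>monoid.mult := \<lambda>x y. y \<otimes>\<^bsub>M\<^esub> x\<rparr>"

definition monoid_iso :: "'a monoid \<Rightarrow> 'b monoid \<Rightarrow> ('a \<Rightarrow> 'b) \<Rightarrow> bool" where
  "monoid_iso M N h \<longleftrightarrow> monoid M \<and> monoid N \<and> h \<in> iso M N \<and> h \<one>\<^bsub>M\<^esub> = \<one>\<^bsub>N\<^esub>"

end

theory Submission
  imports Defs
begin

text \<open>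
  By transposition along \<open>- \<otimes> f\<^sup>* \<stileturn> - \<otimes> f\<close>, the comonoid endomorphisms of \<open>f \<otimes> f\<^sup>*\<close> are the
  coactions \<open>t : f \<rightarrow> f \<otimes> f\<^sup>* \<otimes> f\<close> of this comonoid on \<open>f\<close>. A subbimodule \<open>I\<close> with \<open>\<xi>\<^sub>I\<close> invertible gives the
  coaction \<open>(f \<otimes> i\<^sub>I) \<cdot> \<xi>\<^sub>I\<inverse>\<close>, and \<open>\<Gamma>\<^sub>f I\<close> is its transpose. Multiplicativity needs no
  hypothesis: whenever \<open>\<mu> : M \<rightarrow> S\<^sub>f\<close> makes \<open>\<kappa> = (\<epsilon> \<otimes> f) \<cdot> (f \<otimes> \<mu>)\<close> invertible, the image of \<open>\<mu>\<close> has an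
  invertible \<open>\<xi>\<close> and its coaction is \<open>(f \<otimes> \<mu>) \<cdot> \<kappa>\<inverse>\<close>, because \<open>f \<otimes> -\<close> is right exact; this applies to
  the multiplication \<open>I \<otimes> J \<rightarrow> S\<^sub>f\<close> and to \<open>\<eta>\<close>. Injectivity is descent of elements along \<open>\<eta>\<close>, which
  is what purity provides. For surjectivity, a coaction \<open>t\<close> comes from the equalizer of \<open>f\<^sup>* \<otimes> t\<close> and
  \<open>\<eta> \<otimes> S\<^sub>f\<close>, provided that \<open>f \<otimes> -\<close> preserves it; if \<open>\<eta>\<close> splits, this equalizer is split. The
  statements about \<open>f\<^sup>*\<close> are the same ones in the bicategory with reversed 1-cells: the argument
  uses only properties of \<open>Bim\<close> that are invariant under this reversal.
\<close>

section \<open>Vertical composition\<close>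

text \<open>Reversing 1-cells would ordinarily replace every category by its opposite. Here the
  tensor product, the boundary maps, the constraints and their inverses are abstracted into the
  locale \<open>horizontal\<close>, whose axioms hold again once the arguments of the tensor product
  are swapped. The same bimodules and cells then interpret it twice; subbimodules, images and
  equalizers stay concrete because they see no orientation. Associators cannot be suppressed.
  Calculations therefore run in \<open>fs \<bowtie> (f \<bowtie> -)\<close> wherever possible, with
  the constraints packed into the units \<open>eta\<close>, \<open>eta'\<close> and the counits
  \<open>eps\<close>, \<open>eps'\<close>. Purity, flatness and separability enter only through two
  consequences, \<open>pure_unit\<close> and \<open>flat_coactions\<close>, which lets one
  isomorphism theorem serve all cases. Membership in \<open>Il_set\<close> is first translated into
  invertibility of \<open>sub_xi\<close>. That the subbimodules form a monoid is never verified on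
  triple products: associativity and the unit laws are reflected along the injective map
  \<open>gamma\<close>, so they rest on \<open>pure_unit\<close>.\<close>

abbreviation el where "el F b a \<equiv> carrier (val F b a)"

lemma klinear_closed: "klinear K M N h \<Longrightarrow> x \<in> carrier M \<Longrightarrow> h x \<in> carrier N"
  by (auto simp: klinear_def)

lemma klinear_add:
  "klinear K M N h \<Longrightarrow> x \<in> carrier M \<Longrightarrow> y \<in> carrier M \<Longrightarrow> h (x \<oplus>\<^bsub>M\<^esub> y) = h x \<oplus>\<^bsub>N\<^esub> h y"
  by (auto simp: klinear_def)

lemma klinear_smult:
  "klinear K M N h \<Longrightarrow> k \<in> carrier K \<Longrightarrow> x \<in> carrier M \<Longrightarrow> h (k \<odot>\<^bsub>M\<^esub> x) = k \<odot>\<^bsub>N\<^esub> h x"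
  by (auto simp: klinear_def)

lemma klinear_zero:
  assumes "Module.module K M" "Module.module K N" "klinear K M N h"
  shows "h \<zero>\<^bsub>M\<^esub> = \<zero>\<^bsub>N\<^esub>"
proof -
  interpret M: Module.module K M by fact
  interpret N: Module.module K N by fact
  have c: "h \<zero>\<^bsub>M\<^esub> \<in> carrier N" using assms(3) by (simp add: klinear_closed)
  have "h \<zero>\<^bsub>M\<^esub> \<oplus>\<^bsub>N\<^esub> h \<zero>\<^bsub>M\<^esub> = h \<zero>\<^bsub>M\<^esub>"
    using klinear_add[OF assms(3), of "\<zero>\<^bsub>M\<^esub>" "\<zero>\<^bsub>M\<^esub>"] by simp
  then show ?thesis using c by (metis N.add.l_cancel_one')
qed

lemma klinear_ident: "klinear K M M (\<lambda>x. x)"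
  by (auto simp: klinear_def)

lemma klinear_compose:
  "klinear K M N h \<Longrightarrow> klinear K N P g \<Longrightarrow> klinear K M P (\<lambda>x. g (h x))"
  unfolding klinear_def by (auto simp: Pi_iff)

lemma klinear_cong:
  assumes "Module.module K M" "klinear K M N h" "\<And>x. x \<in> carrier M \<Longrightarrow> g x = h x"
  shows "klinear K M N g"
proof -
  interpret M: Module.module K M by fact
  show ?thesis using assms(2,3) unfolding klinear_def by (auto simp: Pi_iff)
qed

lemma klinear_plus:
  assumes "Module.module K M" "Module.module K N" "klinear K M N g" "klinear K M N h"
  shows "klinear K M N (\<lambda>x. g x \<oplus>\<^bsub>N\<^esub> h x)"
proof -
  interpret M: Module.module K M by fact
  interpret N: Module.module K N by fact
  note c = klinear_closed[OF assms(3)] klinear_closed[OF assms(4)]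
  show ?thesis
    unfolding klinear_def
    using klinear_add[OF assms(3)] klinear_add[OF assms(4)] klinear_smult[OF assms(3)] klinear_smult[OF assms(4)]
    by (simp add: c N.smult_r_distr N.a_ac)
qed

lemma klinear_zero_map:
  assumes "Module.module K N"
  shows "klinear K M N (\<lambda>x. \<zero>\<^bsub>N\<^esub>)"
proof -
  interpret N: Module.module K N by fact
  show ?thesis by (simp add: klinear_def)
qed

lemma mk_cell_simps [simp]: "src (mk_cell F G t) = F" "tgt (mk_cell F G t) = G"
  by (simp_all add: mk_cell_def)

lemma cmp_mk_cell [simp]:
  "b \<in> Ob (cod F) \<Longrightarrow> a \<in> Ob (dom F) \<Longrightarrow> x \<in> el F b a
     \<Longrightarrow> cmp (mk_cell F G t) b a x = t b a x"
  by (simp add: mk_cell_def)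

lemma two_cell_bimodule:
  "two_cell K \<tau> \<Longrightarrow> bimodule K (src \<tau>)" "two_cell K \<tau> \<Longrightarrow> bimodule K (tgt \<tau>)"
  by (simp_all add: two_cell_def)

lemma two_cell_tgt:
  "two_cell K \<tau> \<Longrightarrow> dom (tgt \<tau>) = dom (src \<tau>)" "two_cell K \<tau> \<Longrightarrow> cod (tgt \<tau>) = cod (src \<tau>)"
  by (simp_all add: two_cell_def)

lemma two_cell_linear:
  "two_cell K \<tau> \<Longrightarrow> b \<in> Ob (cod (src \<tau>)) \<Longrightarrow> a \<in> Ob (dom (src \<tau>))
     \<Longrightarrow> klinear K (val (src \<tau>) b a) (val (tgt \<tau>) b a) (cmp \<tau> b a)"
  by (simp add: two_cell_def)

lemma two_cell_natural:
  "two_cell K \<tau> \<Longrightarrow> b \<in> Ob (cod (src \<tau>)) \<Longrightarrow> b' \<in> Ob (cod (src \<tau>)) \<Longrightarrow> a \<in> Ob (dom (src \<tau>))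
     \<Longrightarrow> a' \<in> Ob (dom (src \<tau>)) \<Longrightarrow> \<beta> \<in> carrier (Hom (cod (src \<tau>)) b' b)
     \<Longrightarrow> \<alpha> \<in> carrier (Hom (dom (src \<tau>)) a a') \<Longrightarrow> x \<in> el (src \<tau>) b a
     \<Longrightarrow> cmp \<tau> b' a' (act (src \<tau>) b b' a a' \<beta> \<alpha> x) = act (tgt \<tau>) b b' a a' \<beta> \<alpha> (cmp \<tau> b a x)"
  by (simp add: two_cell_def)

lemma cmp_closed:
  "two_cell K \<tau> \<Longrightarrow> b \<in> Ob (cod (src \<tau>)) \<Longrightarrow> a \<in> Ob (dom (src \<tau>)) \<Longrightarrow> x \<in> el (src \<tau>) b a
     \<Longrightarrow> cmp \<tau> b a x \<in> el (tgt \<tau>) b a"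
  by (meson klinear_closed two_cell_linear)

lemma cell_eqI:
  assumes "two_cell K \<sigma>" "two_cell K \<tau>" "src \<sigma> = src \<tau>" "tgt \<sigma> = tgt \<tau>"
    and "\<And>b a x. b \<in> Ob (cod (src \<tau>)) \<Longrightarrow> a \<in> Ob (dom (src \<tau>)) \<Longrightarrow> x \<in> el (src \<tau>) b a
           \<Longrightarrow> cmp \<sigma> b a x = cmp \<tau> b a x"
  shows "\<sigma> = \<tau>"
proof -
  have "cmp \<sigma> b a x = cmp \<tau> b a x" for b a x
  proof (cases "b \<in> Ob (cod (src \<tau>)) \<and> a \<in> Ob (dom (src \<tau>)) \<and> x \<in> el (src \<tau>) b a")
    case True
    then show ?thesis using assms(5) by blast
  next
    case False
    then have "cmp \<sigma> b a x = undefined" "cmp \<tau> b a x = undefined"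
      using assms(1,2,3) unfolding two_cell_def by auto
    then show ?thesis by simp
  qed
  then have "cmp \<sigma> = cmp \<tau>" by blast
  then show ?thesis using assms(3,4) by simp
qed

lemma two_cell_mk_cell:
  assumes "bimodule K F" "bimodule K G" "dom F = dom G" "cod F = cod G"
    and lin: "\<And>b a. b \<in> Ob (cod F) \<Longrightarrow> a \<in> Ob (dom F) \<Longrightarrow> klinear K (val F b a) (val G b a) (t b a)"
    and nat: "\<And>b b' a a' \<beta> \<alpha> x. b \<in> Ob (cod F) \<Longrightarrow> b' \<in> Ob (cod F) \<Longrightarrow> a \<in> Ob (dom F) \<Longrightarrow> a' \<in> Ob (dom F)
      \<Longrightarrow> \<beta> \<in> carrier (Hom (cod F) b' b) \<Longrightarrow> \<alpha> \<in> carrier (Hom (dom F) a a') \<Longrightarrow> x \<in> el F b a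
      \<Longrightarrow> t b' a' (act F b b' a a' \<beta> \<alpha> x) = act G b b' a a' \<beta> \<alpha> (t b a x)"
  shows "two_cell K (mk_cell F G t)"
proof -
  interpret F: bimodule K F by fact
  have l: "klinear K (val F b a) (val G b a) (cmp (mk_cell F G t) b a)"
    if "b \<in> Ob (cod F)" "a \<in> Ob (dom F)" for b a
    using that by (intro klinear_cong[OF F.val_module lin]) auto
  have n: "cmp (mk_cell F G t) b' a' (act F b b' a a' \<beta> \<alpha> x) = act G b b' a a' \<beta> \<alpha> (cmp (mk_cell F G t) b a x)"
    if "b \<in> Ob (cod F)" "b' \<in> Ob (cod F)" "a \<in> Ob (dom F)" "a' \<in> Ob (dom F)"
      "\<beta> \<in> carrier (Hom (cod F) b' b)" "\<alpha> \<in> carrier (Hom (dom F) a a')" "x \<in> el F b a"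
    for b b' a a' \<beta> \<alpha> x
    using that nat[OF that] klinear_closed[OF F.act_linear[OF that(1-6)]] by simp
  show ?thesis
    unfolding two_cell_def using assms(1-4) l n by (simp add: mk_cell_def)
qed

lemma vcomp_simps [simp]: "src (\<sigma> \<bullet> \<tau>) = src \<tau>" "tgt (\<sigma> \<bullet> \<tau>) = tgt \<sigma>"
  by (simp_all add: vcomp_def)

lemma cmp_vcomp [simp]:
  "b \<in> Ob (cod (src \<tau>)) \<Longrightarrow> a \<in> Ob (dom (src \<tau>)) \<Longrightarrow> x \<in> el (src \<tau>) b a
     \<Longrightarrow> cmp (\<sigma> \<bullet> \<tau>) b a x = cmp \<sigma> b a (cmp \<tau> b a x)"
  by (simp add: vcomp_def)

lemma vcomp_two_cell:
  assumes "two_cell K \<sigma>" "two_cell K \<tau>" "src \<sigma> = tgt \<tau>"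
  shows "two_cell K (\<sigma> \<bullet> \<tau>)"
  unfolding vcomp_def
proof (rule two_cell_mk_cell)
  note t = two_cell_tgt[OF assms(1)] two_cell_tgt[OF assms(2)]
  show "bimodule K (src \<tau>)" "bimodule K (tgt \<sigma>)" using assms two_cell_bimodule by auto
  show "dom (src \<tau>) = dom (tgt \<sigma>)" "cod (src \<tau>) = cod (tgt \<sigma>)" using t assms(3) by auto
  show "klinear K (val (src \<tau>) b a) (val (tgt \<sigma>) b a) (\<lambda>x. cmp \<sigma> b a (cmp \<tau> b a x))"
    if "b \<in> Ob (cod (src \<tau>))" "a \<in> Ob (dom (src \<tau>))" for b a
    using that assms(3) t two_cell_linear[OF assms(2) that] two_cell_linear[OF assms(1), of b a]
    by (auto intro: klinear_compose)
  show "cmp \<sigma> b' a' (cmp \<tau> b' a' (act (src \<tau>) b b' a a' \<beta> \<alpha> x)) =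
        act (tgt \<sigma>) b b' a a' \<beta> \<alpha> (cmp \<sigma> b a (cmp \<tau> b a x))"
    if "b \<in> Ob (cod (src \<tau>))" "b' \<in> Ob (cod (src \<tau>))" "a \<in> Ob (dom (src \<tau>))" "a' \<in> Ob (dom (src \<tau>))"
      "\<beta> \<in> carrier (Hom (cod (src \<tau>)) b' b)" "\<alpha> \<in> carrier (Hom (dom (src \<tau>)) a a')"
      "x \<in> el (src \<tau>) b a"
    for b b' a a' \<beta> \<alpha> x
    using that assms(3) t cmp_closed[OF assms(2) that(1,3,7)]
      two_cell_natural[OF assms(2) that] two_cell_natural[OF assms(1)] by simp
qed

text \<open>The leftmost factor is only evaluated, and both sides are truncated to the source of
  \<open>\<rho>\<close>; what has to be known is that the values of \<open>\<rho>\<close> lie where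
  \<open>\<tau>\<close> lives.\<close>

lemma vcomp_assoc:
  assumes "two_cell K \<tau>" "two_cell K \<rho>" "src \<tau> = tgt \<rho>"
  shows "(\<sigma> \<bullet> \<tau>) \<bullet> \<rho> = \<sigma> \<bullet> \<tau> \<bullet> \<rho>"
proof -
  have c: "cmp ((\<sigma> \<bullet> \<tau>) \<bullet> \<rho>) b a x = cmp (\<sigma> \<bullet> \<tau> \<bullet> \<rho>) b a x" for b a x
  proof (cases "b \<in> Ob (cod (src \<rho>)) \<and> a \<in> Ob (dom (src \<rho>)) \<and> x \<in> el (src \<rho>) b a")
    case True
    then show ?thesis
      using cmp_closed[OF assms(2)] two_cell_tgt[OF assms(2)] assms(3) by simp
  next
    case False
    then show ?thesis by (auto simp: vcomp_def mk_cell_def)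
  qed
  have "cmp ((\<sigma> \<bullet> \<tau>) \<bullet> \<rho>) = cmp (\<sigma> \<bullet> \<tau> \<bullet> \<rho>)" using c by blast
  then show ?thesis by simp
qed

lemma id_cell_simps [simp]: "src (id_cell F) = F" "tgt (id_cell F) = F"
  by (simp_all add: id_cell_def)

lemma cmp_id_cell [simp]:
  "b \<in> Ob (cod F) \<Longrightarrow> a \<in> Ob (dom F) \<Longrightarrow> x \<in> el F b a \<Longrightarrow> cmp (id_cell F) b a x = x"
  by (simp add: id_cell_def)

lemma id_cell_two_cell: "bimodule K F \<Longrightarrow> two_cell K (id_cell F)"
  unfolding id_cell_def by (rule two_cell_mk_cell) (auto simp: klinear_ident)

lemma vcomp_id_left:
  assumes "two_cell K \<tau>" "tgt \<tau> = F"
  shows "id_cell F \<bullet> \<tau> = \<tau>"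
  using assms cmp_closed[OF assms(1)] two_cell_tgt[OF assms(1)]
  by (intro cell_eqI[of K])
    (auto intro!: vcomp_two_cell[of K] id_cell_two_cell two_cell_bimodule)

lemma vcomp_id_right:
  assumes "two_cell K \<tau>" "src \<tau> = F"
  shows "\<tau> \<bullet> id_cell F = \<tau>"
  using assms
  by (intro cell_eqI[of K])
    (auto intro!: vcomp_two_cell[of K] id_cell_two_cell two_cell_bimodule)

lemma cells_iff: "\<tau> \<in> cells K F G \<longleftrightarrow> two_cell K \<tau> \<and> src \<tau> = F \<and> tgt \<tau> = G"
  by (simp add: cells_def)

lemma is_inverse_iff:
  "is_inverse K \<tau> \<sigma> \<longleftrightarrow> two_cell K \<sigma> \<and> src \<sigma> = tgt \<tau> \<and> tgt \<sigma> = src \<tau> \<and>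
     \<sigma> \<bullet> \<tau> = id_cell (src \<tau>) \<and> \<tau> \<bullet> \<sigma> = id_cell (tgt \<tau>)"
  by (auto simp: is_inverse_def cells_iff)

text \<open>Justifies the definite description in \<open>inv_cell\<close>.\<close>

lemma is_inverse_unique:
  assumes "two_cell K \<tau>" "is_inverse K \<tau> \<sigma>" "is_inverse K \<tau> \<rho>"
  shows "\<sigma> = \<rho>"
proof -
  have "\<sigma> = \<sigma> \<bullet> \<tau> \<bullet> \<rho>"
    using assms by (simp add: is_inverse_iff vcomp_id_right[of K])
  also have "\<dots> = (\<sigma> \<bullet> \<tau>) \<bullet> \<rho>"
    using assms by (intro vcomp_assoc[of K, symmetric]) (simp_all add: is_inverse_iff)
  also have "\<dots> = \<rho>"
    using assms by (simp add: is_inverse_iff vcomp_id_left[of K])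
  finally show ?thesis .
qed

lemma inv_cell_eq: "two_cell K \<tau> \<Longrightarrow> is_inverse K \<tau> \<sigma> \<Longrightarrow> inv_cell K \<tau> = \<sigma>"
  unfolding inv_cell_def by (rule the_equality) (auto intro: is_inverse_unique)

lemma iso_cell_inverse: "iso_cell K \<tau> \<Longrightarrow> is_inverse K \<tau> (inv_cell K \<tau>)"
  unfolding iso_cell_def using inv_cell_eq by metis

lemma inv_cell_props:
  assumes "iso_cell K \<tau>"
  shows "two_cell K (inv_cell K \<tau>)" "src (inv_cell K \<tau>) = tgt \<tau>" "tgt (inv_cell K \<tau>) = src \<tau>"
    "inv_cell K \<tau> \<bullet> \<tau> = id_cell (src \<tau>)" "\<tau> \<bullet> inv_cell K \<tau> = id_cell (tgt \<tau>)"
  using iso_cell_inverse[OF assms] by (simp_all add: is_inverse_iff)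

lemma iso_cellI: "two_cell K \<tau> \<Longrightarrow> is_inverse K \<tau> \<sigma> \<Longrightarrow> iso_cell K \<tau>"
  by (auto simp: iso_cell_def)

text \<open>A pointwise inverse of a linear and natural bijection is itself linear and natural, so
  \<open>g\<close> may be any function. The constraints are shown invertible in this way.\<close>

lemma iso_cell_pointwise:
  assumes "two_cell K \<tau>"
    and inv: "\<And>b a y. b \<in> Ob (cod (src \<tau>)) \<Longrightarrow> a \<in> Ob (dom (src \<tau>)) \<Longrightarrow> y \<in> el (tgt \<tau>) b a
      \<Longrightarrow> g b a y \<in> el (src \<tau>) b a \<and> cmp \<tau> b a (g b a y) = y"
    and left: "\<And>b a x. b \<in> Ob (cod (src \<tau>)) \<Longrightarrow> a \<in> Ob (dom (src \<tau>)) \<Longrightarrow> x \<in> el (src \<tau>) b a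
      \<Longrightarrow> g b a (cmp \<tau> b a x) = x"
  shows "iso_cell K \<tau>"
proof -
  interpret F: bimodule K "src \<tau>" by (rule two_cell_bimodule[OF assms(1)])
  interpret G: bimodule K "tgt \<tau>" by (rule two_cell_bimodule[OF assms(1)])
  note t = two_cell_tgt[OF assms(1)]
  let ?s = "mk_cell (tgt \<tau>) (src \<tau>) g"
  have s: "two_cell K ?s"
  proof (rule two_cell_mk_cell)
    fix b a assume o: "b \<in> Ob (cod (tgt \<tau>))" "a \<in> Ob (dom (tgt \<tau>))"
    interpret M: Module.module K "val (src \<tau>) b a" using F.val_module o t by simp
    interpret N: Module.module K "val (tgt \<tau>) b a" using G.val_module o by simp
    have l: "klinear K (val (src \<tau>) b a) (val (tgt \<tau>) b a) (cmp \<tau> b a)"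
      using two_cell_linear[OF assms(1)] o t by simp
    have i: "g b a y \<in> el (src \<tau>) b a" "cmp \<tau> b a (g b a y) = y" if "y \<in> el (tgt \<tau>) b a" for y
      using inv that o t by auto
    \<comment> \<open>Each linearity law for \<open>g\<close> follows by exhibiting a preimage under
      \<open>\<tau>\<close> and applying this.\<close>
    have e: "g b a y = x" if "x \<in> el (src \<tau>) b a" "y = cmp \<tau> b a x" for x y
      using left that o t by simp
    show "klinear K (val (tgt \<tau>) b a) (val (src \<tau>) b a) (g b a)"
      unfolding klinear_def using klinear_add[OF l] klinear_smult[OF l] i by (auto intro!: e)
  next
    fix b b' a a' \<beta> \<alpha> y
    assume *: "b \<in> Ob (cod (tgt \<tau>))" "b' \<in> Ob (cod (tgt \<tau>))" "a \<in> Ob (dom (tgt \<tau>))" "a' \<in> Ob (dom (tgt \<tau>))"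
      "\<beta> \<in> carrier (Hom (cod (tgt \<tau>)) b' b)" "\<alpha> \<in> carrier (Hom (dom (tgt \<tau>)) a a')" "y \<in> el (tgt \<tau>) b a"
    have i: "g b a y \<in> el (src \<tau>) b a" "cmp \<tau> b a (g b a y) = y" using inv * t by auto
    have "act (tgt \<tau>) b b' a a' \<beta> \<alpha> y = cmp \<tau> b' a' (act (src \<tau>) b b' a a' \<beta> \<alpha> (g b a y))"
      using two_cell_natural[OF assms(1), of b b' a a' \<beta> \<alpha> "g b a y"] * i t by simp
    then show "g b' a' (act (tgt \<tau>) b b' a a' \<beta> \<alpha> y) = act (src \<tau>) b b' a a' \<beta> \<alpha> (g b a y)"
      using left klinear_closed[OF F.act_linear] * i t by simp
  qed (use t two_cell_bimodule[OF assms(1)] in auto)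
  have "?s \<bullet> \<tau> = id_cell (src \<tau>)"
    using assms(1) s t left cmp_closed[OF assms(1)]
    by (intro cell_eqI[of K]) (auto intro!: vcomp_two_cell id_cell_two_cell two_cell_bimodule)
  moreover have "\<tau> \<bullet> ?s = id_cell (tgt \<tau>)"
    using assms(1) s t inv
    by (intro cell_eqI[of K]) (auto intro!: vcomp_two_cell id_cell_two_cell two_cell_bimodule)
  ultimately show ?thesis
    using s by (intro iso_cellI[OF assms(1), of ?s]) (simp add: is_inverse_iff)
qed

section \<open>Modules\<close>

lemma msum_simps [simp]: "msum M [] = \<zero>\<^bsub>M\<^esub>" "msum M (x # xs) = x \<oplus>\<^bsub>M\<^esub> msum M xs"
  by (simp_all add: msum_def)

lemma msum_closed:
  assumes "abelian_group M" "set xs \<subseteq> carrier M"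
  shows "msum M xs \<in> carrier M"
proof -
  interpret M: abelian_group M by fact
  show ?thesis using assms(2) by (induction xs) auto
qed

lemma msum_append:
  assumes "abelian_group M" "set xs \<subseteq> carrier M" "set ys \<subseteq> carrier M"
  shows "msum M (xs @ ys) = msum M xs \<oplus>\<^bsub>M\<^esub> msum M ys"
proof -
  interpret M: abelian_group M by fact
  show ?thesis using assms by (induction xs) (auto simp: msum_closed M.a_assoc)
qed

section \<open>Tensor products of bimodules\<close>

lemma (in bimodule) ident_cod: "b \<in> Ob (cod F) \<Longrightarrow> Ident (cod F) b \<in> carrier (Hom (cod F) b b)"
  using kcategory.ident_hom[OF cod_kcategory] .

lemma (in bimodule) ident_dom: "a \<in> Ob (dom F) \<Longrightarrow> Ident (dom F) a \<in> carrier (Hom (dom F) a a)"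
  using kcategory.ident_hom[OF dom_kcategory] .

lemma (in bimodule) val_abelian: "b \<in> Ob (cod F) \<Longrightarrow> a \<in> Ob (dom F) \<Longrightarrow> abelian_group (val F b a)"
  using Module.module.axioms(2)[OF val_module] .

lemma (in bimodule) act_closed:
  "b \<in> Ob (cod F) \<Longrightarrow> b' \<in> Ob (cod F) \<Longrightarrow> a \<in> Ob (dom F) \<Longrightarrow> a' \<in> Ob (dom F)
     \<Longrightarrow> \<beta> \<in> carrier (Hom (cod F) b' b) \<Longrightarrow> \<alpha> \<in> carrier (Hom (dom F) a a') \<Longrightarrow> x \<in> el F b a
     \<Longrightarrow> act F b b' a a' \<beta> \<alpha> x \<in> el F b' a'"
  by (rule klinear_closed[OF act_linear])

lemma (in bimodule) act_cod_dom:
  assumes "b \<in> Ob (cod F)" "b' \<in> Ob (cod F)" "a \<in> Ob (dom F)" "a' \<in> Ob (dom F)"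
    "\<beta> \<in> carrier (Hom (cod F) b' b)" "\<alpha> \<in> carrier (Hom (dom F) a a')" "x \<in> el F b a"
  shows "act F b b' a' a' \<beta> (Ident (dom F) a') (act F b b a a' (Ident (cod F) b) \<alpha> x)
    = act F b b' a a' \<beta> \<alpha> x"
  using act_comp[of b b b' a a' a' "Ident (cod F) b" \<beta> \<alpha> "Ident (dom F) a'" x] assms
    kcategory.comp_ident_left[OF cod_kcategory] kcategory.comp_ident_left[OF dom_kcategory]
  by (simp add: ident_cod ident_dom)

lemma (in bimodule) act_dom_cod:
  assumes "b \<in> Ob (cod F)" "b' \<in> Ob (cod F)" "a \<in> Ob (dom F)" "a' \<in> Ob (dom F)"
    "\<beta> \<in> carrier (Hom (cod F) b' b)" "\<alpha> \<in> carrier (Hom (dom F) a a')" "x \<in> el F b a"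
  shows "act F b' b' a a' (Ident (cod F) b') \<alpha> (act F b b' a a \<beta> (Ident (dom F) a) x)
    = act F b b' a a' \<beta> \<alpha> x"
  using act_comp[of b b' b' a a a' \<beta> "Ident (cod F) b'" "Ident (dom F) a" \<alpha> x] assms
    kcategory.comp_ident_right[OF cod_kcategory] kcategory.comp_ident_right[OF dom_kcategory]
  by (simp add: ident_cod ident_dom)

section \<open>Universal property of the tensor product\<close>

definition tn ::
  "('k,'u::infinite) bimod \<Rightarrow> ('k,'u) bimod \<Rightarrow> 'u \<Rightarrow> 'u \<Rightarrow> 'u \<Rightarrow> 'u \<Rightarrow> 'u \<Rightarrow> 'u" where
  "tn F G c a b y x = tcls F G c a [(b, y, x)]"

text \<open>The map out of the tensor product induced by \<open>h\<close>, evaluated on the stored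
  representative; for balanced \<open>h\<close>, \<open>lift_teq\<close> makes the value independent
  of that choice.\<close>

definition lift_map :: "('k,'u::infinite) module \<Rightarrow> ('u \<Rightarrow> 'u \<Rightarrow> 'u \<Rightarrow> 'u) \<Rightarrow> 'u \<Rightarrow> 'u" where
  "lift_map N h p = msum N (map (\<lambda>(b, y, x). h b y x) (decode p))"

lemma tens_simps [simp]:
  "dom (F \<boxtimes> G) = dom G" "cod (F \<boxtimes> G) = cod F"
  "el (F \<boxtimes> G) c a = tcls F G c a ` lists (tgens F G c a)"
  "zero (val (F \<boxtimes> G) c a) = tcls F G c a []"
  by (simp_all add: tens_def)

text \<open>Concatenation respects \<open>teq\<close>, so the stored representatives may be replaced
  by arbitrary ones.\<close>

lemma tadd: "tcls F G c a l \<oplus>\<^bsub>val (F \<boxtimes> G) c a\<^esub> tcls F G c a m = tcls F G c a (l @ m)"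
proof -
  have "teq F G c a (decode (tcls F G c a l) @ decode (tcls F G c a m)) (l @ m)"
    by (intro teq.append teq.sym[OF decode_tcls])
  then show ?thesis by (simp add: tens_def tcls_eq_iff)
qed

text \<open>Homogeneity over \<open>K\<close> is kept apart, since \<open>teq\<close> is generated
  by additive and balancing relations; it enters as a separate assumption of
  \<open>lift_klinear\<close>.\<close>

locale balanced_map =
  fixes F G :: "('k,'u::infinite) bimod" and c a :: 'u and N :: "('k,'u) module" and h :: "'u \<Rightarrow> 'u \<Rightarrow> 'u \<Rightarrow> 'u"
  assumes closed: "b \<in> Ob (cod G) \<Longrightarrow> y \<in> el F c b \<Longrightarrow> x \<in> el G b a \<Longrightarrow> h b y x \<in> carrier N"
    and add_left: "b \<in> Ob (cod G) \<Longrightarrow> y \<in> el F c b \<Longrightarrow> y' \<in> el F c b \<Longrightarrow> x \<in> el G b a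
        \<Longrightarrow> h b (y \<oplus>\<^bsub>val F c b\<^esub> y') x = h b y x \<oplus>\<^bsub>N\<^esub> h b y' x"
    and add_right: "b \<in> Ob (cod G) \<Longrightarrow> y \<in> el F c b \<Longrightarrow> x \<in> el G b a \<Longrightarrow> x' \<in> el G b a
        \<Longrightarrow> h b y (x \<oplus>\<^bsub>val G b a\<^esub> x') = h b y x \<oplus>\<^bsub>N\<^esub> h b y x'"
    and bal: "b \<in> Ob (cod G) \<Longrightarrow> b' \<in> Ob (cod G) \<Longrightarrow> \<beta> \<in> carrier (Hom (cod G) b b')
        \<Longrightarrow> y \<in> el F c b \<Longrightarrow> x \<in> el G b' a
        \<Longrightarrow> h b' (act F c c b b' (Ident (cod F) c) \<beta> y) x = h b y (act G b' b a a \<beta> (Ident (dom G) a) x)"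

lemmas balancedD = balanced_map.closed balanced_map.add_left balanced_map.add_right balanced_map.bal

locale tensorable =
  fixes K :: "'k ring" and F G :: "('k,'u::infinite) bimod" and c a :: 'u
  assumes bimod_F: "bimodule K F" and bimod_G: "bimodule K G" and dom_cod: "dom F = cod G"
    and c_Ob: "c \<in> Ob (cod F)" and a_Ob: "a \<in> Ob (dom G)"
begin

abbreviation "balanced \<equiv> balanced_map F G c a"

sublocale F: bimodule K F by (rule bimod_F)
sublocale G: bimodule K G by (rule bimod_G)

lemma valF: "b \<in> Ob (cod G) \<Longrightarrow> Module.module K (val F c b)"
  using F.val_module c_Ob dom_cod by simp

lemma valG: "b \<in> Ob (cod G) \<Longrightarrow> Module.module K (val G b a)"
  using G.val_module a_Ob by simp

lemma gens_iff: "(b, y, x) \<in> tgens F G c a \<longleftrightarrow>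
    b \<in> Ob (cod G) \<and> y \<in> el F c b \<and> x \<in> el G b a"
  by (simp add: tgens_def)

lemma F_act_closed: "b \<in> Ob (cod G) \<Longrightarrow> b' \<in> Ob (cod G) \<Longrightarrow> \<beta> \<in> carrier (Hom (cod G) b b')
    \<Longrightarrow> y \<in> el F c b \<Longrightarrow> act F c c b b' (Ident (cod F) c) \<beta> y \<in> el F c b'"
  using F.act_closed c_Ob dom_cod F.ident_cod by simp

lemma G_act_closed: "b \<in> Ob (cod G) \<Longrightarrow> b' \<in> Ob (cod G) \<Longrightarrow> \<beta> \<in> carrier (Hom (cod G) b b')
    \<Longrightarrow> x \<in> el G b' a \<Longrightarrow> act G b' b a a \<beta> (Ident (dom G) a) x \<in> el G b a"
  using G.act_closed a_Ob G.ident_dom by simp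

text \<open>\<open>teq\<close> also relates lists with entries outside \<open>tgens\<close>, through
  \<open>refl\<close>, \<open>append\<close> and \<open>commute\<close>. Membership is invariant
  along each rule; hence the representative that \<open>decode\<close> returns consists of
  generators, and in inductions over \<open>teq\<close> the intermediate lists do too.\<close>

lemma teq_lists: "teq F G c a l l' \<Longrightarrow> l \<in> lists (tgens F G c a) \<longleftrightarrow> l' \<in> lists (tgens F G c a)"
proof (induction rule: teq.induct)
  case (add_left b y x y')
  interpret V: Module.module K "val F c b" using add_left valF gens_iff by blast
  show ?case using add_left by (auto simp: gens_iff)
next
  case (add_right b y x x')
  interpret V: Module.module K "val G b a" using add_right valG gens_iff by blast
  show ?case using add_right by (auto simp: gens_iff)
qed (auto simp: gens_iff F_act_closed G_act_closed)

lemma decode_lists: "l \<in> lists (tgens F G c a) \<Longrightarrow> decode (tcls F G c a l) \<in> lists (tgens F G c a)"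
  using teq_lists[OF decode_tcls] by blast

text \<open>Negate every left factor: \<open>(-y + y) \<otimes> x\<close> collapses to
  \<open>0 \<otimes> x\<close>, hence to the empty list.\<close>

lemma teq_inverse:
  "l \<in> lists (tgens F G c a) \<Longrightarrow> \<exists>m\<in>lists (tgens F G c a). teq F G c a (m @ l) []"
proof (induction l)
  case Nil
  show ?case by (rule bexI[of _ "[]"]) (auto intro: teq.refl)
next
  case (Cons t l)
  then obtain m where m: "m \<in> lists (tgens F G c a)" "teq F G c a (m @ l) []" by auto
  obtain b y x where t: "t = (b, y, x)" by (cases t)
  have g: "(b, y, x) \<in> tgens F G c a" using Cons t by auto
  then interpret V: Module.module K "val F c b" using valF gens_iff by blast
  let ?s = "(b, \<ominus>\<^bsub>val F c b\<^esub> y, x)"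
  have s: "?s \<in> tgens F G c a" using g by (auto simp: gens_iff)
  have "teq F G c a [(b, \<ominus>\<^bsub>val F c b\<^esub> y \<oplus>\<^bsub>val F c b\<^esub> y, x)] [?s, t]"
    unfolding t using s g by (rule teq.add_left)
  moreover have "\<ominus>\<^bsub>val F c b\<^esub> y \<oplus>\<^bsub>val F c b\<^esub> y = \<zero>\<^bsub>val F c b\<^esub>"
    using g by (simp add: gens_iff V.l_neg)
  moreover have "teq F G c a [(b, \<zero>\<^bsub>val F c b\<^esub>, x)] []"
    using g by (intro teq.zero_left) (auto simp: gens_iff)
  ultimately have st: "teq F G c a [?s, t] []" by (metis teq.sym teq.trans)
  have "teq F G c a (m @ [?s, t] @ l) (m @ [] @ l)"
    by (intro teq.append teq.refl st)
  then have "teq F G c a ((m @ [?s]) @ t # l) []" using m(2) by (auto intro: teq.trans)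
  moreover have "m @ [?s] \<in> lists (tgens F G c a)" using m s by auto
  ultimately show ?case by blast
qed

lemma tens_abelian: "abelian_group (val (F \<boxtimes> G) c a)"
proof (rule abelian_groupI)
  fix p q r assume "p \<in> el (F \<boxtimes> G) c a" "q \<in> el (F \<boxtimes> G) c a"
    "r \<in> el (F \<boxtimes> G) c a"
  then obtain l m n where l: "p = tcls F G c a l" "l \<in> lists (tgens F G c a)"
    "q = tcls F G c a m" "m \<in> lists (tgens F G c a)" "r = tcls F G c a n" by auto
  show "p \<oplus>\<^bsub>val (F \<boxtimes> G) c a\<^esub> q \<oplus>\<^bsub>val (F \<boxtimes> G) c a\<^esub> r
      = p \<oplus>\<^bsub>val (F \<boxtimes> G) c a\<^esub> (q \<oplus>\<^bsub>val (F \<boxtimes> G) c a\<^esub> r)"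
    by (simp add: l tadd)
next
  fix p q assume "p \<in> el (F \<boxtimes> G) c a" "q \<in> el (F \<boxtimes> G) c a"
  then obtain l m where l: "p = tcls F G c a l" "l \<in> lists (tgens F G c a)"
    "q = tcls F G c a m" "m \<in> lists (tgens F G c a)" by auto
  show "p \<oplus>\<^bsub>val (F \<boxtimes> G) c a\<^esub> q \<in> el (F \<boxtimes> G) c a"
    using l(2,4) by (simp add: l(1,3) tadd)
  show "p \<oplus>\<^bsub>val (F \<boxtimes> G) c a\<^esub> q = q \<oplus>\<^bsub>val (F \<boxtimes> G) c a\<^esub> p"
    by (simp add: l(1,3) tadd tcls_eq_iff teq.commute)
next
  fix p assume "p \<in> el (F \<boxtimes> G) c a"
  then obtain l where l: "p = tcls F G c a l" "l \<in> lists (tgens F G c a)" by auto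
  show "\<zero>\<^bsub>val (F \<boxtimes> G) c a\<^esub> \<oplus>\<^bsub>val (F \<boxtimes> G) c a\<^esub> p = p" by (simp add: l(1) tadd)
  obtain m where "m\<in>lists (tgens F G c a)" "teq F G c a (m @ l) []" using teq_inverse[OF l(2)] by blast
  then show "\<exists>q\<in>el (F \<boxtimes> G) c a. q \<oplus>\<^bsub>val (F \<boxtimes> G) c a\<^esub> p = \<zero>\<^bsub>val (F \<boxtimes> G) c a\<^esub>"
    by (intro bexI[of _ "tcls F G c a m"]) (auto simp: l(1) tadd tcls_eq_iff)
qed simp

lemma tn_closed: "b \<in> Ob (cod G) \<Longrightarrow> y \<in> el F c b \<Longrightarrow> x \<in> el G b a
    \<Longrightarrow> tn F G c a b y x \<in> el (F \<boxtimes> G) c a"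
  by (auto simp: tn_def gens_iff)

lemma tcls_msum: "l \<in> lists (tgens F G c a)
    \<Longrightarrow> tcls F G c a l = msum (val (F \<boxtimes> G) c a) (map (\<lambda>(b, y, x). tn F G c a b y x) l)"
proof (induction l)
  case (Cons t l)
  then show ?case using tadd[of F G c a "[t]" l] by (auto simp: tn_def split: prod.splits)
qed simp

text \<open>Well-definedness of induced maps. The additivity and balancing relations are the
  assumptions on \<open>h\<close>. The zero relations follow because \<open>h\<close> takes at zero
  a value that equals its own double. In the symmetric and transitive cases \<open>teq_lists\<close>
  supplies membership.\<close>

lemma lift_teq:
  assumes N: "abelian_group N" and h: "balanced N h"
    and t: "teq F G c a l l'" and l: "l \<in> lists (tgens F G c a)"
  shows "msum N (map (\<lambda>(b, y, x). h b y x) l) = msum N (map (\<lambda>(b, y, x). h b y x) l')"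
proof -
  interpret N: abelian_group N by (rule N)
  note hD = balancedD[OF h]
  have cl: "set (map (\<lambda>(b, y, x). h b y x) k) \<subseteq> carrier N" if "k \<in> lists (tgens F G c a)" for k
    using that by (auto simp: gens_iff hD)
  show ?thesis using t l
  proof (induction rule: teq.induct)
    case (sym l l')
    then show ?case using teq_lists by metis
  next
    case (trans l l' l'')
    then show ?case using teq_lists by metis
  next
    case (append l l' m m')
    have "l' \<in> lists (tgens F G c a)" "m' \<in> lists (tgens F G c a)" 
      using teq_lists append by auto
    then show ?case using append cl by (auto simp: msum_append N)
  next
    case (commute l m)
    then have "set (map (\<lambda>(b, y, x). h b y x) l) \<subseteq> carrier N" 
        "set (map (\<lambda>(b, y, x). h b y x) m) \<subseteq> carrier N" using cl by auto
    then show ?case by (simp add: msum_append N msum_closed N.a_comm)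
  next
    case (zero_left b x)
    then have g: "b \<in> Ob (cod G)" "x \<in> el G b a" by (auto simp: gens_iff)
    interpret V: Module.module K "val F c b" using valF g by blast
    have "h b \<zero>\<^bsub>val F c b\<^esub> x \<oplus>\<^bsub>N\<^esub> h b \<zero>\<^bsub>val F c b\<^esub> x = h b \<zero>\<^bsub>val F c b\<^esub> x"
      using hD(2)[of b "\<zero>\<^bsub>val F c b\<^esub>" "\<zero>\<^bsub>val F c b\<^esub>" x] g by simp
    then have "h b \<zero>\<^bsub>val F c b\<^esub> x = \<zero>\<^bsub>N\<^esub>"
      using hD(1)[of b "\<zero>\<^bsub>val F c b\<^esub>" x] g by (metis N.add.l_cancel_one' V.zero_closed)
    then show ?case by simp
  next
    case (zero_right b y)
    then have g: "b \<in> Ob (cod G)" "y \<in> el F c b" by (auto simp: gens_iff)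
    interpret V: Module.module K "val G b a" using valG g by blast
    have "h b y \<zero>\<^bsub>val G b a\<^esub> \<oplus>\<^bsub>N\<^esub> h b y \<zero>\<^bsub>val G b a\<^esub> = h b y \<zero>\<^bsub>val G b a\<^esub>"
      using hD(3)[of b y "\<zero>\<^bsub>val G b a\<^esub>" "\<zero>\<^bsub>val G b a\<^esub>"] g by simp
    then have "h b y \<zero>\<^bsub>val G b a\<^esub> = \<zero>\<^bsub>N\<^esub>"
      using hD(1)[of b y "\<zero>\<^bsub>val G b a\<^esub>"] g by (metis N.add.l_cancel_one' V.zero_closed)
    then show ?case by simp
  next
    case (add_left b y x y')
    then show ?case by (simp add: gens_iff hD)
  next
    case (add_right b y x x')
    then show ?case by (simp add: gens_iff hD)
  next
    case (bal b b' \<beta> y x)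
    then show ?case by (simp add: hD(4))
  qed simp
qed

lemma lift_tcls:
  assumes "abelian_group N" "balanced N h" "l \<in> lists (tgens F G c a)"
  shows "lift_map N h (tcls F G c a l) = msum N (map (\<lambda>(b, y, x). h b y x) l)"
  unfolding lift_map_def
  by (rule lift_teq[OF assms(1,2) _ assms(3), symmetric]) (rule decode_tcls)

lemma lift_tn:
  assumes "abelian_group N" "balanced N h" "b \<in> Ob (cod G)" "y \<in> el F c b" "x \<in> el G b a"
  shows "lift_map N h (tn F G c a b y x) = h b y x"
proof -
  interpret N: abelian_group N by (rule assms)
  have "[(b, y, x)] \<in> lists (tgens F G c a)" using assms by (simp add: gens_iff)
  then show ?thesis
    unfolding tn_def using lift_tcls[OF assms(1,2)] balancedD(1)[OF assms(2-5)] by simp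
qed

lemma lift_closed:
  assumes "abelian_group N" "balanced N h" "p \<in> el (F \<boxtimes> G) c a"
  shows "lift_map N h p \<in> carrier N"
proof -
  obtain l where l: "p = tcls F G c a l" "l \<in> lists (tgens F G c a)" using assms(3) by auto
  have "set (map (\<lambda>(b, y, x). h b y x) l) \<subseteq> carrier N"
    using l(2) balancedD(1)[OF assms(2)] by (auto simp: gens_iff)
  then show ?thesis using l lift_tcls[OF assms(1,2)] by (simp add: msum_closed assms(1))
qed

lemma lift_add:
  assumes "abelian_group N" "balanced N h" "p \<in> el (F \<boxtimes> G) c a" "q \<in> el (F \<boxtimes> G) c a"
  shows "lift_map N h (p \<oplus>\<^bsub>val (F \<boxtimes> G) c a\<^esub> q) = lift_map N h p \<oplus>\<^bsub>N\<^esub> lift_map N h q"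
proof -
  obtain l m where l: "p = tcls F G c a l" "l \<in> lists (tgens F G c a)"
    "q = tcls F G c a m" "m \<in> lists (tgens F G c a)" using assms(3,4) by auto
  have c: "set (map (\<lambda>(b, y, x). h b y x) k) \<subseteq> carrier N" if "k \<in> lists (tgens F G c a)" for k
    using that balancedD(1)[OF assms(2)] by (auto simp: gens_iff)
  have "l @ m \<in> lists (tgens F G c a)" using l by auto
  then show ?thesis
    using lift_tcls[OF assms(1,2)] l(2,4) msum_append[OF assms(1) c[OF l(2)] c[OF l(4)]]
    by (simp add: l(1,3) tadd)
qed

lemma tens_induct [consumes 1, case_names zero add]:
  assumes "p \<in> el (F \<boxtimes> G) c a" and z: "P \<zero>\<^bsub>val (F \<boxtimes> G) c a\<^esub>"
    and s: "\<And>b y x p. b \<in> Ob (cod G) \<Longrightarrow> y \<in> el F c b \<Longrightarrow> x \<in> el G b a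
      \<Longrightarrow> p \<in> el (F \<boxtimes> G) c a \<Longrightarrow> P p \<Longrightarrow> P (tn F G c a b y x \<oplus>\<^bsub>val (F \<boxtimes> G) c a\<^esub> p)"
  shows "P p"
proof -
  obtain l where l: "p = tcls F G c a l" "l \<in> lists (tgens F G c a)" using assms(1) by auto
  have "P (tcls F G c a l)" using l(2)
  proof (induction l)
    case Nil
    then show ?case using z by simp
  next
    case (Cons t l)
    obtain b y x where t: "t = (b, y, x)" by (cases t)
    show ?case using s[of b y x "tcls F G c a l"] Cons t by (simp add: gens_iff tn_def tadd)
  qed
  then show ?thesis using l by simp
qed

lemma tn_balanced: "balanced (val (F \<boxtimes> G) c a) (tn F G c a)"
  by (rule balanced_map.intro)
    (auto intro: tn_closed simp del: tens_simps,
     auto simp: tn_def tadd tcls_eq_iff gens_iff intro!: teq.add_left teq.add_right teq.bal)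

lemmas tn_add_left = balancedD(2)[OF tn_balanced]
lemmas tn_add_right = balancedD(3)[OF tn_balanced]
lemmas tn_bal = balancedD(4)[OF tn_balanced]

lemma F_smult: 
  assumes "b \<in> Ob (cod G)" "b' \<in> Ob (cod G)" "\<beta> \<in> carrier (Hom (cod G) b b')" "k \<in> carrier K" "y \<in> el F c b"
  shows "act F c c b b' (Ident (cod F) c) \<beta> (k \<odot>\<^bsub>val F c b\<^esub> y) = k \<odot>\<^bsub>val F c b'\<^esub> act F c c b b' (Ident (cod F) c) \<beta> y"
  using klinear_smult[OF F.act_linear[of c c b b' "Ident (cod F) c" \<beta>]] assms c_Ob dom_cod F.ident_cod by simp

lemma smult_balanced:
  assumes k: "k \<in> carrier K"
  shows "balanced (val (F \<boxtimes> G) c a) (\<lambda>b y x. tn F G c a b (k \<odot>\<^bsub>val F c b\<^esub> y) x)"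
proof -
  have cl: "k \<odot>\<^bsub>val F c b\<^esub> y \<in> el F c b" if "b \<in> Ob (cod G)" "y \<in> el F c b" for b y
    using Module.module.smult_closed[OF valF] that k by blast
  show ?thesis
  proof (rule balanced_map.intro, goal_cases)
    case (1 b y x)
    then show ?case using cl by (intro tn_closed) 
  next
    case (2 b y y' x)
    then show ?case using cl Module.module.smult_r_distr[OF valF] k by (simp add: tn_add_left del: tens_simps)
  next
    case (3 b y x x')
    then show ?case using cl by (intro tn_add_right)
  next
    case (4 b b' \<beta> y x)
    then show ?case using cl F_smult k tn_bal[of b b' \<beta> "k \<odot>\<^bsub>val F c b\<^esub> y" x] by (simp del: tens_simps)
  qed
qed

text \<open>\<open>smult\<close> rescales the left entries of the representative, which exhibits it
  as an induced map; independence of the representative and additivity then come from the lemmas on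
  \<open>lift_map\<close>.\<close>

lemma smult_lift:
  assumes k: "k \<in> carrier K" and p: "p \<in> el (F \<boxtimes> G) c a"
  shows "k \<odot>\<^bsub>val (F \<boxtimes> G) c a\<^esub> p
    = lift_map (val (F \<boxtimes> G) c a) (\<lambda>b y x. tn F G c a b (k \<odot>\<^bsub>val F c b\<^esub> y) x) p"
proof -
  have d: "decode p \<in> lists (tgens F G c a)" using p decode_lists by auto
  have "map (\<lambda>(b, y, x). (b, k \<odot>\<^bsub>val F c b\<^esub> y, x)) (decode p) \<in> lists (tgens F G c a)"
    using d Module.module.smult_closed[OF valF] k by (fastforce simp: gens_iff)
  from tcls_msum[OF this] show ?thesis
    unfolding lift_map_def by (simp add: tens_def case_prod_unfold comp_def)
qed

lemma tn_smult_left: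
  assumes "k \<in> carrier K" "b \<in> Ob (cod G)" "y \<in> el F c b" "x \<in> el G b a"
  shows "k \<odot>\<^bsub>val (F \<boxtimes> G) c a\<^esub> tn F G c a b y x = tn F G c a b (k \<odot>\<^bsub>val F c b\<^esub> y) x"
  using lift_tn[OF tens_abelian smult_balanced[OF assms(1)] assms(2-4)]
    smult_lift[OF assms(1) tn_closed[OF assms(2-4)]] by simp

text \<open>The scalar crosses the tensor sign as the endomorphism \<open>k\<close> times the
  identity of \<open>b\<close>: linearity of the actions in the acting morphism turns it into scalar
  multiplication on either factor.\<close>

lemma tn_smult_right:
  assumes "k \<in> carrier K" "b \<in> Ob (cod G)" "y \<in> el F c b" "x \<in> el G b a"
  shows "k \<odot>\<^bsub>val (F \<boxtimes> G) c a\<^esub> tn F G c a b y x = tn F G c a b y (k \<odot>\<^bsub>val G b a\<^esub> x)"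
proof -
  interpret C: kcategory K "cod G" by (rule G.cod_kcategory)
  interpret H: Module.module K "Hom (cod G) b b" using C.hom_module assms by blast
  let ?i = "Ident (cod G) b"
  have i: "?i \<in> carrier (Hom (cod G) b b)" using C.ident_hom assms by blast
  then have ki: "k \<odot>\<^bsub>Hom (cod G) b b\<^esub> ?i \<in> carrier (Hom (cod G) b b)" using assms by blast
  have "tn F G c a b (k \<odot>\<^bsub>val F c b\<^esub> y) x
      = tn F G c a b (act F c c b b (Ident (cod F) c) (k \<odot>\<^bsub>Hom (cod G) b b\<^esub> ?i) y) x"
    using klinear_smult[OF F.act_linear_dom[of c c b b "Ident (cod F) c" y] assms(1), of ?i]
      F.act_ident[of c b y] assms c_Ob dom_cod F.ident_cod i by simp
  also have "\<dots> = tn F G c a b y (act G b b a a (k \<odot>\<^bsub>Hom (cod G) b b\<^esub> ?i) (Ident (dom G) a) x)"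
    using tn_bal ki assms by blast
  also have "\<dots> = tn F G c a b y (k \<odot>\<^bsub>val G b a\<^esub> x)"
    using klinear_smult[OF G.act_linear_cod[of b b a a "Ident (dom G) a" x] assms(1), of ?i]
      G.act_ident[of b a x] assms a_Ob G.ident_dom i by simp
  finally show ?thesis using tn_smult_left assms by simp
qed

end

declare tens_simps(3,4) [simp del]

context tensorable
begin

lemma tens_module: "Module.module K (val (F \<boxtimes> G) c a)"
proof -
  interpret T: abelian_group "val (F \<boxtimes> G) c a" by (rule tens_abelian)
  interpret K: cring K using kcategory.cring_K[OF F.dom_kcategory] .
  let ?T = "val (F \<boxtimes> G) c a"
  have cl: "k \<odot>\<^bsub>?T\<^esub> p \<in> carrier ?T" if "k \<in> carrier K" "p \<in> carrier ?T" for k p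
    using lift_closed[OF tens_abelian smult_balanced[OF that(1)] that(2)] by (simp add: smult_lift[OF that])
  have ad: "k \<odot>\<^bsub>?T\<^esub> (p \<oplus>\<^bsub>?T\<^esub> q) = k \<odot>\<^bsub>?T\<^esub> p \<oplus>\<^bsub>?T\<^esub> k \<odot>\<^bsub>?T\<^esub> q"
    if "k \<in> carrier K" "p \<in> carrier ?T" "q \<in> carrier ?T" for k p q
    using lift_add[OF tens_abelian smult_balanced[OF that(1)] that(2,3)]
    by (simp add: smult_lift[OF that(1)] that)
  have z: "k \<odot>\<^bsub>?T\<^esub> \<zero>\<^bsub>?T\<^esub> = \<zero>\<^bsub>?T\<^esub>" if "k \<in> carrier K" for k
    using ad[of k "\<zero>\<^bsub>?T\<^esub>" "\<zero>\<^bsub>?T\<^esub>"] cl[of k "\<zero>\<^bsub>?T\<^esub>"] that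
    by (simp add: T.add.l_cancel_one')
  show ?thesis
  proof (rule Module.moduleI[OF K.is_cring tens_abelian])
    fix k l p assume k: "k \<in> carrier K" "l \<in> carrier K" and p: "p \<in> carrier ?T"
    show "(k \<oplus>\<^bsub>K\<^esub> l) \<odot>\<^bsub>?T\<^esub> p = k \<odot>\<^bsub>?T\<^esub> p \<oplus>\<^bsub>?T\<^esub> l \<odot>\<^bsub>?T\<^esub> p" using p
    proof (induction rule: tens_induct)
      case zero
      show ?case using k z T.zero_closed T.l_zero by (metis K.add.m_closed)
    next
      case (add b y x p)
      interpret V: Module.module K "val F c b" using valF add by blast
      note tc = tn_closed[OF add(1) _ add(3)]
      have "(k \<oplus>\<^bsub>K\<^esub> l) \<odot>\<^bsub>?T\<^esub> tn F G c a b y x = k \<odot>\<^bsub>?T\<^esub> tn F G c a b y x \<oplus>\<^bsub>?T\<^esub> l \<odot>\<^bsub>?T\<^esub> tn F G c a b y x"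
        using add(1-3) k by (simp add: tn_smult_left V.smult_l_distr tn_add_left del: tens_simps)
      moreover have "tn F G c a b y x \<in> carrier ?T" using tc add(2) by blast
      ultimately show ?case
        using add(4,5) k by (simp add: ad cl T.a_ac del: tens_simps)
    qed
    show "(k \<otimes>\<^bsub>K\<^esub> l) \<odot>\<^bsub>?T\<^esub> p = k \<odot>\<^bsub>?T\<^esub> (l \<odot>\<^bsub>?T\<^esub> p)" using p
    proof (induction rule: tens_induct)
      case zero
      show ?case using k z by simp
    next
      case (add b y x p)
      interpret V: Module.module K "val F c b" using valF add by blast
      have "(k \<otimes>\<^bsub>K\<^esub> l) \<odot>\<^bsub>?T\<^esub> tn F G c a b y x = k \<odot>\<^bsub>?T\<^esub> (l \<odot>\<^bsub>?T\<^esub> tn F G c a b y x)"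
        using add(1-3) k by (simp add: tn_smult_left V.smult_assoc1 del: tens_simps)
      moreover have "tn F G c a b y x \<in> carrier ?T" using tn_closed add by blast
      ultimately show ?case
        using add(4,5) k by (simp add: ad cl del: tens_simps)
    qed
  next
    fix p assume p: "p \<in> carrier ?T"
    then show "\<one>\<^bsub>K\<^esub> \<odot>\<^bsub>?T\<^esub> p = p"
    proof (induction rule: tens_induct)
      case zero
      show ?case using z by simp
    next
      case (add b y x p)
      interpret V: Module.module K "val F c b" using valF add by blast
      have "tn F G c a b y x \<in> carrier ?T" using tn_closed add by blast
      then show ?case
        using add by (simp add: ad tn_smult_left del: tens_simps)
    qed
  qed (use cl ad in blast)+
qed

lemma lift_klinear:
  assumes N: "Module.module K N" and h: "balanced N h"
    and s: "\<And>k b y x. k \<in> carrier K \<Longrightarrow> b \<in> Ob (cod G) \<Longrightarrow> y \<in> el F c b \<Longrightarrow> x \<in> el G b a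
      \<Longrightarrow> h b (k \<odot>\<^bsub>val F c b\<^esub> y) x = k \<odot>\<^bsub>N\<^esub> h b y x"
  shows "klinear K (val (F \<boxtimes> G) c a) N (lift_map N h)"
proof -
  interpret N: Module.module K N by (rule N)
  interpret T: Module.module K "val (F \<boxtimes> G) c a" by (rule tens_module)
  note n = N.abelian_group_axioms
  let ?T = "val (F \<boxtimes> G) c a"
  have z: "lift_map N h \<zero>\<^bsub>?T\<^esub> = \<zero>\<^bsub>N\<^esub>" using lift_tcls[OF n h, of "[]"] by (simp add: tens_simps)
  have "lift_map N h (k \<odot>\<^bsub>?T\<^esub> p) = k \<odot>\<^bsub>N\<^esub> lift_map N h p" if k: "k \<in> carrier K" and p: "p \<in> carrier ?T" for k p
    using p
  proof (induction rule: tens_induct)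
    case zero
    then show ?case using T.smult_r_null[OF k] N.smult_r_null[OF k] z by simp
  next
    case (add b y x p)
    have ky: "k \<odot>\<^bsub>val F c b\<^esub> y \<in> el F c b"
      using Module.module.smult_closed[OF valF] add k by blast
    have t: "tn F G c a b y x \<in> carrier ?T" "tn F G c a b (k \<odot>\<^bsub>val F c b\<^esub> y) x \<in> carrier ?T"
      using tn_closed add ky by blast+
    have "k \<odot>\<^bsub>?T\<^esub> (tn F G c a b y x \<oplus>\<^bsub>?T\<^esub> p) = tn F G c a b (k \<odot>\<^bsub>val F c b\<^esub> y) x \<oplus>\<^bsub>?T\<^esub> k \<odot>\<^bsub>?T\<^esub> p"
      using T.smult_r_distr k t add(1-4) tn_smult_left by (metis (no_types, lifting))
    then have "lift_map N h (k \<odot>\<^bsub>?T\<^esub> (tn F G c a b y x \<oplus>\<^bsub>?T\<^esub> p)) 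
       = lift_map N h (tn F G c a b (k \<odot>\<^bsub>val F c b\<^esub> y) x) \<oplus>\<^bsub>N\<^esub> lift_map N h (k \<odot>\<^bsub>?T\<^esub> p)"
      using lift_add[OF n h] t T.smult_closed[OF k add(4)] by metis
    also have "\<dots> = k \<odot>\<^bsub>N\<^esub> h b y x \<oplus>\<^bsub>N\<^esub> k \<odot>\<^bsub>N\<^esub> lift_map N h p"
      using lift_tn[OF n h] ky add s k by metis
    also have "\<dots> = k \<odot>\<^bsub>N\<^esub> lift_map N h (tn F G c a b y x \<oplus>\<^bsub>?T\<^esub> p)"
      using lift_add[OF n h] t add lift_tn[OF n h] lift_closed[OF n h] N.smult_r_distr[OF k] 
         balancedD(1)[OF h] by (metis (no_types, lifting))
    finally show ?case .
  qed
  then show ?thesis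
    unfolding klinear_def using lift_closed[OF n h] lift_add[OF n h] by blast
qed

lemma klinear_ext:
  assumes N: "Module.module K N" and "klinear K (val (F \<boxtimes> G) c a) N g" "klinear K (val (F \<boxtimes> G) c a) N g'"
    and "\<And>b y x. b \<in> Ob (cod G) \<Longrightarrow> y \<in> el F c b \<Longrightarrow> x \<in> el G b a
      \<Longrightarrow> g (tn F G c a b y x) = g' (tn F G c a b y x)"
    and "p \<in> el (F \<boxtimes> G) c a"
  shows "g p = g' p"
  using assms(5)
proof (induction rule: tens_induct)
  case zero
  then show ?case using klinear_zero[OF tens_module N] assms(2,3) by metis
next
  case (add b y x p)
  then show ?case using klinear_add[OF assms(2)] klinear_add[OF assms(3)] assms(4) tn_closed by metis
qed

text \<open>Meant for actions on a tensor product, where \<open>\<gamma>\<close> is the acting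
  morphism: on an elementary tensor only one factor depends on it, and sums of linear maps are
  linear.\<close>

lemma klinear_param:
  assumes M: "Module.module K M" and N: "Module.module K N"
    and l: "\<And>\<gamma>. \<gamma> \<in> carrier M \<Longrightarrow> klinear K (val (F \<boxtimes> G) c a) N (\<phi> \<gamma>)"
    and t: "\<And>b y x. b \<in> Ob (cod G) \<Longrightarrow> y \<in> el F c b \<Longrightarrow> x \<in> el G b a
      \<Longrightarrow> klinear K M N (\<lambda>\<gamma>. \<phi> \<gamma> (tn F G c a b y x))"
    and p: "p \<in> el (F \<boxtimes> G) c a"
  shows "klinear K M N (\<lambda>\<gamma>. \<phi> \<gamma> p)"
  using p
proof (induction rule: tens_induct)
  case zero
  have "klinear K M N (\<lambda>\<gamma>. \<zero>\<^bsub>N\<^esub>)" by (rule klinear_zero_map[OF N])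
  then show ?case by (rule klinear_cong[OF M]) (simp add: klinear_zero[OF tens_module N l])
next
  case (add b y x p)
  from klinear_plus[OF M N t[OF add(1-3)] add.IH] show ?case
    by (rule klinear_cong[OF M]) (simp add: klinear_add[OF l] tn_closed add)
qed

end

lemma (in tensorable) tn_klinear_left:
  assumes "b \<in> Ob (cod G)" "x \<in> el G b a"
  shows "klinear K (val F c b) (val (F \<boxtimes> G) c a) (\<lambda>y. tn F G c a b y x)"
  unfolding klinear_def using assms tn_closed tn_add_left tn_smult_left by auto

lemma (in tensorable) tn_klinear_right:
  assumes "b \<in> Ob (cod G)" "y \<in> el F c b"
  shows "klinear K (val G b a) (val (F \<boxtimes> G) c a) (\<lambda>x. tn F G c a b y x)"
  unfolding klinear_def using assms tn_closed tn_add_right tn_smult_right by auto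

section \<open>Functoriality of the tensor product: actions and horizontal composition\<close>

definition tmap ::
  "('k,'u::infinite) bimod \<Rightarrow> ('k,'u) bimod \<Rightarrow> 'u \<Rightarrow> 'u \<Rightarrow> ('u \<Rightarrow> 'u \<Rightarrow> 'u) \<Rightarrow> ('u \<Rightarrow> 'u \<Rightarrow> 'u) \<Rightarrow> 'u \<Rightarrow> 'u" where
  "tmap F G c a u v p = tcls F G c a (map (\<lambda>(b, y, x). (b, u b y, v b x)) (decode p))"

text \<open>The outer objects may move from \<open>c\<close>, \<open>a\<close> to \<open>c'\<close>,
  \<open>a'\<close> while the middle category stays fixed. With actions for \<open>u\<close>,
  \<open>v\<close> this is \<open>act\<close> of a tensor product; with components of cells it is
  \<open>hcomp\<close>.\<close>

locale tensor_map = S: tensorable K F G c a + T: tensorable K F' G' c' a'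
  for K :: "'k ring" and F G :: "('k,'u::infinite) bimod" and c a and F' G' :: "('k,'u) bimod" and c' a' +
  fixes u v :: "'u \<Rightarrow> 'u \<Rightarrow> 'u"
  assumes cod_eq: "cod G' = cod G"
    and u_lin: "b \<in> Ob (cod G) \<Longrightarrow> klinear K (val F c b) (val F' c' b) (u b)"
    and v_lin: "b \<in> Ob (cod G) \<Longrightarrow> klinear K (val G b a) (val G' b a') (v b)"
    and u_nat: "b \<in> Ob (cod G) \<Longrightarrow> b' \<in> Ob (cod G) \<Longrightarrow> \<beta> \<in> carrier (Hom (cod G) b b') \<Longrightarrow> y \<in> el F c b
      \<Longrightarrow> u b' (act F c c b b' (Ident (cod F) c) \<beta> y) = act F' c' c' b b' (Ident (cod F') c') \<beta> (u b y)"
    and v_nat: "b \<in> Ob (cod G) \<Longrightarrow> b' \<in> Ob (cod G) \<Longrightarrow> \<beta> \<in> carrier (Hom (cod G) b b') \<Longrightarrow> x \<in> el G b' a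
      \<Longrightarrow> v b (act G b' b a a \<beta> (Ident (dom G) a) x) = act G' b' b a' a' \<beta> (Ident (dom G') a') (v b' x)"
begin

lemmas u_closed = klinear_closed[OF u_lin]
lemmas v_closed = klinear_closed[OF v_lin]

lemma tn_uv_balanced: "S.balanced (val (F' \<boxtimes> G') c' a') (\<lambda>b y x. tn F' G' c' a' b (u b y) (v b x))"
proof (rule balanced_map.intro, goal_cases)
  case (1 b y x)
  then show ?case using T.tn_closed cod_eq u_closed v_closed by simp
next
  case (2 b y y' x)
  then show ?case using cod_eq u_closed v_closed klinear_add[OF u_lin] by (simp add: T.tn_add_left)
next
  case (3 b y x x')
  then show ?case using cod_eq u_closed v_closed klinear_add[OF v_lin] by (simp add: T.tn_add_right)
next
  case (4 b b' \<beta> y x)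
  then show ?case using cod_eq u_closed v_closed by (simp add: u_nat v_nat T.tn_bal)
qed

lemma tmap_lift:
  assumes "p \<in> el (F \<boxtimes> G) c a"
  shows "tmap F' G' c' a' u v p
    = lift_map (val (F' \<boxtimes> G') c' a') (\<lambda>b y x. tn F' G' c' a' b (u b y) (v b x)) p"
proof -
  have "decode p \<in> lists (tgens F G c a)" using assms S.decode_lists by (auto simp: tens_simps)
  then have "map (\<lambda>(b, y, x). (b, u b y, v b x)) (decode p) \<in> lists (tgens F' G' c' a')"
    using u_closed v_closed cod_eq by (fastforce simp: S.gens_iff T.gens_iff)
  from T.tcls_msum[OF this] show ?thesis
    by (simp add: tmap_def lift_map_def case_prod_unfold comp_def)
qed

lemma tmap_tn:
  assumes "b \<in> Ob (cod G)" "y \<in> el F c b" "x \<in> el G b a"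
  shows "tmap F' G' c' a' u v (tn F G c a b y x) = tn F' G' c' a' b (u b y) (v b x)"
  using S.lift_tn[OF T.tens_abelian tn_uv_balanced assms] tmap_lift[OF S.tn_closed[OF assms]] by simp

lemma tmap_klinear: "klinear K (val (F \<boxtimes> G) c a) (val (F' \<boxtimes> G') c' a') (tmap F' G' c' a' u v)"
proof (rule klinear_cong[OF S.tens_module S.lift_klinear[OF T.tens_module tn_uv_balanced]])
  fix k b y x assume "k \<in> carrier K" "b \<in> Ob (cod G)" "y \<in> el F c b" "x \<in> el G b a"
  then show "tn F' G' c' a' b (u b (k \<odot>\<^bsub>val F c b\<^esub> y)) (v b x)
    = k \<odot>\<^bsub>val (F' \<boxtimes> G') c' a'\<^esub> tn F' G' c' a' b (u b y) (v b x)"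
    using klinear_smult[OF u_lin] cod_eq u_closed v_closed by (simp add: T.tn_smult_left)
qed (rule tmap_lift)

end

lemma act_tens:
  "act (F \<boxtimes> G) c c' a a' \<gamma> \<alpha> = tmap F G c' a'
     (\<lambda>b. act F c c' b b \<gamma> (Ident (dom F) b)) (\<lambda>b. act G b b a a' (Ident (cod G) b) \<alpha>)"
  by (simp add: tens_def tmap_def fun_eq_iff)

lemma act_tensor_map:
  assumes "bimodule K F" "bimodule K G" "dom F = cod G"
    and "c \<in> Ob (cod F)" "c' \<in> Ob (cod F)" "a \<in> Ob (dom G)" "a' \<in> Ob (dom G)"
    and "\<gamma> \<in> carrier (Hom (cod F) c' c)" "\<alpha> \<in> carrier (Hom (dom G) a a')"
  shows "tensor_map K F G c a F G c' a' (\<lambda>b. act F c c' b b \<gamma> (Ident (dom F) b))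
           (\<lambda>b. act G b b a a' (Ident (cod G) b) \<alpha>)"
proof -
  interpret S: tensorable K F G c a using assms by (auto intro!: tensorable.intro)
  interpret T: tensorable K F G c' a' using assms by (auto intro!: tensorable.intro)
  show ?thesis
  proof (rule tensor_map.intro[OF S.tensorable_axioms T.tensorable_axioms tensor_map_axioms.intro], goal_cases)
    case 1
    show ?case ..
  next
    case (2 b)
    then show ?case using assms S.F.act_linear S.F.ident_dom by simp
  next
    case (3 b)
    then show ?case using assms S.G.act_linear S.G.ident_cod by simp
  next
    case (4 b b' \<beta> y)
    then show ?case using assms S.F.act_cod_dom S.F.act_dom_cod by simp
  next
    case (5 b b' \<beta> x)
    then show ?case using assms S.G.act_cod_dom S.G.act_dom_cod by simp
  qed
qed

lemma act_tn:
  assumes "bimodule K F" "bimodule K G" "dom F = cod G"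
    and "c \<in> Ob (cod F)" "c' \<in> Ob (cod F)" "a \<in> Ob (dom G)" "a' \<in> Ob (dom G)"
    and "\<gamma> \<in> carrier (Hom (cod F) c' c)" "\<alpha> \<in> carrier (Hom (dom G) a a')"
    and "b \<in> Ob (cod G)" "y \<in> el F c b" "x \<in> el G b a"
  shows "act (F \<boxtimes> G) c c' a a' \<gamma> \<alpha> (tn F G c a b y x) =
    tn F G c' a' b (act F c c' b b \<gamma> (Ident (dom F) b) y) (act G b b a a' (Ident (cod G) b) \<alpha> x)"
  unfolding act_tens using tensor_map.tmap_tn[OF act_tensor_map[OF assms(1-9)] assms(10-12)] .

lemma tens_bimodule:
  assumes "bimodule K F" "bimodule K G" "dom F = cod G"
  shows "bimodule K (F \<boxtimes> G)"
proof -
  interpret F: bimodule K F by fact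
  interpret G: bimodule K G by fact
  note tm = act_tensor_map[OF assms]
  show ?thesis
  proof (rule bimodule.intro, goal_cases)
    case 1
    show ?case using G.dom_kcategory by simp
  next
    case 2
    show ?case using F.cod_kcategory by simp
  next
    case (3 c a)
    then interpret S: tensorable K F G c a using assms by (auto intro!: tensorable.intro)
    show ?case by (rule S.tens_module)
  next
    case (4 c c' a a' \<gamma> \<alpha>)
    then show ?case unfolding act_tens by (intro tensor_map.tmap_klinear tm) auto
  next
    case (5 c c' a a' \<alpha> p)
    then interpret S: tensorable K F G c a using assms by (auto intro!: tensorable.intro)
    interpret T: tensorable K F G c' a' using assms 5 by (auto intro!: tensorable.intro)
    have m: "Module.module K (Hom (cod F) c' c)" using 5 kcategory.hom_module[OF F.cod_kcategory] by simp
    show ?case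
      unfolding tens_simps(1,2)
    proof (rule S.klinear_param[OF m T.tens_module _ _ 5(6)])
      fix \<gamma> assume "\<gamma> \<in> carrier (Hom (cod F) c' c)"
      then show "klinear K (val (F \<boxtimes> G) c a) (val (F \<boxtimes> G) c' a') (act (F \<boxtimes> G) c c' a a' \<gamma> \<alpha>)"
        unfolding act_tens using 5 by (intro tensor_map.tmap_klinear tm) auto
    next
      fix b y x assume b: "b \<in> Ob (cod G)" "y \<in> el F c b" "x \<in> el G b a"
      have x: "act G b b a a' (Ident (cod G) b) \<alpha> x \<in> el G b a'"
        using G.act_closed b 5 G.ident_cod by simp
      have l: "klinear K (Hom (cod F) c' c) (val F c' b) (\<lambda>\<gamma>. act F c c' b b \<gamma> (Ident (dom F) b) y)"
        using F.act_linear_cod[of c c' b b "Ident (dom F) b" y] b 5 assms(3) F.ident_dom by simp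
      show "klinear K (Hom (cod F) c' c) (val (F \<boxtimes> G) c' a') (\<lambda>\<gamma>. act (F \<boxtimes> G) c c' a a' \<gamma> \<alpha> (tn F G c a b y x))"
        by (rule klinear_cong[OF m klinear_compose[OF l T.tn_klinear_left[OF b(1) x]]]) (use b 5 in \<open>simp add: act_tn[OF assms]\<close>)
    qed
  next
    case (6 c c' a a' \<gamma> p)
    then interpret S: tensorable K F G c a using assms by (auto intro!: tensorable.intro)
    interpret T: tensorable K F G c' a' using assms 6 by (auto intro!: tensorable.intro)
    have m: "Module.module K (Hom (dom G) a a')" using 6 kcategory.hom_module[OF G.dom_kcategory] by simp
    show ?case
      unfolding tens_simps(1,2)
    proof (rule S.klinear_param[OF m T.tens_module _ _ 6(6)])
      fix \<alpha> assume "\<alpha> \<in> carrier (Hom (dom G) a a')"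
      then show "klinear K (val (F \<boxtimes> G) c a) (val (F \<boxtimes> G) c' a') (act (F \<boxtimes> G) c c' a a' \<gamma> \<alpha>)"
        unfolding act_tens using 6 by (intro tensor_map.tmap_klinear tm) auto
    next
      fix b y x assume b: "b \<in> Ob (cod G)" "y \<in> el F c b" "x \<in> el G b a"
      have y: "act F c c' b b \<gamma> (Ident (dom F) b) y \<in> el F c' b"
        using F.act_closed b 6 F.ident_dom assms(3) by simp
      have l: "klinear K (Hom (dom G) a a') (val G b a') (\<lambda>\<alpha>. act G b b a a' (Ident (cod G) b) \<alpha> x)"
        using G.act_linear_dom[of b b a a' "Ident (cod G) b" x] b 6 G.ident_cod by simp
      show "klinear K (Hom (dom G) a a') (val (F \<boxtimes> G) c' a') (\<lambda>\<alpha>. act (F \<boxtimes> G) c c' a a' \<gamma> \<alpha> (tn F G c a b y x))"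
        by (rule klinear_cong[OF m klinear_compose[OF l T.tn_klinear_right[OF b(1) y]]]) (use b 6 in \<open>simp add: act_tn[OF assms]\<close>)
    qed
  next
    case (7 c a p)
    then interpret S: tensorable K F G c a using assms by (auto intro!: tensorable.intro)
    interpret t: tensor_map K F G c a F G c a "\<lambda>b. act F c c b b (Ident (cod F) c) (Ident (dom F) b)"
           "\<lambda>b. act G b b a a (Ident (cod G) b) (Ident (dom G) a)"
      using tm 7 F.ident_cod G.ident_dom by simp
    have "act (F \<boxtimes> G) c c a a (Ident (cod F) c) (Ident (dom G) a) p = p"
      unfolding act_tens
    proof (rule S.klinear_ext[OF S.tens_module t.tmap_klinear klinear_ident _ 7(3)])
      fix b y x assume "b \<in> Ob (cod G)" "y \<in> el F c b" "x \<in> el G b a"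
      then show "tmap F G c a (\<lambda>b. act F c c b b (Ident (cod F) c) (Ident (dom F) b))
         (\<lambda>b. act G b b a a (Ident (cod G) b) (Ident (dom G) a)) (tn F G c a b y x) = tn F G c a b y x"
        using t.tmap_tn F.act_ident G.act_ident 7 assms(3) by simp
    qed
    then show ?case by simp
  next
    case (8 c c' c'' a a' a'' \<gamma> \<gamma>' \<alpha> \<alpha>' p)
    then interpret S: tensorable K F G c a using assms by (auto intro!: tensorable.intro)
    let ?u = "\<lambda>c c' \<gamma> b. act F c c' b b \<gamma> (Ident (dom F) b)"
    let ?v = "\<lambda>a a' \<alpha> b. act G b b a a' (Ident (cod G) b) \<alpha>"
    have g: "Comp (cod F) c'' c' c \<gamma> \<gamma>' \<in> carrier (Hom (cod F) c'' c)"
      using klinear_closed[OF kcategory.comp_linear_left[OF F.cod_kcategory]] 8 by simp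
    have h: "Comp (dom G) a a' a'' \<alpha>' \<alpha> \<in> carrier (Hom (dom G) a a'')"
      using klinear_closed[OF kcategory.comp_linear_left[OF G.dom_kcategory]] 8 by simp
    interpret t: tensor_map K F G c a F G c' a' "?u c c' \<gamma>" "?v a a' \<alpha>" using tm 8 by simp
    interpret t': tensor_map K F G c' a' F G c'' a'' "?u c' c'' \<gamma>'" "?v a' a'' \<alpha>'" using tm 8 by simp
    interpret r: tensor_map K F G c a F G c'' a'' "?u c c'' (Comp (cod F) c'' c' c \<gamma> \<gamma>')"
        "?v a a'' (Comp (dom G) a a' a'' \<alpha>' \<alpha>)"
      using tm 8 g h by simp
    have "act (F \<boxtimes> G) c c'' a a'' (Comp (cod F) c'' c' c \<gamma> \<gamma>') (Comp (dom G) a a' a'' \<alpha>' \<alpha>) p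
      = act (F \<boxtimes> G) c' c'' a' a'' \<gamma>' \<alpha>' (act (F \<boxtimes> G) c c' a a' \<gamma> \<alpha> p)"
      unfolding act_tens
    proof (rule S.klinear_ext[OF t'.T.tens_module r.tmap_klinear
          klinear_compose[OF t.tmap_klinear t'.tmap_klinear] _ 8(11)])
      fix b y x assume a: "b \<in> Ob (cod G)" "y \<in> el F c b" "x \<in> el G b a"
      have i: "Ident (cod G) b \<in> carrier (Hom (cod G) b b)" using G.ident_cod a by simp
      \<comment> \<open>The identity of the middle object is written as a composite, so that
        \<open>act_comp\<close> applies to each factor.\<close>
      have ii: "Comp (cod G) b b b (Ident (cod G) b) (Ident (cod G) b) = Ident (cod G) b"
        using kcategory.comp_ident_left[OF G.cod_kcategory] i a by simp
      have "?u c c'' (Comp (cod F) c'' c' c \<gamma> \<gamma>') b y = ?u c' c'' \<gamma>' b (?u c c' \<gamma> b y)"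
        using F.act_comp[of c c' c'' b b b \<gamma> \<gamma>' "Ident (cod G) b" "Ident (cod G) b" y] a 8 i ii assms(3) by simp
      moreover have "?v a a'' (Comp (dom G) a a' a'' \<alpha>' \<alpha>) b x = ?v a' a'' \<alpha>' b (?v a a' \<alpha> b x)"
        using G.act_comp[of b b b a a' a'' "Ident (cod G) b" "Ident (cod G) b" \<alpha> \<alpha>' x] a 8 i ii by simp
      ultimately show "tmap F G c'' a'' (?u c c'' (Comp (cod F) c'' c' c \<gamma> \<gamma>'))
         (?v a a'' (Comp (dom G) a a' a'' \<alpha>' \<alpha>)) (tn F G c a b y x)
        = tmap F G c'' a'' (?u c' c'' \<gamma>') (?v a' a'' \<alpha>') (tmap F G c' a' (?u c c' \<gamma>) (?v a a' \<alpha>) (tn F G c a b y x))"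
        using a r.tmap_tn t.tmap_tn t'.tmap_tn t.u_closed t.v_closed by simp
    qed
    then show ?case by simp
  qed
qed

lemma hcomp_simps [simp]: "src (\<sigma> \<star> \<tau>) = src \<sigma> \<boxtimes> src \<tau>" "tgt (\<sigma> \<star> \<tau>) = tgt \<sigma> \<boxtimes> tgt \<tau>"
  by (simp_all add: hcomp_def)

lemma hcomp_tmap:
  "\<sigma> \<star> \<tau> = mk_cell (src \<sigma> \<boxtimes> src \<tau>) (tgt \<sigma> \<boxtimes> tgt \<tau>)
     (\<lambda>c a. tmap (tgt \<sigma>) (tgt \<tau>) c a (\<lambda>b. cmp \<sigma> c b) (\<lambda>b. cmp \<tau> b a))"
  by (simp add: hcomp_def tmap_def[abs_def])

lemma hcomp_tensor_map:
  assumes "two_cell K \<sigma>" "two_cell K \<tau>" "dom (src \<sigma>) = cod (src \<tau>)"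
    and "c \<in> Ob (cod (src \<sigma>))" "a \<in> Ob (dom (src \<tau>))"
  shows "tensor_map K (src \<sigma>) (src \<tau>) c a (tgt \<sigma>) (tgt \<tau>) c a (\<lambda>b. cmp \<sigma> c b) (\<lambda>b. cmp \<tau> b a)"
proof -
  note b = two_cell_bimodule[OF assms(1)] two_cell_bimodule[OF assms(2)]
  note t = two_cell_tgt[OF assms(1)] two_cell_tgt[OF assms(2)]
  interpret S: tensorable K "src \<sigma>" "src \<tau>" c a using assms b by (auto intro!: tensorable.intro)
  interpret T: tensorable K "tgt \<sigma>" "tgt \<tau>" c a using assms b t by (auto intro!: tensorable.intro)
  show ?thesis
  proof (rule tensor_map.intro[OF S.tensorable_axioms T.tensorable_axioms tensor_map_axioms.intro], goal_cases)
    case 1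
    show ?case using t by simp
  next
    case (2 b)
    then show ?case using assms two_cell_linear[OF assms(1)] by simp
  next
    case (3 b)
    then show ?case using assms two_cell_linear[OF assms(2)] by simp
  next
    case (4 b b' \<beta> y)
    then show ?case using assms t two_cell_natural[OF assms(1)] S.F.ident_cod by simp
  next
    case (5 b b' \<beta> x)
    then show ?case using assms t two_cell_natural[OF assms(2)] S.G.ident_dom by simp
  qed
qed

lemma hcomp_two_cell:
  assumes "two_cell K \<sigma>" "two_cell K \<tau>" "dom (src \<sigma>) = cod (src \<tau>)"
  shows "two_cell K (\<sigma> \<star> \<tau>)"
  unfolding hcomp_tmap
proof (rule two_cell_mk_cell, goal_cases)
  note b = two_cell_bimodule[OF assms(1)] two_cell_bimodule[OF assms(2)]
  note t = two_cell_tgt[OF assms(1)] two_cell_tgt[OF assms(2)]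
  case 1
  show ?case using b assms tens_bimodule by blast
  case 2
  show ?case using b t assms by (auto intro!: tens_bimodule)
  case 3
  show ?case using t by simp
  case 4
  show ?case using t by simp
  case (5 c a)
  then show ?case using tensor_map.tmap_klinear[OF hcomp_tensor_map[OF assms]] by simp
  case (6 c c' a a' \<gamma> \<alpha> p)
  interpret h: tensor_map K "src \<sigma>" "src \<tau>" c a "tgt \<sigma>" "tgt \<tau>" c a "\<lambda>b. cmp \<sigma> c b" "\<lambda>b. cmp \<tau> b a"
    using hcomp_tensor_map[OF assms] 6 by simp
  interpret h': tensor_map K "src \<sigma>" "src \<tau>" c' a' "tgt \<sigma>" "tgt \<tau>" c' a' "\<lambda>b. cmp \<sigma> c' b" "\<lambda>b. cmp \<tau> b a'"
    using hcomp_tensor_map[OF assms] 6 by simp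
  have a: "klinear K (val (src \<sigma> \<boxtimes> src \<tau>) c a) (val (src \<sigma> \<boxtimes> src \<tau>) c' a') (act (src \<sigma> \<boxtimes> src \<tau>) c c' a a' \<gamma> \<alpha>)"
    using bimodule.act_linear[OF tens_bimodule] b assms 6 by simp
  have a': "klinear K (val (tgt \<sigma> \<boxtimes> tgt \<tau>) c a) (val (tgt \<sigma> \<boxtimes> tgt \<tau>) c' a') (act (tgt \<sigma> \<boxtimes> tgt \<tau>) c c' a a' \<gamma> \<alpha>)"
    using bimodule.act_linear[OF tens_bimodule, of K "tgt \<sigma>" "tgt \<tau>" c c' a a' \<gamma> \<alpha>] b t assms 6 by simp
  show ?case
  proof (rule h.S.klinear_ext[OF h'.T.tens_module klinear_compose[OF a h'.tmap_klinear]
        klinear_compose[OF h.tmap_klinear a'] _ 6(7)])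
    fix e y x assume e: "e \<in> Ob (cod (src \<tau>))" "y \<in> el (src \<sigma>) c e" "x \<in> el (src \<tau>) e a"
    have i: "Ident (cod (src \<tau>)) e \<in> carrier (Hom (cod (src \<tau>)) e e)" using e h.S.G.ident_cod by simp
    show "tmap (tgt \<sigma>) (tgt \<tau>) c' a' (cmp \<sigma> c') (\<lambda>b. cmp \<tau> b a')
        (act (src \<sigma> \<boxtimes> src \<tau>) c c' a a' \<gamma> \<alpha> (tn (src \<sigma>) (src \<tau>) c a e y x))
      = act (tgt \<sigma> \<boxtimes> tgt \<tau>) c c' a a' \<gamma> \<alpha>
          (tmap (tgt \<sigma>) (tgt \<tau>) c a (cmp \<sigma> c) (\<lambda>b. cmp \<tau> b a) (tn (src \<sigma>) (src \<tau>) c a e y x))"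
      using 6 e b t assms i h.u_closed h.v_closed
        h.S.F.act_closed[of c c' e e \<gamma> _ y] h.S.G.act_closed[of e e a a' _ \<alpha> x]
        two_cell_natural[OF assms(1), of c c' e e \<gamma> _ y] two_cell_natural[OF assms(2), of e e a a' _ \<alpha> x]
      by (simp add: act_tn[of K] h.tmap_tn h'.tmap_tn)
  qed
qed

lemma cmp_hcomp_tn:
  assumes "two_cell K \<sigma>" "two_cell K \<tau>" "src \<sigma> = F" "src \<tau> = G" "dom F = cod G"
    and "c \<in> Ob (cod F)" "a \<in> Ob (dom G)"
    and "b \<in> Ob (cod G)" "y \<in> el F c b" "x \<in> el G b a"
  shows "cmp (\<sigma> \<star> \<tau>) c a (tn F G c a b y x) = tn (tgt \<sigma>) (tgt \<tau>) c a b (cmp \<sigma> c b y) (cmp \<tau> b a x)"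
proof -
  interpret h: tensor_map K F G c a "tgt \<sigma>" "tgt \<tau>" c a "\<lambda>b. cmp \<sigma> c b" "\<lambda>b. cmp \<tau> b a"
    using hcomp_tensor_map[OF assms(1,2)] assms(3-) by simp
  show ?thesis
    unfolding hcomp_tmap using assms h.tmap_tn h.S.tn_closed by simp
qed

lemma tn_closed:
  assumes "bimodule K F" "bimodule K G" "dom F = cod G" "c \<in> Ob (cod F)" "a \<in> Ob (dom G)"
    and "b \<in> Ob (cod G)" "y \<in> el F c b" "x \<in> el G b a"
  shows "tn F G c a b y x \<in> el (F \<boxtimes> G) c a"
proof -
  interpret tensorable K F G c a using assms by (auto intro!: tensorable.intro)
  show ?thesis using tn_closed assms by blast
qed

text \<open>Combined with the rules that compute cells on \<open>tn\<close>, this turns the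
  coherence identities into calculations with elementary tensors.\<close>

lemma tens_cell_eqI:
  assumes "two_cell K \<sigma>" "two_cell K \<tau>" "src \<sigma> = F \<boxtimes> G" "src \<tau> = F \<boxtimes> G" "tgt \<sigma> = tgt \<tau>"
    and FG: "bimodule K F" "bimodule K G" "dom F = cod G"
    and e: "\<And>c a b y x. c \<in> Ob (cod F) \<Longrightarrow> a \<in> Ob (dom G) \<Longrightarrow> b \<in> Ob (cod G) \<Longrightarrow>
       y \<in> el F c b \<Longrightarrow> x \<in> el G b a \<Longrightarrow>
       cmp \<sigma> c a (tn F G c a b y x) = cmp \<tau> c a (tn F G c a b y x)"
  shows "\<sigma> = \<tau>"
proof (rule cell_eqI[OF assms(1,2)])
  fix c a p assume p: "c \<in> Ob (cod (src \<tau>))" "a \<in> Ob (dom (src \<tau>))" "p \<in> el (src \<tau>) c a"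
  then interpret tensorable K F G c a using assms by (auto intro!: tensorable.intro)
  have m: "Module.module K (val (tgt \<tau>) c a)"
    using bimodule.val_module[OF two_cell_bimodule(2)[OF assms(2)]] two_cell_tgt[OF assms(2)] p by simp
  have l: "klinear K (val (F \<boxtimes> G) c a) (val (tgt \<tau>) c a) (cmp \<sigma> c a)"
    "klinear K (val (F \<boxtimes> G) c a) (val (tgt \<tau>) c a) (cmp \<tau> c a)"
    using two_cell_linear[OF assms(1), of c a] two_cell_linear[OF assms(2), of c a] p assms(3-5) by auto
  show "cmp \<sigma> c a p = cmp \<tau> c a p"
    using klinear_ext[OF m l e] p assms(4) by simp
qed (use assms in auto)

lemma hcomp_id:
  assumes "bimodule K F" "bimodule K G" "dom F = cod G"
  shows "id_cell F \<star> id_cell G = id_cell (F \<boxtimes> G)"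
  by (rule tens_cell_eqI[of K])
    (auto simp: assms hcomp_two_cell id_cell_two_cell tens_bimodule cmp_hcomp_tn[of K] tn_closed[of K])

lemma interchange:
  assumes "two_cell K \<sigma>" "two_cell K \<sigma>'" "two_cell K \<tau>" "two_cell K \<tau>'"
    "src \<sigma> = tgt \<sigma>'" "src \<tau> = tgt \<tau>'" "dom (src \<sigma>') = cod (src \<tau>')"
  shows "(\<sigma> \<star> \<tau>) \<bullet> (\<sigma>' \<star> \<tau>') = (\<sigma> \<bullet> \<sigma>') \<star> (\<tau> \<bullet> \<tau>')"
proof (rule tens_cell_eqI[of K])
  note b = two_cell_bimodule[OF assms(1)] two_cell_bimodule[OF assms(2)] 
     two_cell_bimodule[OF assms(3)] two_cell_bimodule[OF assms(4)]
  note t = two_cell_tgt[OF assms(2)] two_cell_tgt[OF assms(4)]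
  show "two_cell K ((\<sigma> \<star> \<tau>) \<bullet> (\<sigma>' \<star> \<tau>'))" "two_cell K ((\<sigma> \<bullet> \<sigma>') \<star> (\<tau> \<bullet> \<tau>'))"
    using assms t by (auto intro!: vcomp_two_cell hcomp_two_cell)
  fix c a b y x assume *: "c \<in> Ob (cod (src \<sigma>'))" "a \<in> Ob (dom (src \<tau>'))" "b \<in> Ob (cod (src \<tau>'))"
    "y \<in> el (src \<sigma>') c b" "x \<in> el (src \<tau>') b a"
  show "cmp ((\<sigma> \<star> \<tau>) \<bullet> (\<sigma>' \<star> \<tau>')) c a (tn (src \<sigma>') (src \<tau>') c a b y x) =
        cmp ((\<sigma> \<bullet> \<sigma>') \<star> (\<tau> \<bullet> \<tau>')) c a (tn (src \<sigma>') (src \<tau>') c a b y x)"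
    using * assms t b cmp_closed[OF assms(2), of c b y] cmp_closed[OF assms(4), of b a x]
    by (simp add: cmp_hcomp_tn[of K] tn_closed[of K] vcomp_two_cell)
qed (use assms two_cell_bimodule in auto)

section \<open>Cells prescribed on elementary tensors\<close>

lemma mk_cell_cong:
  assumes "\<And>b a x. b \<in> Ob (cod F) \<Longrightarrow> a \<in> Ob (dom F) \<Longrightarrow> x \<in> el F b a \<Longrightarrow> t b a x = t' b a x"
  shows "mk_cell F G t = mk_cell F G t'"
  unfolding mk_cell_def using assms by (auto simp: fun_eq_iff)

text \<open>Balancedness, homogeneity and naturality on elementary tensors suffice for a cell out of
  \<open>F \<boxtimes> G\<close>. The unit constraints and the associator are instances.\<close>

locale lift_cell =
  fixes K :: "'k ring" and F G M :: "('k,'u::infinite) bimod" and h :: "'u \<Rightarrow> 'u \<Rightarrow> 'u \<Rightarrow> 'u \<Rightarrow> 'u \<Rightarrow> 'u"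
  assumes F: "bimodule K F" and G: "bimodule K G" and FG: "dom F = cod G"
    and M: "bimodule K M" and dom_M: "dom M = dom G" and cod_M: "cod M = cod F"
    and bal: "c \<in> Ob (cod F) \<Longrightarrow> a \<in> Ob (dom G) \<Longrightarrow> balanced_map F G c a (val M c a) (h c a)"
    and smu: "c \<in> Ob (cod F) \<Longrightarrow> a \<in> Ob (dom G) \<Longrightarrow> k \<in> carrier K \<Longrightarrow> b \<in> Ob (cod G)
      \<Longrightarrow> y \<in> el F c b \<Longrightarrow> x \<in> el G b a
      \<Longrightarrow> h c a b (k \<odot>\<^bsub>val F c b\<^esub> y) x = k \<odot>\<^bsub>val M c a\<^esub> h c a b y x"
    and nat: "c \<in> Ob (cod F) \<Longrightarrow> c' \<in> Ob (cod F) \<Longrightarrow> a \<in> Ob (dom G) \<Longrightarrow> a' \<in> Ob (dom G)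
      \<Longrightarrow> \<gamma> \<in> carrier (Hom (cod F) c' c) \<Longrightarrow> \<alpha> \<in> carrier (Hom (dom G) a a') \<Longrightarrow> b \<in> Ob (cod G)
      \<Longrightarrow> y \<in> el F c b \<Longrightarrow> x \<in> el G b a
      \<Longrightarrow> h c' a' b (act F c c' b b \<gamma> (Ident (dom F) b) y) (act G b b a a' (Ident (cod G) b) \<alpha> x)
          = act M c c' a a' \<gamma> \<alpha> (h c a b y x)"
begin

sublocale M: bimodule K M by (rule M)

lemma tens: "c \<in> Ob (cod F) \<Longrightarrow> a \<in> Ob (dom G) \<Longrightarrow> tensorable K F G c a"
  by (intro tensorable.intro F G FG)

definition cell where
  "cell = mk_cell (F \<boxtimes> G) M (\<lambda>c a. lift_map (val M c a) (h c a))"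

lemma cell_simps [simp]: "src cell = F \<boxtimes> G" "tgt cell = M"
  by (simp_all add: cell_def)

lemma lift_tn:
  assumes "c \<in> Ob (cod F)" "a \<in> Ob (dom G)" "b \<in> Ob (cod G)" "y \<in> el F c b" "x \<in> el G b a"
  shows "lift_map (val M c a) (h c a) (tn F G c a b y x) = h c a b y x"
  using tensorable.lift_tn[OF tens[OF assms(1,2)] M.val_abelian bal] assms dom_M cod_M by simp

lemma cmp_cell:
  assumes "c \<in> Ob (cod F)" "a \<in> Ob (dom G)" "b \<in> Ob (cod G)" "y \<in> el F c b" "x \<in> el G b a"
  shows "cmp cell c a (tn F G c a b y x) = h c a b y x"
  unfolding cell_def using lift_tn[OF assms] assms tn_closed[OF F G FG] by simp

lemma linear: 
  assumes "c \<in> Ob (cod F)" "a \<in> Ob (dom G)"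
  shows "klinear K (val (F \<boxtimes> G) c a) (val M c a) (lift_map (val M c a) (h c a))"
  using tensorable.lift_klinear[OF tens[OF assms] M.val_module bal[OF assms] smu[OF assms]]
    assms dom_M cod_M by simp

lemma two_cell: "two_cell K cell"
  unfolding cell_def
proof (rule two_cell_mk_cell)
  fix b b' a a' \<beta> \<alpha> x
  assume *: "b \<in> Ob (cod (F \<boxtimes> G))" "b' \<in> Ob (cod (F \<boxtimes> G))" "a \<in> Ob (dom (F \<boxtimes> G))" "a' \<in> Ob (dom (F \<boxtimes> G))"
    "\<beta> \<in> carrier (Hom (cod (F \<boxtimes> G)) b' b)" "\<alpha> \<in> carrier (Hom (dom (F \<boxtimes> G)) a a')"
    "x \<in> el (F \<boxtimes> G) b a"
  interpret S: tensorable K F G b a using tens * by simp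
  have l: "klinear K (val (F \<boxtimes> G) b a) (val (F \<boxtimes> G) b' a') (act (F \<boxtimes> G) b b' a a' \<beta> \<alpha>)"
    using bimodule.act_linear[OF tens_bimodule[OF F G FG]] * by simp
  have m: "klinear K (val M b a) (val M b' a') (act M b b' a a' \<beta> \<alpha>)"
    using M.act_linear * dom_M cod_M by simp
  have n: "klinear K (val (F \<boxtimes> G) b' a') (val M b' a') (lift_map (val M b' a') (h b' a'))"
    "klinear K (val (F \<boxtimes> G) b a) (val M b a) (lift_map (val M b a) (h b a))"
    using linear * by simp_all
  show "lift_map (val M b' a') (h b' a') (act (F \<boxtimes> G) b b' a a' \<beta> \<alpha> x) =
       act M b b' a a' \<beta> \<alpha> (lift_map (val M b a) (h b a) x)"
  proof (rule S.klinear_ext[OF _ klinear_compose[OF l n(1)] klinear_compose[OF n(2) m] _ *(7)])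
    show "Module.module K (val M b' a')" using M.val_module * dom_M cod_M by simp
    fix e y x assume e: "e \<in> Ob (cod G)" "y \<in> el F b e" "x \<in> el G e a"
    have "act F b b' e e \<beta> (Ident (dom F) e) y \<in> el F b' e"
      using S.F.act_closed * e FG S.F.ident_dom by simp
    moreover have "act G e e a a' (Ident (cod G) e) \<alpha> x \<in> el G e a'"
      using S.G.act_closed * e S.G.ident_cod by simp
    ultimately show "lift_map (val M b' a') (h b' a') (act (F \<boxtimes> G) b b' a a' \<beta> \<alpha> (tn F G b a e y x)) =
       act M b b' a a' \<beta> \<alpha> (lift_map (val M b a) (h b a) (tn F G b a e y x))"
      using * e act_tn[OF F G FG, of b b' a a' \<beta> \<alpha> e y x] nat[of b b' a a' \<beta> \<alpha> e y x]
      by (simp add: lift_tn)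
  qed
qed (use linear tens_bimodule[OF F G FG] M dom_M cod_M in auto)

end

subsection \<open>Units\<close>

lemma unit_bimod_simps [simp]: "dom (unit_bimod B) = B" "cod (unit_bimod B) = B" "val (unit_bimod B) = Hom B"
  "act (unit_bimod B) b b' d d' \<beta> \<delta> = (\<lambda>h. Comp B b' b d' (Comp B b d d' \<delta> h) \<beta>)"
  by (simp_all add: unit_bimod_def)

lemma (in kcategory) comp_closed:
  "a \<in> Ob A \<Longrightarrow> b \<in> Ob A \<Longrightarrow> c \<in> Ob A \<Longrightarrow> f \<in> carrier (Hom A a b) \<Longrightarrow> g \<in> carrier (Hom A b c)
    \<Longrightarrow> Comp A a b c g f \<in> carrier (Hom A a c)"
  using klinear_closed[OF comp_linear_left] .

lemma (in kcategory) unit_bimodule: "bimodule K (unit_bimod A)"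
proof (rule bimodule.intro, goal_cases)
  case 1
  show ?case using kcategory_axioms by simp
next
  case 2
  show ?case using kcategory_axioms by simp
next
  case (3 b a)
  then show ?case using hom_module by simp
next
  case (4 b b' a a' \<beta> \<alpha>)
  then show ?case
    using klinear_compose[OF comp_linear_right[of b a a' \<alpha>] comp_linear_left[of b' b a' \<beta>]] by simp
next
  case (5 b b' a a' \<alpha> x)
  then show ?case
    using comp_linear_right[of b' b a' "Comp A b a a' \<alpha> x"] comp_closed by simp
next
  case (6 b b' a a' \<beta> x)
  then show ?case
    using klinear_compose[OF comp_linear_left[of b a a' x] comp_linear_left[of b' b a' \<beta>]] by simp
next
  case (7 b a x)
  then show ?case by (simp add: comp_ident_left comp_ident_right)
next
  case (8 b b' b'' a a' a'' \<beta> \<beta>' \<alpha> \<alpha>' x)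
  then show ?case by (simp add: comp_assoc comp_closed)
qed

lemma (in bimodule) unit_cod: "bimodule K (unit_bimod (cod F))"
  using kcategory.unit_bimodule[OF cod_kcategory] .

lemma (in bimodule) unit_dom: "bimodule K (unit_bimod (dom F))"
  using kcategory.unit_bimodule[OF dom_kcategory] .

lemma (in bimodule) act_cod_comp:
  assumes "b \<in> Ob (cod F)" "b' \<in> Ob (cod F)" "b'' \<in> Ob (cod F)" "a \<in> Ob (dom F)"
    "\<beta> \<in> carrier (Hom (cod F) b' b)" "\<beta>' \<in> carrier (Hom (cod F) b'' b')" "x \<in> el F b a"
  shows "act F b b'' a a (Comp (cod F) b'' b' b \<beta> \<beta>') (Ident (dom F) a) x
    = act F b' b'' a a \<beta>' (Ident (dom F) a) (act F b b' a a \<beta> (Ident (dom F) a) x)"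
  using act_comp[of b b' b'' a a a \<beta> \<beta>' "Ident (dom F) a" "Ident (dom F) a" x] assms ident_dom
    kcategory.comp_ident_left[OF dom_kcategory] by simp

lemma (in bimodule) act_dom_comp:
  assumes "b \<in> Ob (cod F)" "a \<in> Ob (dom F)" "a' \<in> Ob (dom F)" "a'' \<in> Ob (dom F)"
    "\<alpha> \<in> carrier (Hom (dom F) a a')" "\<alpha>' \<in> carrier (Hom (dom F) a' a'')" "x \<in> el F b a"
  shows "act F b b a a'' (Ident (cod F) b) (Comp (dom F) a a' a'' \<alpha>' \<alpha>) x
    = act F b b a' a'' (Ident (cod F) b) \<alpha>' (act F b b a a' (Ident (cod F) b) \<alpha> x)"
  using act_comp[of b b b a a' a'' "Ident (cod F) b" "Ident (cod F) b" \<alpha> \<alpha>' x] assms ident_cod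
    kcategory.comp_ident_left[OF cod_kcategory] by simp

text \<open>Restricts \<open>bimodule\<close> to universes of class \<open>infinite\<close>, so that
  tensor products can be formed inside the locale.\<close>

locale inf_bimodule = bimodule K F for K :: "'k ring" and F :: "('k,'u::infinite) bimod"

lemma (in inf_bimodule) lunit_lift_cell:
  "lift_cell K (unit_bimod (cod F)) F F (\<lambda>b a b' \<beta> x. act F b' b a a \<beta> (Ident (dom F) a) x)"
proof -
  interpret C: kcategory K "cod F" by (rule cod_kcategory)
  show ?thesis
  proof (rule lift_cell.intro, goal_cases)
    case 1
    show ?case by (rule unit_cod)
  next
    case 2
    show ?case by (rule bimodule_axioms)
  next
    case 3
    show ?case by simp
  next
    case 4
    show ?case by (rule bimodule_axioms)
  next
    case 5
    show ?case by simp
  next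
    case 6
    show ?case by simp
  next
    case (7 c a)
    interpret S: tensorable K "unit_bimod (cod F)" F c a
      using 7 unit_cod bimodule_axioms by (intro tensorable.intro) auto
    show ?case
    proof (rule balanced_map.intro, goal_cases)
      case (1 b y x)
      then show ?case using 7 act_closed ident_dom by simp
    next
      case (2 b y y' x)
      then show ?case using 7 klinear_add[OF act_linear_cod[of b c a a "Ident (dom F) a" x]] ident_dom by simp
    next
      case (3 b y x x')
      then show ?case using 7 klinear_add[OF act_linear[of b c a a y "Ident (dom F) a"]] ident_dom by simp
    next
      case (4 b b' \<beta> y x)
      then show ?case
        using 7 act_cod_comp[of b' b c a \<beta> y x] C.comp_closed C.ident_hom
        by (simp add: C.comp_ident_right)
    qed
  next
    case (8 c a k b y x)
    then show ?case using klinear_smult[OF act_linear_cod[of b c a a "Ident (dom F) a" x]] ident_dom by simp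
  next
    case (9 c c' a a' \<gamma> \<alpha> b y x)
    have "Comp (cod F) c' c b (Comp (cod F) c b b (Ident (cod F) b) y) \<gamma> = Comp (cod F) c' c b y \<gamma>"
      using 9 C.comp_ident_left by simp
    moreover have "Comp (cod F) c' c b y \<gamma> \<in> carrier (Hom (cod F) c' b)" using 9 C.comp_closed by simp
    moreover have "act F b c a a y (Ident (dom F) a) x \<in> el F c a"
      using 9 act_closed ident_dom by simp
    ultimately show ?case
      using 9 act_cod_dom[of b c' a a' "Comp (cod F) c' c b y \<gamma>" \<alpha> x]
        act_cod_comp[of b c c' a y \<gamma> x] act_dom_cod[of b c' a a' "Comp (cod F) c' c b y \<gamma>" \<alpha> x]
        act_dom_cod[of c c' a a' \<gamma> \<alpha> "act F b c a a y (Ident (dom F) a) x"] by simp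
  qed
qed

lemma (in inf_bimodule) lunit_cell:
  "lunit F = lift_cell.cell (unit_bimod (cod F)) F F (\<lambda>b a b' \<beta> x. act F b' b a a \<beta> (Ident (dom F) a) x)"
  by (simp add: lunit_def lift_cell.cell_def[OF lunit_lift_cell] lift_map_def[abs_def])

lemma lunit_simps [simp]: "src (lunit F) = unit_bimod (cod F) \<boxtimes> F" "tgt (lunit F) = F"
  by (simp_all add: lunit_def)

lemma lunit_two_cell:
  assumes "bimodule K F"
  shows "two_cell K (lunit F)"
  unfolding inf_bimodule.lunit_cell[OF inf_bimodule.intro[OF assms]]
  by (rule lift_cell.two_cell[OF inf_bimodule.lunit_lift_cell[OF inf_bimodule.intro[OF assms]]])

lemma cmp_lunit:
  assumes "bimodule K F" "cod F = B" "b \<in> Ob B" "a \<in> Ob (dom F)" "b' \<in> Ob B"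
    "\<beta> \<in> carrier (Hom B b b')" "x \<in> el F b' a"
  shows "cmp (lunit F) b a (tn (unit_bimod B) F b a b' \<beta> x) = act F b' b a a \<beta> (Ident (dom F) a) x"
  using lift_cell.cmp_cell[OF inf_bimodule.lunit_lift_cell[OF inf_bimodule.intro[OF assms(1)]]] assms
  by (simp add: inf_bimodule.lunit_cell[OF inf_bimodule.intro[OF assms(1)]])

text \<open>The inverse sends \<open>x\<close> to \<open>1 \<otimes> x\<close>. Writing
  \<open>\<beta>\<close> as \<open>1\<close> followed by the action of \<open>\<beta>\<close>,
  balancing gives \<open>\<beta> \<otimes> x = 1 \<otimes> \<beta>x\<close>.\<close>

lemma (in inf_bimodule) lunit_iso: "iso_cell K (lunit F)"
proof -
  interpret C: kcategory K "cod F" by (rule cod_kcategory)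
  let ?U = "unit_bimod (cod F)"
  have tc: "tensorable K ?U F b a" if "b \<in> Ob (cod F)" "a \<in> Ob (dom F)" for b a
    using that unit_cod bimodule_axioms by (intro tensorable.intro) auto
  have tl: "two_cell K (lunit F)" using lunit_two_cell bimodule_axioms by blast
  show ?thesis
  proof (rule iso_cell_pointwise[OF tl, of "\<lambda>b a x. tn ?U F b a b (Ident (cod F) b) x"])
    fix b a y assume "b \<in> Ob (cod (src (lunit F)))" "a \<in> Ob (dom (src (lunit F)))" "y \<in> el (tgt (lunit F)) b a"
    then show "tn ?U F b a b (Ident (cod F) b) y \<in> el (src (lunit F)) b a \<and>
        cmp (lunit F) b a (tn ?U F b a b (Ident (cod F) b) y) = y"
      using bimodule_axioms C.ident_hom tensorable.tn_closed[OF tc] by (simp add: cmp_lunit[of K] act_ident)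
  next
    fix c a p assume *: "c \<in> Ob (cod (src (lunit F)))" "a \<in> Ob (dom (src (lunit F)))" "p \<in> el (src (lunit F)) c a"
    then have o: "c \<in> Ob (cod F)" "a \<in> Ob (dom F)" "p \<in> el (?U \<boxtimes> F) c a" by simp_all
    interpret t: tensorable K ?U F c a using tc o by simp
    have l: "klinear K (val (?U \<boxtimes> F) c a) (val F c a) (cmp (lunit F) c a)"
      using two_cell_linear[OF tl] o by simp
    have r: "klinear K (val F c a) (val (?U \<boxtimes> F) c a) (\<lambda>x. tn ?U F c a c (Ident (cod F) c) x)"
      using t.tn_klinear_right o C.ident_hom by simp
    show "tn ?U F c a c (Ident (cod F) c) (cmp (lunit F) c a p) = p"
    proof (rule t.klinear_ext[OF t.tens_module klinear_compose[OF l r] klinear_ident _ o(3)])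
      fix b y x assume "b \<in> Ob (cod F)" "y \<in> el ?U c b" "x \<in> el F b a"
      then show "tn ?U F c a c (Ident (cod F) c) (cmp (lunit F) c a (tn ?U F c a b y x)) = tn ?U F c a b y x"
        using t.tn_bal[of c b y "Ident (cod F) c" x, symmetric] o C.ident_hom bimodule_axioms
        by (simp add: C.comp_ident_right cmp_lunit[of K])
    qed
  qed
qed

lemma (in inf_bimodule) runit_lift_cell:
  "lift_cell K F (unit_bimod (dom F)) F (\<lambda>b a a' y \<alpha>. act F b b a' a (Ident (cod F) b) \<alpha> y)"
proof -
  interpret D: kcategory K "dom F" by (rule dom_kcategory)
  show ?thesis
  proof (rule lift_cell.intro, goal_cases)
    case 1
    show ?case by (rule bimodule_axioms)
  next
    case 2
    show ?case by (rule unit_dom)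
  next
    case 3
    show ?case by simp
  next
    case 4
    show ?case by (rule bimodule_axioms)
  next
    case 5
    show ?case by simp
  next
    case 6
    show ?case by simp
  next
    case (7 c a)
    interpret S: tensorable K F "unit_bimod (dom F)" c a
      using 7 unit_dom bimodule_axioms by (intro tensorable.intro) auto
    show ?case
    proof (rule balanced_map.intro, goal_cases)
      case (1 b y x)
      then show ?case using 7 act_closed ident_cod by simp
    next
      case (2 b y y' x)
      then show ?case using 7 klinear_add[OF act_linear[of c c b a "Ident (cod F) c" x]] ident_cod by simp
    next
      case (3 b y x x')
      then show ?case using 7 klinear_add[OF act_linear_dom[of c c b a "Ident (cod F) c" y]] ident_cod by simp
    next
      case (4 b b' \<beta> y x)
      then show ?case
        using 7 act_dom_comp[of c b b' a \<beta> x y] D.comp_closed D.ident_hom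
        by (simp add: D.comp_ident_left)
    qed
  next
    case (8 c a k b y x)
    then show ?case using klinear_smult[OF act_linear[of c c b a "Ident (cod F) c" x]] ident_cod by simp
  next
    case (9 c c' a a' \<gamma> \<alpha> b y x)
    have e: "Comp (dom F) b b a' (Comp (dom F) b a a' \<alpha> x) (Ident (dom F) b) = Comp (dom F) b a a' \<alpha> x"
      using 9 D.comp_ident_right D.comp_closed by simp
    have "Comp (dom F) b a a' \<alpha> x \<in> carrier (Hom (dom F) b a')" using 9 D.comp_closed by simp
    moreover have "act F c c b a (Ident (cod F) c) x y \<in> el F c a"
      using 9 act_closed ident_cod by simp
    ultimately show ?case
      using 9 e act_dom_cod[of c c' b a' \<gamma> "Comp (dom F) b a a' \<alpha> x" y]
        act_dom_comp[of c b a a' x \<alpha> y] act_cod_dom[of c c' b a' \<gamma> "Comp (dom F) b a a' \<alpha> x" y]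
        act_cod_dom[of c c' a a' \<gamma> \<alpha> "act F c c b a (Ident (cod F) c) x y"] by simp
  qed
qed

lemma (in inf_bimodule) runit_cell:
  "runit F = lift_cell.cell F (unit_bimod (dom F)) F (\<lambda>b a a' y \<alpha>. act F b b a' a (Ident (cod F) b) \<alpha> y)"
  by (simp add: runit_def lift_cell.cell_def[OF runit_lift_cell] lift_map_def[abs_def])

lemma runit_simps [simp]: "src (runit F) = F \<boxtimes> unit_bimod (dom F)" "tgt (runit F) = F"
  by (simp_all add: runit_def)

lemma runit_two_cell:
  assumes "bimodule K F"
  shows "two_cell K (runit F)"
  unfolding inf_bimodule.runit_cell[OF inf_bimodule.intro[OF assms]]
  by (rule lift_cell.two_cell[OF inf_bimodule.runit_lift_cell[OF inf_bimodule.intro[OF assms]]])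

lemma cmp_runit:
  assumes "bimodule K F" "dom F = A" "b \<in> Ob (cod F)" "a \<in> Ob A" "a' \<in> Ob A"
    "\<alpha> \<in> carrier (Hom A a' a)" "y \<in> el F b a'"
  shows "cmp (runit F) b a (tn F (unit_bimod A) b a a' y \<alpha>) = act F b b a' a (Ident (cod F) b) \<alpha> y"
  using lift_cell.cmp_cell[OF inf_bimodule.runit_lift_cell[OF inf_bimodule.intro[OF assms(1)]]] assms
  by (simp add: inf_bimodule.runit_cell[OF inf_bimodule.intro[OF assms(1)]])

lemma (in inf_bimodule) runit_iso: "iso_cell K (runit F)"
proof -
  interpret D: kcategory K "dom F" by (rule dom_kcategory)
  let ?U = "unit_bimod (dom F)"
  have tc: "tensorable K F ?U b a" if "b \<in> Ob (cod F)" "a \<in> Ob (dom F)" for b a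
    using that unit_dom bimodule_axioms by (intro tensorable.intro) auto
  have tl: "two_cell K (runit F)" using runit_two_cell bimodule_axioms by blast
  show ?thesis
  proof (rule iso_cell_pointwise[OF tl, of "\<lambda>b a x. tn F ?U b a a x (Ident (dom F) a)"])
    fix b a y assume "b \<in> Ob (cod (src (runit F)))" "a \<in> Ob (dom (src (runit F)))" "y \<in> el (tgt (runit F)) b a"
    then show "tn F ?U b a a y (Ident (dom F) a) \<in> el (src (runit F)) b a \<and>
        cmp (runit F) b a (tn F ?U b a a y (Ident (dom F) a)) = y"
      using bimodule_axioms D.ident_hom tensorable.tn_closed[OF tc] by (simp add: cmp_runit[of K] act_ident)
  next
    fix c a p assume *: "c \<in> Ob (cod (src (runit F)))" "a \<in> Ob (dom (src (runit F)))" "p \<in> el (src (runit F)) c a"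
    then have o: "c \<in> Ob (cod F)" "a \<in> Ob (dom F)" "p \<in> el (F \<boxtimes> ?U) c a" by simp_all
    interpret t: tensorable K F ?U c a using tc o by simp
    have l: "klinear K (val (F \<boxtimes> ?U) c a) (val F c a) (cmp (runit F) c a)"
      using two_cell_linear[OF tl] o by simp
    have r: "klinear K (val F c a) (val (F \<boxtimes> ?U) c a) (\<lambda>x. tn F ?U c a a x (Ident (dom F) a))"
      using t.tn_klinear_left o D.ident_hom by simp
    show "tn F ?U c a a (cmp (runit F) c a p) (Ident (dom F) a) = p"
    proof (rule t.klinear_ext[OF t.tens_module klinear_compose[OF l r] klinear_ident _ o(3)])
      fix b y x assume "b \<in> Ob (cod ?U)" "y \<in> el F c b" "x \<in> el ?U b a"
      then show "tn F ?U c a a (cmp (runit F) c a (tn F ?U c a b y x)) (Ident (dom F) a) = tn F ?U c a b y x"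
        using t.tn_bal[of b a x y "Ident (dom F) a"] o D.ident_hom bimodule_axioms
        by (simp add: D.comp_ident_left D.comp_ident_right cmp_runit[of K])
    qed
  qed
qed

subsection \<open>Associativity\<close>

locale composable3 =
  fixes K :: "'k ring" and H G F :: "('k,'u::infinite) bimod"
  assumes bimod_H: "bimodule K H" and bimod_G: "bimodule K G" and bimod_F: "bimodule K F"
    and HG: "dom H = cod G" and GF: "dom G = cod F"
begin

sublocale H: bimodule K H by (rule bimod_H)
sublocale G: bimodule K G by (rule bimod_G)
sublocale F: bimodule K F by (rule bimod_F)

lemma bimod_HG: "bimodule K (H \<boxtimes> G)"
  by (rule tens_bimodule[OF bimod_H bimod_G HG])

lemma bimod_GF: "bimodule K (G \<boxtimes> F)"
  by (rule tens_bimodule[OF bimod_G bimod_F GF])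

lemma bimod_HG_F: "bimodule K ((H \<boxtimes> G) \<boxtimes> F)"
  using tens_bimodule[OF bimod_HG bimod_F] GF by simp

lemma bimod_H_GF: "bimodule K (H \<boxtimes> (G \<boxtimes> F))"
  using tens_bimodule[OF bimod_H bimod_GF] HG by simp

lemma tensorable_HG: "d \<in> Ob (cod H) \<Longrightarrow> b \<in> Ob (cod F) \<Longrightarrow> tensorable K H G d b"
  using bimod_H bimod_G HG GF by (intro tensorable.intro) auto

lemma tensorable_GF: "c \<in> Ob (cod G) \<Longrightarrow> a \<in> Ob (dom F) \<Longrightarrow> tensorable K G F c a"
  using bimod_F bimod_G HG GF by (intro tensorable.intro) auto

lemma tensorable_H_GF: "d \<in> Ob (cod H) \<Longrightarrow> a \<in> Ob (dom F) \<Longrightarrow> tensorable K H (G \<boxtimes> F) d a"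
  using bimod_H bimod_GF HG GF by (intro tensorable.intro) auto

lemma tensorable_HG_F: "d \<in> Ob (cod H) \<Longrightarrow> a \<in> Ob (dom F) \<Longrightarrow> tensorable K (H \<boxtimes> G) F d a"
  using bimod_HG bimod_F HG GF by (intro tensorable.intro) auto

lemma H_ident: "d \<in> Ob (cod H) \<Longrightarrow> c \<in> Ob (cod G) \<Longrightarrow> z \<in> el H d c
    \<Longrightarrow> act H d d c c (Ident (cod H) d) (Ident (cod G) c) z = z"
  using H.act_ident HG by simp

lemma G_ident: "c \<in> Ob (cod G) \<Longrightarrow> b \<in> Ob (cod F) \<Longrightarrow> y \<in> el G c b
    \<Longrightarrow> act G c c b b (Ident (cod G) c) (Ident (cod F) b) y = y"
  using G.act_ident GF by simp

lemma klinear_ext_left: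
  assumes d: "d \<in> Ob (cod H)" "a \<in> Ob (dom F)" and m: "Module.module K N"
    and l: "klinear K (val ((H \<boxtimes> G) \<boxtimes> F) d a) N g" "klinear K (val ((H \<boxtimes> G) \<boxtimes> F) d a) N g'"
    and e: "\<And>b c z y x. b \<in> Ob (cod F) \<Longrightarrow> c \<in> Ob (cod G) \<Longrightarrow> z \<in> el H d c \<Longrightarrow> y \<in> el G c b \<Longrightarrow>
       x \<in> el F b a \<Longrightarrow>
       g (tn (H \<boxtimes> G) F d a b (tn H G d b c z y) x) = g' (tn (H \<boxtimes> G) F d a b (tn H G d b c z y) x)"
    and p: "p \<in> el ((H \<boxtimes> G) \<boxtimes> F) d a"
  shows "g p = g' p"
proof -
  interpret S: tensorable K "H \<boxtimes> G" F d a using tensorable_HG_F d .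
  show ?thesis
  proof (rule S.klinear_ext[OF m l _ p])
    fix b w x assume *: "b \<in> Ob (cod F)" "w \<in> el (H \<boxtimes> G) d b" "x \<in> el F b a"
    interpret T: tensorable K H G d b using tensorable_HG d * by simp
    show "g (tn (H \<boxtimes> G) F d a b w x) = g' (tn (H \<boxtimes> G) F d a b w x)"
      using * by (intro T.klinear_ext[OF m klinear_compose[OF S.tn_klinear_left l(1)]
        klinear_compose[OF S.tn_klinear_left l(2)] _ *(2)] e) auto
  qed
qed

lemma klinear_ext_right:
  assumes d: "d \<in> Ob (cod H)" "a \<in> Ob (dom F)" and m: "Module.module K N"
    and l: "klinear K (val (H \<boxtimes> (G \<boxtimes> F)) d a) N g" "klinear K (val (H \<boxtimes> (G \<boxtimes> F)) d a) N g'"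
    and e: "\<And>b c z y x. b \<in> Ob (cod F) \<Longrightarrow> c \<in> Ob (cod G) \<Longrightarrow> z \<in> el H d c \<Longrightarrow> y \<in> el G c b \<Longrightarrow>
       x \<in> el F b a \<Longrightarrow>
       g (tn H (G \<boxtimes> F) d a c z (tn G F c a b y x)) = g' (tn H (G \<boxtimes> F) d a c z (tn G F c a b y x))"
    and p: "p \<in> el (H \<boxtimes> (G \<boxtimes> F)) d a"
  shows "g p = g' p"
proof -
  interpret S: tensorable K H "G \<boxtimes> F" d a using tensorable_H_GF d .
  show ?thesis
  proof (rule S.klinear_ext[OF m l _ p])
    fix c z w assume *: "c \<in> Ob (cod (G \<boxtimes> F))" "z \<in> el H d c" "w \<in> el (G \<boxtimes> F) c a"
    interpret T: tensorable K G F c a using tensorable_GF d * by simp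
    show "g (tn H (G \<boxtimes> F) d a c z w) = g' (tn H (G \<boxtimes> F) d a c z w)"
      using * by (intro T.klinear_ext[OF m klinear_compose[OF S.tn_klinear_right l(1)]
        klinear_compose[OF S.tn_klinear_right l(2)] _ *(3)] e) auto
  qed
qed

lemma cell_eqI_left:
  assumes "two_cell K \<sigma>" "two_cell K \<tau>" "src \<sigma> = (H \<boxtimes> G) \<boxtimes> F" "src \<tau> = (H \<boxtimes> G) \<boxtimes> F" "tgt \<sigma> = tgt \<tau>"
    and e: "\<And>d a b c z y x. d \<in> Ob (cod H) \<Longrightarrow> a \<in> Ob (dom F) \<Longrightarrow> b \<in> Ob (cod F) \<Longrightarrow> c \<in> Ob (cod G) \<Longrightarrow>
       z \<in> el H d c \<Longrightarrow> y \<in> el G c b \<Longrightarrow> x \<in> el F b a \<Longrightarrow>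
       cmp \<sigma> d a (tn (H \<boxtimes> G) F d a b (tn H G d b c z y) x) = cmp \<tau> d a (tn (H \<boxtimes> G) F d a b (tn H G d b c z y) x)"
  shows "\<sigma> = \<tau>"
proof (rule cell_eqI[OF assms(1,2)])
  fix d a p assume "d \<in> Ob (cod (src \<tau>))" "a \<in> Ob (dom (src \<tau>))" "p \<in> el (src \<tau>) d a"
  then have *: "d \<in> Ob (cod H)" "a \<in> Ob (dom F)" "p \<in> el ((H \<boxtimes> G) \<boxtimes> F) d a" using assms(4) by simp_all
  have m: "Module.module K (val (tgt \<tau>) d a)"
    using bimodule.val_module[OF two_cell_bimodule(2)[OF assms(2)]] two_cell_tgt[OF assms(2)] assms(4) * by simp
  have l: "klinear K (val ((H \<boxtimes> G) \<boxtimes> F) d a) (val (tgt \<tau>) d a) (cmp \<sigma> d a)"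
    "klinear K (val ((H \<boxtimes> G) \<boxtimes> F) d a) (val (tgt \<tau>) d a) (cmp \<tau> d a)"
    using two_cell_linear[OF assms(1), of d a] two_cell_linear[OF assms(2), of d a] assms(3-5) * by auto
  show "cmp \<sigma> d a p = cmp \<tau> d a p"
    by (rule klinear_ext_left[OF *(1,2) m l e *(3)]) (use * in auto)
qed (use assms in simp_all)

text \<open>The associator is a lift in two stages. In the first, \<open>x\<close> is fixed and
  \<open>z \<otimes> y\<close> goes to \<open>z \<otimes> (y \<otimes> x)\<close>; this is balanced
  because the category between \<open>H\<close> and \<open>G\<close> acts on
  \<open>G \<boxtimes> F\<close> through \<open>G\<close>.\<close>

lemma assoc_inner_balanced:
  assumes "d \<in> Ob (cod H)" "a \<in> Ob (dom F)" "b \<in> Ob (cod F)" "x \<in> el F b a"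
  shows "balanced_map H G d b (val (H \<boxtimes> (G \<boxtimes> F)) d a)
    (\<lambda>c z y. tn H (G \<boxtimes> F) d a c z (tn G F c a b y x))"
proof -
  interpret T: tensorable K H G d b using tensorable_HG assms by simp
  interpret S: tensorable K H "G \<boxtimes> F" d a using tensorable_H_GF assms by simp
  have cl: "tn G F c a b y x \<in> el (G \<boxtimes> F) c a" if "c \<in> Ob (cod G)" "y \<in> el G c b" for c y
    using tensorable.tn_closed[OF tensorable_GF] that assms by simp
  show ?thesis
  proof (rule balanced_map.intro, goal_cases)
    case (1 c z y)
    then show ?case using S.tn_closed cl by simp
  next
    case (2 c z z' y)
    then show ?case using S.tn_add_left cl by simp
  next
    case (3 c z y y')
    then show ?case
      using S.tn_add_right cl tensorable.tn_add_left[OF tensorable_GF, of c a b y y' x] assms by simp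
  next
    case (4 c c' \<beta> z y)
    have "act (G \<boxtimes> F) c' c a a \<beta> (Ident (dom F) a) (tn G F c' a b y x)
      = tn G F c a b (act G c' c b b \<beta> (Ident (dom G) b) y) x"
      using act_tn[OF bimod_G bimod_F GF, of c' c a a \<beta> "Ident (dom F) a" b y x] 4 assms F.ident_dom
      by (simp add: F.act_ident)
    then show ?case using S.tn_bal[of c c' \<beta> z "tn G F c' a b y x"] 4 cl by simp
  qed
qed

definition assoc_at where
  "assoc_at d a b x = lift_map (val (H \<boxtimes> (G \<boxtimes> F)) d a) (\<lambda>c z y. tn H (G \<boxtimes> F) d a c z (tn G F c a b y x))"

lemma assoc_inner_linear:
  assumes "d \<in> Ob (cod H)" "a \<in> Ob (dom F)" "b \<in> Ob (cod F)" "x \<in> el F b a"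
  shows "klinear K (val (H \<boxtimes> G) d b) (val (H \<boxtimes> (G \<boxtimes> F)) d a)
    (assoc_at d a b x)"
proof -
  interpret T: tensorable K H G d b using tensorable_HG assms by simp
  interpret S: tensorable K H "G \<boxtimes> F" d a using tensorable_H_GF assms by simp
  show ?thesis
    unfolding assoc_at_def
  proof (rule T.lift_klinear[OF S.tens_module assoc_inner_balanced[OF assms]])
    fix k c z y assume "k \<in> carrier K" "c \<in> Ob (cod G)" "z \<in> el H d c" "y \<in> el G c b"
    then show "tn H (G \<boxtimes> F) d a c (k \<odot>\<^bsub>val H d c\<^esub> z) (tn G F c a b y x) =
       k \<odot>\<^bsub>val (H \<boxtimes> (G \<boxtimes> F)) d a\<^esub> tn H (G \<boxtimes> F) d a c z (tn G F c a b y x)"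
      using S.tn_smult_left tensorable.tn_closed[OF tensorable_GF] assms by simp
  qed
qed

lemma assoc_inner_tn:
  assumes "d \<in> Ob (cod H)" "a \<in> Ob (dom F)" "b \<in> Ob (cod F)" "x \<in> el F b a"
    "c \<in> Ob (cod G)" "z \<in> el H d c" "y \<in> el G c b"
  shows "assoc_at d a b x (tn H G d b c z y)
    = tn H (G \<boxtimes> F) d a c z (tn G F c a b y x)"
proof -
  interpret T: tensorable K H G d b using tensorable_HG assms by simp
  interpret S: tensorable K H "G \<boxtimes> F" d a using tensorable_H_GF assms by simp
  show ?thesis unfolding assoc_at_def using T.lift_tn[OF S.tens_abelian assoc_inner_balanced[OF assms(1-4)] assms(5-7)] .
qed

text \<open>Second stage: the maps \<open>assoc_at\<close> depend additively on \<open>x\<close> and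
  are balanced over the category between \<open>G\<close> and \<open>F\<close>. The properties
  involving \<open>x\<close> or the actions are equalities of linear maps in \<open>w\<close>, hence
  they are checked on \<open>z \<otimes> y\<close>.\<close>

lemma assoc_lift_cell:
  "lift_cell K (H \<boxtimes> G) F (H \<boxtimes> (G \<boxtimes> F)) (\<lambda>d a b w x.
     assoc_at d a b x w)"
proof (rule lift_cell.intro, goal_cases)
  case 1
  show ?case by (rule bimod_HG)
next
  case 2
  show ?case by (rule bimod_F)
next
  case 3
  show ?case using GF by simp
next
  case 4
  show ?case by (rule bimod_H_GF)
next
  case 5
  show ?case by simp
next
  case 6
  show ?case by simp
next
  case (7 d a)
  then have d: "d \<in> Ob (cod H)" "a \<in> Ob (dom F)" by simp_all
  interpret T: tensorable K "H \<boxtimes> G" F d a using tensorable_HG_F d by simp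
  interpret S: tensorable K H "G \<boxtimes> F" d a using tensorable_H_GF d by simp
  note lin = assoc_inner_linear[OF d]
  note inn = assoc_inner_tn[OF d]
  show ?case
  proof (rule balanced_map.intro, goal_cases)
    case (1 b w x)
    then show ?case using klinear_closed[OF lin] by simp
  next
    case (2 b w w' x)
    then show ?case using klinear_add[OF lin] by simp
  next
    case (3 b w x x')
    interpret U: tensorable K H G d b using tensorable_HG d 3 by simp
    interpret V: Module.module K "val F b a" using F.val_module d 3 by simp
    have xx: "x \<oplus>\<^bsub>val F b a\<^esub> x' \<in> el F b a" using 3 by simp
    show ?case
    proof (rule U.klinear_ext[OF S.tens_module lin[OF 3(1) xx] klinear_plus[OF U.tens_module S.tens_module
           lin[OF 3(1,3)] lin[OF 3(1,4)]] _ 3(2)])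
      fix c z y assume *: "c \<in> Ob (cod G)" "z \<in> el H d c" "y \<in> el G c b"
      interpret W: tensorable K G F c a using tensorable_GF * d by simp
      show "assoc_at d a b (x \<oplus>\<^bsub>val F b a\<^esub> x') (tn H G d b c z y) =
          assoc_at d a b x (tn H G d b c z y)
          \<oplus>\<^bsub>val (H \<boxtimes> (G \<boxtimes> F)) d a\<^esub>
          assoc_at d a b x' (tn H G d b c z y)"
        using * 3 xx by (simp add: inn W.tn_add_right S.tn_add_right W.tn_closed)
    qed
  next
    case (4 b b' \<beta> w x)
    interpret U: tensorable K H G d b using tensorable_HG d 4 by simp
    have ac: "klinear K (val (H \<boxtimes> G) d b) (val (H \<boxtimes> G) d b') (act (H \<boxtimes> G) d d b b' (Ident (cod H) d) \<beta>)"
      using bimodule.act_linear[OF bimod_HG] d 4 H.ident_cod GF by simp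
    have xx: "act F b' b a a \<beta> (Ident (dom F) a) x \<in> el F b a"
      using F.act_closed d 4 F.ident_dom by simp
    have "assoc_at d a b' x
         (act (H \<boxtimes> G) d d b b' (Ident (cod H) d) \<beta> w)
       = assoc_at d a b (act F b' b a a \<beta> (Ident (dom F) a) x) w"
    proof (rule U.klinear_ext[OF S.tens_module klinear_compose[OF ac lin[OF 4(2,5)]] lin[OF 4(1) xx] _ 4(4)])
      fix c z y assume *: "c \<in> Ob (cod G)" "z \<in> el H d c" "y \<in> el G c b"
      interpret W: tensorable K G F c a using tensorable_GF * d by simp
      have "act G c c b b' (Ident (cod G) c) \<beta> y \<in> el G c b'"
        using G.act_closed 4 * GF G.ident_cod by simp
      moreover have "act (H \<boxtimes> G) d d b b' (Ident (cod H) d) \<beta> (tn H G d b c z y)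
          = tn H G d b' c z (act G c c b b' (Ident (cod G) c) \<beta> y)"
        using act_tn[OF bimod_H bimod_G HG, of d d b b' "Ident (cod H) d" \<beta> c z y] d 4 * GF H.ident_cod
        by (simp add: H_ident HG)
      ultimately show "assoc_at d a b' x
           (act (H \<boxtimes> G) d d b b' (Ident (cod H) d) \<beta> (tn H G d b c z y))
        = assoc_at d a b (act F b' b a a \<beta> (Ident (dom F) a) x) (tn H G d b c z y)"
        using * 4 xx by (simp add: inn W.tn_bal)
    qed
    then show ?case by simp
  qed
next
  case (8 d a k b w x)
  then show ?case using klinear_smult[OF assoc_inner_linear] by simp
next
  case (9 d d' a a' \<delta> \<alpha> b w x)
  then have d: "d \<in> Ob (cod H)" "a \<in> Ob (dom F)" and d': "d' \<in> Ob (cod H)" "a' \<in> Ob (dom F)" by simp_all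
  note lin = assoc_inner_linear[OF d]
  note inn = assoc_inner_tn[OF d]
  note lin' = assoc_inner_linear[OF d']
  note inn' = assoc_inner_tn[OF d']
  interpret U: tensorable K H G d b using tensorable_HG d 9 by simp
  interpret S: tensorable K H "G \<boxtimes> F" d' a' using tensorable_H_GF d' by simp
  have ib: "Ident (cod F) b \<in> carrier (Hom (cod F) b b)" using F.ident_cod 9 by simp
  have ac: "klinear K (val (H \<boxtimes> G) d b) (val (H \<boxtimes> G) d' b) (act (H \<boxtimes> G) d d' b b \<delta> (Ident (cod F) b))"
    using bimodule.act_linear[OF bimod_HG] 9 ib GF by simp
  have ac': "klinear K (val (H \<boxtimes> (G \<boxtimes> F)) d a) (val (H \<boxtimes> (G \<boxtimes> F)) d' a') (act (H \<boxtimes> (G \<boxtimes> F)) d d' a a' \<delta> \<alpha>)"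
    using bimodule.act_linear[OF bimod_H_GF] 9 by simp
  have xx: "act F b b a a' (Ident (cod F) b) \<alpha> x \<in> el F b a'"
    using F.act_closed 9 ib by simp
  have "assoc_at d' a' b (act F b b a a' (Ident (cod F) b) \<alpha> x)
      (act (H \<boxtimes> G) d d' b b \<delta> (Ident (cod F) b) w)
    = act (H \<boxtimes> (G \<boxtimes> F)) d d' a a' \<delta> \<alpha>
      (assoc_at d a b x w)"
  proof (rule U.klinear_ext[OF S.tens_module klinear_compose[OF ac lin'[OF 9(7) xx]]
        klinear_compose[OF lin[OF 9(7,9)] ac'] _ 9(8)])
    fix c z y assume *: "c \<in> Ob (cod G)" "z \<in> el H d c" "y \<in> el G c b"
    interpret W: tensorable K G F c a using tensorable_GF * d by simp
    have ic: "Ident (cod G) c \<in> carrier (Hom (cod G) c c)" using G.ident_cod * by simp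
    have "act H d d' c c \<delta> (Ident (dom H) c) z \<in> el H d' c"
      using H.act_closed * 9 ic HG by simp
    moreover have "act (H \<boxtimes> G) d d' b b \<delta> (Ident (cod F) b) (tn H G d b c z y)
      = tn H G d' b c (act H d d' c c \<delta> (Ident (dom H) c) z) y"
      using act_tn[OF bimod_H bimod_G HG, of d d' b b \<delta> "Ident (cod F) b" c z y] 9 * ib GF
      by (simp add: G_ident)
    moreover have "act (G \<boxtimes> F) c c a a' (Ident (cod G) c) \<alpha> (tn G F c a b y x)
      = tn G F c a' b y (act F b b a a' (Ident (cod F) b) \<alpha> x)"
      using act_tn[OF bimod_G bimod_F GF, of c c a a' "Ident (cod G) c" \<alpha> b y x] 9 * ic
      by (simp add: GF G_ident)
    ultimately show "assoc_at d' a' b (act F b b a a' (Ident (cod F) b) \<alpha> x)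
      (act (H \<boxtimes> G) d d' b b \<delta> (Ident (cod F) b) (tn H G d b c z y))
    = act (H \<boxtimes> (G \<boxtimes> F)) d d' a a' \<delta> \<alpha>
      (assoc_at d a b x (tn H G d b c z y))"
      using * 9 xx act_tn[OF bimod_H bimod_GF, of d d' a a' \<delta> \<alpha> c z "tn G F c a b y x"] HG
      by (simp add: inn inn' W.tn_closed)
  qed
  then show ?case using GF by simp
qed

end

lemma msum_concat:
  assumes "abelian_group M" "\<And>l. l \<in> set ls \<Longrightarrow> set l \<subseteq> carrier M"
  shows "msum M (concat ls) = msum M (map (msum M) ls)"
  using assms(2)
proof (induction ls)
  case (Cons l ls)
  then show ?case using msum_append[OF assms(1), of l "concat ls"] by fastforce
qed simp

context composable3
begin

text \<open>The definition expands all representatives into a single list. Grouping the sum by the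
  outer triples recovers the two-stage lift, to which \<open>assoc_lift_cell\<close>
  applies.\<close>

lemma assoc_cell:
  "assoc H G F = lift_cell.cell (H \<boxtimes> G) F (H \<boxtimes> (G \<boxtimes> F)) (\<lambda>d a b w x.
     assoc_at d a b x w)"
  unfolding assoc_def lift_cell.cell_def[OF assoc_lift_cell]
proof (rule mk_cell_cong)
  fix d a p assume *: "d \<in> Ob (cod ((H \<boxtimes> G) \<boxtimes> F))" "a \<in> Ob (dom ((H \<boxtimes> G) \<boxtimes> F))" "p \<in> el ((H \<boxtimes> G) \<boxtimes> F) d a"
  interpret T: tensorable K "H \<boxtimes> G" F d a using tensorable_HG_F * by simp
  interpret S: tensorable K H "G \<boxtimes> F" d a using tensorable_H_GF * by simp
  let ?N = "val (H \<boxtimes> (G \<boxtimes> F)) d a"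
  let ?l = "\<lambda>b w x. map (\<lambda>(c, z, y). (c, z, tcls G F c a [(b, y, x)])) (decode w)"
  let ?ls = "map (\<lambda>(b, w, x). ?l b w x) (decode p)"
  have dp: "decode p \<in> lists (tgens (H \<boxtimes> G) F d a)" using * T.decode_lists by (auto simp: tens_simps)
  have l: "?l b w x \<in> lists (tgens H (G \<boxtimes> F) d a)" if b: "(b, w, x) \<in> set (decode p)" for b w x
  proof -
    have g: "b \<in> Ob (cod F)" "w \<in> el (H \<boxtimes> G) d b" "x \<in> el F b a"
      using b dp by (auto simp: T.gens_iff dest!: in_listsD)
    interpret U: tensorable K H G d b using tensorable_HG g * by simp
    have dw: "decode w \<in> lists (tgens H G d b)" using g U.decode_lists by (auto simp: tens_simps)
    have "tcls G F c a [(b, y, x)] \<in> el (G \<boxtimes> F) c a"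
      if "c \<in> Ob (cod G)" "y \<in> el G c b" for c y
      using tensorable.tn_closed[OF tensorable_GF, of c a b y x] that g * by (simp add: tn_def)
    then show ?thesis using dw by (fastforce simp: S.gens_iff U.gens_iff)
  qed
  have ls: "concat ?ls \<in> lists (tgens H (G \<boxtimes> F) d a)" using l by fastforce
  have cl: "set (map (\<lambda>(b, y, x). tn H (G \<boxtimes> F) d a b y x) m) \<subseteq> carrier ?N" if "m \<in> lists (tgens H (G \<boxtimes> F) d a)" for m
    using that S.tn_closed by (fastforce simp: S.gens_iff)
  have "[(c, z, tcls G F c a [(b, y, x)]). (b, w, x) \<leftarrow> decode p, (c, z, y) \<leftarrow> decode w] = concat ?ls"
    by (rule arg_cong[of _ _ concat]) (auto simp: map_concat comp_def intro!: map_cong arg_cong[of _ _ concat])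
  then have "tcls H (G \<boxtimes> F) d a [(c, z, tcls G F c a [(b, y, x)]). (b, w, x) \<leftarrow> decode p, (c, z, y) \<leftarrow> decode w]
    = msum ?N (map (\<lambda>(b, y, x). tn H (G \<boxtimes> F) d a b y x) (concat ?ls))"
    using S.tcls_msum[OF ls] by simp
  also have "\<dots> = msum ?N (concat (map (map (\<lambda>(b, y, x). tn H (G \<boxtimes> F) d a b y x)) ?ls))"
    by (simp add: map_concat)
  also have "\<dots> = msum ?N (map (msum ?N) (map (map (\<lambda>(b, y, x). tn H (G \<boxtimes> F) d a b y x)) ?ls))"
  proof (rule msum_concat[OF S.tens_abelian])
    fix m assume "m \<in> set (map (map (\<lambda>(b, y, x). tn H (G \<boxtimes> F) d a b y x)) ?ls)"
    then obtain b w x where "(b, w, x) \<in> set (decode p)" "m = map (\<lambda>(b, y, x). tn H (G \<boxtimes> F) d a b y x) (?l b w x)"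
      by auto
    then show "set m \<subseteq> carrier ?N" using cl[OF l] by simp
  qed
  also have "\<dots> = lift_map ?N (\<lambda>b w x. assoc_at d a b x w) p"
    by (simp add: assoc_at_def lift_map_def case_prod_unfold comp_def tn_def[of G F])
  finally show "tcls H (G \<boxtimes> F) d a [(c, z, tcls G F c a [(b, y, x)]). (b, w, x) \<leftarrow> decode p, (c, z, y) \<leftarrow> decode w]
    = lift_map ?N (\<lambda>b w x. assoc_at d a b x w) p" .
qed

lemma assoc_two_cell: "two_cell K (assoc H G F)"
  unfolding assoc_cell by (rule lift_cell.two_cell[OF assoc_lift_cell])

lemma cmp_assoc:
  assumes "d \<in> Ob (cod H)" "a \<in> Ob (dom F)" "b \<in> Ob (cod F)" "x \<in> el F b a"
    "c \<in> Ob (cod G)" "z \<in> el H d c" "y \<in> el G c b"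
  shows "cmp (assoc H G F) d a (tn (H \<boxtimes> G) F d a b (tn H G d b c z y) x)
    = tn H (G \<boxtimes> F) d a c z (tn G F c a b y x)"
  using lift_cell.cmp_cell[OF assoc_lift_cell, of d a b "tn H G d b c z y" x] assms
    tensorable.tn_closed[OF tensorable_HG] assoc_inner_tn
  by (simp add: assoc_cell)

end

context composable3
begin

text \<open>The inverse associator is built in the same two stages with \<open>z\<close> fixed in
  place of \<open>x\<close>; balancing now uses that the category between \<open>G\<close> and
  \<open>F\<close> acts on \<open>H \<boxtimes> G\<close> through \<open>G\<close>.\<close>

lemma assoc_inv_inner_balanced:
  assumes "d \<in> Ob (cod H)" "a \<in> Ob (dom F)" "c \<in> Ob (cod G)" "z \<in> el H d c"
  shows "balanced_map G F c a (val ((H \<boxtimes> G) \<boxtimes> F) d a)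
    (\<lambda>b y x. tn (H \<boxtimes> G) F d a b (tn H G d b c z y) x)"
proof -
  interpret T: tensorable K G F c a using tensorable_GF assms by simp
  interpret S: tensorable K "H \<boxtimes> G" F d a using tensorable_HG_F assms by simp
  have cl: "tn H G d b c z y \<in> el (H \<boxtimes> G) d b" if "b \<in> Ob (cod F)" "y \<in> el G c b" for b y
    using tensorable.tn_closed[OF tensorable_HG] that assms by simp
  show ?thesis
  proof (rule balanced_map.intro, goal_cases)
    case (1 b y x)
    then show ?case using S.tn_closed cl by simp
  next
    case (2 b y y' x)
    then show ?case
      using S.tn_add_left cl tensorable.tn_add_right[OF tensorable_HG, of d b c z y y'] assms by simp
  next
    case (3 b y x x')
    then show ?case using S.tn_add_right cl by simp
  next
    case (4 b b' \<beta> y x)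
    have "act (H \<boxtimes> G) d d b b' (Ident (cod H) d) \<beta> (tn H G d b c z y)
      = tn H G d b' c z (act G c c b b' (Ident (cod G) c) \<beta> y)"
      using act_tn[OF bimod_H bimod_G HG, of d d b b' "Ident (cod H) d" \<beta> c z y] 4 assms H.ident_cod GF
      by (simp add: H_ident HG)
    then show ?case using S.tn_bal[of b b' \<beta> "tn H G d b c z y" x] 4 cl by simp
  qed
qed

definition assoc_inv_at where
  "assoc_inv_at d a c z = lift_map (val ((H \<boxtimes> G) \<boxtimes> F) d a) (\<lambda>b y x. tn (H \<boxtimes> G) F d a b (tn H G d b c z y) x)"

lemma assoc_inv_inner_linear:
  assumes "d \<in> Ob (cod H)" "a \<in> Ob (dom F)" "c \<in> Ob (cod G)" "z \<in> el H d c"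
  shows "klinear K (val (G \<boxtimes> F) c a) (val ((H \<boxtimes> G) \<boxtimes> F) d a)
    (assoc_inv_at d a c z)"
proof -
  interpret T: tensorable K G F c a using tensorable_GF assms by simp
  interpret S: tensorable K "H \<boxtimes> G" F d a using tensorable_HG_F assms by simp
  show ?thesis
    unfolding assoc_inv_at_def
  proof (rule T.lift_klinear[OF S.tens_module assoc_inv_inner_balanced[OF assms]])
    fix k b y x assume *: "k \<in> carrier K" "b \<in> Ob (cod F)" "y \<in> el G c b" "x \<in> el F b a"
    interpret U: tensorable K H G d b using tensorable_HG assms * by simp
    show "tn (H \<boxtimes> G) F d a b (tn H G d b c z (k \<odot>\<^bsub>val G c b\<^esub> y)) x =
       k \<odot>\<^bsub>val ((H \<boxtimes> G) \<boxtimes> F) d a\<^esub> tn (H \<boxtimes> G) F d a b (tn H G d b c z y) x"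
      using S.tn_smult_left[of k b "tn H G d b c z y" x] U.tn_smult_right[of k c z y] U.tn_closed assms * by simp
  qed
qed

lemma assoc_inv_inner_tn:
  assumes "d \<in> Ob (cod H)" "a \<in> Ob (dom F)" "c \<in> Ob (cod G)" "z \<in> el H d c"
    "b \<in> Ob (cod F)" "y \<in> el G c b" "x \<in> el F b a"
  shows "assoc_inv_at d a c z (tn G F c a b y x)
    = tn (H \<boxtimes> G) F d a b (tn H G d b c z y) x"
proof -
  interpret T: tensorable K G F c a using tensorable_GF assms by simp
  interpret S: tensorable K "H \<boxtimes> G" F d a using tensorable_HG_F assms by simp
  show ?thesis unfolding assoc_inv_at_def using T.lift_tn[OF S.tens_abelian assoc_inv_inner_balanced[OF assms(1-4)] assms(5-7)] .
qed

lemma assoc_inv_balanced: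
  assumes d: "d \<in> Ob (cod H)" "a \<in> Ob (dom F)"
  shows "balanced_map H (G \<boxtimes> F) d a (val ((H \<boxtimes> G) \<boxtimes> F) d a) (assoc_inv_at d a)"
proof -
  interpret T: tensorable K H "G \<boxtimes> F" d a using tensorable_H_GF d by simp
  interpret S: tensorable K "H \<boxtimes> G" F d a using tensorable_HG_F d by simp
  note lin = assoc_inv_inner_linear[OF d]
  note inn = assoc_inv_inner_tn[OF d]
  show ?thesis
  proof (rule balanced_map.intro, goal_cases)
    case (1 c z w)
    then show ?case using klinear_closed[OF lin] by simp
  next
    case (2 c z z' w)
    then have c: "c \<in> Ob (cod G)" by simp
    interpret U: tensorable K G F c a using tensorable_GF d c by simp
    interpret V: Module.module K "val H d c" using H.val_module d c HG by simp
    have zz: "z \<oplus>\<^bsub>val H d c\<^esub> z' \<in> el H d c" using 2 by simp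
    show ?case
    proof (rule U.klinear_ext[OF S.tens_module lin[OF c zz] klinear_plus[OF U.tens_module S.tens_module
           lin[OF c 2(2)] lin[OF c 2(3)]] _ 2(4)])
      fix b y x assume *: "b \<in> Ob (cod F)" "y \<in> el G c b" "x \<in> el F b a"
      interpret W: tensorable K H G d b using tensorable_HG * d by simp
      show "assoc_inv_at d a c (z \<oplus>\<^bsub>val H d c\<^esub> z') (tn G F c a b y x) =
          assoc_inv_at d a c z (tn G F c a b y x)
          \<oplus>\<^bsub>val ((H \<boxtimes> G) \<boxtimes> F) d a\<^esub>
          assoc_inv_at d a c z' (tn G F c a b y x)"
        using * 2 c zz by (simp add: inn W.tn_add_left S.tn_add_left W.tn_closed)
    qed
  next
    case (3 c z w w')
    then show ?case using klinear_add[OF lin] by simp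
  next
    case (4 c c' \<beta> z w)
    then have c: "c \<in> Ob (cod G)" "c' \<in> Ob (cod G)" "\<beta> \<in> carrier (Hom (cod G) c c')" by simp_all
    interpret U: tensorable K G F c' a using tensorable_GF d c by simp
    have ac: "klinear K (val (G \<boxtimes> F) c' a) (val (G \<boxtimes> F) c a) (act (G \<boxtimes> F) c' c a a \<beta> (Ident (dom F) a))"
      using bimodule.act_linear[OF bimod_GF] d c F.ident_dom by simp
    have zz: "act H d d c c' (Ident (cod H) d) \<beta> z \<in> el H d c'"
      using H.act_closed d 4 c H.ident_cod HG by simp
    have "assoc_inv_at d a c' (act H d d c c' (Ident (cod H) d) \<beta> z) w
       = assoc_inv_at d a c z
         (act (G \<boxtimes> F) c' c a a \<beta> (Ident (dom F) a) w)"
    proof (rule U.klinear_ext[OF S.tens_module lin[OF c(2) zz] klinear_compose[OF ac lin[OF c(1) 4(4)]] _ 4(5)])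
      fix b y x assume *: "b \<in> Ob (cod F)" "y \<in> el G c' b" "x \<in> el F b a"
      interpret W: tensorable K H G d b using tensorable_HG * d by simp
      have "act G c' c b b \<beta> (Ident (cod F) b) y \<in> el G c b"
        using G.act_closed c * GF F.ident_cod by simp
      moreover have "act (G \<boxtimes> F) c' c a a \<beta> (Ident (dom F) a) (tn G F c' a b y x)
          = tn G F c a b (act G c' c b b \<beta> (Ident (cod F) b) y) x"
        using act_tn[OF bimod_G bimod_F GF, of c' c a a \<beta> "Ident (dom F) a" b y x] d c * F.ident_dom
        by (simp add: F.act_ident GF)
      ultimately show "assoc_inv_at d a c' (act H d d c c' (Ident (cod H) d) \<beta> z) (tn G F c' a b y x)
       = assoc_inv_at d a c z
         (act (G \<boxtimes> F) c' c a a \<beta> (Ident (dom F) a) (tn G F c' a b y x))"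
        using * 4 c zz W.tn_bal[of c c' \<beta> z y] by (simp add: inn GF)
    qed
    then show ?case by simp
  qed
qed

lemma assoc_inv_smult:
  assumes d: "d \<in> Ob (cod H)" "a \<in> Ob (dom F)" and k: "k \<in> carrier K" and c: "c \<in> Ob (cod G)"
    and z: "z \<in> el H d c" and w: "w \<in> el (G \<boxtimes> F) c a"
  shows "assoc_inv_at d a c (k \<odot>\<^bsub>val H d c\<^esub> z) w = k \<odot>\<^bsub>val ((H \<boxtimes> G) \<boxtimes> F) d a\<^esub> assoc_inv_at d a c z w"
proof -
  note lin = assoc_inv_inner_linear[OF d c]
  note inn = assoc_inv_inner_tn[OF d c]
  interpret U: tensorable K G F c a using tensorable_GF d c by simp
  interpret S: tensorable K "H \<boxtimes> G" F d a using tensorable_HG_F d by simp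
  interpret V: Module.module K "val H d c" using H.val_module d c HG by simp
  interpret N: Module.module K "val ((H \<boxtimes> G) \<boxtimes> F) d a" by (rule S.tens_module)
  have kz: "k \<odot>\<^bsub>val H d c\<^esub> z \<in> el H d c" using z k by simp
  \<comment> \<open>Multiplication by \<open>k\<close> is \<open>K\<close>-linear because
    \<open>K\<close> is commutative.\<close>
  have kl: "klinear K (val ((H \<boxtimes> G) \<boxtimes> F) d a) (val ((H \<boxtimes> G) \<boxtimes> F) d a) (\<lambda>p. k \<odot>\<^bsub>val ((H \<boxtimes> G) \<boxtimes> F) d a\<^esub> p)"
    unfolding klinear_def using k
    by (simp add: N.smult_r_distr flip: N.smult_assoc1) (simp add: V.m_comm)
  show ?thesis
  proof (rule U.klinear_ext[OF S.tens_module lin[OF kz] klinear_compose[OF lin[OF z] kl] _ w])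
    fix b y x assume *: "b \<in> Ob (cod F)" "y \<in> el G c b" "x \<in> el F b a"
    interpret W: tensorable K H G d b using tensorable_HG * d by simp
    show "assoc_inv_at d a c (k \<odot>\<^bsub>val H d c\<^esub> z) (tn G F c a b y x)
      = k \<odot>\<^bsub>val ((H \<boxtimes> G) \<boxtimes> F) d a\<^esub>
        assoc_inv_at d a c z (tn G F c a b y x)"
      using * z k c kz by (simp add: inn W.tn_closed S.tn_smult_left W.tn_smult_left)
  qed
qed

lemma assoc_iso: "iso_cell K (assoc H G F)"
proof -
  let ?g = "\<lambda>d a. lift_map (val ((H \<boxtimes> G) \<boxtimes> F) d a) (assoc_inv_at d a)"
  have klin: "klinear K (val (H \<boxtimes> (G \<boxtimes> F)) d a) (val ((H \<boxtimes> G) \<boxtimes> F) d a) (?g d a)"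
    if d: "d \<in> Ob (cod H)" "a \<in> Ob (dom F)" for d a
  proof -
    interpret T: tensorable K H "G \<boxtimes> F" d a using tensorable_H_GF d .
    interpret S: tensorable K "H \<boxtimes> G" F d a using tensorable_HG_F d .
    show ?thesis
      by (rule T.lift_klinear[OF S.tens_module assoc_inv_balanced[OF d]]) (use assoc_inv_smult[OF d] in simp)
  qed
  have g: "?g d a (tn H (G \<boxtimes> F) d a c z (tn G F c a b y x)) = tn (H \<boxtimes> G) F d a b (tn H G d b c z y) x"
    if d: "d \<in> Ob (cod H)" "a \<in> Ob (dom F)" and x: "b \<in> Ob (cod F)" "x \<in> el F b a"
      "c \<in> Ob (cod G)" "z \<in> el H d c" "y \<in> el G c b" for d a b c z y x
  proof -
    interpret T: tensorable K H "G \<boxtimes> F" d a using tensorable_H_GF d .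
    interpret S: tensorable K "H \<boxtimes> G" F d a using tensorable_HG_F d .
    show ?thesis
      using T.lift_tn[OF S.tens_abelian assoc_inv_balanced[OF d], of c z "tn G F c a b y x"] x d
        tensorable.tn_closed[OF tensorable_GF] assoc_inv_inner_tn by simp
  qed
  have s: "src (assoc H G F) = (H \<boxtimes> G) \<boxtimes> F" "tgt (assoc H G F) = H \<boxtimes> (G \<boxtimes> F)"
    by (simp_all add: assoc_def)
  have l: "klinear K (val ((H \<boxtimes> G) \<boxtimes> F) d a) (val (H \<boxtimes> (G \<boxtimes> F)) d a) (cmp (assoc H G F) d a)"
    if "d \<in> Ob (cod H)" "a \<in> Ob (dom F)" for d a
    using two_cell_linear[OF assoc_two_cell, of d a] that s by simp
  note m = bimodule.val_module[OF bimod_HG_F] bimodule.val_module[OF bimod_H_GF]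
  show ?thesis
  proof (rule iso_cell_pointwise[OF assoc_two_cell, of ?g])
    fix d a p assume "d \<in> Ob (cod (src (assoc H G F)))" "a \<in> Ob (dom (src (assoc H G F)))" "p \<in> el (tgt (assoc H G F)) d a"
    then have o: "d \<in> Ob (cod H)" "a \<in> Ob (dom F)" "p \<in> el (H \<boxtimes> (G \<boxtimes> F)) d a" by (simp_all add: s)
    have "cmp (assoc H G F) d a (?g d a p) = p"
      by (rule klinear_ext_right[OF o(1,2) m(2) klinear_compose[OF klin l] klinear_ident _ o(3)])
        (use o in \<open>simp_all add: g cmp_assoc\<close>)
    then show "?g d a p \<in> el (src (assoc H G F)) d a \<and> cmp (assoc H G F) d a (?g d a p) = p"
      using klinear_closed[OF klin[OF o(1,2)] o(3)] by (simp add: s)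
  next
    fix d a p assume "d \<in> Ob (cod (src (assoc H G F)))" "a \<in> Ob (dom (src (assoc H G F)))" "p \<in> el (src (assoc H G F)) d a"
    then have o: "d \<in> Ob (cod H)" "a \<in> Ob (dom F)" "p \<in> el ((H \<boxtimes> G) \<boxtimes> F) d a" by (simp_all add: s)
    show "?g d a (cmp (assoc H G F) d a p) = p"
      by (rule klinear_ext_left[OF o(1,2) m(1) klinear_compose[OF l klin] klinear_ident _ o(3)])
        (use o in \<open>simp_all add: g cmp_assoc\<close>)
  qed
qed

end

lemma assoc_simps [simp]: "src (assoc H G F) = (H \<boxtimes> G) \<boxtimes> F" "tgt (assoc H G F) = H \<boxtimes> (G \<boxtimes> F)"
  by (simp_all add: assoc_def)

lemma cmp_assoc_tn:
  assumes "bimodule K H" "bimodule K G" "bimodule K F" "dom H = cod G" "dom G = cod F"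
    "d \<in> Ob (cod H)" "a \<in> Ob (dom F)" "b \<in> Ob (cod F)" "x \<in> el F b a"
    "c \<in> Ob (cod G)" "z \<in> el H d c" "y \<in> el G c b"
  shows "cmp (assoc H G F) d a (tn (H \<boxtimes> G) F d a b (tn H G d b c z y) x)
    = tn H (G \<boxtimes> F) d a c z (tn G F c a b y x)"
  by (rule composable3.cmp_assoc[OF composable3.intro]) (fact assms)+

lemma two_cell_assoc:
  assumes "bimodule K H" "bimodule K G" "bimodule K F" "dom H = cod G" "dom G = cod F"
  shows "two_cell K (assoc H G F)"
  by (rule composable3.assoc_two_cell[OF composable3.intro]) (fact assms)+

section \<open>Naturality and coherence of the constraints\<close>

lemma assoc_natural:
  assumes "two_cell K \<rho>" "two_cell K \<sigma>" "two_cell K \<tau>" "dom (src \<rho>) = cod (src \<sigma>)" "dom (src \<sigma>) = cod (src \<tau>)"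
  shows "assoc (tgt \<rho>) (tgt \<sigma>) (tgt \<tau>) \<bullet> ((\<rho> \<star> \<sigma>) \<star> \<tau>) = (\<rho> \<star> (\<sigma> \<star> \<tau>)) \<bullet> assoc (src \<rho>) (src \<sigma>) (src \<tau>)"
proof -
  note b = two_cell_bimodule[OF assms(1)] two_cell_bimodule[OF assms(2)] two_cell_bimodule[OF assms(3)]
  note t = two_cell_tgt[OF assms(1)] two_cell_tgt[OF assms(2)] two_cell_tgt[OF assms(3)]
  interpret composable3 K "src \<rho>" "src \<sigma>" "src \<tau>" using b assms by (intro composable3.intro) auto
  show ?thesis
  proof (rule cell_eqI_left)
    fix d a b c z y x
    assume *: "d \<in> Ob (cod (src \<rho>))" "a \<in> Ob (dom (src \<tau>))" "b \<in> Ob (cod (src \<tau>))" "c \<in> Ob (cod (src \<sigma>))"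
      "z \<in> el (src \<rho>) d c" "y \<in> el (src \<sigma>) c b" "x \<in> el (src \<tau>) b a"
    note c = cmp_closed[OF assms(1), of d c z] cmp_closed[OF assms(2), of c b y] cmp_closed[OF assms(3), of b a x]
    show "cmp (assoc (tgt \<rho>) (tgt \<sigma>) (tgt \<tau>) \<bullet> (\<rho> \<star> \<sigma>) \<star> \<tau>) d a
        (tn (src \<rho> \<boxtimes> src \<sigma>) (src \<tau>) d a b (tn (src \<rho>) (src \<sigma>) d b c z y) x)
      = cmp ((\<rho> \<star> \<sigma> \<star> \<tau>) \<bullet> assoc (src \<rho>) (src \<sigma>) (src \<tau>)) d a
        (tn (src \<rho> \<boxtimes> src \<sigma>) (src \<tau>) d a b (tn (src \<rho>) (src \<sigma>) d b c z y) x)"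
      using * assms b t c
      by (simp add: cmp_hcomp_tn[of K] cmp_assoc_tn[of K] tn_closed[of K] hcomp_two_cell tens_bimodule)
  qed (use assms b t in \<open>auto intro!: vcomp_two_cell hcomp_two_cell two_cell_assoc\<close>)
qed

text \<open>On \<open>(z \<otimes> y) \<otimes> x\<close> one side lets the middle morphism
  \<open>y\<close> act on \<open>x\<close>, the other lets it act on \<open>z\<close>; the balancing
  relation says that the results agree.\<close>

lemma triangle:
  assumes "bimodule K G" "bimodule K F" "dom G = cod F" "B = dom G"
  shows "(id_cell G \<star> lunit F) \<bullet> assoc G (unit_bimod B) F = runit G \<star> id_cell F"
proof -
  interpret G: bimodule K G by fact
  interpret F: bimodule K F by fact
  interpret composable3 K G "unit_bimod B" F using assms G.unit_dom by (intro composable3.intro) auto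
  show ?thesis
  proof (rule cell_eqI_left)
    fix d a b c z y x
    assume *: "d \<in> Ob (cod G)" "a \<in> Ob (dom F)" "b \<in> Ob (cod F)" "c \<in> Ob (cod (unit_bimod B))"
      "z \<in> el G d c" "y \<in> el (unit_bimod B) c b" "x \<in> el F b a"
    interpret T: tensorable K G F d a using * assms by (intro tensorable.intro) auto
    show "cmp ((id_cell G \<star> lunit F) \<bullet> assoc G (unit_bimod B) F) d a
        (tn (G \<boxtimes> unit_bimod B) F d a b (tn G (unit_bimod B) d b c z y) x)
      = cmp (runit G \<star> id_cell F) d a (tn (G \<boxtimes> unit_bimod B) F d a b (tn G (unit_bimod B) d b c z y) x)"
      using * assms G.unit_dom T.tn_bal[of c b y z x]
      by (simp add: cmp_hcomp_tn[of K] cmp_assoc_tn[of K] tn_closed[of K] hcomp_two_cell tens_bimodule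
          lunit_two_cell runit_two_cell id_cell_two_cell cmp_lunit[of K] cmp_runit[of K])
  qed (use assms G.unit_dom in \<open>auto intro!: vcomp_two_cell hcomp_two_cell two_cell_assoc id_cell_two_cell
        lunit_two_cell runit_two_cell\<close>)
qed

text \<open>In any bicategory this follows from pentagon and triangle; on elements it is immediate,
  because the category acts on \<open>G \<boxtimes> F\<close> through \<open>G\<close>.\<close>

lemma lunit_tens:
  assumes "bimodule K G" "bimodule K F" "dom G = cod F" "B = cod G"
  shows "lunit (G \<boxtimes> F) \<bullet> assoc (unit_bimod B) G F = lunit G \<star> id_cell F"
proof -
  interpret G: bimodule K G by fact
  interpret F: bimodule K F by fact
  interpret composable3 K "unit_bimod B" G F using assms G.unit_cod by (intro composable3.intro) auto
  show ?thesis
  proof (rule cell_eqI_left)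
    fix d a b c z y x
    assume *: "d \<in> Ob (cod (unit_bimod B))" "a \<in> Ob (dom F)" "b \<in> Ob (cod F)" "c \<in> Ob (cod G)"
      "z \<in> el (unit_bimod B) d c" "y \<in> el G c b" "x \<in> el F b a"
    show "cmp (lunit (G \<boxtimes> F) \<bullet> assoc (unit_bimod B) G F) d a
        (tn (unit_bimod B \<boxtimes> G) F d a b (tn (unit_bimod B) G d b c z y) x)
      = cmp (lunit G \<star> id_cell F) d a (tn (unit_bimod B \<boxtimes> G) F d a b (tn (unit_bimod B) G d b c z y) x)"
      using * assms G.unit_cod G.ident_dom F.ident_dom
        F.act_ident act_tn[OF assms(1-3), of c d a a z "Ident (dom F) a" b y x]
      by (simp add: cmp_hcomp_tn[of K] cmp_assoc_tn[of K] tn_closed[of K] hcomp_two_cell tens_bimodule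
          lunit_two_cell id_cell_two_cell cmp_lunit[of K])
  qed (use assms G.unit_cod in \<open>auto intro!: vcomp_two_cell hcomp_two_cell two_cell_assoc id_cell_two_cell
        lunit_two_cell tens_bimodule\<close>)
qed

lemma runit_tens:
  assumes "bimodule K G" "bimodule K F" "dom G = cod F" "A = dom F"
  shows "(id_cell G \<star> runit F) \<bullet> assoc G F (unit_bimod A) = runit (G \<boxtimes> F)"
proof -
  interpret G: bimodule K G by fact
  interpret F: bimodule K F by fact
  interpret composable3 K G F "unit_bimod A" using assms F.unit_dom by (intro composable3.intro) auto
  show ?thesis
  proof (rule cell_eqI_left)
    fix d a b c z y x
    assume *: "d \<in> Ob (cod G)" "a \<in> Ob (dom (unit_bimod A))" "b \<in> Ob (cod (unit_bimod A))" "c \<in> Ob (cod F)"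
      "z \<in> el G d c" "y \<in> el F c b" "x \<in> el (unit_bimod A) b a"
    show "cmp ((id_cell G \<star> runit F) \<bullet> assoc G F (unit_bimod A)) d a
        (tn (G \<boxtimes> F) (unit_bimod A) d a b (tn G F d b c z y) x)
      = cmp (runit (G \<boxtimes> F)) d a (tn (G \<boxtimes> F) (unit_bimod A) d a b (tn G F d b c z y) x)"
      using * assms F.unit_dom G.ident_cod F.ident_cod
        G.act_ident act_tn[OF assms(1-3), of d d b a "Ident (cod G) d" x c z y]
      by (simp add: cmp_hcomp_tn[of K] cmp_assoc_tn[of K] tn_closed[of K] hcomp_two_cell tens_bimodule
          runit_two_cell id_cell_two_cell cmp_runit[of K])
  qed (use assms F.unit_dom in \<open>auto intro!: vcomp_two_cell hcomp_two_cell two_cell_assoc id_cell_two_cell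
        runit_two_cell tens_bimodule\<close>)
qed

lemma lunit_natural:
  assumes "two_cell K \<tau>"
  shows "lunit (tgt \<tau>) \<bullet> (id_cell (unit_bimod (cod (src \<tau>))) \<star> \<tau>) = \<tau> \<bullet> lunit (src \<tau>)"
proof -
  note b = two_cell_bimodule[OF assms] and t = two_cell_tgt[OF assms]
  interpret F: bimodule K "src \<tau>" by (rule b)
  show ?thesis
  proof (rule tens_cell_eqI[of K _ _ "unit_bimod (cod (src \<tau>))" "src \<tau>"])
    fix c a d y x assume *: "c \<in> Ob (cod (unit_bimod (cod (src \<tau>))))" "a \<in> Ob (dom (src \<tau>))" "d \<in> Ob (cod (src \<tau>))"
      "y \<in> el (unit_bimod (cod (src \<tau>))) c d" "x \<in> el (src \<tau>) d a"
    show "cmp (lunit (tgt \<tau>) \<bullet> (id_cell (unit_bimod (cod (src \<tau>))) \<star> \<tau>)) c a (tn (unit_bimod (cod (src \<tau>))) (src \<tau>) c a d y x)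
      = cmp (\<tau> \<bullet> lunit (src \<tau>)) c a (tn (unit_bimod (cod (src \<tau>))) (src \<tau>) c a d y x)"
      using * assms b t F.unit_cod cmp_closed[OF assms] F.ident_dom two_cell_natural[OF assms, of d c a a y "Ident (dom (src \<tau>)) a" x]
      by (simp add: cmp_hcomp_tn[of K] tn_closed[of K] id_cell_two_cell cmp_lunit[of K])
  qed (use assms b t F.unit_cod in \<open>auto intro!: vcomp_two_cell hcomp_two_cell id_cell_two_cell lunit_two_cell\<close>)
qed

lemma runit_natural:
  assumes "two_cell K \<tau>"
  shows "runit (tgt \<tau>) \<bullet> (\<tau> \<star> id_cell (unit_bimod (dom (src \<tau>)))) = \<tau> \<bullet> runit (src \<tau>)"
proof -
  note b = two_cell_bimodule[OF assms] and t = two_cell_tgt[OF assms]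
  interpret F: bimodule K "src \<tau>" by (rule b)
  show ?thesis
  proof (rule tens_cell_eqI[of K _ _ "src \<tau>" "unit_bimod (dom (src \<tau>))"])
    fix c a d y x assume *: "c \<in> Ob (cod (src \<tau>))" "a \<in> Ob (dom (unit_bimod (dom (src \<tau>))))"
      "d \<in> Ob (cod (unit_bimod (dom (src \<tau>))))"
      "y \<in> el (src \<tau>) c d" "x \<in> el (unit_bimod (dom (src \<tau>))) d a"
    show "cmp (runit (tgt \<tau>) \<bullet> (\<tau> \<star> id_cell (unit_bimod (dom (src \<tau>))))) c a (tn (src \<tau>) (unit_bimod (dom (src \<tau>))) c a d y x)
      = cmp (\<tau> \<bullet> runit (src \<tau>)) c a (tn (src \<tau>) (unit_bimod (dom (src \<tau>))) c a d y x)"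
      using * assms b t F.unit_dom cmp_closed[OF assms] F.ident_cod two_cell_natural[OF assms, of c c d a "Ident (cod (src \<tau>)) c" x y]
      by (simp add: cmp_hcomp_tn[of K] tn_closed[of K] id_cell_two_cell cmp_runit[of K])
  qed (use assms b t F.unit_dom in \<open>auto intro!: vcomp_two_cell hcomp_two_cell id_cell_two_cell runit_two_cell\<close>)
qed

lemma lunit_runit_unit:
  assumes "kcategory K A"
  shows "lunit (unit_bimod A) = runit (unit_bimod A)"
proof -
  interpret A: kcategory K A by fact
  note u = A.unit_bimodule
  show ?thesis
  proof (rule tens_cell_eqI[of K _ _ "unit_bimod A" "unit_bimod A"])
    fix c a d y x assume *: "c \<in> Ob (cod (unit_bimod A))" "a \<in> Ob (dom (unit_bimod A))"
      "d \<in> Ob (cod (unit_bimod A))"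
      "y \<in> el (unit_bimod A) c d" "x \<in> el (unit_bimod A) d a"
    then show "cmp (lunit (unit_bimod A)) c a (tn (unit_bimod A) (unit_bimod A) c a d y x)
       = cmp (runit (unit_bimod A)) c a (tn (unit_bimod A) (unit_bimod A) c a d y x)"
      using u by (simp add: cmp_lunit[of K] cmp_runit[of K] A.comp_ident_left A.comp_ident_right A.comp_closed)
  qed (use u in \<open>auto intro!: lunit_two_cell runit_two_cell\<close>)
qed

lemma pentagon:
  assumes "bimodule K I" "bimodule K H" "bimodule K G" "bimodule K F"
    "dom I = cod H" "dom H = cod G" "dom G = cod F"
  shows "assoc I H (G \<boxtimes> F) \<bullet> assoc (I \<boxtimes> H) G F
    = (id_cell I \<star> assoc H G F) \<bullet> assoc I (H \<boxtimes> G) F \<bullet> (assoc I H G \<star> id_cell F)"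
proof -
  have IH: "bimodule K (I \<boxtimes> H)" using assms tens_bimodule by blast
  interpret S: composable3 K "I \<boxtimes> H" G F using assms IH by (intro composable3.intro) auto
  let ?l = "assoc I H (G \<boxtimes> F) \<bullet> assoc (I \<boxtimes> H) G F"
  let ?r = "(id_cell I \<star> assoc H G F) \<bullet> assoc I (H \<boxtimes> G) F \<bullet> (assoc I H G \<star> id_cell F)"
  have lr: "two_cell K ?l" "two_cell K ?r"
    using assms by (auto intro!: vcomp_two_cell hcomp_two_cell id_cell_two_cell two_cell_assoc tens_bimodule)
  show ?thesis
  proof (rule S.cell_eqI_left[OF lr])
    fix d a b c w y x
    assume *: "d \<in> Ob (cod (I \<boxtimes> H))" "a \<in> Ob (dom F)" "b \<in> Ob (cod F)" "c \<in> Ob (cod G)"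
      "w \<in> el (I \<boxtimes> H) d c" "y \<in> el G c b" "x \<in> el F b a"
    interpret T: tensorable K I H d c using * assms by (intro tensorable.intro) auto
    have 1: "klinear K (val (I \<boxtimes> H) d c) (val ((I \<boxtimes> H) \<boxtimes> G) d b) (\<lambda>w. tn (I \<boxtimes> H) G d b c w y)"
      using tensorable.tn_klinear_left[OF S.tensorable_HG] * by simp
    have 2: "klinear K (val ((I \<boxtimes> H) \<boxtimes> G) d b) (val (((I \<boxtimes> H) \<boxtimes> G) \<boxtimes> F) d a) (\<lambda>w. tn ((I \<boxtimes> H) \<boxtimes> G) F d a b w x)"
      using tensorable.tn_klinear_left[OF S.tensorable_HG_F] * by simp
    note 3 = klinear_compose[OF 1 2]
    have l: "klinear K (val (((I \<boxtimes> H) \<boxtimes> G) \<boxtimes> F) d a) (val (I \<boxtimes> (H \<boxtimes> (G \<boxtimes> F))) d a) (cmp ?l d a)"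
      "klinear K (val (((I \<boxtimes> H) \<boxtimes> G) \<boxtimes> F) d a) (val (I \<boxtimes> (H \<boxtimes> (G \<boxtimes> F))) d a) (cmp ?r d a)"
      using two_cell_linear[OF lr(1), of d a] two_cell_linear[OF lr(2), of d a] * by simp_all
    have m: "Module.module K (val (I \<boxtimes> (H \<boxtimes> (G \<boxtimes> F))) d a)"
      using * assms by (intro bimodule.val_module[OF tens_bimodule] tens_bimodule) auto
    show "cmp ?l d a (tn ((I \<boxtimes> H) \<boxtimes> G) F d a b (tn (I \<boxtimes> H) G d b c w y) x)
       = cmp ?r d a (tn ((I \<boxtimes> H) \<boxtimes> G) F d a b (tn (I \<boxtimes> H) G d b c w y) x)"
    \<comment> \<open>The reduction for the triple \<open>I \<boxtimes> H\<close>, \<open>G\<close>,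
      \<open>F\<close> leaves an arbitrary element \<open>w\<close> of
      \<open>I \<boxtimes> H\<close>; this second reduction makes it elementary.\<close>
    proof (rule T.klinear_ext[OF m klinear_compose[OF 3 l(1)] klinear_compose[OF 3 l(2)] _ *(5)])
      fix e v z assume e: "e \<in> Ob (cod H)" "v \<in> el I d e" "z \<in> el H e c"
      show "cmp ?l d a (tn ((I \<boxtimes> H) \<boxtimes> G) F d a b (tn (I \<boxtimes> H) G d b c (tn I H d c e v z) y) x)
        = cmp ?r d a (tn ((I \<boxtimes> H) \<boxtimes> G) F d a b (tn (I \<boxtimes> H) G d b c (tn I H d c e v z) y) x)"
        using e * assms by (simp add: cmp_hcomp_tn[of K] cmp_assoc_tn[of K] tn_closed[of K] hcomp_two_cell
          tens_bimodule two_cell_assoc id_cell_two_cell)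
    qed
  qed (auto)
qed

section \<open>Subbimodules\<close>

lemma klinear_minus:
  assumes "Module.module K M" "Module.module K N" "klinear K M N h" "x \<in> carrier M"
  shows "h (\<ominus>\<^bsub>M\<^esub> x) = \<ominus>\<^bsub>N\<^esub> h x"
proof -
  interpret M: Module.module K M by fact
  interpret N: Module.module K N by fact
  have "h (\<ominus>\<^bsub>M\<^esub> x) \<oplus>\<^bsub>N\<^esub> h x = \<zero>\<^bsub>N\<^esub>"
    using klinear_add[OF assms(3), of "\<ominus>\<^bsub>M\<^esub> x" x] klinear_zero[OF assms(1-3)] assms(4) by (simp add: M.l_neg)
  then show ?thesis
    using N.minus_equality klinear_closed[OF assms(3)] assms(4) by simp
qed

lemma sub_bimod_simps [simp]:
  "dom (sub_bimod F I) = dom F" "cod (sub_bimod F I) = cod F" "act (sub_bimod F I) = act F"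
  "el (sub_bimod F I) b a = I b a"
  "add (val (sub_bimod F I) b a) = add (val F b a)"
  "smult (val (sub_bimod F I) b a) = smult (val F b a)"
  by (simp_all add: sub_bimod_def)

lemma subbimodule_subset:
  assumes "subbimodule K F I" "x \<in> I b a"
  shows "b \<in> Ob (cod F)" "a \<in> Ob (dom F)" "x \<in> el F b a"
proof -
  show *: "b \<in> Ob (cod F)" "a \<in> Ob (dom F)" using assms unfolding subbimodule_def by blast+
  then have "submodule (I b a) K (val F b a)" using assms unfolding subbimodule_def by blast
  then show "x \<in> el F b a"
    using subgroup.subset[OF submodule.axioms(1)] assms(2) by fastforce
qed

lemma subbimodule_act:
  "subbimodule K F I \<Longrightarrow> b \<in> Ob (cod F) \<Longrightarrow> b' \<in> Ob (cod F) \<Longrightarrow> a \<in> Ob (dom F) \<Longrightarrow> a' \<in> Ob (dom F)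
    \<Longrightarrow> \<beta> \<in> carrier (Hom (cod F) b' b) \<Longrightarrow> \<alpha> \<in> carrier (Hom (dom F) a a') \<Longrightarrow> x \<in> I b a
    \<Longrightarrow> act F b b' a a' \<beta> \<alpha> x \<in> I b' a'"
  unfolding subbimodule_def by blast

lemma sub_bimod_bimodule:
  assumes "bimodule K F" "subbimodule K F I"
  shows "bimodule K (sub_bimod F I)"
proof -
  interpret F: bimodule K F by fact
  note sub = subbimodule_subset[OF assms(2)]
  have m: "Module.module K (val (sub_bimod F I) b a)" if "b \<in> Ob (cod F)" "a \<in> Ob (dom F)" for b a
    using submodule.submodule_is_module[of "I b a" K "val F b a"] F.val_module[OF that] assms(2) that
    unfolding subbimodule_def by (simp add: sub_bimod_def)
  note ac = subbimodule_act[OF assms(2)]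
  have restr: "klinear K M (val (sub_bimod F I) b a) h"
    if "klinear K M (val F b a) h" "\<And>x. x \<in> carrier M \<Longrightarrow> h x \<in> I b a" for M h b a
    using that by (auto simp: klinear_def)
  have restr': "klinear K (val (sub_bimod F I) b a) N h"
    if "klinear K (val F b a) N h" for N h b a
    using that sub unfolding klinear_def by (auto simp: Pi_iff)
  show ?thesis
  proof (rule bimodule.intro, goal_cases)
    case 1
    show ?case using F.dom_kcategory by simp
  next
    case 2
    show ?case using F.cod_kcategory by simp
  next
    case (3 b a)
    then show ?case using m by simp
  next
    case (4 b b' a a' \<beta> \<alpha>)
    then show ?case using restr'[OF F.act_linear] ac by (intro restr) simp_all
  next
    case (5 b b' a a' \<alpha> x)
    then show ?case using F.act_linear_cod sub ac by (intro restr) simp_all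
  next
    case (6 b b' a a' \<beta> x)
    then show ?case using F.act_linear_dom sub ac by (intro restr) simp_all
  next
    case (7 b a x)
    then show ?case using F.act_ident sub by simp
  next
    case (8 b b' b'' a a' a'' \<beta> \<beta>' \<alpha> \<alpha>' x)
    then show ?case using F.act_comp sub by simp
  qed
qed

lemma incl_simps [simp]: "src (incl F I) = sub_bimod F I" "tgt (incl F I) = F"
  by (simp_all add: incl_def)

lemma cmp_incl:
  assumes "subbimodule K F I" "x \<in> I b a"
  shows "cmp (incl F I) b a x = x"
  using assms subbimodule_subset[OF assms] by (simp add: incl_def)

lemma incl_two_cell:
  assumes "bimodule K F" "subbimodule K F I"
  shows "two_cell K (incl F I)"
  unfolding incl_def
proof (rule two_cell_mk_cell)
  fix b a
  show "klinear K (val (sub_bimod F I) b a) (val F b a) (\<lambda>x. x)"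
    using subbimodule_subset[OF assms(2)] by (auto simp: klinear_def)
qed (use assms sub_bimod_bimodule in auto)

lemma incl_mono:
  assumes "subbimodule K F I" "two_cell K s" "two_cell K t" "tgt s = sub_bimod F I" "tgt t = sub_bimod F I"
    and e: "incl F I \<bullet> s = incl F I \<bullet> t"
  shows "s = t"
proof (rule cell_eqI[OF assms(2,3)])
  have st: "src s = src t" using arg_cong[OF e, of src] by simp
  then show "src s = src t" .
  fix b a x assume x: "b \<in> Ob (cod (src t))" "a \<in> Ob (dom (src t))" "x \<in> el (src t) b a"
  have "cmp (incl F I \<bullet> s) b a x = cmp (incl F I \<bullet> t) b a x" using e by simp
  moreover have "cmp s b a x \<in> I b a" "cmp t b a x \<in> I b a"
    using cmp_closed[OF assms(2), of b a x] cmp_closed[OF assms(3), of b a x] x st assms(4,5) by simp_all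
  ultimately show "cmp s b a x = cmp t b a x"
    using x st by (simp add: cmp_incl[OF assms(1)])
qed (use assms in simp)

text \<open>The last clause records the components of \<open>s\<close>; surjectivity onto an image
  is read off from it.\<close>

lemma incl_factor:
  assumes "bimodule K F" "subbimodule K F I" "two_cell K t" "tgt t = F"
    and i: "\<And>b a x. b \<in> Ob (cod (src t)) \<Longrightarrow> a \<in> Ob (dom (src t)) \<Longrightarrow> x \<in> el (src t) b a \<Longrightarrow> cmp t b a x \<in> I b a"
  obtains s where "two_cell K s" "src s = src t" "tgt s = sub_bimod F I" "incl F I \<bullet> s = t"
    "\<And>b a x. b \<in> Ob (cod (src t)) \<Longrightarrow> a \<in> Ob (dom (src t)) \<Longrightarrow> x \<in> el (src t) b a \<Longrightarrow> cmp s b a x = cmp t b a x"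
proof
  let ?s = "mk_cell (src t) (sub_bimod F I) (cmp t)"
  note tt = two_cell_tgt[OF assms(3)]
  show s: "two_cell K ?s"
  proof (rule two_cell_mk_cell)
    fix b a assume "b \<in> Ob (cod (src t))" "a \<in> Ob (dom (src t))"
    then show "klinear K (val (src t) b a) (val (sub_bimod F I) b a) (cmp t b a)"
      using two_cell_linear[OF assms(3), of b a] i assms(4) by (auto simp: klinear_def)
  next
    fix b b' a a' \<beta> \<alpha> x
    assume "b \<in> Ob (cod (src t))" "b' \<in> Ob (cod (src t))" "a \<in> Ob (dom (src t))" "a' \<in> Ob (dom (src t))"
      "\<beta> \<in> carrier (Hom (cod (src t)) b' b)" "\<alpha> \<in> carrier (Hom (dom (src t)) a a')"
      "x \<in> el (src t) b a"
    then show "cmp t b' a' (act (src t) b b' a a' \<beta> \<alpha> x) = act (sub_bimod F I) b b' a a' \<beta> \<alpha> (cmp t b a x)"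
      using two_cell_natural[OF assms(3)] assms(4) by simp
  qed (use assms tt sub_bimod_bimodule two_cell_bimodule in auto)
  show "src ?s = src t" "tgt ?s = sub_bimod F I" by simp_all
  show c: "cmp ?s b a x = cmp t b a x"
    if "b \<in> Ob (cod (src t))" "a \<in> Ob (dom (src t))" "x \<in> el (src t) b a" for b a x
    using that by simp
  show "incl F I \<bullet> ?s = t"
    using assms s i by (intro cell_eqI[of K]) (auto intro!: vcomp_two_cell incl_two_cell simp: cmp_incl[OF assms(2)])
qed

lemma incl_factor_subset:
  assumes "subbimodule K F I" "subbimodule K F J" "two_cell K u" "src u = sub_bimod F I" "tgt u = sub_bimod F J"
    and e: "incl F I = incl F J \<bullet> u"
  shows "I b a \<subseteq> J b a"
proof
  fix x assume x: "x \<in> I b a"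
  note o = subbimodule_subset[OF assms(1) x]
  have "cmp u b a x \<in> J b a" using cmp_closed[OF assms(3), of b a x] o x assms(4,5) by simp
  moreover have "cmp (incl F I) b a x = cmp (incl F J \<bullet> u) b a x" using e by simp
  ultimately show "x \<in> J b a" using o x assms(4) by (simp add: cmp_incl[OF assms(1)] cmp_incl[OF assms(2)])
qed

text \<open>Mutual factorization means mutual containment of the subsets. A subbimodule is empty off
  the objects, so the two functions agree at all indices.\<close>

lemma incl_factor_eq:
  assumes "subbimodule K F I" "subbimodule K F J"
    "two_cell K u" "src u = sub_bimod F I" "tgt u = sub_bimod F J" "incl F I = incl F J \<bullet> u"
    "two_cell K v" "src v = sub_bimod F J" "tgt v = sub_bimod F I" "incl F J = incl F I \<bullet> v"
  shows "I = J"
proof (intro ext equalityI)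
  fix b a
  show "I b a \<subseteq> J b a" by (rule incl_factor_subset[OF assms(1-6)])
  show "J b a \<subseteq> I b a" by (rule incl_factor_subset[OF assms(2,1,7-10)])
qed

section \<open>Images, right exactness and equalizers\<close>

lemma image_subbimodule:
  assumes "two_cell K \<tau>"
  shows "subbimodule K (tgt \<tau>) (image_cell \<tau>)"
proof -
  interpret F: bimodule K "src \<tau>" by (rule two_cell_bimodule[OF assms])
  interpret G: bimodule K "tgt \<tau>" by (rule two_cell_bimodule[OF assms])
  note t = two_cell_tgt[OF assms]
  have "submodule (image_cell \<tau> b a) K (val (tgt \<tau>) b a)"
    if "b \<in> Ob (cod (src \<tau>))" "a \<in> Ob (dom (src \<tau>))" for b a
  proof -
    interpret M: Module.module K "val (src \<tau>) b a" using F.val_module that by simp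
    interpret N: Module.module K "val (tgt \<tau>) b a" using G.val_module that t by simp
    note l = two_cell_linear[OF assms that]
    have im: "image_cell \<tau> b a = cmp \<tau> b a ` el (src \<tau>) b a" using that by (simp add: image_cell_def)
    show ?thesis unfolding im
    proof (rule N.submoduleI)
      show "cmp \<tau> b a ` el (src \<tau>) b a \<subseteq> el (tgt \<tau>) b a"
        using klinear_closed[OF l] by auto
      show "\<zero>\<^bsub>val (tgt \<tau>) b a\<^esub> \<in> cmp \<tau> b a ` el (src \<tau>) b a"
        using klinear_zero[OF M.module_axioms N.module_axioms l] M.zero_closed by (metis imageI)
    next
      fix y assume "y \<in> cmp \<tau> b a ` el (src \<tau>) b a"
      then obtain x where "x \<in> el (src \<tau>) b a" "y = cmp \<tau> b a x" by blast
      then show "\<ominus>\<^bsub>val (tgt \<tau>) b a\<^esub> y \<in> cmp \<tau> b a ` el (src \<tau>) b a"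
        using klinear_minus[OF M.module_axioms N.module_axioms l, of x]
        by (intro image_eqI[of _ _ "\<ominus>\<^bsub>val (src \<tau>) b a\<^esub> x"]) simp_all
    next
      fix y y' assume "y \<in> cmp \<tau> b a ` el (src \<tau>) b a" "y' \<in> cmp \<tau> b a ` el (src \<tau>) b a"
      then obtain x x' where "x \<in> el (src \<tau>) b a" "y = cmp \<tau> b a x"
        "x' \<in> el (src \<tau>) b a" "y' = cmp \<tau> b a x'" by blast
      then show "y \<oplus>\<^bsub>val (tgt \<tau>) b a\<^esub> y' \<in> cmp \<tau> b a ` el (src \<tau>) b a"
        using klinear_add[OF l, of x x']
        by (intro image_eqI[of _ _ "x \<oplus>\<^bsub>val (src \<tau>) b a\<^esub> x'"]) simp_all
    next
      fix k y assume k: "k \<in> carrier K" and "y \<in> cmp \<tau> b a ` el (src \<tau>) b a"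
      then obtain x where "x \<in> el (src \<tau>) b a" "y = cmp \<tau> b a x" by blast
      then show "k \<odot>\<^bsub>val (tgt \<tau>) b a\<^esub> y \<in> cmp \<tau> b a ` el (src \<tau>) b a"
        using klinear_smult[OF l k, of x] k
        by (intro image_eqI[of _ _ "k \<odot>\<^bsub>val (src \<tau>) b a\<^esub> x"]) simp_all
    qed
  qed
  moreover have "act (tgt \<tau>) b b' a a' \<beta> \<alpha> y \<in> image_cell \<tau> b' a'"
    if *: "b \<in> Ob (cod (src \<tau>))" "b' \<in> Ob (cod (src \<tau>))" "a \<in> Ob (dom (src \<tau>))" "a' \<in> Ob (dom (src \<tau>))"
      "\<beta> \<in> carrier (Hom (cod (src \<tau>)) b' b)" "\<alpha> \<in> carrier (Hom (dom (src \<tau>)) a a')"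
    and y: "y \<in> image_cell \<tau> b a" for b b' a a' \<beta> \<alpha> y
  proof -
    obtain x where "x \<in> el (src \<tau>) b a" "y = cmp \<tau> b a x"
      using y * by (auto simp: image_cell_def)
    then show ?thesis
      using two_cell_natural[OF assms *, of x] F.act_closed[OF *, of x] *
      by (auto simp: image_cell_def intro!: image_eqI[of _ _ "act (src \<tau>) b b' a a' \<beta> \<alpha> x"])
  qed
  ultimately show ?thesis
    unfolding subbimodule_def t by (auto simp: image_cell_def)
qed

definition surj_cell :: "('k,'u) cell \<Rightarrow> bool" where
  "surj_cell \<pi> \<longleftrightarrow> (\<forall>b\<in>Ob (cod (src \<pi>)). \<forall>a\<in>Ob (dom (src \<pi>)). \<forall>y\<in>el (tgt \<pi>) b a.
     \<exists>x\<in>el (src \<pi>) b a. y = cmp \<pi> b a x)"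

lemma image_factor:
  assumes "two_cell K \<tau>"
  obtains \<pi> where "two_cell K \<pi>" "src \<pi> = src \<tau>" "tgt \<pi> = sub_bimod (tgt \<tau>) (image_cell \<tau>)"
    "incl (tgt \<tau>) (image_cell \<tau>) \<bullet> \<pi> = \<tau>" "surj_cell \<pi>"
proof -
  have "cmp \<tau> b a x \<in> image_cell \<tau> b a"
    if "b \<in> Ob (cod (src \<tau>))" "a \<in> Ob (dom (src \<tau>))" "x \<in> el (src \<tau>) b a" for b a x
    using that by (simp add: image_cell_def)
  then obtain \<pi> where p: "two_cell K \<pi>" "src \<pi> = src \<tau>" "tgt \<pi> = sub_bimod (tgt \<tau>) (image_cell \<tau>)"
    "incl (tgt \<tau>) (image_cell \<tau>) \<bullet> \<pi> = \<tau>"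
    "\<And>b a x. b \<in> Ob (cod (src \<tau>)) \<Longrightarrow> a \<in> Ob (dom (src \<tau>)) \<Longrightarrow> x \<in> el (src \<tau>) b a \<Longrightarrow> cmp \<pi> b a x = cmp \<tau> b a x"
    using incl_factor[OF two_cell_bimodule(2)[OF assms] image_subbimodule[OF assms] assms] by metis
  have "surj_cell \<pi>"
    unfolding surj_cell_def using p(2,3,5) by (auto simp: image_cell_def)
  then show thesis using that p by blast
qed

definition epi_cell :: "'k ring \<Rightarrow> ('k,'u) cell \<Rightarrow> bool" where
  "epi_cell K \<pi> \<longleftrightarrow> (\<forall>\<rho> \<rho>'. two_cell K \<rho> \<longrightarrow> two_cell K \<rho>' \<longrightarrow> src \<rho> = tgt \<pi> \<longrightarrow> src \<rho>' = tgt \<pi> \<longrightarrow>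
     \<rho> \<bullet> \<pi> = \<rho>' \<bullet> \<pi> \<longrightarrow> \<rho> = \<rho>')"

text \<open>The part of right exactness used below: \<open>y \<otimes> x\<close> lifts along the
  cell by choosing a preimage of \<open>x\<close> alone, and cells out of a tensor product are
  determined on elementary tensors.\<close>

lemma tens_surj_epi:
  assumes "bimodule K f" "two_cell K \<pi>" "surj_cell \<pi>" "dom f = cod (src \<pi>)"
  shows "epi_cell K (id_cell f \<star> \<pi>)"
  unfolding epi_cell_def
proof (intro allI impI)
  fix \<rho> \<rho>' assume r: "two_cell K \<rho>" "two_cell K \<rho>'" "src \<rho> = tgt (id_cell f \<star> \<pi>)" "src \<rho>' = tgt (id_cell f \<star> \<pi>)"
    and e: "\<rho> \<bullet> (id_cell f \<star> \<pi>) = \<rho>' \<bullet> (id_cell f \<star> \<pi>)"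
  note t = two_cell_tgt[OF assms(2)] and b = two_cell_bimodule[OF assms(2)]
  show "\<rho> = \<rho>'"
  proof (rule tens_cell_eqI[OF r(1,2), of f "tgt \<pi>"])
    show "tgt \<rho> = tgt \<rho>'" using arg_cong[OF e, of tgt] by simp
    fix c a d y x assume *: "c \<in> Ob (cod f)" "a \<in> Ob (dom (tgt \<pi>))" "d \<in> Ob (cod (tgt \<pi>))"
      "y \<in> el f c d" "x \<in> el (tgt \<pi>) d a"
    then obtain x' where x': "x' \<in> el (src \<pi>) d a" "x = cmp \<pi> d a x'"
      using assms(3) t unfolding surj_cell_def by simp blast
    have "cmp (\<rho> \<bullet> (id_cell f \<star> \<pi>)) c a (tn f (src \<pi>) c a d y x') = cmp (\<rho>' \<bullet> (id_cell f \<star> \<pi>)) c a (tn f (src \<pi>) c a d y x')"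
      using e by simp
    then show "cmp \<rho> c a (tn f (tgt \<pi>) c a d y x) = cmp \<rho>' c a (tn f (tgt \<pi>) c a d y x)"
      using * x' assms b t by (simp add: cmp_hcomp_tn[of K] tn_closed[of K] id_cell_two_cell)
  qed (use assms r t b in auto)
qed

lemma tens_surj_epi':
  assumes "bimodule K f" "two_cell K \<pi>" "surj_cell \<pi>" "cod f = dom (src \<pi>)"
  shows "epi_cell K (\<pi> \<star> id_cell f)"
  unfolding epi_cell_def
proof (intro allI impI)
  fix \<rho> \<rho>' assume r: "two_cell K \<rho>" "two_cell K \<rho>'" "src \<rho> = tgt (\<pi> \<star> id_cell f)" "src \<rho>' = tgt (\<pi> \<star> id_cell f)"
    and e: "\<rho> \<bullet> (\<pi> \<star> id_cell f) = \<rho>' \<bullet> (\<pi> \<star> id_cell f)"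
  note t = two_cell_tgt[OF assms(2)] and b = two_cell_bimodule[OF assms(2)]
  show "\<rho> = \<rho>'"
  proof (rule tens_cell_eqI[OF r(1,2), of "tgt \<pi>" f])
    show "tgt \<rho> = tgt \<rho>'" using arg_cong[OF e, of tgt] by simp
    fix c a d y x assume *: "c \<in> Ob (cod (tgt \<pi>))" "a \<in> Ob (dom f)" "d \<in> Ob (cod f)"
      "y \<in> el (tgt \<pi>) c d" "x \<in> el f d a"
    then obtain y' where y': "y' \<in> el (src \<pi>) c d" "y = cmp \<pi> c d y'"
      using assms(3,4) t unfolding surj_cell_def by simp blast
    have "cmp (\<rho> \<bullet> (\<pi> \<star> id_cell f)) c a (tn (src \<pi>) f c a d y' x) = cmp (\<rho>' \<bullet> (\<pi> \<star> id_cell f)) c a (tn (src \<pi>) f c a d y' x)"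
      using e by simp
    then show "cmp \<rho> c a (tn (tgt \<pi>) f c a d y x) = cmp \<rho>' c a (tn (tgt \<pi>) f c a d y x)"
      using * y' assms b t by (simp add: cmp_hcomp_tn[of K] tn_closed[of K] id_cell_two_cell)
  qed (use assms r t b in auto)
qed

definition equalizer_sub :: "('k,'u) cell \<Rightarrow> ('k,'u) cell \<Rightarrow> 'u \<Rightarrow> 'u \<Rightarrow> 'u set" where
  "equalizer_sub p q b a =
     (if b \<in> Ob (cod (src p)) \<and> a \<in> Ob (dom (src p))
      then {x \<in> el (src p) b a. cmp p b a x = cmp q b a x} else {})"

lemma equalizer_subbimodule:
  assumes "two_cell K p" "two_cell K q" "src p = src q" "tgt p = tgt q"
  shows "subbimodule K (src p) (equalizer_sub p q)"
proof -
  interpret F: bimodule K "src p" by (rule two_cell_bimodule[OF assms(1)])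
  interpret G: bimodule K "tgt p" by (rule two_cell_bimodule[OF assms(1)])
  note t = two_cell_tgt[OF assms(1)]
  have "submodule (equalizer_sub p q b a) K (val (src p) b a)"
    if o: "b \<in> Ob (cod (src p))" "a \<in> Ob (dom (src p))" for b a
  proof -
    interpret M: Module.module K "val (src p) b a" using F.val_module that by simp
    interpret N: Module.module K "val (tgt p) b a" using G.val_module that t by simp
    have p: "klinear K (val (src p) b a) (val (tgt p) b a) (cmp p b a)" using two_cell_linear[OF assms(1) o] .
    have q: "klinear K (val (src p) b a) (val (tgt p) b a) (cmp q b a)"
      using two_cell_linear[OF assms(2), of b a] o assms(3,4) by simp
    have im: "equalizer_sub p q b a = {x \<in> el (src p) b a. cmp p b a x = cmp q b a x}"
      using that by (simp add: equalizer_sub_def)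
    show ?thesis unfolding im
      by (rule M.submoduleI)
        (auto simp: klinear_zero[OF M.module_axioms N.module_axioms p] klinear_zero[OF M.module_axioms N.module_axioms q]
          klinear_minus[OF M.module_axioms N.module_axioms p] klinear_minus[OF M.module_axioms N.module_axioms q]
          klinear_add[OF p] klinear_add[OF q] klinear_smult[OF p] klinear_smult[OF q])
  qed
  moreover have "act (src p) b b' a a' \<beta> \<alpha> x \<in> equalizer_sub p q b' a'"
    if *: "b \<in> Ob (cod (src p))" "b' \<in> Ob (cod (src p))" "a \<in> Ob (dom (src p))" "a' \<in> Ob (dom (src p))"
      "\<beta> \<in> carrier (Hom (cod (src p)) b' b)" "\<alpha> \<in> carrier (Hom (dom (src p)) a a')"
    and x: "x \<in> equalizer_sub p q b a" for b b' a a' \<beta> \<alpha> x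
    using * x two_cell_natural[OF assms(1) *, of x] two_cell_natural[OF assms(2), of b b' a a' \<beta> \<alpha> x]
      F.act_closed[OF *, of x] assms(3,4) by (simp add: equalizer_sub_def)
  ultimately show ?thesis
    unfolding subbimodule_def by (auto simp: equalizer_sub_def)
qed

text \<open>Equalizers are computed pointwise. Realizing them by inclusions is what makes a
  subbimodule out of a coaction later on.\<close>

lemma equalizer_exists:
  assumes "two_cell K p" "two_cell K q" "src p = src q" "tgt p = tgt q"
  shows "is_equalizer K (incl (src p) (equalizer_sub p q)) p q"
proof -
  note b = two_cell_bimodule[OF assms(1)]
  note s = equalizer_subbimodule[OF assms]
  note i = incl_two_cell[OF b(1) s]
  let ?i = "incl (src p) (equalizer_sub p q)"
  have e: "p \<bullet> ?i = q \<bullet> ?i"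
  proof (rule cell_eqI[of K])
    show "two_cell K (p \<bullet> ?i)" "two_cell K (q \<bullet> ?i)" using assms i by (auto intro!: vcomp_two_cell)
    fix b a x assume "b \<in> Ob (cod (src (q \<bullet> ?i)))" "a \<in> Ob (dom (src (q \<bullet> ?i)))"
      "x \<in> el (src (q \<bullet> ?i)) b a"
    then show "cmp (p \<bullet> ?i) b a x = cmp (q \<bullet> ?i) b a x"
      by (simp add: cmp_incl[OF s]) (simp add: equalizer_sub_def)
  qed (use assms in simp_all)
  have ex: "\<exists>!s. s \<in> cells K T (src ?i) \<and> ?i \<bullet> s = t" if t: "t \<in> cells K T (tgt ?i)" "p \<bullet> t = q \<bullet> t" for T t
  proof -
    have tt: "two_cell K t" "src t = T" "tgt t = src p" using t by (simp_all add: cells_iff)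
    have "cmp t b a x \<in> equalizer_sub p q b a"
      if "b \<in> Ob (cod (src t))" "a \<in> Ob (dom (src t))" "x \<in> el (src t) b a" for b a x
    proof -
      have "cmp (p \<bullet> t) b a x = cmp (q \<bullet> t) b a x" using t(2) by simp
      then show ?thesis
        using that cmp_closed[OF tt(1) that] two_cell_tgt[OF tt(1)] tt(3) by (simp add: equalizer_sub_def)
    qed
    then obtain u where u: "two_cell K u" "src u = src t" "tgt u = sub_bimod (src p) (equalizer_sub p q)" "?i \<bullet> u = t"
      using incl_factor[OF b(1) s tt(1,3)] by metis
    show ?thesis
    proof (rule ex1I[of _ u])
      show "u \<in> cells K T (src ?i) \<and> ?i \<bullet> u = t" using u tt by (simp add: cells_iff)
      fix v assume v: "v \<in> cells K T (src ?i) \<and> ?i \<bullet> v = t"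
      then have "two_cell K v" "tgt v = sub_bimod (src p) (equalizer_sub p q)" by (simp_all add: cells_iff)
      moreover have "?i \<bullet> v = ?i \<bullet> u" using v u(4) by simp
      ultimately show "v = u" using incl_mono[OF s _ u(1) _ u(3)] by blast
    qed
  qed
  show ?thesis
    unfolding is_equalizer_def
  proof (intro conjI allI ballI impI)
    fix T t assume "t \<in> cells K T (tgt ?i)" "p \<bullet> t = q \<bullet> t"
    then show "\<exists>!s. s \<in> cells K T (src ?i) \<and> ?i \<bullet> s = t" by (rule ex)
  qed (use i e assms in \<open>simp_all add: cells_iff\<close>)
qed

section \<open>Bicategory structures and their reversal\<close>

text \<open>The inverses \<open>as'\<close>, \<open>lu'\<close>, \<open>ru'\<close> are parameters
  because reversal exchanges \<open>as\<close> with \<open>as'\<close>; right exactness is stated on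
  both sides for the same reason. \<open>lu_ten\<close>, \<open>ru_ten\<close> and
  \<open>lu_ru_unit\<close> are taken as axioms instead of being rederived from
  \<open>pentagon\<close> and \<open>triangle\<close>, since elements give them directly.\<close>

locale horizontal =
  fixes K :: "'k ring"
    and dm cd :: "('k,'u::infinite) bimod \<Rightarrow> ('k,'u) kcat"
    and ten :: "('k,'u) bimod \<Rightarrow> ('k,'u) bimod \<Rightarrow> ('k,'u) bimod"  (infixr \<open>\<bowtie>\<close> 70)
    and hc :: "('k,'u) cell \<Rightarrow> ('k,'u) cell \<Rightarrow> ('k,'u) cell"  (infixr \<open>\<diamond>\<close> 70)
    and as as' :: "('k,'u) bimod \<Rightarrow> ('k,'u) bimod \<Rightarrow> ('k,'u) bimod \<Rightarrow> ('k,'u) cell"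
    and lu lu' ru ru' :: "('k,'u) bimod \<Rightarrow> ('k,'u) cell"
  assumes dm_tgt [simp]: "two_cell K \<tau> \<Longrightarrow> dm (tgt \<tau>) = dm (src \<tau>)"
    and cd_tgt [simp]: "two_cell K \<tau> \<Longrightarrow> cd (tgt \<tau>) = cd (src \<tau>)"
    and dm_sub [simp]: "dm (sub_bimod F X) = dm F"
    and cd_sub [simp]: "cd (sub_bimod F X) = cd F"
    and dm_ten [simp]: "dm (F \<bowtie> G) = dm G"
    and cd_ten [simp]: "cd (F \<bowtie> G) = cd F"
    and dm_unit [simp]: "dm (unit_bimod C) = C"
    and cd_unit [simp]: "cd (unit_bimod C) = C"
    and ten_bimodule [simp]: "bimodule K F \<Longrightarrow> bimodule K G \<Longrightarrow> dm F = cd G \<Longrightarrow> bimodule K (F \<bowtie> G)"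
    and unit_dm [simp]: "bimodule K F \<Longrightarrow> bimodule K (unit_bimod (dm F))"
    and unit_cd [simp]: "bimodule K F \<Longrightarrow> bimodule K (unit_bimod (cd F))"
    and hc_src [simp]: "src (\<sigma> \<diamond> \<tau>) = src \<sigma> \<bowtie> src \<tau>"
    and hc_tgt [simp]: "tgt (\<sigma> \<diamond> \<tau>) = tgt \<sigma> \<bowtie> tgt \<tau>"
    and hc_two_cell [simp]:
      "two_cell K \<sigma> \<Longrightarrow> two_cell K \<tau> \<Longrightarrow> dm (src \<sigma>) = cd (src \<tau>) \<Longrightarrow> two_cell K (\<sigma> \<diamond> \<tau>)"
    and hc_id: "bimodule K F \<Longrightarrow> bimodule K G \<Longrightarrow> dm F = cd G \<Longrightarrow> id_cell F \<diamond> id_cell G = id_cell (F \<bowtie> G)"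
    and hc_vcomp: "two_cell K \<sigma> \<Longrightarrow> two_cell K \<sigma>' \<Longrightarrow> two_cell K \<tau> \<Longrightarrow> two_cell K \<tau>' \<Longrightarrow> src \<sigma> = tgt \<sigma>'
       \<Longrightarrow> src \<tau> = tgt \<tau>' \<Longrightarrow> dm (src \<sigma>') = cd (src \<tau>') \<Longrightarrow> (\<sigma> \<diamond> \<tau>) \<bullet> (\<sigma>' \<diamond> \<tau>') = (\<sigma> \<bullet> \<sigma>') \<diamond> (\<tau> \<bullet> \<tau>')"
    and as_two_cell [simp]: "bimodule K H \<Longrightarrow> bimodule K G \<Longrightarrow> bimodule K F \<Longrightarrow> dm H = cd G \<Longrightarrow> dm G = cd F \<Longrightarrow> two_cell K (as H G F)"
    and as_src [simp]: "bimodule K H \<Longrightarrow> bimodule K G \<Longrightarrow> bimodule K F \<Longrightarrow> dm H = cd G \<Longrightarrow> dm G = cd F \<Longrightarrow> src (as H G F) = (H \<bowtie> G) \<bowtie> F"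
    and as_tgt [simp]: "bimodule K H \<Longrightarrow> bimodule K G \<Longrightarrow> bimodule K F \<Longrightarrow> dm H = cd G \<Longrightarrow> dm G = cd F \<Longrightarrow> tgt (as H G F) = H \<bowtie> (G \<bowtie> F)"
    and as'_two_cell [simp]: "bimodule K H \<Longrightarrow> bimodule K G \<Longrightarrow> bimodule K F \<Longrightarrow> dm H = cd G \<Longrightarrow> dm G = cd F \<Longrightarrow> two_cell K (as' H G F)"
    and as'_src [simp]: "bimodule K H \<Longrightarrow> bimodule K G \<Longrightarrow> bimodule K F \<Longrightarrow> dm H = cd G \<Longrightarrow> dm G = cd F \<Longrightarrow> src (as' H G F) = H \<bowtie> (G \<bowtie> F)"
    and as'_tgt [simp]: "bimodule K H \<Longrightarrow> bimodule K G \<Longrightarrow> bimodule K F \<Longrightarrow> dm H = cd G \<Longrightarrow> dm G = cd F \<Longrightarrow> tgt (as' H G F) = (H \<bowtie> G) \<bowtie> F"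
    and as_as' [simp]: "bimodule K H \<Longrightarrow> bimodule K G \<Longrightarrow> bimodule K F \<Longrightarrow> dm H = cd G \<Longrightarrow> dm G = cd F \<Longrightarrow> as H G F \<bullet> as' H G F = id_cell (H \<bowtie> (G \<bowtie> F))"
    and as'_as [simp]: "bimodule K H \<Longrightarrow> bimodule K G \<Longrightarrow> bimodule K F \<Longrightarrow> dm H = cd G \<Longrightarrow> dm G = cd F \<Longrightarrow> as' H G F \<bullet> as H G F = id_cell ((H \<bowtie> G) \<bowtie> F)"
    and as_natural: "two_cell K \<rho> \<Longrightarrow> two_cell K \<sigma> \<Longrightarrow> two_cell K \<tau> \<Longrightarrow> dm (src \<rho>) = cd (src \<sigma>) \<Longrightarrow> dm (src \<sigma>) = cd (src \<tau>)
       \<Longrightarrow> as (tgt \<rho>) (tgt \<sigma>) (tgt \<tau>) \<bullet> ((\<rho> \<diamond> \<sigma>) \<diamond> \<tau>) = (\<rho> \<diamond> (\<sigma> \<diamond> \<tau>)) \<bullet> as (src \<rho>) (src \<sigma>) (src \<tau>)"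
    and lu_two_cell [simp]: "bimodule K F \<Longrightarrow> two_cell K (lu F)"
    and lu_src [simp]: "bimodule K F \<Longrightarrow> src (lu F) = unit_bimod (cd F) \<bowtie> F"
    and lu_tgt [simp]: "bimodule K F \<Longrightarrow> tgt (lu F) = F"
    and lu'_two_cell [simp]: "bimodule K F \<Longrightarrow> two_cell K (lu' F)"
    and lu'_src [simp]: "bimodule K F \<Longrightarrow> src (lu' F) = F"
    and lu'_tgt [simp]: "bimodule K F \<Longrightarrow> tgt (lu' F) = unit_bimod (cd F) \<bowtie> F"
    and lu_lu' [simp]: "bimodule K F \<Longrightarrow> lu F \<bullet> lu' F = id_cell F"
    and lu'_lu [simp]: "bimodule K F \<Longrightarrow> lu' F \<bullet> lu F = id_cell (unit_bimod (cd F) \<bowtie> F)"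
    and lu_natural: "two_cell K \<tau> \<Longrightarrow> lu (tgt \<tau>) \<bullet> (id_cell (unit_bimod (cd (src \<tau>))) \<diamond> \<tau>) = \<tau> \<bullet> lu (src \<tau>)"
    and ru_two_cell [simp]: "bimodule K F \<Longrightarrow> two_cell K (ru F)"
    and ru_src [simp]: "bimodule K F \<Longrightarrow> src (ru F) = F \<bowtie> unit_bimod (dm F)"
    and ru_tgt [simp]: "bimodule K F \<Longrightarrow> tgt (ru F) = F"
    and ru'_two_cell [simp]: "bimodule K F \<Longrightarrow> two_cell K (ru' F)"
    and ru'_src [simp]: "bimodule K F \<Longrightarrow> src (ru' F) = F"
    and ru'_tgt [simp]: "bimodule K F \<Longrightarrow> tgt (ru' F) = F \<bowtie> unit_bimod (dm F)"
    and ru_ru' [simp]: "bimodule K F \<Longrightarrow> ru F \<bullet> ru' F = id_cell F"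
    and ru'_ru [simp]: "bimodule K F \<Longrightarrow> ru' F \<bullet> ru F = id_cell (F \<bowtie> unit_bimod (dm F))"
    and ru_natural: "two_cell K \<tau> \<Longrightarrow> ru (tgt \<tau>) \<bullet> (\<tau> \<diamond> id_cell (unit_bimod (dm (src \<tau>)))) = \<tau> \<bullet> ru (src \<tau>)"
    and pentagon: "bimodule K I \<Longrightarrow> bimodule K H \<Longrightarrow> bimodule K G \<Longrightarrow> bimodule K F \<Longrightarrow> dm I = cd H \<Longrightarrow> dm H = cd G \<Longrightarrow> dm G = cd F
       \<Longrightarrow> as I H (G \<bowtie> F) \<bullet> as (I \<bowtie> H) G F = (id_cell I \<diamond> as H G F) \<bullet> as I (H \<bowtie> G) F \<bullet> (as I H G \<diamond> id_cell F)"
    and triangle: "bimodule K G \<Longrightarrow> bimodule K F \<Longrightarrow> dm G = cd F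
       \<Longrightarrow> (id_cell G \<diamond> lu F) \<bullet> as G (unit_bimod (cd F)) F = ru G \<diamond> id_cell F"
    and lu_ten: "bimodule K G \<Longrightarrow> bimodule K F \<Longrightarrow> dm G = cd F
       \<Longrightarrow> lu (G \<bowtie> F) \<bullet> as (unit_bimod (cd G)) G F = lu G \<diamond> id_cell F"
    and ru_ten: "bimodule K G \<Longrightarrow> bimodule K F \<Longrightarrow> dm G = cd F
       \<Longrightarrow> (id_cell G \<diamond> ru F) \<bullet> as G F (unit_bimod (dm F)) = ru (G \<bowtie> F)"
    and lu_ru_unit: "bimodule K (unit_bimod C) \<Longrightarrow> lu (unit_bimod C) = ru (unit_bimod C)"
    and ten_epi: "bimodule K F \<Longrightarrow> two_cell K \<pi> \<Longrightarrow> surj_cell \<pi> \<Longrightarrow> dm F = cd (src \<pi>) \<Longrightarrow> epi_cell K (id_cell F \<diamond> \<pi>)"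
    and ten_epi': "bimodule K F \<Longrightarrow> two_cell K \<pi> \<Longrightarrow> surj_cell \<pi> \<Longrightarrow> cd F = dm (src \<pi>) \<Longrightarrow> epi_cell K (\<pi> \<diamond> id_cell F)"
begin

abbreviation "bi \<equiv> bimodule K"
abbreviation "ar \<equiv> two_cell K"

lemma ar_bi [simp]: "ar \<tau> \<Longrightarrow> bi (src \<tau>)" "ar \<tau> \<Longrightarrow> bi (tgt \<tau>)"
  by (rule two_cell_bimodule; assumption)+

lemma ar_vcomp [simp]: "ar \<sigma> \<Longrightarrow> ar \<tau> \<Longrightarrow> src \<sigma> = tgt \<tau> \<Longrightarrow> ar (\<sigma> \<bullet> \<tau>)"
  by (rule vcomp_two_cell)

lemma ar_id [simp]: "bi F \<Longrightarrow> ar (id_cell F)"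
  by (rule id_cell_two_cell)

lemma vc_id [simp]: "ar \<tau> \<Longrightarrow> tgt \<tau> = F \<Longrightarrow> id_cell F \<bullet> \<tau> = \<tau>" "ar \<tau> \<Longrightarrow> src \<tau> = F \<Longrightarrow> \<tau> \<bullet> id_cell F = \<tau>"
  by (rule vcomp_id_left vcomp_id_right; assumption)+

lemma vc_assoc: "ar \<tau> \<Longrightarrow> ar \<rho> \<Longrightarrow> src \<tau> = tgt \<rho> \<Longrightarrow> (\<sigma> \<bullet> \<tau>) \<bullet> \<rho> = \<sigma> \<bullet> \<tau> \<bullet> \<rho>"
  by (rule vcomp_assoc)

text \<open>Composites are kept nested to the right, where \<open>\<sigma> \<bullet> \<tau>\<close>
  need not be a subterm; this form rewrites the left end of a longer composite.\<close>

lemma vc_cong: "\<sigma> \<bullet> \<tau> = \<kappa> \<Longrightarrow> ar \<tau> \<Longrightarrow> ar \<rho> \<Longrightarrow> src \<tau> = tgt \<rho> \<Longrightarrow> \<sigma> \<bullet> \<tau> \<bullet> \<rho> = \<kappa> \<bullet> \<rho>"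
  using vc_assoc by metis

lemma wl_vc: "bi F \<Longrightarrow> ar \<sigma> \<Longrightarrow> ar \<tau> \<Longrightarrow> src \<sigma> = tgt \<tau> \<Longrightarrow> dm F = cd (src \<tau>)
    \<Longrightarrow> id_cell F \<diamond> (\<sigma> \<bullet> \<tau>) = (id_cell F \<diamond> \<sigma>) \<bullet> (id_cell F \<diamond> \<tau>)"
  using hc_vcomp[of "id_cell F" "id_cell F" \<sigma> \<tau>] by simp

lemma wr_vc: "bi F \<Longrightarrow> ar \<sigma> \<Longrightarrow> ar \<tau> \<Longrightarrow> src \<sigma> = tgt \<tau> \<Longrightarrow> dm (src \<tau>) = cd F
    \<Longrightarrow> (\<sigma> \<bullet> \<tau>) \<diamond> id_cell F = (\<sigma> \<diamond> id_cell F) \<bullet> (\<tau> \<diamond> id_cell F)"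
  using hc_vcomp[of \<sigma> \<tau> "id_cell F" "id_cell F"] by simp

lemma hc_wr_wl:
  assumes "ar \<sigma>" "ar \<tau>" "dm (src \<sigma>) = cd (src \<tau>)" "tgt \<tau> = X" "src \<sigma> = Y"
  shows "(\<sigma> \<diamond> id_cell X) \<bullet> (id_cell Y \<diamond> \<tau>) = \<sigma> \<diamond> \<tau>"
proof -
  have "(\<sigma> \<diamond> id_cell X) \<bullet> (id_cell Y \<diamond> \<tau>) = (\<sigma> \<bullet> id_cell Y) \<diamond> (id_cell X \<bullet> \<tau>)"
    using assms by (intro hc_vcomp) auto
  then show ?thesis using assms by simp
qed

lemma hc_wl_wr:
  assumes "ar \<sigma>" "ar \<tau>" "dm (src \<sigma>) = cd (src \<tau>)" "tgt \<sigma> = X" "src \<tau> = Y"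
  shows "(id_cell X \<diamond> \<tau>) \<bullet> (\<sigma> \<diamond> id_cell Y) = \<sigma> \<diamond> \<tau>"
proof -
  have "(id_cell X \<diamond> \<tau>) \<bullet> (\<sigma> \<diamond> id_cell Y) = (id_cell X \<bullet> \<sigma>) \<diamond> (\<tau> \<bullet> id_cell Y)"
    using assms by (intro hc_vcomp) auto
  then show ?thesis using assms by simp
qed

lemma as_nat: "ar \<rho> \<Longrightarrow> ar \<sigma> \<Longrightarrow> ar \<tau> \<Longrightarrow> dm (src \<rho>) = cd (src \<sigma>) \<Longrightarrow> dm (src \<sigma>) = cd (src \<tau>)
    \<Longrightarrow> tgt \<rho> = X \<Longrightarrow> tgt \<sigma> = Y \<Longrightarrow> tgt \<tau> = Z
    \<Longrightarrow> as X Y Z \<bullet> ((\<rho> \<diamond> \<sigma>) \<diamond> \<tau>) = (\<rho> \<diamond> (\<sigma> \<diamond> \<tau>)) \<bullet> as (src \<rho>) (src \<sigma>) (src \<tau>)"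
  using as_natural by metis

lemma as'_nat: 
  assumes "ar \<rho>" "ar \<sigma>" "ar \<tau>" "dm (src \<rho>) = cd (src \<sigma>)" "dm (src \<sigma>) = cd (src \<tau>)"
    "tgt \<rho> = X" "tgt \<sigma> = Y" "tgt \<tau> = Z"
  shows "as' X Y Z \<bullet> (\<rho> \<diamond> (\<sigma> \<diamond> \<tau>)) = ((\<rho> \<diamond> \<sigma>) \<diamond> \<tau>) \<bullet> as' (src \<rho>) (src \<sigma>) (src \<tau>)"
proof -
  have b: "bi X" "bi Y" "bi Z" "dm X = cd Y" "dm Y = cd Z" using assms by auto
  have "as' X Y Z \<bullet> (\<rho> \<diamond> (\<sigma> \<diamond> \<tau>)) = as' X Y Z \<bullet> ((\<rho> \<diamond> (\<sigma> \<diamond> \<tau>)) \<bullet> as (src \<rho>) (src \<sigma>) (src \<tau>)) \<bullet> as' (src \<rho>) (src \<sigma>) (src \<tau>)"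
    using assms b by (simp add: vc_assoc)
  also have "\<dots> = as' X Y Z \<bullet> (as X Y Z \<bullet> ((\<rho> \<diamond> \<sigma>) \<diamond> \<tau>)) \<bullet> as' (src \<rho>) (src \<sigma>) (src \<tau>)"
    using as_nat[OF assms] by simp
  also have "\<dots> = ((\<rho> \<diamond> \<sigma>) \<diamond> \<tau>) \<bullet> as' (src \<rho>) (src \<sigma>) (src \<tau>)"
    using assms b by (simp add: vc_assoc vc_cong[OF as'_as])
  finally show ?thesis .
qed

text \<open>The right side is a left inverse of the composite in \<open>pentagon\<close>, the left
  side a right inverse.\<close>

lemma pentagon':
  assumes "bi I" "bi H" "bi G" "bi F" "dm I = cd H" "dm H = cd G" "dm G = cd F"
  shows "as' (I \<bowtie> H) G F \<bullet> as' I H (G \<bowtie> F)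
    = (as' I H G \<diamond> id_cell F) \<bullet> as' I (H \<bowtie> G) F \<bullet> (id_cell I \<diamond> as' H G F)"
proof -
  let ?r = "(as' I H G \<diamond> id_cell F) \<bullet> as' I (H \<bowtie> G) F \<bullet> (id_cell I \<diamond> as' H G F)"
  have 1: "(id_cell I \<diamond> as' H G F) \<bullet> (id_cell I \<diamond> as H G F) = id_cell (I \<bowtie> ((H \<bowtie> G) \<bowtie> F))"
    using assms by (simp add: hc_id flip: wl_vc)
  have 2: "(as' I H G \<diamond> id_cell F) \<bullet> (as I H G \<diamond> id_cell F) = id_cell (((I \<bowtie> H) \<bowtie> G) \<bowtie> F)"
    using assms by (simp add: hc_id flip: wr_vc)
  have "?r \<bullet> (as I H (G \<bowtie> F) \<bullet> as (I \<bowtie> H) G F) = id_cell (((I \<bowtie> H) \<bowtie> G) \<bowtie> F)"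
    unfolding pentagon[OF assms] using assms by (simp add: vc_assoc 2 vc_cong[OF 1] vc_cong[OF as'_as])
  then have "(?r \<bullet> (as I H (G \<bowtie> F) \<bullet> as (I \<bowtie> H) G F)) \<bullet> as' (I \<bowtie> H) G F \<bullet> as' I H (G \<bowtie> F)
      = as' (I \<bowtie> H) G F \<bullet> as' I H (G \<bowtie> F)"
    using assms by simp
  then show ?thesis using assms by (simp add: vc_assoc vc_cong[OF as_as'])
qed

lemma triangle':
  assumes "bi G" "bi F" "dm G = cd F"
  shows "(ru G \<diamond> id_cell F) \<bullet> as' G (unit_bimod (cd F)) F = id_cell G \<diamond> lu F"
  unfolding triangle[OF assms, symmetric] using assms by (simp add: vc_assoc)

lemma lu_ten':
  assumes "bi G" "bi F" "dm G = cd F"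
  shows "(lu G \<diamond> id_cell F) \<bullet> as' (unit_bimod (cd G)) G F = lu (G \<bowtie> F)"
  unfolding lu_ten[OF assms, symmetric] using assms by (simp add: vc_assoc)

lemma ru_ten':
  assumes "bi G" "bi F" "dm G = cd F"
  shows "ru (G \<bowtie> F) \<bullet> as' G F (unit_bimod (dm F)) = id_cell G \<diamond> ru F"
  unfolding ru_ten[OF assms, symmetric] using assms by (simp add: vc_assoc)

text \<open>The mirrored axioms are the primed laws: the associator becomes \<open>as'\<close>,
  \<open>lu\<close> trades places with \<open>ru\<close>, and \<open>ten_epi\<close> with
  \<open>ten_epi'\<close>. Every result of the locale thereby has a mirror image.\<close>

lemma reversed:
  "horizontal K cd dm (\<lambda>F G. G \<bowtie> F) (\<lambda>\<sigma> \<tau>. \<tau> \<diamond> \<sigma>) (\<lambda>H G F. as' F G H) (\<lambda>H G F. as F G H) ru ru' lu lu'"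
proof (rule horizontal.intro, goal_cases)
  case (15 F G)
  then show ?case using hc_id[of G F] by simp
next
  case (16 \<sigma> \<sigma>' \<tau> \<tau>')
  then show ?case using hc_vcomp[of \<tau> \<tau>' \<sigma> \<sigma>'] by simp
next
  case (25 \<rho> \<sigma> \<tau>)
  then show ?case using as'_nat[of \<tau> \<sigma> \<rho>] by simp
next
  case (34 \<tau>)
  then show ?case by (rule ru_natural)
next
  case (43 \<tau>)
  then show ?case by (rule lu_natural)
next
  case (44 I H G F)
  then show ?case using pentagon'[of F G H I] by simp
next
  case (45 G F)
  then show ?case using triangle'[of F G] by simp
next
  case (46 G F)
  then show ?case using ru_ten'[of F G] by simp
next
  case (47 G F)
  then show ?case using lu_ten'[of F G] by simp
next
  case (48 C)
  then show ?case using lu_ru_unit by simp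
next
  case (49 F \<pi>)
  then show ?case using ten_epi' by simp
next
  case (50 F \<pi>)
  then show ?case using ten_epi by simp
qed simp_all

end

section \<open>Whiskering rules and coherence laws with inverted edges\<close>

context horizontal
begin

abbreviation lw (infixr \<open>\<rhd>\<close> 66) where "F \<rhd> t \<equiv> id_cell F \<diamond> t"
abbreviation rw (infixl \<open>\<lhd>\<close> 67) where "t \<lhd> F \<equiv> t \<diamond> id_cell F"

lemma lu'_nat:
  assumes "ar t" "tgt t = Y"
  shows "lu' Y \<bullet> t = (unit_bimod (cd (src t)) \<rhd> t) \<bullet> lu' (src t)"
proof -
  have c: "cd Y = cd (src t)" "bi Y" using assms by auto
  have "lu' Y \<bullet> t = lu' Y \<bullet> (t \<bullet> lu (src t)) \<bullet> lu' (src t)" using assms c by (simp add: vc_assoc)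
  also have "\<dots> = lu' Y \<bullet> (lu Y \<bullet> (unit_bimod (cd (src t)) \<rhd> t)) \<bullet> lu' (src t)"
    using lu_natural[OF assms(1)] assms by simp
  also have "\<dots> = (unit_bimod (cd (src t)) \<rhd> t) \<bullet> lu' (src t)"
    using assms c by (simp add: vc_assoc vc_cong[OF lu'_lu])
  finally show ?thesis .
qed

lemma ru'_nat:
  assumes "ar t" "tgt t = Y"
  shows "ru' Y \<bullet> t = (t \<lhd> unit_bimod (dm (src t))) \<bullet> ru' (src t)"
  using horizontal.lu'_nat[OF reversed] assms by blast

lemma as_wl:
  assumes "bi X" "bi Y" "ar t" "dm X = cd Y" "dm Y = cd (src t)" "tgt t = Z"
  shows "as X Y Z \<bullet> (X \<bowtie> Y \<rhd> t) = (X \<rhd> (Y \<rhd> t)) \<bullet> as X Y (src t)"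
  using as_nat[of "id_cell X" "id_cell Y" t X Y Z] assms by (simp add: hc_id)

lemma as_wr:
  assumes "ar t" "bi Y" "bi Z" "dm (src t) = cd Y" "dm Y = cd Z" "tgt t = X"
  shows "as X Y Z \<bullet> (t \<lhd> Y \<lhd> Z) = (t \<lhd> (Y \<bowtie> Z)) \<bullet> as (src t) Y Z"
  using as_nat[of t "id_cell Y" "id_cell Z" X Y Z] assms by (simp add: hc_id)

lemma as_wm:
  assumes "bi X" "ar t" "bi Z" "dm X = cd (src t)" "dm (src t) = cd Z" "tgt t = Y"
  shows "as X Y Z \<bullet> ((X \<rhd> t) \<lhd> Z) = (X \<rhd> (t \<lhd> Z)) \<bullet> as X (src t) Z"
  using as_nat[of "id_cell X" t "id_cell Z" X Y Z] assms by simp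

lemma as'_wl:
  assumes "bi X" "bi Y" "ar t" "dm X = cd Y" "dm Y = cd (src t)" "tgt t = Z"
  shows "as' X Y Z \<bullet> (X \<rhd> (Y \<rhd> t)) = (X \<bowtie> Y \<rhd> t) \<bullet> as' X Y (src t)"
  using as'_nat[of "id_cell X" "id_cell Y" t X Y Z] assms by (simp add: hc_id)

lemma as'_wr:
  assumes "ar t" "bi Y" "bi Z" "dm (src t) = cd Y" "dm Y = cd Z" "tgt t = X"
  shows "as' X Y Z \<bullet> (t \<lhd> (Y \<bowtie> Z)) = (t \<lhd> Y \<lhd> Z) \<bullet> as' (src t) Y Z"
  using as'_nat[of t "id_cell Y" "id_cell Z" X Y Z] assms by (simp add: hc_id)

lemma as'_wm:
  assumes "bi X" "ar t" "bi Z" "dm X = cd (src t)" "dm (src t) = cd Z" "tgt t = Y"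
  shows "as' X Y Z \<bullet> (X \<rhd> (t \<lhd> Z)) = ((X \<rhd> t) \<lhd> Z) \<bullet> as' X (src t) Z"
  using as'_nat[of "id_cell X" t "id_cell Z" X Y Z] assms by simp

lemma wl_as_as':
  assumes "bi I" "bi H" "bi G" "bi F" "dm I = cd H" "dm H = cd G" "dm G = cd F"
  shows "(I \<rhd> as H G F) \<bullet> (I \<rhd> as' H G F) = id_cell (I \<bowtie> (H \<bowtie> (G \<bowtie> F)))"
    "(I \<rhd> as' H G F) \<bullet> (I \<rhd> as H G F) = id_cell (I \<bowtie> ((H \<bowtie> G) \<bowtie> F))"
  using assms by (simp_all add: hc_id flip: wl_vc)

lemma wr_as_as':
  assumes "bi I" "bi H" "bi G" "bi F" "dm I = cd H" "dm H = cd G" "dm G = cd F"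
  shows "(as I H G \<lhd> F) \<bullet> (as' I H G \<lhd> F) = id_cell ((I \<bowtie> (H \<bowtie> G)) \<bowtie> F)"
    "(as' I H G \<lhd> F) \<bullet> (as I H G \<lhd> F) = id_cell (((I \<bowtie> H) \<bowtie> G) \<bowtie> F)"
  using assms by (simp_all add: hc_id flip: wr_vc)

text \<open>The pentagon solved for the composite that arises when \<open>eps\<close> is evaluated
  at a tensor product; three of its edges occur inverted.\<close>

lemma pentagon_wl:
  assumes "bi I" "bi H" "bi G" "bi F" "dm I = cd H" "dm H = cd G" "dm G = cd F"
  shows "as' I H (G \<bowtie> F) \<bullet> (I \<rhd> as H G F) = as (I \<bowtie> H) G F \<bullet> (as' I H G \<lhd> F) \<bullet> as' I (H \<bowtie> G) F"
proof -
  have "as' I H (G \<bowtie> F) \<bullet> (I \<rhd> as H G F)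
     = as (I \<bowtie> H) G F \<bullet> (as' (I \<bowtie> H) G F \<bullet> as' I H (G \<bowtie> F)) \<bullet> (I \<rhd> as H G F)"
    using assms by (simp add: vc_assoc vc_cong[OF as_as'])
  also have "\<dots> = as (I \<bowtie> H) G F \<bullet> (as' I H G \<lhd> F) \<bullet> as' I (H \<bowtie> G) F"
    unfolding pentagon'[OF assms] using assms by (simp add: vc_assoc wl_as_as')
  finally show ?thesis .
qed

lemma pentagon_wr:
  assumes "bi I" "bi H" "bi G" "bi F" "dm I = cd H" "dm H = cd G" "dm G = cd F"
  shows "as (I \<bowtie> H) G F \<bullet> (as' I H G \<lhd> F) = as' I H (G \<bowtie> F) \<bullet> (I \<rhd> as H G F) \<bullet> as I (H \<bowtie> G) F"
proof -
  have "as (I \<bowtie> H) G F \<bullet> (as' I H G \<lhd> F)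
     = as' I H (G \<bowtie> F) \<bullet> (as I H (G \<bowtie> F) \<bullet> as (I \<bowtie> H) G F) \<bullet> (as' I H G \<lhd> F)"
    using assms by (simp add: vc_assoc vc_cong[OF as'_as])
  also have "\<dots> = as' I H (G \<bowtie> F) \<bullet> (I \<rhd> as H G F) \<bullet> as I (H \<bowtie> G) F"
    unfolding pentagon[OF assms] using assms by (simp add: vc_assoc wr_as_as')
  finally show ?thesis .
qed

lemma lu_ten'':
  assumes "bi G" "bi F" "dm G = cd F"
  shows "as (unit_bimod (cd G)) G F \<bullet> (lu' G \<lhd> F) = lu' (G \<bowtie> F)"
proof -
  have 1: "(lu G \<lhd> F) \<bullet> (lu' G \<lhd> F) = id_cell (G \<bowtie> F)" using assms by (simp add: hc_id flip: wr_vc)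
  have "lu' (G \<bowtie> F) = lu' (G \<bowtie> F) \<bullet> (lu G \<lhd> F) \<bullet> (lu' G \<lhd> F)"
    using assms by (simp add: 1)
  also have "\<dots> = lu' (G \<bowtie> F) \<bullet> lu (G \<bowtie> F) \<bullet> as (unit_bimod (cd G)) G F \<bullet> (lu' G \<lhd> F)"
    unfolding lu_ten[OF assms, symmetric] using assms by (simp add: vc_assoc)
  also have "\<dots> = as (unit_bimod (cd G)) G F \<bullet> (lu' G \<lhd> F)"
    using assms lu'_lu[of "G \<bowtie> F"] by (simp add: vc_cong[OF lu'_lu])
  finally show ?thesis by simp
qed

lemma triangle'':
  assumes "bi G" "bi F" "dm G = cd F"
  shows "as' G (unit_bimod (cd F)) F \<bullet> (G \<rhd> lu' F) = ru' G \<lhd> F"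
proof -
  have 1: "(G \<rhd> lu F) \<bullet> (G \<rhd> lu' F) = id_cell (G \<bowtie> F)" using assms by (simp add: hc_id flip: wl_vc)
  have 2: "(ru' G \<lhd> F) \<bullet> (ru G \<lhd> F) = id_cell ((G \<bowtie> unit_bimod (cd F)) \<bowtie> F)"
    using assms by (simp add: hc_id flip: wr_vc)
  have "ru' G \<lhd> F = (ru' G \<lhd> F) \<bullet> (G \<rhd> lu F) \<bullet> (G \<rhd> lu' F)"
    using assms by (simp add: 1)
  also have "\<dots> = (ru' G \<lhd> F) \<bullet> (ru G \<lhd> F) \<bullet> as' G (unit_bimod (cd F)) F \<bullet> (G \<rhd> lu' F)"
    unfolding triangle'[OF assms, symmetric] using assms by (simp add: vc_assoc)
  also have "\<dots> = as' G (unit_bimod (cd F)) F \<bullet> (G \<rhd> lu' F)"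
    using assms by (simp add: vc_cong[OF 2])
  finally show ?thesis by simp
qed

end

section \<open>Adjunctions\<close>

locale adj = horizontal K dm cd ten hc as as' lu lu' ru ru'
  for K :: "'k ring"
    and dm cd :: "('k,'u::infinite) bimod \<Rightarrow> ('k,'u) kcat"
    and ten (infixr \<open>\<bowtie>\<close> 70) and hc (infixr \<open>\<diamond>\<close> 70) and as as' lu lu' ru ru' +
  fixes A B :: "('k,'u) kcat" and f fs :: "('k,'u) bimod" and \<eta> \<epsilon> :: "('k,'u) cell"
  assumes bi_f [simp]: "bimodule K f" and bi_fs [simp]: "bimodule K fs"
    and dm_f [simp]: "dm f = A" and cd_f [simp]: "cd f = B"
    and dm_fs [simp]: "dm fs = B" and cd_fs [simp]: "cd fs = A"
    and ar_\<eta> [simp]: "two_cell K \<eta>" and src_\<eta> [simp]: "src \<eta> = unit_bimod A" and tgt_\<eta> [simp]: "tgt \<eta> = fs \<bowtie> f"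
    and ar_\<epsilon> [simp]: "two_cell K \<epsilon>" and src_\<epsilon> [simp]: "src \<epsilon> = f \<bowtie> fs" and tgt_\<epsilon> [simp]: "tgt \<epsilon> = unit_bimod B"
    and tri1: "lu f \<bullet> (\<epsilon> \<diamond> id_cell f) \<bullet> as' f fs f \<bullet> (id_cell f \<diamond> \<eta>) \<bullet> ru' f = id_cell f"
    and tri2: "ru fs \<bullet> (id_cell fs \<diamond> \<epsilon>) \<bullet> as fs f fs \<bullet> (\<eta> \<diamond> id_cell fs) \<bullet> lu' fs = id_cell fs"
begin

lemma unit_A [simp]: "bi (unit_bimod A)" and unit_B [simp]: "bi (unit_bimod B)"
  using unit_dm[OF bi_f] unit_cd[OF bi_f] by simp_all

text \<open>Unit and counit of the adjunction between \<open>f \<bowtie> -\<close> and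
  \<open>fs \<bowtie> -\<close>, with all constraints absorbed. Owing to the bracketing
  \<open>fs \<bowtie> (f \<bowtie> X)\<close>, naturality and the triangle identities mention no
  associator.\<close>

definition eta where "eta X = as fs f X \<bullet> (\<eta> \<lhd> X) \<bullet> lu' X"
definition eps where "eps Y = lu Y \<bullet> (\<epsilon> \<lhd> Y) \<bullet> as' f fs Y"

lemma eta_simps [simp]:
  assumes "bi X" "cd X = A"
  shows "ar (eta X)" "src (eta X) = X" "tgt (eta X) = fs \<bowtie> (f \<bowtie> X)"
  using assms by (simp_all add: eta_def)

lemma eps_simps [simp]:
  assumes "bi Y" "cd Y = B"
  shows "ar (eps Y)" "src (eps Y) = f \<bowtie> (fs \<bowtie> Y)" "tgt (eps Y) = Y"
  using assms by (simp_all add: eps_def)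

lemma eta_nat:
  assumes "ar t" "cd (src t) = A" "tgt t = Y"
  shows "eta Y \<bullet> t = (fs \<rhd> (f \<rhd> t)) \<bullet> eta (src t)"
proof -
  have c: "bi Y" "cd Y = A" using assms by auto
  have 1: "lu' Y \<bullet> t = (unit_bimod A \<rhd> t) \<bullet> lu' (src t)"
    using lu'_nat[OF assms(1,3)] assms by simp
  have 2: "(\<eta> \<lhd> Y) \<bullet> (unit_bimod A \<rhd> t) = (fs \<bowtie> f \<rhd> t) \<bullet> (\<eta> \<lhd> src t)"
    using assms by (simp add: hc_wr_wl hc_wl_wr)
  have 3: "as fs f Y \<bullet> (fs \<bowtie> f \<rhd> t) = (fs \<rhd> (f \<rhd> t)) \<bullet> as fs f (src t)"
    using assms by (intro as_wl) auto
  show ?thesis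
    using assms c by (simp add: eta_def vc_assoc 1 vc_cong[OF 2] vc_cong[OF 3])
qed

lemma eps_nat:
  assumes "ar t" "cd (src t) = B" "tgt t = Y"
  shows "eps Y \<bullet> (f \<rhd> (fs \<rhd> t)) = t \<bullet> eps (src t)"
proof -
  have c: "bi Y" "cd Y = B" using assms by auto
  have 1: "lu Y \<bullet> (unit_bimod B \<rhd> t) = t \<bullet> lu (src t)"
    using lu_natural[OF assms(1)] assms by simp
  have 2: "(\<epsilon> \<lhd> Y) \<bullet> (f \<bowtie> fs \<rhd> t) = (unit_bimod B \<rhd> t) \<bullet> (\<epsilon> \<lhd> src t)"
    using assms by (simp add: hc_wr_wl hc_wl_wr)
  have 3: "as' f fs Y \<bullet> (f \<rhd> (fs \<rhd> t)) = (f \<bowtie> fs \<rhd> t) \<bullet> as' f fs (src t)"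
    using assms by (intro as'_wl) auto
  show ?thesis
    using assms c by (simp add: eps_def vc_assoc vc_cong[OF 1] vc_cong[OF 2] 3)
qed

text \<open>The contraction at the far left does not touch the right factor: the pentagon,
  naturality of the associator and \<open>lu_ten\<close> move \<open>X\<close> out of
  \<open>eps\<close>.\<close>

lemma eps_ten:
  assumes "bi Y" "bi X" "cd Y = B" "dm Y = cd X"
  shows "eps (Y \<bowtie> X) \<bullet> (f \<rhd> as fs Y X) = (eps Y \<lhd> X) \<bullet> as' f (fs \<bowtie> Y) X"
proof -
  have 1: "as' f fs (Y \<bowtie> X) \<bullet> (f \<rhd> as fs Y X) = as (f \<bowtie> fs) Y X \<bullet> (as' f fs Y \<lhd> X) \<bullet> as' f (fs \<bowtie> Y) X"
    using assms by (intro pentagon_wl) auto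
  have 2: "(\<epsilon> \<lhd> (Y \<bowtie> X)) \<bullet> as (f \<bowtie> fs) Y X = as (unit_bimod B) Y X \<bullet> (\<epsilon> \<lhd> Y \<lhd> X)"
    using as_wr[of \<epsilon> Y X "unit_bimod B"] assms by simp
  have 3: "lu (Y \<bowtie> X) \<bullet> as (unit_bimod B) Y X = lu Y \<lhd> X"
    using lu_ten[of Y X] assms by simp
  show ?thesis
    using assms by (simp add: eps_def vc_assoc 1 vc_cong[OF 2] vc_cong[OF 3] wr_vc)
qed

lemma eta_ten:
  assumes "bi Y" "bi X" "cd Y = A" "dm Y = cd X"
  shows "(fs \<rhd> as f Y X) \<bullet> as fs (f \<bowtie> Y) X \<bullet> (eta Y \<lhd> X) = eta (Y \<bowtie> X)"
proof -
  have 1: "(fs \<rhd> as f Y X) \<bullet> as fs (f \<bowtie> Y) X \<bullet> (as fs f Y \<lhd> X) = as fs f (Y \<bowtie> X) \<bullet> as (fs \<bowtie> f) Y X"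
    using assms by (intro pentagon[symmetric]) auto
  have 2: "as (fs \<bowtie> f) Y X \<bullet> (\<eta> \<lhd> Y \<lhd> X) = (\<eta> \<lhd> (Y \<bowtie> X)) \<bullet> as (unit_bimod A) Y X"
    using as_wr[of \<eta> Y X] assms by simp
  have 3: "as (unit_bimod A) Y X \<bullet> (lu' Y \<lhd> X) = lu' (Y \<bowtie> X)"
    using lu_ten''[of Y X] assms by simp
  have "(fs \<rhd> as f Y X) \<bullet> as fs (f \<bowtie> Y) X \<bullet> (eta Y \<lhd> X)
      = ((fs \<rhd> as f Y X) \<bullet> as fs (f \<bowtie> Y) X \<bullet> (as fs f Y \<lhd> X)) \<bullet> (\<eta> \<lhd> Y \<lhd> X) \<bullet> (lu' Y \<lhd> X)"
    using assms by (simp add: eta_def vc_assoc wr_vc)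
  also have "\<dots> = eta (Y \<bowtie> X)"
    unfolding 1 using assms by (simp add: eta_def vc_assoc vc_cong[OF 2] 3)
  finally show ?thesis .
qed

text \<open>This is \<open>tri1\<close> whiskered by \<open>X\<close>; \<open>eps_ten\<close> and
  \<open>triangle''\<close> carry the whiskering through the constraints.\<close>

lemma eps_eta:
  assumes "bi X" "cd X = A"
  shows "eps (f \<bowtie> X) \<bullet> (f \<rhd> eta X) = id_cell (f \<bowtie> X)"
proof -
  have 1: "eps (f \<bowtie> X) \<bullet> (f \<rhd> as fs f X) = (eps f \<lhd> X) \<bullet> as' f (fs \<bowtie> f) X"
    using assms by (intro eps_ten) auto
  have 2: "as' f (fs \<bowtie> f) X \<bullet> (f \<rhd> (\<eta> \<lhd> X)) = ((f \<rhd> \<eta>) \<lhd> X) \<bullet> as' f (unit_bimod A) X"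
    using as'_wm[of f \<eta> X] assms by simp
  have 3: "as' f (unit_bimod A) X \<bullet> (f \<rhd> lu' X) = ru' f \<lhd> X"
    using triangle''[of f X] assms by simp
  have 4: "eps f \<bullet> (f \<rhd> \<eta>) \<bullet> ru' f = id_cell f"
    using tri1 by (simp add: eps_def vc_assoc)
  have "eps (f \<bowtie> X) \<bullet> (f \<rhd> eta X) = eps (f \<bowtie> X) \<bullet> (f \<rhd> as fs f X) \<bullet> (f \<rhd> (\<eta> \<lhd> X)) \<bullet> (f \<rhd> lu' X)"
    using assms by (simp add: eta_def wl_vc)
  also have "\<dots> = (eps f \<lhd> X) \<bullet> ((f \<rhd> \<eta>) \<lhd> X) \<bullet> (ru' f \<lhd> X)"
    using assms by (simp add: vc_cong[OF 1] vc_cong[OF 2] vc_assoc 3)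
  also have "\<dots> = (eps f \<bullet> (f \<rhd> \<eta>) \<bullet> ru' f) \<lhd> X"
    using assms by (simp add: wr_vc)
  also have "\<dots> = id_cell (f \<bowtie> X)" unfolding 4 using assms by (simp add: hc_id)
  finally show ?thesis .
qed

text \<open>This is \<open>tri2\<close> whiskered by \<open>Y\<close>, with \<open>eta_ten\<close>
  and \<open>triangle\<close> carrying the whiskering.\<close>

lemma eta_eps:
  assumes "bi Y" "cd Y = B"
  shows "(fs \<rhd> eps Y) \<bullet> eta (fs \<bowtie> Y) = id_cell (fs \<bowtie> Y)"
proof -
  have 1: "(fs \<rhd> (\<epsilon> \<lhd> Y)) \<bullet> as fs (f \<bowtie> fs) Y = as fs (unit_bimod B) Y \<bullet> ((fs \<rhd> \<epsilon>) \<lhd> Y)"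
    using as_wm[of fs \<epsilon> Y] assms by simp
  have 2: "(fs \<rhd> lu Y) \<bullet> as fs (unit_bimod B) Y = ru fs \<lhd> Y"
    using triangle[of fs Y] assms by simp
  have 3: "ru fs \<bullet> (fs \<rhd> \<epsilon>) \<bullet> eta fs = id_cell fs"
    using tri2 by (simp add: eta_def vc_assoc)
  have 4: "eta (fs \<bowtie> Y) = (fs \<rhd> as f fs Y) \<bullet> as fs (f \<bowtie> fs) Y \<bullet> (eta fs \<lhd> Y)"
    using eta_ten[of fs Y] assms by simp
  have 5: "(fs \<rhd> as' f fs Y) \<bullet> (fs \<rhd> as f fs Y) = id_cell (fs \<bowtie> ((f \<bowtie> fs) \<bowtie> Y))"
    using assms by (intro wl_as_as') auto
  have "(fs \<rhd> eps Y) \<bullet> eta (fs \<bowtie> Y) = (ru fs \<lhd> Y) \<bullet> ((fs \<rhd> \<epsilon>) \<lhd> Y) \<bullet> (eta fs \<lhd> Y)"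
    unfolding 4 using assms by (simp add: eps_def wl_vc vc_assoc vc_cong[OF 5] vc_cong[OF 1] vc_cong[OF 2])
  also have "\<dots> = (ru fs \<bullet> (fs \<rhd> \<epsilon>) \<bullet> eta fs) \<lhd> Y"
    using assms by (simp add: wr_vc)
  also have "\<dots> = id_cell (fs \<bowtie> Y)" unfolding 3 using assms by (simp add: hc_id)
  finally show ?thesis .
qed

text \<open>The two triangle identities trade places, and so do \<open>f\<close> and
  \<open>fs\<close>; \<open>\<eta>\<close> and \<open>\<epsilon>\<close> remain the same
  cells.\<close>

lemma reversed_adj:
  "adj K cd dm (\<lambda>F G. G \<bowtie> F) (\<lambda>\<sigma> \<tau>. \<tau> \<diamond> \<sigma>) (\<lambda>H G F. as' F G H) (\<lambda>H G F. as F G H) ru ru' lu lu' A B fs f \<eta> \<epsilon>"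
  by (intro adj.intro reversed adj_axioms.intro) (simp_all add: tri1 tri2)

end

context horizontal
begin

lemma pentagon_wr':
  assumes "bi I" "bi H" "bi G" "bi F" "dm I = cd H" "dm H = cd G" "dm G = cd F"
  shows "(as I H G \<lhd> F) \<bullet> as' (I \<bowtie> H) G F = as' I (H \<bowtie> G) F \<bullet> (I \<rhd> as' H G F) \<bullet> as I H (G \<bowtie> F)"
proof -
  have "(as I H G \<lhd> F) \<bullet> as' (I \<bowtie> H) G F
     = (as I H G \<lhd> F) \<bullet> (as' (I \<bowtie> H) G F \<bullet> as' I H (G \<bowtie> F)) \<bullet> as I H (G \<bowtie> F)"
    using assms by (simp add: vc_assoc)
  also have "\<dots> = as' I (H \<bowtie> G) F \<bullet> (I \<rhd> as' H G F) \<bullet> as I H (G \<bowtie> F)"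
    unfolding pentagon'[OF assms] using assms by (simp add: vc_assoc vc_cong[OF wr_as_as'(1)])
  finally show ?thesis .
qed

lemma ru_ten'':
  assumes "bi G" "bi F" "dm G = cd F"
  shows "as' G F (unit_bimod (dm F)) \<bullet> (G \<rhd> ru' F) = ru' (G \<bowtie> F)"
  using horizontal.lu_ten''[OF reversed, of F G] assms by simp

lemma lu'_ru'_unit:
  assumes "bi (unit_bimod C)"
  shows "lu' (unit_bimod C) = ru' (unit_bimod C)"
proof -
  have "lu' (unit_bimod C) = lu' (unit_bimod C) \<bullet> ru (unit_bimod C) \<bullet> ru' (unit_bimod C)"
    using assms by simp
  also have "\<dots> = ru' (unit_bimod C)"
    using assms by (simp add: vc_cong[OF lu'_lu] flip: lu_ru_unit)
  finally show ?thesis .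
qed

text \<open>Applied to constraints and to split monomorphisms alike.\<close>

lemma left_cancel:
  assumes "l \<bullet> n = id_cell X" "n \<bullet> a = n \<bullet> b" "ar n" "ar a" "ar b" "src n = X" "tgt a = X" "tgt b = X"
  shows "a = b"
proof -
  have "l \<bullet> n \<bullet> a = a" using vc_cong[OF assms(1), of a] assms(3-) by simp
  moreover have "l \<bullet> n \<bullet> b = b" using vc_cong[OF assms(1), of b] assms(3-) by simp
  ultimately show ?thesis using assms(2) by metis
qed

end

section \<open>Comonoid endomorphisms and coactions\<close>

context adj
begin

abbreviation "S \<equiv> fs \<bowtie> f"
abbreviation "C \<equiv> f \<bowtie> fs"

text \<open>Unit and counit of the adjunction between \<open>- \<bowtie> fs\<close> and
  \<open>- \<bowtie> f\<close>. They are \<open>eta\<close> and \<open>eps\<close> of the mirrored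
  structure, from which their laws are read off.\<close>

definition eta' where "eta' X = as' X fs f \<bullet> (X \<rhd> \<eta>) \<bullet> ru' X"
definition eps' where "eps' Y = ru Y \<bullet> (Y \<rhd> \<epsilon>) \<bullet> as Y f fs"

lemma eta'_simps [simp]:
  assumes "bi X" "dm X = A"
  shows "ar (eta' X)" "src (eta' X) = X" "tgt (eta' X) = (X \<bowtie> fs) \<bowtie> f"
  using assms by (simp_all add: eta'_def)

lemma eps'_simps [simp]:
  assumes "bi Y" "dm Y = B"
  shows "ar (eps' Y)" "src (eps' Y) = (Y \<bowtie> f) \<bowtie> fs" "tgt (eps' Y) = Y"
  using assms by (simp_all add: eps'_def)

lemma eta'_nat:
  assumes "ar t" "dm (src t) = A" "tgt t = Y"
  shows "eta' Y \<bullet> t = (t \<lhd> fs \<lhd> f) \<bullet> eta' (src t)"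
  using adj.eta_nat[OF reversed_adj assms] unfolding adj.eta_def[OF reversed_adj] eta'_def .

lemma eps'_nat:
  assumes "ar t" "dm (src t) = B" "tgt t = Y"
  shows "eps' Y \<bullet> (t \<lhd> f \<lhd> fs) = t \<bullet> eps' (src t)"
  using adj.eps_nat[OF reversed_adj assms] unfolding adj.eps_def[OF reversed_adj] eps'_def .

lemma eps'_eta':
  assumes "bi X" "dm X = A"
  shows "eps' (X \<bowtie> fs) \<bullet> (eta' X \<lhd> fs) = id_cell (X \<bowtie> fs)"
  using adj.eps_eta[OF reversed_adj assms]
  unfolding adj.eta_def[OF reversed_adj] adj.eps_def[OF reversed_adj] eta'_def eps'_def .

lemma eta'_eps':
  assumes "bi Y" "dm Y = B"
  shows "(eps' Y \<lhd> f) \<bullet> eta' (Y \<bowtie> f) = id_cell (Y \<bowtie> f)"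
  using adj.eta_eps[OF reversed_adj assms]
  unfolding adj.eta_def[OF reversed_adj] adj.eps_def[OF reversed_adj] eta'_def eps'_def .

lemma as_eta': "as f fs f \<bullet> eta' f = (f \<rhd> \<eta>) \<bullet> ru' f"
  by (simp add: eta'_def vc_assoc vc_cong[OF as_as'])

text \<open>The transpose of \<open>g\<close> is \<open>(g \<lhd> f) \<bullet> eta' f\<close>;
  contracting with \<open>eps'\<close> recovers \<open>g\<close> by naturality and one triangle
  identity. Equations between cells out of \<open>C\<close> may thus be tested on
  transposes.\<close>

lemma transpose_inverse:
  assumes "ar g" "src g = C" "tgt g = Z"
  shows "eps' Z \<bullet> (((g \<lhd> f) \<bullet> eta' f) \<lhd> fs) = g"
proof -
  have z: "bi Z" "dm Z = B"
    using dm_tgt[OF assms(1)] ar_bi(2)[OF assms(1)] assms(2,3) by simp_all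
  have 1: "eps' Z \<bullet> (g \<lhd> f \<lhd> fs) = g \<bullet> eps' C"
    using eps'_nat[OF assms(1), of Z] assms by simp
  have 2: "eps' C \<bullet> (eta' f \<lhd> fs) = id_cell C" by (rule eps'_eta') simp_all
  show ?thesis
    using assms z by (simp add: wr_vc vc_assoc vc_cong[OF 1] 2)
qed

lemma transpose_inj:
  assumes "ar g" "src g = C" "tgt g = Z" "ar h" "src h = C" "tgt h = Z"
    and "(g \<lhd> f) \<bullet> eta' f = (h \<lhd> f) \<bullet> eta' f"
  shows "g = h"
  using transpose_inverse[OF assms(1-3)] transpose_inverse[OF assms(4-6)] assms(7) by metis

text \<open>The transpose of \<open>g\<close>, re-bracketed to land in \<open>f \<bowtie> S\<close>
  instead of \<open>C \<bowtie> f\<close>: in this form it can be factored through cells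
  \<open>f \<rhd> incl S I\<close>.\<close>

definition coaction_of where "coaction_of g = as f fs f \<bullet> (g \<lhd> f) \<bullet> eta' f"
definition endo_of where "endo_of t = eps' C \<bullet> ((as' f fs f \<bullet> t) \<lhd> fs)"

lemma coaction_of_simps [simp]:
  assumes "ar g" "src g = C" "tgt g = C"
  shows "ar (coaction_of g)" "src (coaction_of g) = f" "tgt (coaction_of g) = f \<bowtie> S"
  using assms by (simp_all add: coaction_of_def)

lemma endo_of_simps [simp]:
  assumes "ar t" "src t = f" "tgt t = f \<bowtie> S"
  shows "ar (endo_of t)" "src (endo_of t) = C" "tgt (endo_of t) = C"
  using assms by (simp_all add: endo_of_def)

lemma as'_coaction_of:
  assumes "ar g" "src g = C" "tgt g = C"
  shows "as' f fs f \<bullet> coaction_of g = (g \<lhd> f) \<bullet> eta' f"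
  using assms by (simp add: coaction_of_def vc_cong[OF as'_as])

lemma endo_of_coaction_of:
  assumes "ar g" "src g = C" "tgt g = C"
  shows "endo_of (coaction_of g) = g"
  using transpose_inverse[OF assms] assms by (simp add: endo_of_def as'_coaction_of)

lemma coaction_of_endo_of:
  assumes "ar t" "src t = f" "tgt t = f \<bowtie> S"
  shows "coaction_of (endo_of t) = t"
proof -
  have 1: "((as' f fs f \<bullet> t) \<lhd> fs \<lhd> f) \<bullet> eta' f = eta' (C \<bowtie> f) \<bullet> as' f fs f \<bullet> t"
    using eta'_nat[of "as' f fs f \<bullet> t" "C \<bowtie> f"] assms by simp
  have 2: "(eps' C \<lhd> f) \<bullet> eta' (C \<bowtie> f) = id_cell (C \<bowtie> f)" by (rule eta'_eps') simp_all
  have "coaction_of (endo_of t) = as f fs f \<bullet> (eps' C \<lhd> f) \<bullet> ((as' f fs f \<bullet> t) \<lhd> fs \<lhd> f) \<bullet> eta' f"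
    unfolding coaction_of_def endo_of_def
    using assms wr_vc[of f "eps' C" "(as' f fs f \<bullet> t) \<lhd> fs"] by (simp add: vc_assoc)
  also have "\<dots> = t" unfolding 1 using assms by (simp add: vc_cong[OF 2] vc_cong[OF as_as'])
  finally show ?thesis .
qed

definition Delta where "Delta = as' f fs C \<bullet> (f \<rhd> eta fs)"

lemma Delta_simps [simp]: "ar Delta" "src Delta = C" "tgt Delta = C \<bowtie> C"
  by (simp_all add: Delta_def)

text \<open>The comodule laws of \<open>C\<close> on \<open>f\<close>, re-bracketed: the counit then
  acts by \<open>eps f\<close> and the comultiplication by \<open>f \<rhd> eta S\<close>.\<close>

definition coaction where
  "coaction t \<longleftrightarrow> ar t \<and> src t = f \<and> tgt t = f \<bowtie> S \<and> eps f \<bullet> t = id_cell f \<and>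
     (f \<rhd> (fs \<rhd> t)) \<bullet> t = (f \<rhd> eta S) \<bullet> t"

definition comonoid_endo where
  "comonoid_endo g \<longleftrightarrow> ar g \<and> src g = C \<and> tgt g = C \<and> Delta \<bullet> g = (g \<diamond> g) \<bullet> Delta \<and> \<epsilon> \<bullet> g = \<epsilon>"

text \<open>\<open>eps f \<bullet> coaction_of g\<close> is the transpose of
  \<open>\<epsilon> \<bullet> g\<close> followed by the invertible \<open>lu f\<close>, and for
  \<open>\<epsilon>\<close> itself this composite is the identity by \<open>tri1\<close>.\<close>

lemma counit_iff:
  assumes "ar g" "src g = C" "tgt g = C"
  shows "\<epsilon> \<bullet> g = \<epsilon> \<longleftrightarrow> eps f \<bullet> coaction_of g = id_cell f"
proof -
  have 1: "eps f \<bullet> coaction_of g = lu f \<bullet> ((\<epsilon> \<bullet> g) \<lhd> f) \<bullet> eta' f"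
    using assms by (simp add: eps_def coaction_of_def vc_assoc vc_cong[OF as'_as] wr_vc)
  have 2: "lu f \<bullet> (\<epsilon> \<lhd> f) \<bullet> eta' f = id_cell f"
    using tri1 by (simp add: eta'_def)
  have l: "lu' f \<bullet> lu f = id_cell (unit_bimod B \<bowtie> f)" by simp
  show ?thesis
  proof
    assume "eps f \<bullet> coaction_of g = id_cell f"
    then have "lu f \<bullet> ((\<epsilon> \<bullet> g) \<lhd> f) \<bullet> eta' f = lu f \<bullet> (\<epsilon> \<lhd> f) \<bullet> eta' f" using 1 2 by simp
    then have "((\<epsilon> \<bullet> g) \<lhd> f) \<bullet> eta' f = (\<epsilon> \<lhd> f) \<bullet> eta' f"
      by (rule left_cancel[OF l]) (use assms in simp_all)
    then show "\<epsilon> \<bullet> g = \<epsilon>"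
      by (rule transpose_inj[rotated 6]) (use assms in simp_all)
  qed (use 1 2 in simp)
qed

lemma eta_unit: "eta (unit_bimod A) = (fs \<rhd> ru' f) \<bullet> \<eta>"
proof -
  have 1: "(\<eta> \<lhd> unit_bimod A) \<bullet> ru' (unit_bimod A) = ru' S \<bullet> \<eta>"
    using ru'_nat[of \<eta> S] by simp
  have 2: "ru' S = as' fs f (unit_bimod A) \<bullet> (fs \<rhd> ru' f)"
    using ru_ten''[of fs f] by simp
  show ?thesis
    by (simp add: eta_def lu'_ru'_unit 1 2 vc_assoc vc_cong[OF as_as'])
qed

text \<open>Naturality of \<open>eta\<close> at \<open>\<eta>\<close>: the two ways of inserting a
  pair of units agree.\<close>

lemma eta_S_\<eta>: "eta S \<bullet> \<eta> = (fs \<rhd> (as f fs f \<bullet> eta' f)) \<bullet> \<eta>"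
  using eta_nat[of \<eta> S] by (simp add: eta_unit as_eta' wl_vc vc_assoc)

text \<open>The origin of \<open>eta S\<close> in the coassociativity law: \<open>Delta\<close> uses
  the unit at \<open>fs\<close>, and \<open>eta_ten\<close> merges the remaining factor
  \<open>f\<close> into it.\<close>

lemma comult_transpose:
  "(f \<rhd> (fs \<rhd> as f fs f)) \<bullet> as f fs (C \<bowtie> f) \<bullet> as C C f \<bullet> (Delta \<lhd> f) = (f \<rhd> eta S) \<bullet> as f fs f"
proof -
  have 1: "as C C f \<bullet> (as' f fs C \<lhd> f) = as' f fs (C \<bowtie> f) \<bullet> (f \<rhd> as fs C f) \<bullet> as f (fs \<bowtie> C) f"
    by (rule pentagon_wr) simp_all
  have 2: "as f (fs \<bowtie> C) f \<bullet> ((f \<rhd> eta fs) \<lhd> f) = (f \<rhd> (eta fs \<lhd> f)) \<bullet> as f fs f"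
    using as_wm[of f "eta fs" f] by simp
  have 3: "(f \<rhd> (fs \<rhd> as f fs f)) \<bullet> (f \<rhd> as fs C f) \<bullet> (f \<rhd> (eta fs \<lhd> f)) = f \<rhd> eta S"
    using eta_ten[of fs f] by (simp flip: wl_vc)
  have "(f \<rhd> (fs \<rhd> as f fs f)) \<bullet> as f fs (C \<bowtie> f) \<bullet> as C C f \<bullet> (Delta \<lhd> f)
    = ((f \<rhd> (fs \<rhd> as f fs f)) \<bullet> (f \<rhd> as fs C f) \<bullet> (f \<rhd> (eta fs \<lhd> f))) \<bullet> as f fs f"
    by (simp add: Delta_def wr_vc vc_cong[OF 1] vc_assoc vc_cong[OF as_as'] 2)
  then show ?thesis unfolding 3 .
qed

text \<open>After the invertible re-bracketing \<open>?N\<close> both sides insert two units next to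
  \<open>f\<close>, and \<open>eta_S_\<eta>\<close> identifies the two insertions.\<close>

lemma comult_eta': "as C C f \<bullet> (Delta \<lhd> f) \<bullet> eta' f = (C \<rhd> eta' f) \<bullet> eta' f"
proof -
  let ?N = "(f \<rhd> (fs \<rhd> as f fs f)) \<bullet> as f fs (C \<bowtie> f)"
  have 1: "(f \<rhd> (fs \<rhd> as' f fs f)) \<bullet> (f \<rhd> (fs \<rhd> as f fs f)) = id_cell (f \<bowtie> (fs \<bowtie> (C \<bowtie> f)))"
    by (simp add: hc_id flip: wl_vc)
  have N: "(as' f fs (C \<bowtie> f) \<bullet> (f \<rhd> (fs \<rhd> as' f fs f))) \<bullet> ?N = id_cell (C \<bowtie> (C \<bowtie> f))"
    by (simp add: vc_assoc vc_cong[OF 1])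
  have 2: "as f fs (C \<bowtie> f) \<bullet> (C \<rhd> eta' f) = (f \<rhd> (fs \<rhd> eta' f)) \<bullet> as f fs f"
    using as_wl[of f fs "eta' f"] by simp
  have "?N \<bullet> as C C f \<bullet> (Delta \<lhd> f) \<bullet> eta' f
    = ((f \<rhd> (fs \<rhd> as f fs f)) \<bullet> as f fs (C \<bowtie> f) \<bullet> as C C f \<bullet> (Delta \<lhd> f)) \<bullet> eta' f"
    by (simp add: vc_assoc)
  also have "\<dots> = (f \<rhd> (eta S \<bullet> \<eta>)) \<bullet> ru' f"
    unfolding comult_transpose by (simp add: vc_assoc as_eta' wl_vc)
  also have "\<dots> = (f \<rhd> (fs \<rhd> (as f fs f \<bullet> eta' f))) \<bullet> (as f fs f \<bullet> eta' f)"
    unfolding eta_S_\<eta> by (simp add: vc_assoc as_eta' wl_vc)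
  also have "\<dots> = ?N \<bullet> (C \<rhd> eta' f) \<bullet> eta' f"
    by (simp add: vc_assoc vc_cong[OF 2] wl_vc)
  finally show ?thesis
    by (rule left_cancel[OF N]) simp_all
qed

text \<open>Both sides of the comultiplicativity equation are transposed and followed by the same
  invertible re-bracketing \<open>?J\<close>. The first becomes the coaction followed by
  \<open>f \<rhd> eta S\<close>, the second the coaction applied twice; transposition is
  injective.\<close>

lemma comult_iff:
  assumes g: "ar g" "src g = C" "tgt g = C"
  shows "Delta \<bullet> g = (g \<diamond> g) \<bullet> Delta \<longleftrightarrow> (f \<rhd> (fs \<rhd> coaction_of g)) \<bullet> coaction_of g = (f \<rhd> eta S) \<bullet> coaction_of g"
proof -
  let ?N = "(f \<rhd> (fs \<rhd> as f fs f)) \<bullet> as f fs (C \<bowtie> f)"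
  let ?J = "?N \<bullet> as C C f"
  let ?t = "(g \<lhd> f) \<bullet> eta' f"
  have 1: "(f \<rhd> (fs \<rhd> as' f fs f)) \<bullet> (f \<rhd> (fs \<rhd> as f fs f)) = id_cell (f \<bowtie> (fs \<bowtie> (C \<bowtie> f)))"
    by (simp add: hc_id flip: wl_vc)
  have J: "(as' C C f \<bullet> as' f fs (C \<bowtie> f) \<bullet> (f \<rhd> (fs \<rhd> as' f fs f))) \<bullet> ?J = id_cell ((C \<bowtie> C) \<bowtie> f)"
    by (simp add: vc_assoc vc_cong[OF 1] vc_cong[OF as'_as])
  have "?J \<bullet> ((Delta \<bullet> g) \<lhd> f) \<bullet> eta' f
    = ((f \<rhd> (fs \<rhd> as f fs f)) \<bullet> as f fs (C \<bowtie> f) \<bullet> as C C f \<bullet> (Delta \<lhd> f)) \<bullet> ?t"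
    using g by (simp add: vc_assoc wr_vc)
  also have "\<dots> = (f \<rhd> eta S) \<bullet> coaction_of g"
    unfolding comult_transpose using g by (simp add: vc_assoc coaction_of_def)
  finally have L: "?J \<bullet> ((Delta \<bullet> g) \<lhd> f) \<bullet> eta' f = (f \<rhd> eta S) \<bullet> coaction_of g" .
  have 2: "as C C f \<bullet> ((g \<diamond> g) \<lhd> f) = (g \<diamond> (g \<lhd> f)) \<bullet> as C C f"
    using as_nat[of g g "id_cell f"] g by simp
  have 3: "(g \<diamond> (g \<lhd> f)) \<bullet> (C \<rhd> eta' f) = (C \<rhd> ?t) \<bullet> (g \<lhd> f)"
    using hc_vcomp[of g "id_cell C" "g \<lhd> f" "eta' f"] hc_wl_wr[of g ?t C f] g by simp
  have 4: "as f fs (C \<bowtie> f) \<bullet> (C \<rhd> ?t) = (f \<rhd> (fs \<rhd> ?t)) \<bullet> as f fs f"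
    using as_wl[of f fs ?t] g by simp
  have "?J \<bullet> (((g \<diamond> g) \<bullet> Delta) \<lhd> f) \<bullet> eta' f = ?N \<bullet> (g \<diamond> (g \<lhd> f)) \<bullet> as C C f \<bullet> (Delta \<lhd> f) \<bullet> eta' f"
    using g by (simp add: vc_assoc wr_vc vc_cong[OF 2])
  also have "\<dots> = ?N \<bullet> (C \<rhd> ?t) \<bullet> ?t"
    unfolding comult_eta' using g by (simp add: vc_assoc vc_cong[OF 3])
  also have "\<dots> = (f \<rhd> (fs \<rhd> as f fs f)) \<bullet> (f \<rhd> (fs \<rhd> ?t)) \<bullet> as f fs f \<bullet> ?t"
    using g vc_cong[OF 4, of ?t] by (simp add: vc_assoc)
  also have "\<dots> = (f \<rhd> (fs \<rhd> coaction_of g)) \<bullet> coaction_of g"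
    using g by (simp add: coaction_of_def vc_assoc wl_vc)
  finally have R: "?J \<bullet> (((g \<diamond> g) \<bullet> Delta) \<lhd> f) \<bullet> eta' f = (f \<rhd> (fs \<rhd> coaction_of g)) \<bullet> coaction_of g" .
  show ?thesis
  proof
    assume "(f \<rhd> (fs \<rhd> coaction_of g)) \<bullet> coaction_of g = (f \<rhd> eta S) \<bullet> coaction_of g"
    then have "?J \<bullet> ((Delta \<bullet> g) \<lhd> f) \<bullet> eta' f = ?J \<bullet> (((g \<diamond> g) \<bullet> Delta) \<lhd> f) \<bullet> eta' f" using L R by simp
    then have "((Delta \<bullet> g) \<lhd> f) \<bullet> eta' f = (((g \<diamond> g) \<bullet> Delta) \<lhd> f) \<bullet> eta' f"
      by (rule left_cancel[OF J]) (use g in simp_all)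
    then show "Delta \<bullet> g = (g \<diamond> g) \<bullet> Delta"
      by (rule transpose_inj[rotated 6]) (use g in simp_all)
  next
    assume "Delta \<bullet> g = (g \<diamond> g) \<bullet> Delta"
    then show "(f \<rhd> (fs \<rhd> coaction_of g)) \<bullet> coaction_of g = (f \<rhd> eta S) \<bullet> coaction_of g" using L R by simp
  qed
qed

lemma comonoid_endo_iff_coaction:
  assumes "ar g" "src g = C" "tgt g = C"
  shows "comonoid_endo g \<longleftrightarrow> coaction (coaction_of g)"
  using counit_iff[OF assms] comult_iff[OF assms] assms by (auto simp: comonoid_endo_def coaction_def)

end

lemma is_inverseI:
  "two_cell K \<sigma> \<Longrightarrow> src \<sigma> = tgt \<tau> \<Longrightarrow> tgt \<sigma> = src \<tau> \<Longrightarrow> \<sigma> \<bullet> \<tau> = id_cell (src \<tau>)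
     \<Longrightarrow> \<tau> \<bullet> \<sigma> = id_cell (tgt \<tau>) \<Longrightarrow> is_inverse K \<tau> \<sigma>"
  by (simp add: is_inverse_iff)

section \<open>The comparison map\<close>

context adj
begin

definition sub_xi where "sub_xi I = eps f \<bullet> (f \<rhd> incl S I)"
text \<open>The condition is put on \<open>sub_xi\<close>, a cell into \<open>f\<close>, rather than
  on the multiplication into \<open>S\<close>, because the inverse of \<open>sub_xi\<close> is the
  ingredient of the coaction. \<open>iso_mulS_iff\<close> compares the two conditions.\<close>

definition inv_subs where "inv_subs = {I. subbimodule K S I \<and> iso_cell K (sub_xi I)}"
definition sub_coaction where "sub_coaction I = (f \<rhd> incl S I) \<bullet> inv_cell K (sub_xi I)"
definition gamma where "gamma I = endo_of (sub_coaction I)"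
definition mulS where "mulS = (fs \<rhd> eps f) \<bullet> as fs f S"
definition prodS where "prodS I J = image_cell (mulS \<bullet> (incl S I \<diamond> incl S J))"

lemma sub_simps [simp]:
  assumes "subbimodule K S I"
  shows "bi (sub_bimod S I)" "ar (incl S I)"
  using sub_bimod_bimodule[OF _ assms] incl_two_cell[OF _ assms] by simp_all

lemma mulS_simps [simp]: "ar mulS" "src mulS = S \<bowtie> S" "tgt mulS = S"
  by (simp_all add: mulS_def)

lemma sub_xi_simps [simp]:
  assumes "subbimodule K S I"
  shows "ar (sub_xi I)" "src (sub_xi I) = f \<bowtie> sub_bimod S I" "tgt (sub_xi I) = f"
  using assms by (simp_all add: sub_xi_def)

lemma inv_subs_sub: "I \<in> inv_subs \<Longrightarrow> subbimodule K S I"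
  by (simp add: inv_subs_def)

lemma inv_sub_xi [simp]:
  assumes "I \<in> inv_subs"
  shows "ar (inv_cell K (sub_xi I))" "src (inv_cell K (sub_xi I)) = f" "tgt (inv_cell K (sub_xi I)) = f \<bowtie> sub_bimod S I"
    "inv_cell K (sub_xi I) \<bullet> sub_xi I = id_cell (f \<bowtie> sub_bimod S I)" "sub_xi I \<bullet> inv_cell K (sub_xi I) = id_cell f"
  using inv_cell_props[of K "sub_xi I"] assms inv_subs_sub[OF assms] by (simp_all add: inv_subs_def)

lemma sub_coaction_simps [simp]:
  assumes "I \<in> inv_subs"
  shows "ar (sub_coaction I)" "src (sub_coaction I) = f" "tgt (sub_coaction I) = f \<bowtie> S"
  using assms inv_subs_sub[OF assms] by (simp_all add: sub_coaction_def)

text \<open>The inclusion is the transpose of \<open>sub_xi I\<close> under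
  \<open>f \<bowtie> -\<close>, by naturality of \<open>eta\<close> and a triangle identity.\<close>

lemma wl_sub_xi_eta:
  assumes "subbimodule K S I"
  shows "(fs \<rhd> sub_xi I) \<bullet> eta (sub_bimod S I) = incl S I"
proof -
  have 1: "(fs \<rhd> (f \<rhd> incl S I)) \<bullet> eta (sub_bimod S I) = eta S \<bullet> incl S I"
    using eta_nat[of "incl S I" S] assms by simp
  have 2: "(fs \<rhd> eps f) \<bullet> eta S = id_cell S" by (rule eta_eps) simp_all
  show ?thesis
    using assms by (simp add: sub_xi_def wl_vc vc_assoc 1 vc_cong[OF 2])
qed

text \<open>Inverting \<open>\<xi>\<close> in \<open>wl_sub_xi_eta\<close> turns the inclusion into
  the unit at \<open>I\<close>, and naturality of \<open>eta\<close> does the rest. The equation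
  places \<open>I\<close> inside the equalizer of \<open>fs \<rhd> sub_coaction I\<close> and
  \<open>eta S\<close>.\<close>

lemma wl_sub_coaction_incl:
  assumes "I \<in> inv_subs"
  shows "(fs \<rhd> sub_coaction I) \<bullet> incl S I = eta S \<bullet> incl S I"
proof -
  note s = inv_subs_sub[OF assms]
  have 1: "(fs \<rhd> inv_cell K (sub_xi I)) \<bullet> (fs \<rhd> sub_xi I) = id_cell (fs \<bowtie> (f \<bowtie> sub_bimod S I))"
    using assms s by (simp add: hc_id flip: wl_vc)
  have 2: "(fs \<rhd> inv_cell K (sub_xi I)) \<bullet> incl S I = eta (sub_bimod S I)"
    unfolding wl_sub_xi_eta[OF s, symmetric] using assms s by (simp add: vc_cong[OF 1])
  show ?thesis
    using eta_nat[of "incl S I" S] assms s by (simp add: sub_coaction_def wl_vc vc_assoc 2)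
qed

lemma eps_sub_coaction:
  assumes "I \<in> inv_subs"
  shows "eps f \<bullet> sub_coaction I = id_cell f"
proof -
  have "eps f \<bullet> sub_coaction I = (eps f \<bullet> (f \<rhd> incl S I)) \<bullet> inv_cell K (sub_xi I)"
    using assms inv_subs_sub[OF assms] by (simp add: sub_coaction_def vc_assoc)
  then show ?thesis unfolding sub_xi_def[symmetric] using assms by simp
qed

text \<open>Coassociativity is \<open>wl_sub_coaction_incl\<close> whiskered by \<open>f\<close> and
  composed with the inverse of \<open>\<xi>\<close>.\<close>

lemma coaction_sub_coaction:
  assumes "I \<in> inv_subs"
  shows "coaction (sub_coaction I)"
proof -
  note s = inv_subs_sub[OF assms]
  have "(f \<rhd> (fs \<rhd> sub_coaction I)) \<bullet> sub_coaction I = (f \<rhd> ((fs \<rhd> sub_coaction I) \<bullet> incl S I)) \<bullet> inv_cell K (sub_xi I)"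
    using assms s by (simp add: sub_coaction_def[of I] wl_vc vc_assoc)
  also have "\<dots> = (f \<rhd> eta S) \<bullet> sub_coaction I"
    unfolding wl_sub_coaction_incl[OF assms] using assms s by (simp add: sub_coaction_def wl_vc vc_assoc)
  finally show ?thesis
    using assms eps_sub_coaction[OF assms] by (simp add: coaction_def)
qed

text \<open>\<open>\<mu>\<close> is a surjection \<open>\<pi>\<close> followed by the inclusion of
  its image, and \<open>(f \<rhd> \<pi>) \<bullet> \<kappa>'\<close> is the inverse of
  \<open>\<xi>\<close>. As a right inverse it is immediate; as a left inverse it is tested after
  \<open>f \<rhd> \<pi>\<close>, an epimorphism by \<open>ten_epi\<close>.\<close>

lemma image_inv_subs:
  assumes \<mu>: "ar \<mu>" "tgt \<mu> = S" and \<kappa>: "is_inverse K (eps f \<bullet> (f \<rhd> \<mu>)) \<kappa>'"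
  shows "image_cell \<mu> \<in> inv_subs" "sub_coaction (image_cell \<mu>) = (f \<rhd> \<mu>) \<bullet> \<kappa>'"
proof -
  let ?L = "image_cell \<mu>"
  have s: "subbimodule K S ?L" using image_subbimodule[OF \<mu>(1)] \<mu>(2) by simp
  have c: "cd (src \<mu>) = A" "dm (src \<mu>) = A" "bi (src \<mu>)"
    using cd_tgt[OF \<mu>(1)] dm_tgt[OF \<mu>(1)] \<mu> by simp_all
  obtain \<pi> where p: "ar \<pi>" "src \<pi> = src \<mu>" "tgt \<pi> = sub_bimod S ?L" "incl S ?L \<bullet> \<pi> = \<mu>" "surj_cell \<pi>"
    using image_factor[OF \<mu>(1)] \<mu>(2) by metis
  have k: "ar \<kappa>'" "src \<kappa>' = f" "tgt \<kappa>' = f \<bowtie> src \<mu>" 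
    "\<kappa>' \<bullet> eps f \<bullet> (f \<rhd> \<mu>) = id_cell (f \<bowtie> src \<mu>)" "(eps f \<bullet> (f \<rhd> \<mu>)) \<bullet> \<kappa>' = id_cell f"
    using \<kappa> c \<mu> by (simp_all add: is_inverse_iff)
  have 1: "(f \<rhd> incl S ?L) \<bullet> (f \<rhd> \<pi>) = f \<rhd> \<mu>"
    using s p c by (simp flip: wl_vc)
  have x: "sub_xi ?L \<bullet> (f \<rhd> \<pi>) = eps f \<bullet> (f \<rhd> \<mu>)"
    using s p c by (simp add: sub_xi_def vc_assoc 1)
  let ?i = "(f \<rhd> \<pi>) \<bullet> \<kappa>'"
  have i: "ar ?i" "src ?i = f" "tgt ?i = f \<bowtie> sub_bimod S ?L" using p k c s by simp_all
  have r: "sub_xi ?L \<bullet> ?i = id_cell f"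
    using s p k c by (simp add: vc_cong[OF x])
  have e: "epi_cell K (f \<rhd> \<pi>)" using ten_epi[of f \<pi>] p c by simp
  have "(?i \<bullet> sub_xi ?L) \<bullet> (f \<rhd> \<pi>) = (f \<rhd> \<pi>) \<bullet> \<kappa>' \<bullet> eps f \<bullet> (f \<rhd> \<mu>)"
    using s p k(1-3) c by (simp add: vc_assoc x)
  also have "\<dots> = id_cell (f \<bowtie> sub_bimod S ?L) \<bullet> (f \<rhd> \<pi>)"
    unfolding k(4) using p c by simp
  finally have l: "?i \<bullet> sub_xi ?L = id_cell (f \<bowtie> sub_bimod S ?L)"
    using e[unfolded epi_cell_def, rule_format, of "?i \<bullet> sub_xi ?L" "id_cell (f \<bowtie> sub_bimod S ?L)"] s i p c by simp
  have inv: "is_inverse K (sub_xi ?L) ?i"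
    using s by (intro is_inverseI) (simp_all add: i l r del: hc_src hc_tgt vcomp_simps)
  show "?L \<in> inv_subs" using s iso_cellI[OF _ inv] by (simp add: inv_subs_def)
  have "inv_cell K (sub_xi ?L) = ?i" using s by (intro inv_cell_eq[OF _ inv]) simp
  then show "sub_coaction ?L = (f \<rhd> \<mu>) \<bullet> \<kappa>'"
    using s p k c by (simp add: sub_coaction_def vc_cong[OF 1])
qed

text \<open>In \<open>Y \<bowtie> f \<bowtie> fs \<bowtie> f\<close> the inner pair
  \<open>f \<bowtie> fs\<close> is contracted to a unit; whether this unit is absorbed by
  \<open>Y\<close> or by the last \<open>f\<close> makes no difference, by the triangle law.\<close>

lemma eps'_wr:
  assumes "bi Y" "dm Y = B"
  shows "(eps' Y \<lhd> f) \<bullet> as' (Y \<bowtie> f) fs f = (Y \<rhd> eps f) \<bullet> as Y f S"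
proof -
  have 1: "(as Y f fs \<lhd> f) \<bullet> as' (Y \<bowtie> f) fs f = as' Y C f \<bullet> (Y \<rhd> as' f fs f) \<bullet> as Y f S"
    using assms by (intro pentagon_wr') simp_all
  have 2: "((Y \<rhd> \<epsilon>) \<lhd> f) \<bullet> as' Y C f = as' Y (unit_bimod B) f \<bullet> (Y \<rhd> (\<epsilon> \<lhd> f))"
    using as'_wm[of Y \<epsilon> f] assms by simp
  have 3: "(ru Y \<lhd> f) \<bullet> as' Y (unit_bimod B) f = Y \<rhd> lu f"
    using triangle'[of Y f] assms by simp
  show ?thesis
    using assms by (simp add: eps'_def eps_def wr_vc wl_vc vc_assoc 1 vc_cong[OF 2] vc_cong[OF 3])
qed

text \<open>Contracting \<open>f \<bowtie> I \<bowtie> J\<close> through the multiplication amounts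
  to absorbing first \<open>I\<close>, then \<open>J\<close>, since naturality of \<open>eps\<close>
  lets the counits be applied from the left in turn. The cell is thereby a composite of invertible
  ones.\<close>

lemma product_kappa:
  assumes "I \<in> inv_subs" "J \<in> inv_subs"
  shows "eps f \<bullet> (f \<rhd> (mulS \<bullet> (incl S I \<diamond> incl S J)))
    = sub_xi J \<bullet> (sub_xi I \<lhd> sub_bimod S J) \<bullet> as' f (sub_bimod S I) (sub_bimod S J)"
proof -
  note s = inv_subs_sub[OF assms(1)] inv_subs_sub[OF assms(2)]
  let ?X = "sub_bimod S I" and ?Y = "sub_bimod S J"
  let ?i = "incl S I" and ?j = "incl S J"
  have 1: "eps f \<bullet> (f \<rhd> (fs \<rhd> eps f)) = eps f \<bullet> eps (f \<bowtie> S)"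
    using eps_nat[of "eps f" f] by simp
  have 2: "eps (f \<bowtie> S) \<bullet> (f \<rhd> as fs f S) = (eps f \<lhd> S) \<bullet> as' f S S"
    by (rule eps_ten) simp_all
  have 3: "as' f S S \<bullet> (f \<rhd> (?i \<lhd> S)) = ((f \<rhd> ?i) \<lhd> S) \<bullet> as' f ?X S"
    using as'_wm[of f ?i S] s by simp
  have 4: "as' f ?X S \<bullet> (f \<rhd> (?X \<rhd> ?j)) = (f \<bowtie> ?X \<rhd> ?j) \<bullet> as' f ?X ?Y"
    using as'_wl[of f ?X ?j] s by simp
  have 5: "?i \<diamond> ?j = (?i \<lhd> S) \<bullet> (?X \<rhd> ?j)"
    using s by (simp add: hc_wr_wl)
  have 6: "(sub_xi I \<lhd> S) \<bullet> (f \<bowtie> ?X \<rhd> ?j) = (f \<rhd> ?j) \<bullet> (sub_xi I \<lhd> ?Y)"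
    using s by (simp add: hc_wr_wl hc_wl_wr)
  have "eps f \<bullet> (f \<rhd> (mulS \<bullet> (?i \<diamond> ?j)))
     = eps f \<bullet> (f \<rhd> (fs \<rhd> eps f)) \<bullet> (f \<rhd> as fs f S) \<bullet> (f \<rhd> (?i \<lhd> S)) \<bullet> (f \<rhd> (?X \<rhd> ?j))"
    unfolding 5 using s by (simp add: mulS_def wl_vc vc_assoc)
  also have "\<dots> = eps f \<bullet> (eps f \<lhd> S) \<bullet> ((f \<rhd> ?i) \<lhd> S) \<bullet> (f \<bowtie> ?X \<rhd> ?j) \<bullet> as' f ?X ?Y"
    using s by (simp add: vc_cong[OF 1] vc_assoc vc_cong[OF 2] vc_cong[OF 3] 4)
  also have "\<dots> = eps f \<bullet> (sub_xi I \<lhd> S) \<bullet> (f \<bowtie> ?X \<rhd> ?j) \<bullet> as' f ?X ?Y"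
    using s by (simp add: sub_xi_def[of I] wr_vc vc_assoc)
  also have "\<dots> = sub_xi J \<bullet> (sub_xi I \<lhd> ?Y) \<bullet> as' f ?X ?Y"
    using s by (simp add: vc_cong[OF 6] sub_xi_def[of J] vc_assoc)
  finally show ?thesis .
qed

lemma product_inverse:
  assumes "I \<in> inv_subs" "J \<in> inv_subs"
  shows "is_inverse K (eps f \<bullet> (f \<rhd> (mulS \<bullet> (incl S I \<diamond> incl S J))))
    (as f (sub_bimod S I) (sub_bimod S J) \<bullet> (inv_cell K (sub_xi I) \<lhd> sub_bimod S J) \<bullet> inv_cell K (sub_xi J))"
proof -
  note s = inv_subs_sub[OF assms(1)] inv_subs_sub[OF assms(2)]
  let ?X = "sub_bimod S I" and ?Y = "sub_bimod S J"
  have 1: "(inv_cell K (sub_xi I) \<lhd> ?Y) \<bullet> (sub_xi I \<lhd> ?Y) = id_cell ((f \<bowtie> ?X) \<bowtie> ?Y)"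
    "(sub_xi I \<lhd> ?Y) \<bullet> (inv_cell K (sub_xi I) \<lhd> ?Y) = id_cell (f \<bowtie> ?Y)"
    using assms s by (simp_all add: hc_id flip: wr_vc)
  show ?thesis
    unfolding product_kappa[OF assms]
    using assms s by (intro is_inverseI)
      (simp_all add: vc_assoc vc_cong[OF inv_sub_xi(4)] vc_cong[OF 1(1)] vc_cong[OF 1(2)] vc_cong[OF as'_as])
qed

text \<open>The right side is the coaction that \<open>image_inv_subs\<close> attaches to the
  multiplication on the two subbimodules, with the inverse taken from
  \<open>product_inverse\<close>. In the transpose of \<open>gamma I \<bullet> gamma J\<close> the
  contraction contained in \<open>gamma I\<close> is moved by naturality until it meets the two
  inclusions and forms \<open>mulS\<close> with them.\<close>

lemma coaction_of_product:
  assumes "I \<in> inv_subs" "J \<in> inv_subs"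
  shows "coaction_of (gamma I \<bullet> gamma J) = (f \<rhd> (mulS \<bullet> (incl S I \<diamond> incl S J))) \<bullet>
    as f (sub_bimod S I) (sub_bimod S J) \<bullet> (inv_cell K (sub_xi I) \<lhd> sub_bimod S J) \<bullet> inv_cell K (sub_xi J)"
proof -
  note s = inv_subs_sub[OF assms(1)] inv_subs_sub[OF assms(2)]
  let ?X = "sub_bimod S I" and ?Y = "sub_bimod S J"
  let ?i = "incl S I" and ?j = "incl S J" and ?k = "inv_cell K (sub_xi I)" and ?l = "inv_cell K (sub_xi J)"
  let ?u = "as' f fs f \<bullet> sub_coaction I"
  have g: "ar (gamma I)" "src (gamma I) = C" "tgt (gamma I) = C" "ar (gamma J)" "src (gamma J) = C" "tgt (gamma J) = C"
    using assms by (simp_all add: gamma_def)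
  have u: "ar ?u" "src ?u = f" "tgt ?u = C \<bowtie> f" using assms by simp_all
  \<comment> \<open>Only \<open>gamma J\<close> meets the unit \<open>eta' f\<close> and turns into
    its coaction; \<open>gamma I\<close> keeps the contraction \<open>eps'\<close> from its
    definition.\<close>
  have 0: "(gamma J \<lhd> f) \<bullet> eta' f = as' f fs f \<bullet> (f \<rhd> ?j) \<bullet> ?l"
    using as'_coaction_of[OF g(4-6)] coaction_of_endo_of[OF sub_coaction_simps[OF assms(2)]] unfolding gamma_def sub_coaction_def by metis
  have 1: "gamma I \<lhd> f = (eps' C \<lhd> f) \<bullet> (?u \<lhd> fs \<lhd> f)"
    unfolding gamma_def endo_of_def using u wr_vc[of f "eps' C" "?u \<lhd> fs"] by simp
  have 2: "(?u \<lhd> fs \<lhd> f) \<bullet> as' f fs f = as' (C \<bowtie> f) fs f \<bullet> (?u \<lhd> S)"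
    using as'_wr[of ?u fs f "C \<bowtie> f"] u by simp
  have 3: "(?u \<lhd> S) \<bullet> (f \<rhd> ?j) = (C \<bowtie> f \<rhd> ?j) \<bullet> (?u \<lhd> ?Y)"
    using u s hc_wr_wl[of ?u ?j S f] hc_wl_wr[of ?u ?j "C \<bowtie> f" ?Y] by simp
  \<comment> \<open>Here the contraction passes from the adjunction on the right to
    \<open>eps f\<close> under \<open>C\<close>, the form in which it can meet the inclusion of
    \<open>J\<close>.\<close>
  have 4: "(eps' C \<lhd> f) \<bullet> as' (C \<bowtie> f) fs f = (C \<rhd> eps f) \<bullet> as C f S"
    by (rule eps'_wr) simp_all
  have 5: "as C f S \<bullet> (C \<bowtie> f \<rhd> ?j) = (C \<rhd> (f \<rhd> ?j)) \<bullet> as C f ?Y"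
    using as_wl[of C f ?j S] s by simp
  have 6: "as f fs f \<bullet> (C \<rhd> eps f) = (f \<rhd> (fs \<rhd> eps f)) \<bullet> as f fs (f \<bowtie> S)"
    using as_wl[of f fs "eps f" f] by simp
  have 7: "as f fs (f \<bowtie> S) \<bullet> (C \<rhd> (f \<rhd> ?j)) = (f \<rhd> (fs \<rhd> (f \<rhd> ?j))) \<bullet> as f fs (f \<bowtie> ?Y)"
    using as_wl[of f fs "f \<rhd> ?j" "f \<bowtie> S"] s by simp
  have 8: "?u \<lhd> ?Y = (as' f fs f \<lhd> ?Y) \<bullet> ((f \<rhd> ?i) \<lhd> ?Y) \<bullet> (?k \<lhd> ?Y)"
    using assms s by (simp add: sub_coaction_def wr_vc)
  have 9: "as C f ?Y \<bullet> (as' f fs f \<lhd> ?Y) = as' f fs (f \<bowtie> ?Y) \<bullet> (f \<rhd> as fs f ?Y) \<bullet> as f S ?Y"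
    using s by (intro pentagon_wr) simp_all
  have 10: "as f S ?Y \<bullet> ((f \<rhd> ?i) \<lhd> ?Y) = (f \<rhd> (?i \<lhd> ?Y)) \<bullet> as f ?X ?Y"
    using as_wm[of f ?i ?Y] s by simp
  have 11: "(fs \<rhd> (f \<rhd> ?j)) \<bullet> as fs f ?Y = as fs f S \<bullet> (S \<rhd> ?j)"
    using as_wl[of fs f ?j S] s by simp
  have 12: "(S \<rhd> ?j) \<bullet> (?i \<lhd> ?Y) = ?i \<diamond> ?j"
    using s by (simp add: hc_wl_wr)
  have 13: "(fs \<rhd> eps f) \<bullet> (fs \<rhd> (f \<rhd> ?j)) \<bullet> as fs f ?Y \<bullet> (?i \<lhd> ?Y) = mulS \<bullet> (?i \<diamond> ?j)"
    using s by (simp add: vc_cong[OF 11] vc_assoc 12 mulS_def)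
  have "coaction_of (gamma I \<bullet> gamma J) = as f fs f \<bullet> (gamma I \<lhd> f) \<bullet> (gamma J \<lhd> f) \<bullet> eta' f"
    using g by (simp add: coaction_of_def wr_vc vc_assoc)
  also have "\<dots> = as f fs f \<bullet> (eps' C \<lhd> f) \<bullet> ((?u \<lhd> fs \<lhd> f) \<bullet> as' f fs f) \<bullet> (f \<rhd> ?j) \<bullet> ?l"
    unfolding 0 unfolding 1 using assms s u by (simp add: vc_assoc)
  also have "\<dots> = as f fs f \<bullet> ((eps' C \<lhd> f) \<bullet> as' (C \<bowtie> f) fs f) \<bullet> ((?u \<lhd> S) \<bullet> (f \<rhd> ?j)) \<bullet> ?l"
    unfolding 2 using assms s u by (simp add: vc_assoc)
  also have "\<dots> = as f fs f \<bullet> (C \<rhd> eps f) \<bullet> (as C f S \<bullet> (C \<bowtie> f \<rhd> ?j)) \<bullet> (?u \<lhd> ?Y) \<bullet> ?l"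
    unfolding 3 4 using assms s u by (simp add: vc_assoc)
  also have "\<dots> = (f \<rhd> (fs \<rhd> eps f)) \<bullet> (f \<rhd> (fs \<rhd> (f \<rhd> ?j))) \<bullet> as f fs (f \<bowtie> ?Y) \<bullet> as C f ?Y \<bullet> (?u \<lhd> ?Y) \<bullet> ?l"
    unfolding 5 using assms s u by (simp add: vc_assoc vc_cong[OF 6] vc_cong[OF 7])
  also have "\<dots> = (f \<rhd> (fs \<rhd> eps f)) \<bullet> (f \<rhd> (fs \<rhd> (f \<rhd> ?j))) \<bullet> (f \<rhd> as fs f ?Y) \<bullet> (f \<rhd> (?i \<lhd> ?Y)) \<bullet> as f ?X ?Y \<bullet> (?k \<lhd> ?Y) \<bullet> ?l"
    unfolding 8 using assms s by (simp add: vc_assoc vc_cong[OF 9] vc_cong[OF as_as'] vc_cong[OF 10])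
  also have "\<dots> = (f \<rhd> ((fs \<rhd> eps f) \<bullet> (fs \<rhd> (f \<rhd> ?j)) \<bullet> as fs f ?Y \<bullet> (?i \<lhd> ?Y))) \<bullet> as f ?X ?Y \<bullet> (?k \<lhd> ?Y) \<bullet> ?l"
    using assms s by (simp add: wl_vc vc_assoc)
  finally show ?thesis unfolding 13 .
qed

lemma gamma_product:
  assumes "I \<in> inv_subs" "J \<in> inv_subs"
  shows "prodS I J \<in> inv_subs" "gamma (prodS I J) = gamma I \<bullet> gamma J"
proof -
  note s = inv_subs_sub[OF assms(1)] inv_subs_sub[OF assms(2)]
  let ?\<mu> = "mulS \<bullet> (incl S I \<diamond> incl S J)"
  have m: "ar ?\<mu>" "tgt ?\<mu> = S" using s by simp_all
  note im = image_inv_subs[OF m product_inverse[OF assms]]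
  show "prodS I J \<in> inv_subs" using im(1) by (simp add: prodS_def)
  have g: "ar (gamma I)" "src (gamma I) = C" "tgt (gamma I) = C" "ar (gamma J)" "src (gamma J) = C" "tgt (gamma J) = C"
    using assms by (simp_all add: gamma_def)
  have "gamma (prodS I J) = endo_of (coaction_of (gamma I \<bullet> gamma J))"
    unfolding gamma_def[of "prodS I J"] coaction_of_product[OF assms] unfolding prodS_def im(2) ..
  then show "gamma (prodS I J) = gamma I \<bullet> gamma J" using endo_of_coaction_of[of "gamma I \<bullet> gamma J"] g by simp
qed

text \<open>For \<open>\<mu> = \<eta>\<close> the cell to be inverted is \<open>ru f\<close>, by a
  triangle identity, and \<open>(f \<rhd> \<eta>) \<bullet> ru' f\<close> is the re-bracketed
  transpose of the identity.\<close>

lemma gamma_unit: "image_cell \<eta> \<in> inv_subs" "gamma (image_cell \<eta>) = id_cell C"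
proof -
  have e: "eps f \<bullet> (f \<rhd> \<eta>) \<bullet> ru' f = id_cell f"
    using tri1 by (simp add: eps_def vc_assoc)
  have "(eps f \<bullet> (f \<rhd> \<eta>)) \<bullet> ru' f \<bullet> ru f = (eps f \<bullet> (f \<rhd> \<eta>) \<bullet> ru' f) \<bullet> ru f"
    by (simp add: vc_assoc)
  then have k: "eps f \<bullet> (f \<rhd> \<eta>) = ru f" unfolding e by simp
  have "is_inverse K (eps f \<bullet> (f \<rhd> \<eta>)) (ru' f)"
    unfolding k by (rule is_inverseI) simp_all
  note im = image_inv_subs[OF ar_\<eta> tgt_\<eta> this]
  show "image_cell \<eta> \<in> inv_subs" by (rule im(1))
  have "coaction_of (id_cell C) = (f \<rhd> \<eta>) \<bullet> ru' f"
    using as_eta' by (simp add: coaction_of_def hc_id)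
  then show "gamma (image_cell \<eta>) = id_cell C"
    using endo_of_coaction_of[of "id_cell C"] by (simp add: gamma_def im(2))
qed

section \<open>The two monoids and the criterion for an isomorphism\<close>

definition end_monoid where
  "end_monoid = \<lparr>carrier = {g. comonoid_endo g}, monoid.mult = (\<lambda>g h. g \<bullet> h), one = id_cell C\<rparr>"

definition inv_subs_monoid where
  "inv_subs_monoid = \<lparr>carrier = inv_subs, monoid.mult = prodS, one = image_cell \<eta>\<rparr>"

lemma comonoid_endo_comp:
  assumes "comonoid_endo g" "comonoid_endo h"
  shows "comonoid_endo (g \<bullet> h)"
proof -
  have g: "ar g" "src g = C" "tgt g = C" "Delta \<bullet> g = (g \<diamond> g) \<bullet> Delta" "\<epsilon> \<bullet> g = \<epsilon>"
    and h: "ar h" "src h = C" "tgt h = C" "Delta \<bullet> h = (h \<diamond> h) \<bullet> Delta" "\<epsilon> \<bullet> h = \<epsilon>"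
    using assms by (auto simp: comonoid_endo_def)
  have 1: "(g \<bullet> h) \<diamond> (g \<bullet> h) = (g \<diamond> g) \<bullet> (h \<diamond> h)"
    using g h by (simp add: hc_vcomp)
  have "Delta \<bullet> g \<bullet> h = ((g \<bullet> h) \<diamond> (g \<bullet> h)) \<bullet> Delta"
    unfolding 1 using g(1-3) h(1-3) by (simp add: vc_cong[OF g(4)] vc_assoc h(4))
  moreover have "\<epsilon> \<bullet> g \<bullet> h = \<epsilon>"
    using g(1-3) h(1-3) by (simp add: vc_cong[OF g(5)] h(5))
  ultimately show ?thesis using g(1-3) h(1-3) by (simp add: comonoid_endo_def)
qed

lemma comonoid_endo_id: "comonoid_endo (id_cell C)"
  by (simp add: comonoid_endo_def hc_id)

lemma end_monoid_monoid: "monoid end_monoid"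
proof (rule monoidI)
  fix g h k assume "g \<in> carrier end_monoid" "h \<in> carrier end_monoid" "k \<in> carrier end_monoid"
  then show "(g \<otimes>\<^bsub>end_monoid\<^esub> h) \<otimes>\<^bsub>end_monoid\<^esub> k = g \<otimes>\<^bsub>end_monoid\<^esub> (h \<otimes>\<^bsub>end_monoid\<^esub> k)"
    by (simp add: end_monoid_def comonoid_endo_def vc_assoc)
qed (auto simp: end_monoid_def comonoid_endo_comp comonoid_endo_id, simp_all add: comonoid_endo_def)

lemma gamma_comonoid_endo:
  assumes "I \<in> inv_subs"
  shows "comonoid_endo (gamma I)"
  using comonoid_endo_iff_coaction[of "gamma I"] coaction_sub_coaction[OF assms] coaction_of_endo_of[of "sub_coaction I"] assms by (simp add: gamma_def)

text \<open>The existence half of the assertion that \<open>eta X\<close> is an equalizer of the two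
  cells from \<open>M X\<close> to \<open>M (M X)\<close>, where \<open>M\<close> is the monad
  \<open>fs \<bowtie> (f \<bowtie> -)\<close>. Purity and a splitting of \<open>\<eta>\<close> both
  provide it.\<close>

definition pure_unit where
  "pure_unit \<longleftrightarrow> (\<forall>X t. bi X \<longrightarrow> cd X = A \<longrightarrow> ar t \<longrightarrow> tgt t = fs \<bowtie> (f \<bowtie> X) \<longrightarrow>
     eta (fs \<bowtie> (f \<bowtie> X)) \<bullet> t = (fs \<rhd> (f \<rhd> eta X)) \<bullet> t \<longrightarrow>
     (\<exists>u. ar u \<and> src u = src t \<and> tgt u = X \<and> eta X \<bullet> u = t))"

text \<open>What surjectivity takes from flatness: \<open>t\<close> factors through
  \<open>f \<rhd> incl S I\<close> for some \<open>I\<close> on which \<open>fs \<rhd> t\<close> and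
  \<open>eta S\<close> agree, and \<open>f \<rhd> incl S I\<close> is monic. It is stated for
  coactions only, so that a splitting of \<open>\<eta>\<close> can provide it as well.\<close>

definition flat_coactions where
  "flat_coactions \<longleftrightarrow> (\<forall>t. coaction t \<longrightarrow> (\<exists>I s. subbimodule K S I \<and> (fs \<rhd> t) \<bullet> incl S I = eta S \<bullet> incl S I \<and>
     ar s \<and> src s = f \<and> tgt s = f \<bowtie> sub_bimod S I \<and> (f \<rhd> incl S I) \<bullet> s = t \<and>
     (\<forall>a b. ar a \<longrightarrow> ar b \<longrightarrow> tgt a = f \<bowtie> sub_bimod S I \<longrightarrow> tgt b = f \<bowtie> sub_bimod S I \<longrightarrow>
        (f \<rhd> incl S I) \<bullet> a = (f \<rhd> incl S I) \<bullet> b \<longrightarrow> a = b)))"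

text \<open>If \<open>I\<close> and \<open>J\<close> induce the same coaction, then \<open>t\<close> below equalizes the two maps out of the
  image of \<open>sub_bimod S J\<close> under the monad, so purity factors \<open>I\<close> through \<open>J\<close>.\<close>

lemma sub_coaction_factor:
  assumes p: pure_unit and I: "I \<in> inv_subs" and J: "J \<in> inv_subs" and e: "sub_coaction I = sub_coaction J"
  obtains u where "ar u" "src u = sub_bimod S I" "tgt u = sub_bimod S J" "incl S I = incl S J \<bullet> u"
proof -
  note s = inv_subs_sub[OF I] inv_subs_sub[OF J]
  let ?X = "sub_bimod S I" and ?Y = "sub_bimod S J"
  let ?i = "incl S I" and ?j = "incl S J" and ?l = "inv_cell K (sub_xi J)"
  let ?t = "(fs \<rhd> ?l) \<bullet> ?i"
  let ?M = "\<lambda>t. fs \<rhd> (f \<rhd> t)"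
  have t: "ar ?t" "src ?t = ?X" "tgt ?t = fs \<bowtie> (f \<bowtie> ?Y)" using J s by simp_all
  have Mj: "?M ?j \<bullet> ?t = eta S \<bullet> ?i"
    using wl_sub_coaction_incl[OF I] J s unfolding e by (simp add: sub_coaction_def wl_vc vc_assoc)
  have n1: "?M (?M ?j) \<bullet> eta (fs \<bowtie> (f \<bowtie> ?Y)) = eta (fs \<bowtie> (f \<bowtie> S)) \<bullet> ?M ?j"
    using eta_nat[of "?M ?j" "fs \<bowtie> (f \<bowtie> S)"] s by simp
  have n2: "?M ?j \<bullet> eta ?Y = eta S \<bullet> ?j"
    using eta_nat[of ?j S] s by simp
  have n2': "?M (?M ?j) \<bullet> ?M (eta ?Y) = ?M (eta S) \<bullet> ?M ?j"
    using n2 s by (simp flip: wl_vc)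
  have n3: "?M (eta S) \<bullet> eta S = eta (fs \<bowtie> (f \<bowtie> S)) \<bullet> eta S"
    using eta_nat[of "eta S" "fs \<bowtie> (f \<bowtie> S)"] by simp
  \<comment> \<open>As \<open>\<xi>\<close> of \<open>J\<close> is invertible,
    \<open>f \<rhd> ?j\<close> has the retraction \<open>?l \<bullet> eps f\<close>; hence
    \<open>?M (?M ?j)\<close> is split and can be cancelled.\<close>
  have retr: "(?l \<bullet> eps f) \<bullet> (f \<rhd> ?j) = id_cell (f \<bowtie> ?Y)"
    using inv_sub_xi(4)[OF J] J s by (simp add: sub_xi_def vc_assoc)
  have "?M (fs \<rhd> (?l \<bullet> eps f)) \<bullet> ?M (?M ?j) = ?M (fs \<rhd> ((?l \<bullet> eps f) \<bullet> (f \<rhd> ?j)))"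
    using J s by (simp flip: wl_vc)
  also have "\<dots> = id_cell (fs \<bowtie> (f \<bowtie> (fs \<bowtie> (f \<bowtie> ?Y))))"
    unfolding retr using s by (simp add: hc_id)
  finally have R: "?M (fs \<rhd> (?l \<bullet> eps f)) \<bullet> ?M (?M ?j) = id_cell (fs \<bowtie> (f \<bowtie> (fs \<bowtie> (f \<bowtie> ?Y))))" .
  have "?M (?M ?j) \<bullet> eta (fs \<bowtie> (f \<bowtie> ?Y)) \<bullet> ?t = eta (fs \<bowtie> (f \<bowtie> S)) \<bullet> eta S \<bullet> ?i"
    unfolding Mj[symmetric] using t s by (simp add: vc_cong[OF n1] vc_assoc)
  moreover have "?M (?M ?j) \<bullet> ?M (eta ?Y) \<bullet> ?t = eta (fs \<bowtie> (f \<bowtie> S)) \<bullet> eta S \<bullet> ?i"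
  proof -
    have "?M (?M ?j) \<bullet> ?M (eta ?Y) \<bullet> ?t = ?M (eta S) \<bullet> ?M ?j \<bullet> ?t"
      using vc_cong[OF n2', of ?t] t s by (simp add: vc_assoc)
    also have "\<dots> = eta (fs \<bowtie> (f \<bowtie> S)) \<bullet> eta S \<bullet> ?i"
      unfolding Mj using s by (simp add: vc_cong[OF n3] vc_assoc)
    finally show ?thesis .
  qed
  ultimately have "?M (?M ?j) \<bullet> eta (fs \<bowtie> (f \<bowtie> ?Y)) \<bullet> ?t = ?M (?M ?j) \<bullet> ?M (eta ?Y) \<bullet> ?t" by metis
  then have eq: "eta (fs \<bowtie> (f \<bowtie> ?Y)) \<bullet> ?t = ?M (eta ?Y) \<bullet> ?t"
    by (rule left_cancel[OF R]) (use s J in simp_all)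
  have Y: "bi ?Y" "cd ?Y = A" using s by simp_all
  obtain u where u: "ar u" "src u = src ?t" "tgt u = ?Y" "eta ?Y \<bullet> u = ?t"
    using p[unfolded pure_unit_def, rule_format, OF Y t(1,3) eq] by blast
  have x: "(fs \<rhd> sub_xi J) \<bullet> (fs \<rhd> ?l) = id_cell S"
    using J s by (simp add: hc_id flip: wl_vc)
  \<comment> \<open>\<open>wl_sub_xi_eta\<close> writes \<open>?j\<close> through the unit, after
    which \<open>\<xi>\<close> cancels against its inverse in \<open>?t\<close>.\<close>
  have "?j \<bullet> u = (fs \<rhd> sub_xi J) \<bullet> eta ?Y \<bullet> u"
    using wl_sub_xi_eta[OF s(2)] u(1-3) s vc_assoc[of "eta ?Y" u "fs \<rhd> sub_xi J"] by simp
  also have "\<dots> = ?i" unfolding u(4) using J s by (simp add: vc_cong[OF x])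
  finally have "?i = ?j \<bullet> u" by (rule HOL.sym)
  moreover have "src u = ?X" using u(2) t(2) by (rule HOL.trans)
  ultimately show thesis using that u(1,3) by blast
qed

lemma gamma_inj:
  assumes p: pure_unit
  shows "inj_on gamma inv_subs"
proof (rule inj_onI)
  fix I J assume I: "I \<in> inv_subs" and J: "J \<in> inv_subs" and "gamma I = gamma J"
  then have e: "sub_coaction I = sub_coaction J"
    using coaction_of_endo_of[of "sub_coaction I"] coaction_of_endo_of[of "sub_coaction J"] unfolding gamma_def by (metis sub_coaction_simps)
  obtain u where "ar u" "src u = sub_bimod S I" "tgt u = sub_bimod S J" "incl S I = incl S J \<bullet> u"
    using sub_coaction_factor[OF p I J e] .
  moreover obtain v where "ar v" "src v = sub_bimod S J" "tgt v = sub_bimod S I" "incl S J = incl S I \<bullet> v"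
    using sub_coaction_factor[OF p J I e[symmetric]] .
  ultimately show "I = J" using incl_factor_eq[OF inv_subs_sub[OF I] inv_subs_sub[OF J]] by metis
qed

text \<open>The factor \<open>s\<close> of the coaction is the inverse of \<open>\<xi>\<close>. One
  composite is the counit law; the other is tested after the monic \<open>f \<rhd> incl S I\<close>,
  where naturality of \<open>eps\<close> and the equalizing property reduce it to a triangle
  identity.\<close>

lemma gamma_surj:
  assumes flat_coactions "comonoid_endo g"
  obtains I where "I \<in> inv_subs" "gamma I = g"
proof -
  have g: "ar g" "src g = C" "tgt g = C" using assms(2) by (simp_all add: comonoid_endo_def)
  let ?t = "coaction_of g"
  have c: "coaction ?t" using comonoid_endo_iff_coaction[OF g] assms(2) by simp
  then obtain I s where s: "subbimodule K S I" and eq: "(fs \<rhd> ?t) \<bullet> incl S I = eta S \<bullet> incl S I"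
    and ss: "ar s" "src s = f" "tgt s = f \<bowtie> sub_bimod S I" and st: "(f \<rhd> incl S I) \<bullet> s = ?t"
    and mono: "\<And>a b. ar a \<Longrightarrow> ar b \<Longrightarrow> tgt a = f \<bowtie> sub_bimod S I \<Longrightarrow> tgt b = f \<bowtie> sub_bimod S I \<Longrightarrow>
        (f \<rhd> incl S I) \<bullet> a = (f \<rhd> incl S I) \<bullet> b \<Longrightarrow> a = b"
    using assms(1) unfolding flat_coactions_def by metis
  let ?i = "incl S I"
  have t: "ar ?t" "src ?t = f" "tgt ?t = f \<bowtie> S" "eps f \<bullet> ?t = id_cell f"
    using c by (simp_all add: coaction_def)
  have r: "sub_xi I \<bullet> s = id_cell f"
    using st ss s t(4) by (simp add: sub_xi_def vc_assoc)
  have 1: "?t \<bullet> eps f = eps (f \<bowtie> S) \<bullet> (f \<rhd> (fs \<rhd> ?t))"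
    using eps_nat[of ?t "f \<bowtie> S"] t by simp
  have 2: "eps (f \<bowtie> S) \<bullet> (f \<rhd> eta S) = id_cell (f \<bowtie> S)"
    by (rule eps_eta) simp_all
  have "(f \<rhd> ?i) \<bullet> s \<bullet> sub_xi I = ?t \<bullet> eps f \<bullet> (f \<rhd> ?i)"
    using vc_cong[OF st, of "sub_xi I"] ss s by (simp add: sub_xi_def)
  also have "\<dots> = eps (f \<bowtie> S) \<bullet> (f \<rhd> ((fs \<rhd> ?t) \<bullet> ?i))"
    using s t(1-3) vc_cong[OF 1, of "f \<rhd> ?i"] by (simp add: vc_assoc wl_vc)
  also have "\<dots> = (f \<rhd> ?i) \<bullet> id_cell (f \<bowtie> sub_bimod S I)"
    unfolding eq using s by (simp add: wl_vc vc_cong[OF 2])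
  finally have l: "s \<bullet> sub_xi I = id_cell (f \<bowtie> sub_bimod S I)"
    using mono[of "s \<bullet> sub_xi I" "id_cell (f \<bowtie> sub_bimod S I)"] ss s by simp
  have inv: "is_inverse K (sub_xi I) s"
    using ss s l r by (simp add: is_inverse_iff)
  have I: "I \<in> inv_subs" using s iso_cellI[OF _ inv] by (simp add: inv_subs_def)
  have "sub_coaction I = ?t" using inv_cell_eq[OF _ inv] s st by (simp add: sub_coaction_def)
  then have "gamma I = g" using endo_of_coaction_of[OF g] by (simp add: gamma_def)
  then show thesis using that I by blast
qed

text \<open>\<open>gamma\<close> carries products to composites and the unit to the identity, so
  being injective it pulls associativity and the unit laws back from cells to subbimodules.\<close>

theorem gamma_iso:
  assumes pure_unit flat_coactions
  shows "monoid_iso inv_subs_monoid end_monoid gamma"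
proof -
  interpret E: monoid end_monoid by (rule end_monoid_monoid)
  have bij: "bij_betw gamma inv_subs (carrier end_monoid)"
    unfolding bij_betw_def
  proof
    show "inj_on gamma inv_subs" using gamma_inj[OF assms(1)] .
    show "gamma ` inv_subs = carrier end_monoid"
      using gamma_comonoid_endo gamma_surj[OF assms(2)] by (auto simp: end_monoid_def) (metis imageI)
  qed
  have mul: "gamma (prodS I J) = gamma I \<otimes>\<^bsub>end_monoid\<^esub> gamma J" if "I \<in> inv_subs" "J \<in> inv_subs" for I J
    using gamma_product(2)[OF that] by (simp add: end_monoid_def)
  have one: "gamma (image_cell \<eta>) = \<one>\<^bsub>end_monoid\<^esub>" using gamma_unit(2) by (simp add: end_monoid_def)
  have cl: "gamma I \<in> carrier end_monoid" if "I \<in> inv_subs" for I using gamma_comonoid_endo[OF that] by (simp add: end_monoid_def)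
  note inj = inj_onD[OF gamma_inj[OF assms(1)]]
  have "monoid inv_subs_monoid"
  proof (rule monoidI)
    fix I J L assume *: "I \<in> carrier inv_subs_monoid" "J \<in> carrier inv_subs_monoid" "L \<in> carrier inv_subs_monoid"
    then show "I \<otimes>\<^bsub>inv_subs_monoid\<^esub> J \<in> carrier inv_subs_monoid" by (simp add: inv_subs_monoid_def gamma_product)
    show "(I \<otimes>\<^bsub>inv_subs_monoid\<^esub> J) \<otimes>\<^bsub>inv_subs_monoid\<^esub> L = I \<otimes>\<^bsub>inv_subs_monoid\<^esub> (J \<otimes>\<^bsub>inv_subs_monoid\<^esub> L)"
      using * by (intro inj) (simp_all add: inv_subs_monoid_def gamma_product(1) mul cl E.m_assoc)
    show "\<one>\<^bsub>inv_subs_monoid\<^esub> \<otimes>\<^bsub>inv_subs_monoid\<^esub> I = I" "I \<otimes>\<^bsub>inv_subs_monoid\<^esub> \<one>\<^bsub>inv_subs_monoid\<^esub> = I"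
      using * by (auto intro!: inj simp: inv_subs_monoid_def gamma_product(1) mul cl one gamma_unit(1))
  qed (simp add: inv_subs_monoid_def gamma_unit(1))
  then show ?thesis
    unfolding monoid_iso_def iso_def hom_def using E.monoid_axioms bij mul one cl
    by (auto simp: inv_subs_monoid_def)
qed

end

section \<open>Purity, flatness and splittings imply the two conditions\<close>

lemma equalizer_mono:
  assumes e: "is_equalizer K e p q" and a: "two_cell K a" "two_cell K b" "tgt a = src e" "tgt b = src e" "e \<bullet> a = e \<bullet> b"
  shows "a = b"
proof -
  have E: "two_cell K e" "two_cell K p" "two_cell K q" "src p = tgt e" "src q = tgt e" "p \<bullet> e = q \<bullet> e"
    "\<And>T t. t \<in> cells K T (tgt e) \<Longrightarrow> p \<bullet> t = q \<bullet> t \<Longrightarrow> \<exists>!s. s \<in> cells K T (src e) \<and> e \<bullet> s = t"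
    using e by (auto simp: is_equalizer_def cells_iff)
  have s: "src b = src a" using a(5) by (metis vcomp_simps(1))
  have "p \<bullet> e \<bullet> a = q \<bullet> e \<bullet> a"
    using vcomp_assoc[OF E(1) a(1), of p] vcomp_assoc[OF E(1) a(1), of q] a(3) E(6) by metis
  moreover have "e \<bullet> a \<in> cells K (src a) (tgt e)" using E(1) a(1,3) by (simp add: cells_iff vcomp_two_cell)
  ultimately have "\<exists>!s. s \<in> cells K (src a) (src e) \<and> e \<bullet> s = e \<bullet> a" by (intro E(7))
  moreover have "a \<in> cells K (src a) (src e)" "b \<in> cells K (src a) (src e)" using a(1-4) s by (simp_all add: cells_iff)
  ultimately show ?thesis using a(5) by metis
qed

lemma equalizer_factor:
  assumes e: "is_equalizer K e p q" and "two_cell K t" "tgt t = tgt e" "p \<bullet> t = q \<bullet> t"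
  obtains s where "two_cell K s" "src s = src t" "tgt s = src e" "e \<bullet> s = t"
proof -
  have t: "t \<in> cells K (src t) (tgt e)" using assms(2,3) by (simp add: cells_iff)
  have "\<And>T t. t \<in> cells K T (tgt e) \<Longrightarrow> p \<bullet> t = q \<bullet> t \<Longrightarrow> \<exists>!s. s \<in> cells K T (src e) \<and> e \<bullet> s = t"
    using e by (simp add: is_equalizer_def)
  from ex1_implies_ex[OF this[OF t assms(4)]] show thesis
    using that by (auto simp: cells_iff)
qed

lemma monoid_iso_cong:
  assumes "monoid_iso M N h" "\<And>x. x \<in> carrier M \<Longrightarrow> h' x = h x"
  shows "monoid_iso M N h'"
proof -
  interpret M: monoid M using assms(1) by (simp add: monoid_iso_def)
  have "bij_betw h' (carrier M) (carrier N) = bij_betw h (carrier M) (carrier N)"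
    using assms(2) by (rule bij_betw_cong)
  then show ?thesis
    using assms unfolding monoid_iso_def iso_def hom_def by (auto simp: Pi_iff)
qed

context adj
begin

text \<open>Composing \<open>fs \<rhd> a\<close> with \<open>eta X\<close> is transposition under
  \<open>f \<bowtie> -\<close>, which \<open>eps\<close> undoes.\<close>

lemma wl_eta_inj:
  assumes "bi X" "cd X = A" "ar a" "src a = f \<bowtie> X" "ar b" "src b = f \<bowtie> X" "tgt a = Z" "tgt b = Z"
    and e: "(fs \<rhd> a) \<bullet> eta X = (fs \<rhd> b) \<bullet> eta X"
  shows "a = b"
proof -
  have "c = eps Z \<bullet> (f \<rhd> ((fs \<rhd> c) \<bullet> eta X))" if c: "ar c" "src c = f \<bowtie> X" "tgt c = Z" for c
  proof -
    have z: "bi Z" "cd Z = B" using cd_tgt[OF c(1)] ar_bi(2)[OF c(1)] c(2,3) by simp_all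
    have 1: "eps Z \<bullet> (f \<rhd> (fs \<rhd> c)) = c \<bullet> eps (f \<bowtie> X)"
      using eps_nat[of c Z] c by simp
    show ?thesis
      using assms(1,2) c z eps_eta[OF assms(1,2)] by (simp add: wl_vc vc_cong[OF 1] vc_assoc)
  qed
  from this[of a] this[of b] show ?thesis using assms by metis
qed

text \<open>The functor \<open>fs \<bowtie> -\<close> reflects invertibility of maps between objects in the image of
  \<open>f \<bowtie> -\<close>: the inverse of \<open>sub_xi I\<close> is the transpose of the inverse of \<open>fs \<rhd> sub_xi I\<close>.\<close>

lemma iso_mulS_iff:
  assumes s: "subbimodule K S I"
  shows "iso_cell K (mulS \<bullet> (S \<rhd> incl S I)) \<longleftrightarrow> iso_cell K (sub_xi I)"
proof -
  let ?X = "sub_bimod S I" and ?i = "incl S I" and ?\<xi> = "sub_xi I"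
  have 1: "as fs f S \<bullet> (S \<rhd> ?i) = (fs \<rhd> (f \<rhd> ?i)) \<bullet> as fs f ?X"
    using as_wl[of fs f ?i S] s by simp
  have m: "mulS \<bullet> (S \<rhd> ?i) = (fs \<rhd> ?\<xi>) \<bullet> as fs f ?X"
    using s by (simp add: mulS_def sub_xi_def vc_assoc 1 wl_vc)
  show ?thesis
  proof
    assume i: "iso_cell K ?\<xi>"
    then have "I \<in> inv_subs" using s by (simp add: inv_subs_def)
    note x = inv_sub_xi[OF this]
    have 2: "(fs \<rhd> inv_cell K ?\<xi>) \<bullet> (fs \<rhd> ?\<xi>) = id_cell (fs \<bowtie> (f \<bowtie> ?X))"
      "(fs \<rhd> ?\<xi>) \<bullet> (fs \<rhd> inv_cell K ?\<xi>) = id_cell S"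
      using x s by (simp_all add: hc_id flip: wl_vc)
    have "is_inverse K ((fs \<rhd> ?\<xi>) \<bullet> as fs f ?X) (as' fs f ?X \<bullet> (fs \<rhd> inv_cell K ?\<xi>))"
      using x(1-3) s by (intro is_inverseI)
        (simp_all add: vc_assoc vc_cong[OF 2(1)] 2(2) vc_cong[OF as_as'])
    then show "iso_cell K (mulS \<bullet> (S \<rhd> ?i))" unfolding m using s by (intro iso_cellI) simp_all
  next
    assume "iso_cell K (mulS \<bullet> (S \<rhd> ?i))"
    then have i: "iso_cell K ((fs \<rhd> ?\<xi>) \<bullet> as fs f ?X)" unfolding m .
    define w where "w = inv_cell K ((fs \<rhd> ?\<xi>) \<bullet> as fs f ?X)"
    have w: "ar w" "src w = S" "tgt w = S \<bowtie> ?X"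
      "w \<bullet> (fs \<rhd> ?\<xi>) \<bullet> as fs f ?X = id_cell (S \<bowtie> ?X)" "((fs \<rhd> ?\<xi>) \<bullet> as fs f ?X) \<bullet> w = id_cell S"
      using inv_cell_props[OF i] s by (simp_all add: w_def)
    let ?s = "as fs f ?X \<bullet> w"
    have s1: "(fs \<rhd> ?\<xi>) \<bullet> ?s = id_cell S" using w(1-3,5) s by (simp add: vc_assoc)
    have "?s \<bullet> (fs \<rhd> ?\<xi>) = as fs f ?X \<bullet> (w \<bullet> (fs \<rhd> ?\<xi>) \<bullet> as fs f ?X) \<bullet> as' fs f ?X"
      using w(1-3) s by (simp add: vc_assoc)
    then have s2: "?s \<bullet> (fs \<rhd> ?\<xi>) = id_cell (fs \<bowtie> (f \<bowtie> ?X))" unfolding w(4) using s by simp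
    \<comment> \<open>The transpose of \<open>?s \<bullet> \<eta>\<close>, a cell from the unit to
      \<open>fs \<bowtie> (f \<bowtie> ?X)\<close>; \<open>ru' f\<close> supplies the unit
      factor.\<close>
    define z where "z = eps (f \<bowtie> ?X) \<bullet> (f \<rhd> ?s) \<bullet> (f \<rhd> \<eta>) \<bullet> ru' f"
    have z: "ar z" "src z = f" "tgt z = f \<bowtie> ?X" using w s by (simp_all add: z_def)
    have 3: "?\<xi> \<bullet> eps (f \<bowtie> ?X) = eps f \<bullet> (f \<rhd> (fs \<rhd> ?\<xi>))"
      using eps_nat[of ?\<xi> f] s by simp
    have 4: "(f \<rhd> (fs \<rhd> ?\<xi>)) \<bullet> (f \<rhd> ?s) = id_cell (f \<bowtie> S)"
      using s1 w s by (simp add: hc_id flip: wl_vc)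
    have 5: "eps f \<bullet> (f \<rhd> \<eta>) \<bullet> ru' f = id_cell f"
      using tri1 by (simp add: eps_def vc_assoc)
    have r: "?\<xi> \<bullet> z = id_cell f"
      unfolding z_def using w(1-3) s vc_cong[OF 4, of "(f \<rhd> \<eta>) \<bullet> ru' f"] vc_cong[OF 3, of "(f \<rhd> ?s) \<bullet> (f \<rhd> \<eta>) \<bullet> ru' f"]
      by (simp add: vc_assoc 5)
    \<comment> \<open>\<open>?s\<close> inverts \<open>fs \<rhd> ?\<xi>\<close> on both sides, so
      the right inverse \<open>fs \<rhd> z\<close> must coincide with it.\<close>
    have "fs \<rhd> z = (?s \<bullet> (fs \<rhd> ?\<xi>)) \<bullet> (fs \<rhd> z)" unfolding s2 using z s by simp
    also have "\<dots> = ?s \<bullet> (fs \<rhd> (?\<xi> \<bullet> z))" using z s w(1-3) by (simp add: vc_assoc wl_vc)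
    also have "\<dots> = ?s" unfolding r using w(1-3) s by (simp add: hc_id)
    finally have fz: "fs \<rhd> z = ?s" .
    have zz: "fs \<rhd> (z \<bullet> ?\<xi>) = fs \<rhd> id_cell (f \<bowtie> ?X)"
      using z s wl_vc[of fs z ?\<xi>] s2 unfolding fz by (simp add: hc_id)
    have l: "z \<bullet> ?\<xi> = id_cell (f \<bowtie> ?X)"
    \<comment> \<open>\<open>fs \<rhd> -\<close> is faithful on cells whose source has the form
      \<open>f \<bowtie> X\<close>.\<close>
    proof (rule wl_eta_inj[of ?X _ _ "f \<bowtie> ?X"])
      show "(fs \<rhd> (z \<bullet> ?\<xi>)) \<bullet> eta ?X = (fs \<rhd> id_cell (f \<bowtie> ?X)) \<bullet> eta ?X" unfolding zz ..
    qed (use z s in simp_all)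
    have "is_inverse K ?\<xi> z" using z s l r by (simp add: is_inverse_iff)
    then show "iso_cell K ?\<xi>" using s by (intro iso_cellI) simp_all
  qed
qed

text \<open>Regularity presents \<open>eta X\<close>, up to constraints, as the equalizer of some
  unspecified pair \<open>p\<close>, \<open>q\<close>. To show that \<open>t\<close> equalizes this
  pair, both composites are followed by \<open>eta\<close> at the common target: naturality and the
  assumption on \<open>t\<close> then express them through \<open>p\<close> and \<open>q\<close>
  after \<open>eta X\<close>, which agree. Purity at that target makes \<open>eta\<close> monic
  there.\<close>

lemma pure_unit_of_regular_mono:
  assumes "\<And>h. bi h \<Longrightarrow> cd h = A \<Longrightarrow> regular_mono K (\<eta> \<lhd> h)"
  shows pure_unit
  unfolding pure_unit_def
proof (intro allI impI)
  fix X t assume X: "bi X" "cd X = A" and t: "ar t" "tgt t = fs \<bowtie> (f \<bowtie> X)"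
    and et: "eta (fs \<bowtie> (f \<bowtie> X)) \<bullet> t = (fs \<rhd> (f \<rhd> eta X)) \<bullet> t"
  have eta_mono: "a = b" if Z: "bi Z" "cd Z = A" and a: "ar a" "ar b" "tgt a = Z" "tgt b = Z"
    and e: "eta Z \<bullet> a = eta Z \<bullet> b" for Z a b
  proof -
    obtain p q where pq: "is_equalizer K (\<eta> \<lhd> Z) p q" using assms[OF Z] by (auto simp: regular_mono_def)
    have l: "as' fs f Z \<bullet> as fs f Z = id_cell (S \<bowtie> Z)" "lu Z \<bullet> lu' Z = id_cell Z"
      using Z by simp_all
    have "as fs f Z \<bullet> (\<eta> \<lhd> Z) \<bullet> lu' Z \<bullet> a = as fs f Z \<bullet> (\<eta> \<lhd> Z) \<bullet> lu' Z \<bullet> b"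
      using e Z a by (simp add: eta_def vc_assoc)
    then have "(\<eta> \<lhd> Z) \<bullet> lu' Z \<bullet> a = (\<eta> \<lhd> Z) \<bullet> lu' Z \<bullet> b"
      by (rule left_cancel[OF l(1)]) (use Z a in simp_all)
    then have "lu' Z \<bullet> a = lu' Z \<bullet> b"
      by (rule equalizer_mono[OF pq, rotated 4]) (use Z a in simp_all)
    then show "a = b" by (rule left_cancel[OF l(2)]) (use Z a in simp_all)
  qed
  obtain p q where pq: "is_equalizer K (\<eta> \<lhd> X) p q" using assms[OF X] by (auto simp: regular_mono_def)
  then have p: "ar p" "ar q" "src p = S \<bowtie> X" "src q = S \<bowtie> X" "tgt q = tgt p"
    and pe: "p \<bullet> (\<eta> \<lhd> X) = q \<bullet> (\<eta> \<lhd> X)"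
    unfolding is_equalizer_def cells_iff by simp_all
  let ?Z = "tgt p" and ?a = "as' fs f X"
  have Z: "bi ?Z" "cd ?Z = A" using p cd_tgt[OF p(1)] by simp_all
  have pm: "(p \<bullet> ?a) \<bullet> eta X = (q \<bullet> ?a) \<bullet> eta X"
    using p X vc_cong[OF pe, of "lu' X"] by (simp add: eta_def vc_assoc vc_cong[OF as'_as])
  have n: "eta ?Z \<bullet> (r \<bullet> ?a) \<bullet> t = (fs \<rhd> (f \<rhd> ((r \<bullet> ?a) \<bullet> eta X))) \<bullet> t"
    if r: "ar r" "src r = S \<bowtie> X" "tgt r = ?Z" for r
  proof -
    have 1: "eta ?Z \<bullet> (r \<bullet> ?a) = (fs \<rhd> (f \<rhd> (r \<bullet> ?a))) \<bullet> eta (fs \<bowtie> (f \<bowtie> X))"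
      using eta_nat[of "r \<bullet> ?a" ?Z] r X by simp
    have "eta ?Z \<bullet> (r \<bullet> ?a) \<bullet> t = (fs \<rhd> (f \<rhd> (r \<bullet> ?a))) \<bullet> eta (fs \<bowtie> (f \<bowtie> X)) \<bullet> t"
      using vc_cong[OF 1, of t] r X t Z by (simp add: vc_assoc)
    also have "\<dots> = (fs \<rhd> (f \<rhd> (r \<bullet> ?a))) \<bullet> (fs \<rhd> (f \<rhd> eta X)) \<bullet> t" unfolding et ..
    also have "\<dots> = (fs \<rhd> (f \<rhd> ((r \<bullet> ?a) \<bullet> eta X))) \<bullet> t"
      using r X t by (simp add: wl_vc vc_assoc)
    finally show ?thesis .
  qed
  have "eta ?Z \<bullet> (p \<bullet> ?a) \<bullet> t = eta ?Z \<bullet> (q \<bullet> ?a) \<bullet> t"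
    unfolding n[OF p(1,3) HOL.refl] n[OF p(2,4,5)] pm ..
  then have "(p \<bullet> ?a) \<bullet> t = (q \<bullet> ?a) \<bullet> t"
    by (rule eta_mono[OF Z, rotated 4]) (use p X t in simp_all)
  then have "p \<bullet> ?a \<bullet> t = q \<bullet> ?a \<bullet> t" using p X t by (simp add: vc_assoc)
  then obtain s where s: "ar s" "src s = src (?a \<bullet> t)" "tgt s = src (\<eta> \<lhd> X)" "(\<eta> \<lhd> X) \<bullet> s = ?a \<bullet> t"
    by (rule equalizer_factor[OF pq, rotated 2]) (use X t in simp_all)
  have s': "src s = src t" "tgt s = unit_bimod A \<bowtie> X" using s(2,3) by simp_all
  have "eta X \<bullet> lu X \<bullet> s = as fs f X \<bullet> (\<eta> \<lhd> X) \<bullet> s"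
    using X s(1) s' lu'_lu[of X] by (simp add: eta_def vc_assoc vc_cong[OF lu'_lu])
  also have "\<dots> = t" unfolding s(4) using X t by (simp add: vc_cong[OF as_as'])
  finally show "\<exists>u. ar u \<and> src u = src t \<and> tgt u = X \<and> eta X \<bullet> u = t"
    using X s(1) s' by (intro exI[of _ "lu X \<bullet> s"]) simp
qed

text \<open>The equalizer of \<open>fs \<rhd> t\<close> and \<open>eta S\<close> is an inclusion,
  \<open>f\<close> preserves it by flatness, and coassociativity says that \<open>t\<close>
  equalizes the pair whiskered by \<open>f\<close>.\<close>

lemma flat_coactions_of_flat:
  assumes flat: "\<And>e p q. is_equalizer K e p q \<Longrightarrow> bi (src e) \<Longrightarrow> cd (src e) = A
    \<Longrightarrow> is_equalizer K (f \<rhd> e) (f \<rhd> p) (f \<rhd> q)"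
  shows flat_coactions
  unfolding flat_coactions_def
proof (intro allI impI)
  fix t assume "coaction t"
  then have t: "ar t" "src t = f" "tgt t = f \<bowtie> S" "(f \<rhd> (fs \<rhd> t)) \<bullet> t = (f \<rhd> eta S) \<bullet> t"
    by (simp_all add: coaction_def)
  let ?p = "fs \<rhd> t" and ?q = "eta S"
  let ?I = "equalizer_sub ?p ?q"
  have pq: "ar ?p" "ar ?q" "src ?p = src ?q" "tgt ?p = tgt ?q" "src ?p = S" using t by simp_all
  have s: "subbimodule K S ?I" using equalizer_subbimodule[OF pq(1-4)] unfolding pq(5) .
  have e: "is_equalizer K (incl S ?I) ?p ?q" using equalizer_exists[OF pq(1-4)] unfolding pq(5) .
  have fe: "is_equalizer K (f \<rhd> incl S ?I) (f \<rhd> ?p) (f \<rhd> ?q)" using flat[OF e] s by simp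
  obtain u where u: "ar u" "src u = src t" "tgt u = src (f \<rhd> incl S ?I)" "(f \<rhd> incl S ?I) \<bullet> u = t"
    using t by (elim equalizer_factor[OF fe, rotated 2]) (simp_all)
  have "(fs \<rhd> t) \<bullet> incl S ?I = eta S \<bullet> incl S ?I" using e by (simp add: is_equalizer_def)
  moreover have "a = b" if "ar a" "ar b" "tgt a = f \<bowtie> sub_bimod S ?I" "tgt b = f \<bowtie> sub_bimod S ?I"
      "(f \<rhd> incl S ?I) \<bullet> a = (f \<rhd> incl S ?I) \<bullet> b" for a b
    using equalizer_mono[OF fe that(1,2)] that(3-5) by simp
  moreover have "src u = f" "tgt u = f \<bowtie> sub_bimod S ?I" using u(2,3) t(2) by simp_all
  ultimately show "\<exists>I s. subbimodule K S I \<and> (fs \<rhd> t) \<bullet> incl S I = eta S \<bullet> incl S I \<and>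
     ar s \<and> src s = f \<and> tgt s = f \<bowtie> sub_bimod S I \<and> (f \<rhd> incl S I) \<bullet> s = t \<and>
     (\<forall>a b. ar a \<longrightarrow> ar b \<longrightarrow> tgt a = f \<bowtie> sub_bimod S I \<longrightarrow> tgt b = f \<bowtie> sub_bimod S I \<longrightarrow>
        (f \<rhd> incl S I) \<bullet> a = (f \<rhd> incl S I) \<bullet> b \<longrightarrow> a = b)"
    using s u(1,4) by blast
qed

text \<open>A retraction \<open>r\<close> of \<open>\<eta>\<close> spread over all 1-cells: it
  yields a natural retraction of \<open>eta X\<close>.\<close>

definition rho where "rho r X = lu X \<bullet> (r \<lhd> X) \<bullet> as' fs f X"

context
  fixes r assumes r: "ar r" "src r = S" "tgt r = unit_bimod A" "r \<bullet> \<eta> = id_cell (unit_bimod A)"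
begin

lemma rho_simps [simp]:
  assumes "bi X" "cd X = A"
  shows "ar (rho r X)" "src (rho r X) = fs \<bowtie> (f \<bowtie> X)" "tgt (rho r X) = X"
  using assms r by (simp_all add: rho_def)

lemma rho_nat:
  assumes "ar t" "cd (src t) = A" "tgt t = Y"
  shows "rho r Y \<bullet> (fs \<rhd> (f \<rhd> t)) = t \<bullet> rho r (src t)"
proof -
  have c: "bi Y" "cd Y = A" using assms by auto
  have 1: "lu Y \<bullet> (unit_bimod A \<rhd> t) = t \<bullet> lu (src t)"
    using lu_natural[OF assms(1)] assms by simp
  have 2: "(r \<lhd> Y) \<bullet> (S \<rhd> t) = (unit_bimod A \<rhd> t) \<bullet> (r \<lhd> src t)"
    using assms r by (simp add: hc_wr_wl hc_wl_wr)
  have 3: "as' fs f Y \<bullet> (fs \<rhd> (f \<rhd> t)) = (S \<rhd> t) \<bullet> as' fs f (src t)"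
    using assms by (intro as'_wl) auto
  show ?thesis
    using assms c r(1-3) by (simp add: rho_def vc_assoc vc_cong[OF 1] vc_cong[OF 2] 3)
qed

lemma rho_eta:
  assumes "bi X" "cd X = A"
  shows "rho r X \<bullet> eta X = id_cell X"
proof -
  have 1: "(r \<lhd> X) \<bullet> (\<eta> \<lhd> X) = id_cell (unit_bimod A \<bowtie> X)"
    using assms r by (simp add: hc_id flip: wr_vc)
  show ?thesis
    using assms r(1-3) by (simp add: rho_def eta_def vc_assoc vc_cong[OF as'_as] vc_cong[OF 1])
qed

text \<open>The witness is \<open>rho r X \<bullet> t\<close>. Naturality of \<open>rho\<close> at
  \<open>eta X\<close> trades \<open>eta X \<bullet> rho r X\<close> for \<open>rho r\<close> after
  the monad applied to \<open>eta X\<close>, and the assumption on \<open>t\<close> turns the latter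
  into a unit that \<open>rho r\<close> retracts.\<close>

lemma pure_unit_of_retraction: pure_unit
  unfolding pure_unit_def
proof (intro allI impI)
  fix X t assume X: "bi X" "cd X = A" and t: "ar t" "tgt t = fs \<bowtie> (f \<bowtie> X)"
    and et: "eta (fs \<bowtie> (f \<bowtie> X)) \<bullet> t = (fs \<rhd> (f \<rhd> eta X)) \<bullet> t"
  let ?M = "fs \<bowtie> (f \<bowtie> X)"
  have 1: "rho r ?M \<bullet> (fs \<rhd> (f \<rhd> eta X)) = eta X \<bullet> rho r X"
    using rho_nat[of "eta X" ?M] X by simp
  have 2: "rho r ?M \<bullet> eta ?M = id_cell ?M" using rho_eta X by simp
  have "eta X \<bullet> rho r X \<bullet> t = rho r ?M \<bullet> (fs \<rhd> (f \<rhd> eta X)) \<bullet> t"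
    using X t by (simp add: vc_cong[OF 1] vc_assoc)
  also have "\<dots> = t" unfolding et[symmetric] using X t by (simp add: vc_cong[OF 2])
  finally show "\<exists>u. ar u \<and> src u = src t \<and> tgt u = X \<and> eta X \<bullet> u = t"
    using X t by (intro exI[of _ "rho r X \<bullet> t"]) simp
qed

text \<open>The retraction makes the pair \<open>fs \<rhd> t\<close>, \<open>eta S\<close> a split equalizer, with idempotent \<open>e\<close>,
  and split equalizers are preserved by every functor.\<close>

lemma flat_coactions_of_retraction: flat_coactions
  unfolding flat_coactions_def
proof (intro allI impI)
  fix t assume "coaction t"
  then have t: "ar t" "src t = f" "tgt t = f \<bowtie> S" "(f \<rhd> (fs \<rhd> t)) \<bullet> t = (f \<rhd> eta S) \<bullet> t"
    by (simp_all add: coaction_def)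
  let ?p = "fs \<rhd> t" and ?q = "eta S"
  let ?I = "equalizer_sub ?p ?q"
  let ?i = "incl S ?I" and ?M = "fs \<bowtie> (f \<bowtie> S)"
  have pq: "ar ?p" "ar ?q" "src ?p = src ?q" "tgt ?p = tgt ?q" "src ?p = S" using t by simp_all
  have s: "subbimodule K S ?I" using equalizer_subbimodule[OF pq(1-4)] unfolding pq(5) .
  have eq: "is_equalizer K ?i ?p ?q" using equalizer_exists[OF pq(1-4)] unfolding pq(5) .
  have ei: "?p \<bullet> ?i = ?q \<bullet> ?i" using eq by (simp add: is_equalizer_def)
  \<comment> \<open>\<open>e\<close> projects \<open>S\<close> onto the equalizer: applying
    \<open>rho\<close> to coassociativity gives \<open>?p \<bullet> e = ?q \<bullet> e\<close>, and
    \<open>e\<close> fixes \<open>?i\<close> because \<open>rho\<close> retracts the unit.\<close>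
  define e where "e = rho r S \<bullet> ?p"
  have e: "ar e" "src e = S" "tgt e = S" using t by (simp_all add: e_def)
  have 1: "rho r ?M \<bullet> (fs \<rhd> (f \<rhd> ?p)) = ?p \<bullet> rho r S"
    using rho_nat[of ?p ?M] t by simp
  have 2: "(fs \<rhd> (f \<rhd> ?p)) \<bullet> ?p = (fs \<rhd> (f \<rhd> eta S)) \<bullet> ?p"
    using t wl_vc[of fs "f \<rhd> ?p" t] wl_vc[of fs "f \<rhd> eta S" t] by simp
  have 3: "rho r ?M \<bullet> (fs \<rhd> (f \<rhd> eta S)) = eta S \<bullet> rho r S"
    using rho_nat[of "eta S" ?M] by simp
  have "?p \<bullet> e = rho r ?M \<bullet> (fs \<rhd> (f \<rhd> ?p)) \<bullet> ?p"
    using t(1-3) vc_cong[OF 1, of ?p] by (simp add: e_def vc_assoc)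
  also have "\<dots> = ?q \<bullet> e"
    unfolding 2 using t(1-3) vc_cong[OF 3, of ?p] by (simp add: e_def vc_assoc)
  finally obtain h where h: "ar h" "src h = src e" "tgt h = src ?i" "?i \<bullet> h = e"
    using e by (elim equalizer_factor[OF eq, rotated 2]) simp_all
  have h': "src h = S" "tgt h = sub_bimod S ?I" using h(2,3) e by simp_all
  have "?i \<bullet> h \<bullet> ?i = rho r S \<bullet> ?p \<bullet> ?i"
    using vc_cong[OF h(4), of ?i] h(1) h' s t(1-3) by (simp add: e_def vc_assoc)
  also have "\<dots> = ?i \<bullet> id_cell (sub_bimod S ?I)"
    unfolding ei using s rho_eta[of S] vc_cong[of "rho r S" "eta S" "id_cell S" ?i] by simp
  finally have hi: "h \<bullet> ?i = id_cell (sub_bimod S ?I)"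
    by (rule equalizer_mono[OF eq, rotated 4]) (use h(1) h' s in simp_all)
  have fhi: "(f \<rhd> h) \<bullet> (f \<rhd> ?i) = id_cell (f \<bowtie> sub_bimod S ?I)"
    using hi h(1) h' s by (simp add: hc_id flip: wl_vc)
  have 4: "(f \<rhd> rho r S) \<bullet> (f \<rhd> eta S) = id_cell (f \<bowtie> S)"
    using rho_eta[of S] by (simp add: hc_id flip: wl_vc)
  \<comment> \<open>In front of \<open>t\<close>, coassociativity replaces
    \<open>f \<rhd> ?p\<close> by \<open>f \<rhd> eta S\<close>, which
    \<open>f \<rhd> rho r S\<close> retracts; so \<open>f \<rhd> e\<close> fixes
    \<open>t\<close>.\<close>
  have "(f \<rhd> ?i) \<bullet> (f \<rhd> h) \<bullet> t = (f \<rhd> e) \<bullet> t"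
    using h(1) h' s t wl_vc[of f ?i h] vc_assoc[of "f \<rhd> h" t "f \<rhd> ?i"] unfolding h(4) by simp
  also have "\<dots> = (f \<rhd> rho r S) \<bullet> (f \<rhd> ?p) \<bullet> t"
    using t(1-3) by (simp add: e_def wl_vc vc_assoc)
  also have "\<dots> = t" unfolding t(4) using t(1-3) by (simp add: vc_cong[OF 4])
  finally have u: "(f \<rhd> ?i) \<bullet> (f \<rhd> h) \<bullet> t = t" .
  have "a = b" if "ar a" "ar b" "tgt a = f \<bowtie> sub_bimod S ?I" "tgt b = f \<bowtie> sub_bimod S ?I"
      "(f \<rhd> ?i) \<bullet> a = (f \<rhd> ?i) \<bullet> b" for a b
    by (rule left_cancel[OF fhi that(5)]) (use that s in simp_all)
  moreover have "ar ((f \<rhd> h) \<bullet> t)" "src ((f \<rhd> h) \<bullet> t) = f" "tgt ((f \<rhd> h) \<bullet> t) = f \<bowtie> sub_bimod S ?I"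
    using h(1) h' t(1-3) by simp_all
  ultimately show "\<exists>I s. subbimodule K S I \<and> (fs \<rhd> t) \<bullet> incl S I = eta S \<bullet> incl S I \<and>
     ar s \<and> src s = f \<and> tgt s = f \<bowtie> sub_bimod S I \<and> (f \<rhd> incl S I) \<bullet> s = t \<and>
     (\<forall>a b. ar a \<longrightarrow> ar b \<longrightarrow> tgt a = f \<bowtie> sub_bimod S I \<longrightarrow> tgt b = f \<bowtie> sub_bimod S I \<longrightarrow>
        (f \<rhd> incl S I) \<bullet> a = (f \<rhd> incl S I) \<bullet> b \<longrightarrow> a = b)"
    using s ei u by blast
qed

end

text \<open>\<open>f \<bowtie> \<eta> \<bowtie> fs\<close> can be bracketed from either side. The
  mirrored comultiplication is therefore the same cell, and both orientations share one monoid of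
  comonoid endomorphisms.\<close>

lemma Delta_reversed: "as C f fs \<bullet> (eta' f \<lhd> fs) = Delta"
proof -
  have 1: "as' f fs C \<bullet> (f \<rhd> as fs f fs) = as C f fs \<bullet> (as' f fs f \<lhd> fs) \<bullet> as' f S fs"
    by (rule pentagon_wl) simp_all
  have 2: "as' f S fs \<bullet> (f \<rhd> (\<eta> \<lhd> fs)) = ((f \<rhd> \<eta>) \<lhd> fs) \<bullet> as' f (unit_bimod A) fs"
    using as'_wm[of f \<eta> fs] by simp
  have 3: "as' f (unit_bimod A) fs \<bullet> (f \<rhd> lu' fs) = ru' f \<lhd> fs"
    using triangle''[of f fs] by simp
  show ?thesis
    by (simp add: Delta_def eta_def eta'_def wl_vc wr_vc vc_cong[OF 1] vc_assoc vc_cong[OF 2] 3)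
qed

end

section \<open>The theorem\<close>

lemma assoc_iso:
  assumes "bimodule K H" "bimodule K G" "bimodule K F" "dom H = cod G" "dom G = cod F"
  shows "iso_cell K (assoc H G F)"
  by (rule composable3.assoc_iso[OF composable3.intro]) (fact assms)+

lemma bim_horizontal:
  "horizontal K dom cod tens hcomp assoc (\<lambda>H G F. inv_cell K (assoc H G F))
     lunit (\<lambda>F. inv_cell K (lunit F)) runit (\<lambda>F. inv_cell K (runit F))"
proof (rule horizontal.intro, goal_cases)
  case (1 \<tau>)
  then show ?case by (rule two_cell_tgt)
next
  case (2 \<tau>)
  then show ?case by (rule two_cell_tgt)
next
  case (9 F G)
  then show ?case by (rule tens_bimodule)
next
  case (10 F)
  then show ?case by (rule bimodule.unit_dom)
next
  case (11 F)
  then show ?case by (rule bimodule.unit_cod)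
next
  case (14 \<sigma> \<tau>)
  then show ?case by (rule hcomp_two_cell)
next
  case (15 F G)
  then show ?case by (rule hcomp_id)
next
  case (16 \<sigma> \<sigma>' \<tau> \<tau>')
  then show ?case by (rule interchange)
next
  case (17 H G F)
  then show ?case by (rule two_cell_assoc)
next
  case (20 H G F)
  from inv_cell_props(1)[OF assoc_iso[OF this]] show ?case .
next
  case (21 H G F)
  from inv_cell_props(2)[OF assoc_iso[OF this]] show ?case by simp
next
  case (22 H G F)
  from inv_cell_props(3)[OF assoc_iso[OF this]] show ?case by simp
next
  case (23 H G F)
  from inv_cell_props(5)[OF assoc_iso[OF this]] show ?case by simp
next
  case (24 H G F)
  from inv_cell_props(4)[OF assoc_iso[OF this]] show ?case by simp
next
  case (25 \<rho> \<sigma> \<tau>)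
  then show ?case by (rule assoc_natural)
next
  case (26 F)
  then show ?case by (rule lunit_two_cell)
next
  case (29 F)
  from inv_cell_props(1)[OF inf_bimodule.lunit_iso[OF inf_bimodule.intro[OF this]]] show ?case .
next
  case (30 F)
  from inv_cell_props(2)[OF inf_bimodule.lunit_iso[OF inf_bimodule.intro[OF this]]] show ?case by simp
next
  case (31 F)
  from inv_cell_props(3)[OF inf_bimodule.lunit_iso[OF inf_bimodule.intro[OF this]]] show ?case by simp
next
  case (32 F)
  from inv_cell_props(5)[OF inf_bimodule.lunit_iso[OF inf_bimodule.intro[OF this]]] show ?case by simp
next
  case (33 F)
  from inv_cell_props(4)[OF inf_bimodule.lunit_iso[OF inf_bimodule.intro[OF this]]] show ?case by simp
next
  case (34 \<tau>)
  then show ?case by (rule lunit_natural)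
next
  case (35 F)
  then show ?case by (rule runit_two_cell)
next
  case (38 F)
  from inv_cell_props(1)[OF inf_bimodule.runit_iso[OF inf_bimodule.intro[OF this]]] show ?case .
next
  case (39 F)
  from inv_cell_props(2)[OF inf_bimodule.runit_iso[OF inf_bimodule.intro[OF this]]] show ?case by simp
next
  case (40 F)
  from inv_cell_props(3)[OF inf_bimodule.runit_iso[OF inf_bimodule.intro[OF this]]] show ?case by simp
next
  case (41 F)
  from inv_cell_props(5)[OF inf_bimodule.runit_iso[OF inf_bimodule.intro[OF this]]] show ?case by simp
next
  case (42 F)
  from inv_cell_props(4)[OF inf_bimodule.runit_iso[OF inf_bimodule.intro[OF this]]] show ?case by simp
next
  case (43 \<tau>)
  then show ?case by (rule runit_natural)
next
  case (44 I H G F)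
  then show ?case by (rule pentagon)
next
  case (45 G F)
  then show ?case by (simp add: triangle)
next
  case (46 G F)
  then show ?case by (simp add: lunit_tens)
next
  case (47 G F)
  then show ?case by (simp add: runit_tens)
next
  case (48 C)
  \<comment> \<open>The axiom assumes that the unit is a bimodule; its domain is then the
    \<open>K\<close>-category required here.\<close>
  from bimodule.dom_kcategory[OF this] show ?case by (intro lunit_runit_unit[of K]) simp
next
  case (49 F \<pi>)
  then show ?case by (rule tens_surj_epi)
next
  case (50 F \<pi>)
  then show ?case by (rule tens_surj_epi')
qed simp_all

lemma adjunction_adj:
  assumes "adjunction K A B f fs \<eta> \<epsilon>"
  shows "adj K dom cod tens hcomp assoc (\<lambda>H G F. inv_cell K (assoc H G F))
     lunit (\<lambda>F. inv_cell K (lunit F)) runit (\<lambda>F. inv_cell K (runit F)) A B f fs \<eta> \<epsilon>"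
  using assms unfolding adjunction_def one_cell_def cells_iff
  by (intro adj.intro bim_horizontal adj_axioms.intro) auto

section \<open>Both orientations in the bicategory of bimodules\<close>

locale bim_adjunction =
  fixes K :: "'k ring" and A B :: "('k,'u::infinite) kcat" and f fs :: "('k,'u) bimod"
    and \<eta> \<epsilon> :: "('k,'u) cell"
  assumes adjunction: "adjunction K A B f fs \<eta> \<epsilon>"
begin

sublocale L: adj K dom cod tens hcomp assoc "\<lambda>H G F. inv_cell K (assoc H G F)"
    lunit "\<lambda>F. inv_cell K (lunit F)" runit "\<lambda>F. inv_cell K (runit F)" A B f fs \<eta> \<epsilon>
  by (rule adjunction_adj[OF adjunction])

sublocale R: adj K cod dom "\<lambda>F G. tens G F" "\<lambda>\<sigma> \<tau>. hcomp \<tau> \<sigma>" "\<lambda>H G F. inv_cell K (assoc F G H)" "\<lambda>H G F. assoc F G H"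
    runit "\<lambda>F. inv_cell K (runit F)" lunit "\<lambda>F. inv_cell K (lunit F)" A B fs f \<eta> \<epsilon>
  by (rule L.reversed_adj)

lemma mon_mult_L: "mon_mult K f fs \<epsilon> = L.mulS"
  by (simp add: mon_mult_def L.mulS_def L.eps_def)

text \<open>The mirrored multiplication lets the contracted unit be absorbed by \<open>fs\<close>
  instead of \<open>f\<close>; \<open>eps'_wr\<close> at \<open>fs\<close> identifies the
  two.\<close>

lemma mon_mult_R: "mon_mult K f fs \<epsilon> = R.mulS"
proof -
  have "R.mulS = (L.eps' fs \<star> id_cell f) \<bullet> inv_cell K (assoc (fs \<boxtimes> f) fs f)"
    by (simp add: R.mulS_def R.eps_def L.eps'_def)
  also have "\<dots> = L.mulS"
    using L.eps'_wr[of fs] by (simp add: L.mulS_def)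
  finally show ?thesis by (simp add: mon_mult_L)
qed

lemma comon_comult_L: "comon_comult K f fs \<eta> = L.Delta"
  by (simp add: comon_comult_def L.Delta_def L.eta_def)

lemma comon_comult_R: "comon_comult K f fs \<eta> = R.Delta"
proof -
  have "R.Delta = assoc (f \<boxtimes> fs) f fs \<bullet> (L.eta' f \<star> id_cell fs)"
    by (simp add: R.Delta_def R.eta_def L.eta'_def)
  then show ?thesis using L.Delta_reversed by (simp add: comon_comult_L)
qed

lemma comonoid_End_L: "comonoid_End K f fs \<eta> \<epsilon> = L.end_monoid"
  by (auto simp: comonoid_End_def L.end_monoid_def L.comonoid_endo_def cells_iff comon_comult_L)

lemma comonoid_End_R: "comonoid_End K f fs \<eta> \<epsilon> = R.end_monoid"
  by (auto simp: comonoid_End_def R.end_monoid_def R.comonoid_endo_def cells_iff comon_comult_R)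

lemma Il_L: "Il K f fs \<eta> \<epsilon> = L.inv_subs_monoid"
proof -
  have "Il_set K f fs \<epsilon> = L.inv_subs"
    unfolding Il_set_def L.inv_subs_def mon_mult_L using L.iso_mulS_iff by blast
  moreover have "sub_prod K f fs \<epsilon> = L.prodS"
    by (intro ext) (simp add: sub_prod_def L.prodS_def mon_mult_L)
  ultimately show ?thesis by (simp add: Il_def L.inv_subs_monoid_def)
qed

text \<open>In the mirrored structure horizontal composites are taken in the other order, so
  \<open>R.prodS\<close> is the product with its factors exchanged. This is where the opposite
  monoid comes from.\<close>

lemma Ir_R: "opposite_monoid (Ir K f fs \<eta> \<epsilon>) = R.inv_subs_monoid"
proof -
  have "Ir_set K f fs \<epsilon> = R.inv_subs"
    unfolding Ir_set_def R.inv_subs_def mon_mult_R using R.iso_mulS_iff by blast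
  moreover have "(\<lambda>I J. sub_prod K f fs \<epsilon> J I) = R.prodS"
    by (intro ext) (simp add: sub_prod_def R.prodS_def mon_mult_R)
  ultimately show ?thesis by (simp add: Ir_def R.inv_subs_monoid_def opposite_monoid_def)
qed

text \<open>The two formulas differ by distributing whiskering over vertical composites and by
  re-nesting.\<close>

lemma Gamma_L:
  assumes "I \<in> L.inv_subs"
  shows "Gamma K f fs \<epsilon> I = L.gamma I"
proof -
  note s = L.inv_subs_sub[OF assms]
  have x: "xi K f fs \<epsilon> I = L.sub_xi I"
    using s by (simp add: xi_def L.sub_xi_def L.eps_def L.vc_assoc)
  show ?thesis
    unfolding Gamma_def x L.gamma_def L.endo_of_def L.sub_coaction_def L.eps'_def
    using s assms by (simp add: L.wr_vc L.vc_assoc)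
qed

lemma Gamma_R:
  assumes "I \<in> R.inv_subs"
  shows "Gamma_star K f fs \<epsilon> I = R.gamma I"
proof -
  note s = R.inv_subs_sub[OF assms]
  have x: "xi_star K f fs \<epsilon> I = R.sub_xi I"
    using s by (simp add: xi_star_def R.sub_xi_def R.eps_def R.vc_assoc)
  show ?thesis
    unfolding Gamma_star_def x R.gamma_def R.endo_of_def R.sub_coaction_def R.eps'_def
    using s assms by (simp add: R.wr_vc R.vc_assoc)
qed

lemma iso_L:
  assumes L.pure_unit L.flat_coactions
  shows "monoid_iso (Il K f fs \<eta> \<epsilon>) (comonoid_End K f fs \<eta> \<epsilon>) (Gamma K f fs \<epsilon>)"
  unfolding Il_L comonoid_End_L
  by (rule monoid_iso_cong[OF L.gamma_iso[OF assms]]) (simp add: L.inv_subs_monoid_def Gamma_L)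

lemma iso_R:
  assumes R.pure_unit R.flat_coactions
  shows "monoid_iso (opposite_monoid (Ir K f fs \<eta> \<epsilon>)) (comonoid_End K f fs \<eta> \<epsilon>) (Gamma_star K f fs \<epsilon>)"
  unfolding Ir_R comonoid_End_R
  by (rule monoid_iso_cong[OF R.gamma_iso[OF assms]]) (simp add: R.inv_subs_monoid_def Gamma_R)

lemma pure_L:
  assumes "right_pure K \<eta>"
  shows L.pure_unit
proof (rule L.pure_unit_of_regular_mono)
  fix h assume "bimodule K h" "cod h = A"
  then show "regular_mono K (\<eta> \<star> id_cell h)"
    using assms bimodule.dom_kcategory[of K h] by (auto simp: right_pure_def one_cell_def)
qed

lemma pure_R:
  assumes "left_pure K \<eta>"
  shows R.pure_unit
proof (rule R.pure_unit_of_regular_mono)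
  fix h assume "bimodule K h" "dom h = A"
  then show "regular_mono K (id_cell h \<star> \<eta>)"
    using assms bimodule.cod_kcategory[of K h] by (auto simp: left_pure_def one_cell_def)
qed

lemma flat_L:
  assumes "right_flat K f"
  shows L.flat_coactions
proof (rule L.flat_coactions_of_flat)
  fix e p q assume "is_equalizer K e p q" "bimodule K (src e)" "cod (src e) = A"
  then show "is_equalizer K (id_cell f \<star> e) (id_cell f \<star> p) (id_cell f \<star> q)"
    using assms bimodule.dom_kcategory[of K "src e"] by (auto simp: right_flat_def one_cell_def)
qed

lemma flat_R:
  assumes "left_flat K fs"
  shows R.flat_coactions
proof (rule R.flat_coactions_of_flat)
  fix e p q assume "is_equalizer K e p q" "bimodule K (src e)" "dom (src e) = A"
  then show "is_equalizer K (e \<star> id_cell fs) (p \<star> id_cell fs) (q \<star> id_cell fs)"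
    using assms bimodule.cod_kcategory[of K "src e"] by (auto simp: left_flat_def one_cell_def)
qed

text \<open>A retraction of \<open>\<eta>\<close> has no orientation, so the same cell serves both
  interpretations.\<close>

lemma separable_pure_flat:
  assumes "separable K \<eta>"
  shows L.pure_unit L.flat_coactions R.pure_unit R.flat_coactions
proof -
  obtain r where "two_cell K r" "src r = fs \<boxtimes> f" "tgt r = unit_bimod A" "r \<bullet> \<eta> = id_cell (unit_bimod A)"
    using assms by (auto simp: separable_def split_mono_def cells_iff)
  then show L.pure_unit L.flat_coactions R.pure_unit R.flat_coactions
    by (rule L.pure_unit_of_retraction L.flat_coactions_of_retraction R.pure_unit_of_retraction R.flat_coactions_of_retraction; assumption)+
qed

end

theorem theorem4p8:
  fixes K :: "'k ring"
    and A B :: "('k,'u::infinite) kcat"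
    and f fs :: "('k,'u) bimod"
    and \<eta> \<epsilon> :: "('k,'u) cell"
  assumes "cring K"
    and "kcategory K A"
    and "kcategory K B"
    and "adjunction K A B f fs \<eta> \<epsilon>"
  shows
    "(right_flat K f \<and> right_pure K \<eta> \<longrightarrow>
        monoid_iso (Il K f fs \<eta> \<epsilon>) (comonoid_End K f fs \<eta> \<epsilon>) (Gamma K f fs \<epsilon>)) \<and>
     (left_flat K fs \<and> left_pure K \<eta> \<longrightarrow>
        monoid_iso (opposite_monoid (Ir K f fs \<eta> \<epsilon>)) (comonoid_End K f fs \<eta> \<epsilon>)
          (Gamma_star K f fs \<epsilon>)) \<and>
     (separable K \<eta> \<longrightarrow>
        monoid_iso (Il K f fs \<eta> \<epsilon>) (comonoid_End K f fs \<eta> \<epsilon>) (Gamma K f fs \<epsilon>) \<and>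
        monoid_iso (opposite_monoid (Ir K f fs \<eta> \<epsilon>)) (comonoid_End K f fs \<eta> \<epsilon>)
          (Gamma_star K f fs \<epsilon>))"
proof -
  interpret bim_adjunction K A B f fs \<eta> \<epsilon> by (rule bim_adjunction.intro) (fact assms(4))
  show ?thesis
    using iso_L iso_R pure_L pure_R flat_L flat_R separable_pure_flat by blast
qed

end
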